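(* Let $X$ be an object in a cartesian Rosický tangent category with scalar $R$-multiplication. Let $\mathcal{O}:=\mathrm{Hom}(X,R)$. Then the Lie algebra of vector fields $\mathcal{X}:=\Gamma(X,TX)$ and the graded commutative $\mathcal{O}$-algebra of forms $$\Omega^\bullet(X):=\mathrm{Hom}_{\mathcal{O}}\bigl(\wedge^\bullet_{\mathcal{O}}\mathcal{X},\mathcal{O}\bigr),$$ together with the Chevalley–Eilenberg differential $d$ and the inner derivative $\iota$, constitute a Cartan calculus.
   Context: **Rosický tangent structure.** A Rosický tangent structure on a category $\mathcal{C}$ consists of a functor $T:\mathcal{C}\to\mathcal{C}$ and natural transformations $\pi:T\to 1$, $0:1\to T$, $+:T_2\to T$, $\lambda:T\to T^2$, $\tau:T^2\to T^2$ such that for all objects $X$: (i) for all $k\ge1$ the fiber product $T_kX=TX\times_X\cdots\times_XTX$ of $k$ copies of $\pi_X:TX\to X$ exists and is preserved by $T$, i.e. the natural morphism $\nu_{k,X}:T(T_kX)\to T^2X\times_{TX}^{T\pi_X,T\pi_X}\cdots\times_{TX}^{T\pi_X,T\pi_X}T^2X$ is an isomorphism; (ii) $\pi_X:TX\to X$ with addition $+_X$ and zero $0_X$ is an abelian group object in the slice category $\mathcal{C}_{/X}$; let $-_X:T_2X\to TX$ denote the fiberwise difference; (iii) $\tau_X\circ\tau_X=\mathrm{id}$, $\tau_{TX}\circ T\tau_X\circ\tau_{TX}=T\tau_X\circ\tau_{TX}\circ T\tau_X$, $\pi_{TX}\circ\tau_X=T\pi_X$, and $+_{TX}\circ(\tau_X\times_{TX}\tau_X)=\tau_X\circ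 T(+_X)\circ\nu_{2,X}^{-1}$ on $T^2X\times_{TX}^{T\pi_X,T\pi_X}T^2X$; (iv) $\pi_{TX}\circ\lambda_X=0_X\circ\pi_X$, $\lambda_{TX}\circ\lambda_X=T\lambda_X\circ\lambda_X$, and $+_{TX}\circ(\lambda_X\times_{0_X}\lambda_X)=\lambda_X\circ+_X$; (v) $\tau_X\circ\lambda_X=\lambda_X$ and $T\tau_X\circ\tau_{TX}\circ T\lambda_X=\lambda_{TX}\circ\tau_X$; (vi) the commutative square $(\pi_{TX},T\pi_X)\circ\lambda_X=(0_X,0_X)\circ\pi_X:TX\to T_2X$ is a pullback square. The extended vertical lift is $(\lambda_2)_X:=\tau_X\circ+_{TX}\circ(T0_X\times_{0_X}\lambda_X):T_2X\to T^2X$. It is known that the square with $(\lambda_2)_X$, $T\pi_X:T^2X\to TX$, $\pi_X\circ\mathrm{pr}_1:T_2X\to X$ and $0_X:X\to TX$ is a pullback. **Cartesian.** The tangent structure is cartesian if $\mathcal{C}$ has finite products and $\chi_{X,Y}:=(T\mathrm{pr}_1,T\mathrm{pr}_2):T(X\times Y)\to TX\times TY$ is invertible for all $X,Y$. For $f:X\times Y\to Z$ the partial tangent morphisms are $T_{(1)}f:=Tf\circ\chi_{X,Y}^{-1}\circ(\mathrm{id}_{TX}\times0_Y):TX\times Y\to TZ$ and $T_{(2)}f:=Tf\circ\chi_{X,Y}^{-1}\circ(0_X\times\mathrm{id}_{TY}):X\times TY\to TZ$. **Vector fields.** A vector field on $X$ is a section $v:X\to TX$ of $\pi_X$; $\Gamma(X,TX)$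 denotes the set of them, with sum $v+w:=+_X\circ(v,w)$. The bracket $[v,w]$ is the unique vector field with $\delta(v,w)=(\lambda_2)_X\circ(w,[v,w])$, where $\delta(v,w):=-_{TX}\circ(Tw\circ v,\ \tau_X\circ Tv\circ w):X\to T^2X$. It is known (Rosický, Cockett–Cruttwell) that this is a Lie bracket, i.e. biadditive, antisymmetric, and satisfying the Jacobi identity. **Scalar multiplication.** Let $R$ be a commutative unital ring object in $\mathcal{C}$ with addition $\hat{+}$, zero $\hat{0}$, multiplication $\hat{m}$, unit $\hat{1}$. An $R$-module structure on the tangent bundle is a natural morphism $\kappa_X:R\times TX\to TX$ with $\pi_X\circ\kappa_X=\pi_X\circ\mathrm{pr}_2$, $\kappa_X\circ(\mathrm{id}_R\times\kappa_X)=\kappa_X\circ(\hat{m}\times\mathrm{id}_{TX})$, $\kappa_X\circ(\hat{1}\times\mathrm{id}_{TX})$ equal to the canonical isomorphism $*\times TX\cong TX$, $\kappa_X\circ(\hat{+}\times\mathrm{id}_{TX})=+_X\circ(\kappa_X\circ(\mathrm{pr}_1,\mathrm{pr}_3),\kappa_X\circ(\mathrm{pr}_2,\mathrm{pr}_3))$, and $\kappa_X\circ(\mathrm{id}_R\times+_X)=+_X\circ(\kappa_X\circ(\mathrm{pr}_1,\mathrm{pr}_2),\kappa_X\circ(\mathrm{pr}_1,\mathrm{pr}_3))$ on $R\times T_2X$. The tangent fiber $T_{\hat{0}}R:=*\times_R^{\hat{0},\pi_R}TR$ (if it exists) inherits an $R$-module structure from $+_R,0_R,\kappa_R$. $R$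 is tangent-stable if $T_{\hat{0}}R$ exists and there is an isomorphism of $R$-modules $T_{\hat{0}}R\cong R$, which is then fixed. In that case $\eta_R:TR\to R$ is the projection onto the fiber: the morphism $T_{(2)}\hat{+}\circ(\hat{\iota}\circ\pi_R,\mathrm{id}_{TR}):TR\to TR$ (with $\hat{\iota}$ the additive inverse of $R$) factors uniquely through $T_{\hat{0}}R\to TR$, and $\eta_R$ is the resulting $TR\to T_{\hat{0}}R$ followed by $T_{\hat{0}}R\cong R$. The $R$-module structure $\kappa$ is a scalar $R$-multiplication if $R$ is tangent-stable and for all $X$: (S1) $\lambda_X\circ\kappa_X=\kappa_{TX}\circ(\mathrm{id}_R\times\lambda_X)$; (S2) $T_{(1)}\kappa_X=(\lambda_2)_X\circ(\kappa_X\circ(\mathrm{pr}_1,\mathrm{pr}_3),\kappa_X\circ(\mathrm{pr}_2,\mathrm{pr}_3))\circ((\pi_R,\eta_R)\times\mathrm{id}_{TX})$ on $TR\times TX$; (S3) $T_{(2)}\kappa_X=\tau_X\circ\kappa_{TX}\circ(\mathrm{id}_R\times\tau_X)$ on $R\times T^2X$. **Functions.** $\mathcal{O}=\mathrm{Hom}(X,R)$ is a commutative ring with $f+g:=\hat{+}\circ(f,g)$, $fg:=\hat{m}\circ(f,g)$. Vector fields act on functions by $v\cdot f:=\eta_R\circ Tf\circ v$, and $\Gamma(X,TX)$ is an $\mathcal{O}$-module via $fv:=\kappa_X\circ(f,v)$. **Forms.** An element of $\Omega^n=\mathrm{Hom}_{\mathcal{O}}(\wedge^n_{\mathcal{O}}\mathcal{X},\mathcal{O})$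 is a Lie–Rinehart $n$-form, i.e. a map $\omega:\mathcal{X}^n\to\mathcal{O}$ that is antisymmetric and $\mathcal{O}$-linear in every argument; $\Omega^0=\mathcal{O}$. The product of $\alpha\in\Omega^p$, $\beta\in\Omega^q$ is defined by the antisymmetrization of the pointwise multiplication of forms, $$(\alpha\wedge\beta)(v_1,\dots,v_{p+q}):=\tfrac{1}{(p+q)!}\sum_{\sigma\in S_{p+q}}(-1)^{|\sigma|}\,\alpha(v_{\sigma(1)},\dots,v_{\sigma(p)})\,\beta(v_{\sigma(p+1)},\dots,v_{\sigma(p+q)}),$$ where $S_{p+q}$ is the symmetric group and $(-1)^{|\sigma|}$ the sign of $\sigma$. The Chevalley–Eilenberg differential of $\omega\in\Omega^n$ is $$(d\omega)(v_0,\dots,v_n)=\sum_{0\le i\le n}(-1)^iv_i\cdot\omega(v_0,\dots,\hat{v}_i,\dots,v_n)+\sum_{0\le i<j\le n}(-1)^{i+j}\omega([v_i,v_j],v_0,\dots,\hat{v}_i,\dots,\hat{v}_j,\dots,v_n).$$ The inner derivative is $(\iota_v\omega)(v_1,\dots,v_{n-1})=\omega(v,v_1,\dots,v_{n-1})$, and $\iota_v$ is zero on $\Omega^0$. **Cartan calculus.** A graded derivation of degree $p$ of a graded commutative algebra $\Omega$ is a linear (additive) map $\delta:\Omega\to\Omega$ raising degree by $p$ with $\delta(\alpha\wedge\beta)=\delta\alpha\wedge\beta+(-1)^{p|\alpha|}\alpha\wedge\delta\beta$; for derivations $\delta,\epsilon$ of degrees $p,q$, $[\delta,\epsilon]=\delta\epsilon-(-1)^{pq}\epsilon\delta$.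 A Cartan calculus consists of a differential graded commutative algebra $(\Omega,d)$ ($d$ a graded derivation of degree $1$ with $d^2=0$), an $\Omega^0$-module $\mathcal{X}$ with a Lie bracket, and for every $v\in\mathcal{X}$ a graded derivation $\iota_v$ of degree $-1$, such that $\iota_{v+w}=\iota_v+\iota_w$, $\iota_{fv}\omega=f\wedge\iota_v\omega$, and, with $\mathcal{L}_v:=[\iota_v,d]$, $[\iota_v,\iota_w]=0$, $[\mathcal{L}_v,\iota_w]=\iota_{[v,w]}$, $[\mathcal{L}_v,\mathcal{L}_w]=\mathcal{L}_{[v,w]}$, $[\mathcal{L}_v,d]=0$ for all $v,w\in\mathcal{X}$, $f\in\Omega^0$, $\omega\in\Omega$.
   Formalization: The product of forms is normalized as the sum over (p,q)-shuffles, i.e. with factor 1/(p!q!) instead of the printed 1/(p+q)!, because with the printed factor neither the Chevalley–Eilenberg differential nor the inner derivative is a derivation. *)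

theory Defs
  imports "HOL-Algebra.Module" "HOL-Combinatorics.Permutations"
begin

section \<open>Categories\<close>

record ('o, 'a) category =
  Obj :: "'o set"
  Hom :: "'o \<Rightarrow> 'o \<Rightarrow> 'a set"
  Ident :: "'o \<Rightarrow> 'a"
  Comp :: "'a \<Rightarrow> 'a \<Rightarrow> 'a"  (infixr \<open>\<bullet>\<index>\<close> 70)

text \<open>Hom sets are pairwise disjoint, so an arrow determines its source and its target.\<close>

locale category =
  fixes C :: "('o, 'a, 'm) category_scheme" (structure)
  assumes Hom_Obj: "f \<in> Hom C X Y \<Longrightarrow> X \<in> Obj C \<and> Y \<in> Obj C"
    and Hom_disjoint: "f \<in> Hom C X Y \<Longrightarrow> f \<in> Hom C X' Y' \<Longrightarrow> X = X' \<and> Y = Y'"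
    and Id_closed: "X \<in> Obj C \<Longrightarrow> Ident C X \<in> Hom C X X"
    and Comp_closed: "f \<in> Hom C X Y \<Longrightarrow> g \<in> Hom C Y Z \<Longrightarrow> g \<bullet> f \<in> Hom C X Z"
    and Comp_assoc: "f \<in> Hom C W X \<Longrightarrow> g \<in> Hom C X Y \<Longrightarrow> h \<in> Hom C Y Z \<Longrightarrow>
      (h \<bullet> g) \<bullet> f = h \<bullet> (g \<bullet> f)"
    and Id_left: "f \<in> Hom C X Y \<Longrightarrow> Ident C Y \<bullet> f = f"
    and Id_right: "f \<in> Hom C X Y \<Longrightarrow> f \<bullet> Ident C X = f"
begin

definition is_inverse :: "'a \<Rightarrow> 'a \<Rightarrow> bool" where
  "is_inverse f g \<longleftrightarrow> (\<exists>X Y. f \<in> Hom C X Y \<and> g \<in> Hom C Y X \<and> g \<bullet> f = Ident C X \<and> f \<bullet> g = Ident C Y)"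

definition is_iso :: "'a \<Rightarrow> bool" where
  "is_iso f \<longleftrightarrow> (\<exists>g. is_inverse f g)"

definition inverse_of :: "'a \<Rightarrow> 'a" where
  "inverse_of f = (THE g. is_inverse f g)"

definition is_terminal :: "'o \<Rightarrow> bool" where
  "is_terminal I \<longleftrightarrow> I \<in> Obj C \<and> (\<forall>X \<in> Obj C. \<exists>!f. f \<in> Hom C X I)"

definition is_product :: "'o \<Rightarrow> 'o \<Rightarrow> 'o \<Rightarrow> 'a \<Rightarrow> 'a \<Rightarrow> bool" where
  "is_product X Y P p q \<longleftrightarrow> p \<in> Hom C P X \<and> q \<in> Hom C P Y \<and>
     (\<forall>Z. \<forall>a \<in> Hom C Z X. \<forall>b \<in> Hom C Z Y. \<exists>!h. h \<in> Hom C Z P \<and> p \<bullet> h = a \<and> q \<bullet> h = b)"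

definition is_pullback :: "'a \<Rightarrow> 'a \<Rightarrow> 'o \<Rightarrow> 'a \<Rightarrow> 'a \<Rightarrow> bool" where
  "is_pullback f g P p q \<longleftrightarrow>
     (\<exists>A B D. f \<in> Hom C A D \<and> g \<in> Hom C B D \<and> p \<in> Hom C P A \<and> q \<in> Hom C P B \<and>
        f \<bullet> p = g \<bullet> q \<and>
        (\<forall>Z. \<forall>a \<in> Hom C Z A. \<forall>b \<in> Hom C Z B. f \<bullet> a = g \<bullet> b \<longrightarrow>
           (\<exists>!h. h \<in> Hom C Z P \<and> p \<bullet> h = a \<and> q \<bullet> h = b)))"

text \<open>\<open>(P, q 1, ..., q k)\<close> is a fiber product of \<open>k\<close> copies of \<open>f\<close>, for \<open>k \<ge> 1\<close>.\<close>

definition is_fiber_power :: "'a \<Rightarrow> nat \<Rightarrow> 'o \<Rightarrow> (nat \<Rightarrow> 'a) \<Rightarrow> bool" where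
  "is_fiber_power f k P q \<longleftrightarrow>
     (\<exists>A B. f \<in> Hom C A B \<and> (\<forall>i \<in> {1..k}. q i \<in> Hom C P A) \<and>
        (\<forall>i \<in> {1..k}. \<forall>j \<in> {1..k}. f \<bullet> q i = f \<bullet> q j) \<and>
        (\<forall>Z a. (\<forall>i \<in> {1..k}. a i \<in> Hom C Z A) \<longrightarrow>
           (\<forall>i \<in> {1..k}. \<forall>j \<in> {1..k}. f \<bullet> a i = f \<bullet> a j) \<longrightarrow>
           (\<exists>!h. h \<in> Hom C Z P \<and> (\<forall>i \<in> {1..k}. q i \<bullet> h = a i))))"

end


section \<open>Rosick\'y tangent structures\<close>

text \<open>The letters of the mathematical literature are
  \<open>T\<close> (\<open>Tob\<close> on objects, \<open>Tar\<close> on arrows), \<open>\<pi>\<close> (\<open>tproj\<close>), \<open>0\<close> (\<open>tzero\<close>), \<open>+\<close> (\<open>tplus\<close>),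
  \<open>\<lambda>\<close> (\<open>tlift\<close>) and \<open>\<tau>\<close> (\<open>tflip\<close>). The record also carries a choice
  \<open>Tpow k X\<close> of the fiber products \<open>T\<^sub>k X\<close> with projections \<open>tpr k X i\<close>, \<open>1 \<le> i \<le> k\<close>.\<close>

record ('o, 'a) tangent_category = "('o, 'a) category" +
  Tob :: "'o \<Rightarrow> 'o"
  Tar :: "'a \<Rightarrow> 'a"
  Tpow :: "nat \<Rightarrow> 'o \<Rightarrow> 'o"
  tpr :: "nat \<Rightarrow> 'o \<Rightarrow> nat \<Rightarrow> 'a"
  tproj :: "'o \<Rightarrow> 'a"
  tzero :: "'o \<Rightarrow> 'a"
  tplus :: "'o \<Rightarrow> 'a"
  tlift :: "'o \<Rightarrow> 'a"
  tflip :: "'o \<Rightarrow> 'a"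

text \<open>That \<open>T\<close> preserves the fiber product \<open>T\<^sub>k X\<close> is expressed by saying that \<open>T\<close> sends its
  limit cone to a limit cone. Below, \<open>T (T\<^sub>2 X)\<close> with the projections \<open>T pr\<^sub>i\<close> therefore serves as
  the fiber product of two copies of \<open>T \<pi>\<^sub>X\<close>, so that \<open>\<nu>\<^sub>2\<^sub>,\<^sub>X\<close> is the identity.\<close>

locale tangent_fiber_powers = category C
  for C :: "('o, 'a, 'm) tangent_category_scheme" (structure) +
  assumes Tob_closed: "X \<in> Obj C \<Longrightarrow> Tob C X \<in> Obj C"
    and Tar_closed: "f \<in> Hom C X Y \<Longrightarrow> Tar C f \<in> Hom C (Tob C X) (Tob C Y)"
    and Tar_Id: "X \<in> Obj C \<Longrightarrow> Tar C (Ident C X) = Ident C (Tob C X)"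
    and Tar_Comp: "f \<in> Hom C X Y \<Longrightarrow> g \<in> Hom C Y Z \<Longrightarrow> Tar C (g \<bullet> f) = Tar C g \<bullet> Tar C f"
    and tproj_closed: "X \<in> Obj C \<Longrightarrow> tproj C X \<in> Hom C (Tob C X) X"
    and tproj_natural: "f \<in> Hom C X Y \<Longrightarrow> tproj C Y \<bullet> Tar C f = f \<bullet> tproj C X"
    and Tpow_fiber_power: "X \<in> Obj C \<Longrightarrow> 1 \<le> k \<Longrightarrow>
      is_fiber_power (tproj C X) k (Tpow C k X) (tpr C k X)"
    and Tpow_preserved: "X \<in> Obj C \<Longrightarrow> 1 \<le> k \<Longrightarrow>
      is_fiber_power (Tar C (tproj C X)) k (Tob C (Tpow C k X)) (\<lambda>i. Tar C (tpr C k X i))"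
begin

definition tpair :: "'o \<Rightarrow> 'a \<Rightarrow> 'a \<Rightarrow> 'a" where
  "tpair X a b = (THE h. (\<exists>Z. h \<in> Hom C Z (Tpow C 2 X)) \<and> tpr C 2 X 1 \<bullet> h = a \<and> tpr C 2 X 2 \<bullet> h = b)"

text \<open>The functor \<open>T\<^sub>2\<close> on an arrow \<open>f : X \<rightarrow> Y\<close>.\<close>

definition T2ar :: "'o \<Rightarrow> 'o \<Rightarrow> 'a \<Rightarrow> 'a" where
  "T2ar X Y f = tpair Y (Tar C f \<bullet> tpr C 2 X 1) (Tar C f \<bullet> tpr C 2 X 2)"

end

locale tangent_category = tangent_fiber_powers C
  for C :: "('o, 'a, 'm) tangent_category_scheme" (structure) +
  assumes tzero_closed: "X \<in> Obj C \<Longrightarrow> tzero C X \<in> Hom C X (Tob C X)"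
    and tzero_natural: "f \<in> Hom C X Y \<Longrightarrow> Tar C f \<bullet> tzero C X = tzero C Y \<bullet> f"
    and tplus_closed: "X \<in> Obj C \<Longrightarrow> tplus C X \<in> Hom C (Tpow C 2 X) (Tob C X)"
    and tplus_natural: "f \<in> Hom C X Y \<Longrightarrow> Tar C f \<bullet> tplus C X = tplus C Y \<bullet> T2ar X Y f"
    and tlift_closed: "X \<in> Obj C \<Longrightarrow> tlift C X \<in> Hom C (Tob C X) (Tob C (Tob C X))"
    and tlift_natural: "f \<in> Hom C X Y \<Longrightarrow> Tar C (Tar C f) \<bullet> tlift C X = tlift C Y \<bullet> Tar C f"
    and tflip_closed: "X \<in> Obj C \<Longrightarrow> tflip C X \<in> Hom C (Tob C (Tob C X)) (Tob C (Tob C X))"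
    and tflip_natural: "f \<in> Hom C X Y \<Longrightarrow>
      Tar C (Tar C f) \<bullet> tflip C X = tflip C Y \<bullet> Tar C (Tar C f)"
  \<comment> \<open>abelian group object in the slice category over \<open>X\<close>\<close>
    and tproj_tzero: "X \<in> Obj C \<Longrightarrow> tproj C X \<bullet> tzero C X = Ident C X"
    and tproj_tplus: "X \<in> Obj C \<Longrightarrow> tproj C X \<bullet> tplus C X = tproj C X \<bullet> tpr C 2 X 1"
    and tplus_assoc: "X \<in> Obj C \<Longrightarrow>
      tplus C X \<bullet> tpair X (tplus C X \<bullet> tpair X (tpr C 3 X 1) (tpr C 3 X 2)) (tpr C 3 X 3) =
      tplus C X \<bullet> tpair X (tpr C 3 X 1) (tplus C X \<bullet> tpair X (tpr C 3 X 2) (tpr C 3 X 3))"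
    and tplus_comm: "X \<in> Obj C \<Longrightarrow> tplus C X \<bullet> tpair X (tpr C 2 X 2) (tpr C 2 X 1) = tplus C X"
    and tplus_tzero: "X \<in> Obj C \<Longrightarrow>
      tplus C X \<bullet> tpair X (Ident C (Tob C X)) (tzero C X \<bullet> tproj C X) = Ident C (Tob C X)"
    and tplus_inverse: "X \<in> Obj C \<Longrightarrow>
      \<exists>n \<in> Hom C (Tob C X) (Tob C X). tproj C X \<bullet> n = tproj C X \<and>
        tplus C X \<bullet> tpair X (Ident C (Tob C X)) n = tzero C X \<bullet> tproj C X"
  \<comment> \<open>symmetric structure\<close>
    and tflip_tflip: "X \<in> Obj C \<Longrightarrow> tflip C X \<bullet> tflip C X = Ident C (Tob C (Tob C X))"
    and tflip_braid: "X \<in> Obj C \<Longrightarrow>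
      tflip C (Tob C X) \<bullet> Tar C (tflip C X) \<bullet> tflip C (Tob C X) =
      Tar C (tflip C X) \<bullet> tflip C (Tob C X) \<bullet> Tar C (tflip C X)"
    and tproj_tflip: "X \<in> Obj C \<Longrightarrow> tproj C (Tob C X) \<bullet> tflip C X = Tar C (tproj C X)"
    and tplus_tflip: "X \<in> Obj C \<Longrightarrow>
      tplus C (Tob C X) \<bullet>
        tpair (Tob C X) (tflip C X \<bullet> Tar C (tpr C 2 X 1)) (tflip C X \<bullet> Tar C (tpr C 2 X 2)) =
      tflip C X \<bullet> Tar C (tplus C X)"
  \<comment> \<open>vertical lift\<close>
    and tproj_tlift: "X \<in> Obj C \<Longrightarrow> tproj C (Tob C X) \<bullet> tlift C X = tzero C X \<bullet> tproj C X"
    and tlift_tlift: "X \<in> Obj C \<Longrightarrow> tlift C (Tob C X) \<bullet> tlift C X = Tar C (tlift C X) \<bullet> tlift C X"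
    and tplus_tlift: "X \<in> Obj C \<Longrightarrow>
      tplus C (Tob C X) \<bullet> tpair (Tob C X) (tlift C X \<bullet> tpr C 2 X 1) (tlift C X \<bullet> tpr C 2 X 2) =
      tlift C X \<bullet> tplus C X"
    and tflip_tlift: "X \<in> Obj C \<Longrightarrow> tflip C X \<bullet> tlift C X = tlift C X"
    and tflip_Tlift: "X \<in> Obj C \<Longrightarrow>
      Tar C (tflip C X) \<bullet> tflip C (Tob C X) \<bullet> Tar C (tlift C X) = tlift C (Tob C X) \<bullet> tflip C X"
    and tlift_pullback: "X \<in> Obj C \<Longrightarrow>
      is_pullback (tpair X (tproj C (Tob C X)) (Tar C (tproj C X))) (tpair X (tzero C X) (tzero C X))
        (Tob C X) (tlift C X) (tproj C X)"
begin

definition tneg :: "'o \<Rightarrow> 'a" where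
  "tneg X = (THE n. n \<in> Hom C (Tob C X) (Tob C X) \<and> tproj C X \<bullet> n = tproj C X \<and>
     tplus C X \<bullet> tpair X (Ident C (Tob C X)) n = tzero C X \<bullet> tproj C X)"

definition tminus :: "'o \<Rightarrow> 'a" where
  "tminus X = tplus C X \<bullet> tpair X (tpr C 2 X 1) (tneg X \<bullet> tpr C 2 X 2)"

definition tlift2 :: "'o \<Rightarrow> 'a" where
  "tlift2 X = tflip C X \<bullet> tplus C (Tob C X) \<bullet>
     tpair (Tob C X) (Tar C (tzero C X) \<bullet> tpr C 2 X 1) (tlift C X \<bullet> tpr C 2 X 2)"

definition vector_field_set :: "'o \<Rightarrow> 'a set" where
  "vector_field_set X = {v \<in> Hom C X (Tob C X). tproj C X \<bullet> v = Ident C X}"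

definition vf_delta :: "'o \<Rightarrow> 'a \<Rightarrow> 'a \<Rightarrow> 'a" where
  "vf_delta X v w =
     tminus (Tob C X) \<bullet> tpair (Tob C X) (Tar C w \<bullet> v) (tflip C X \<bullet> Tar C v \<bullet> w)"

definition vf_bracket :: "'o \<Rightarrow> 'a \<Rightarrow> 'a \<Rightarrow> 'a" where
  "vf_bracket X v w =
     (THE u. u \<in> vector_field_set X \<and> vf_delta X v w = tlift2 X \<bullet> tpair X w u)"

end


section \<open>Cartesian tangent structures\<close>

text \<open>Finite products are given by a terminal object \<open>Terminal\<close> and binary products \<open>Prod X Y\<close>
  with projections \<open>pr1 X Y\<close>, \<open>pr2 X Y\<close>.\<close>

record ('o, 'a) cartesian_tangent_category = "('o, 'a) tangent_category" +
  Terminal :: "'o"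
  Prod :: "'o \<Rightarrow> 'o \<Rightarrow> 'o"
  pr1 :: "'o \<Rightarrow> 'o \<Rightarrow> 'a"
  pr2 :: "'o \<Rightarrow> 'o \<Rightarrow> 'a"

locale tangent_category_with_products = tangent_category C
  for C :: "('o, 'a, 'm) cartesian_tangent_category_scheme" (structure) +
  assumes Terminal: "is_terminal (Terminal C)"
    and Prod: "X \<in> Obj C \<Longrightarrow> Y \<in> Obj C \<Longrightarrow> is_product X Y (Prod C X Y) (pr1 C X Y) (pr2 C X Y)"
begin

definition bang :: "'o \<Rightarrow> 'a" where
  "bang X = (THE f. f \<in> Hom C X (Terminal C))"

definition pair :: "'a \<Rightarrow> 'a \<Rightarrow> 'a" where
  "pair a b = (THE h. \<exists>Z X Y. a \<in> Hom C Z X \<and> b \<in> Hom C Z Y \<and> h \<in> Hom C Z (Prod C X Y) \<and>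
     pr1 C X Y \<bullet> h = a \<and> pr2 C X Y \<bullet> h = b)"

text \<open>\<open>f \<prod_map> g\<close> for arrows \<open>f\<close> with source \<open>A\<close> and \<open>g\<close> with source \<open>B\<close>.\<close>

definition prod_map :: "'o \<Rightarrow> 'o \<Rightarrow> 'a \<Rightarrow> 'a \<Rightarrow> 'a" where
  "prod_map A B f g = pair (f \<bullet> pr1 C A B) (g \<bullet> pr2 C A B)"

definition chi :: "'o \<Rightarrow> 'o \<Rightarrow> 'a" where
  "chi X Y = pair (Tar C (pr1 C X Y)) (Tar C (pr2 C X Y))"

definition partial1 :: "'o \<Rightarrow> 'o \<Rightarrow> 'a \<Rightarrow> 'a" where
  "partial1 X Y f =
     Tar C f \<bullet> inverse_of (chi X Y) \<bullet> prod_map (Tob C X) Y (Ident C (Tob C X)) (tzero C Y)"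

definition partial2 :: "'o \<Rightarrow> 'o \<Rightarrow> 'a \<Rightarrow> 'a" where
  "partial2 X Y f =
     Tar C f \<bullet> inverse_of (chi X Y) \<bullet> prod_map X (Tob C Y) (tzero C X) (Ident C (Tob C Y))"

text \<open>Projections of \<open>(X \<prod_map> Y) \<prod_map> Z\<close>.\<close>

definition pr13 :: "'o \<Rightarrow> 'o \<Rightarrow> 'o \<Rightarrow> 'a" where
  "pr13 X Y Z = pr1 C X Y \<bullet> pr1 C (Prod C X Y) Z"

definition pr23 :: "'o \<Rightarrow> 'o \<Rightarrow> 'o \<Rightarrow> 'a" where
  "pr23 X Y Z = pr2 C X Y \<bullet> pr1 C (Prod C X Y) Z"

definition pr33 :: "'o \<Rightarrow> 'o \<Rightarrow> 'o \<Rightarrow> 'a" where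
  "pr33 X Y Z = pr2 C (Prod C X Y) Z"

end

locale cartesian_tangent_category = tangent_category_with_products C
  for C :: "('o, 'a, 'm) cartesian_tangent_category_scheme" (structure) +
  assumes chi_iso: "X \<in> Obj C \<Longrightarrow> Y \<in> Obj C \<Longrightarrow> is_iso (chi X Y)"


section \<open>Scalar multiplication\<close>

text \<open>\<open>Robj\<close> is the ring object \<open>R\<close>; \<open>kappa X\<close> is the scalar multiplication \<open>R \<prod_map> TX \<rightarrow> TX\<close>;
  \<open>Tfib\<close> is the tangent fiber of \<open>R\<close> at \<open>0\<close>, \<open>fib_inc\<close> its inclusion into \<open>TR\<close>, and \<open>fib_iso\<close> the
  fixed isomorphism from it to \<open>R\<close>.\<close>

record ('o, 'a) scalar_tangent_category = "('o, 'a) cartesian_tangent_category" +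
  Robj :: "'o"
  radd :: "'a"
  rzero :: "'a"
  rmult :: "'a"
  rone :: "'a"
  kappa :: "'o \<Rightarrow> 'a"
  Tfib :: "'o"
  fib_inc :: "'a"
  fib_iso :: "'a"

locale ring_object = cartesian_tangent_category C
  for C :: "('o, 'a, 'm) scalar_tangent_category_scheme" (structure) +
  assumes R_Obj: "Robj C \<in> Obj C"
    and radd_closed: "radd C \<in> Hom C (Prod C (Robj C) (Robj C)) (Robj C)"
    and rzero_closed: "rzero C \<in> Hom C (Terminal C) (Robj C)"
    and rmult_closed: "rmult C \<in> Hom C (Prod C (Robj C) (Robj C)) (Robj C)"
    and rone_closed: "rone C \<in> Hom C (Terminal C) (Robj C)"
    and radd_assoc:
      "radd C \<bullet> pair (radd C \<bullet> pair (pr13 (Robj C) (Robj C) (Robj C)) (pr23 (Robj C) (Robj C) (Robj C)))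
                     (pr33 (Robj C) (Robj C) (Robj C)) =
       radd C \<bullet> pair (pr13 (Robj C) (Robj C) (Robj C))
                     (radd C \<bullet> pair (pr23 (Robj C) (Robj C) (Robj C)) (pr33 (Robj C) (Robj C) (Robj C)))"
    and radd_comm: "radd C \<bullet> pair (pr2 C (Robj C) (Robj C)) (pr1 C (Robj C) (Robj C)) = radd C"
    and radd_rzero: "radd C \<bullet> pair (Ident C (Robj C)) (rzero C \<bullet> bang (Robj C)) = Ident C (Robj C)"
    and radd_inverse:
      "\<exists>n \<in> Hom C (Robj C) (Robj C). radd C \<bullet> pair (Ident C (Robj C)) n = rzero C \<bullet> bang (Robj C)"
    and rmult_assoc:
      "rmult C \<bullet> pair (rmult C \<bullet> pair (pr13 (Robj C) (Robj C) (Robj C)) (pr23 (Robj C) (Robj C) (Robj C)))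
                      (pr33 (Robj C) (Robj C) (Robj C)) =
       rmult C \<bullet> pair (pr13 (Robj C) (Robj C) (Robj C))
                      (rmult C \<bullet> pair (pr23 (Robj C) (Robj C) (Robj C)) (pr33 (Robj C) (Robj C) (Robj C)))"
    and rmult_comm: "rmult C \<bullet> pair (pr2 C (Robj C) (Robj C)) (pr1 C (Robj C) (Robj C)) = rmult C"
    and rmult_rone: "rmult C \<bullet> pair (Ident C (Robj C)) (rone C \<bullet> bang (Robj C)) = Ident C (Robj C)"
    and rdistrib:
      "rmult C \<bullet> pair (pr13 (Robj C) (Robj C) (Robj C))
                      (radd C \<bullet> pair (pr23 (Robj C) (Robj C) (Robj C)) (pr33 (Robj C) (Robj C) (Robj C))) =
       radd C \<bullet> pair (rmult C \<bullet> pair (pr13 (Robj C) (Robj C) (Robj C)) (pr23 (Robj C) (Robj C) (Robj C)))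
                     (rmult C \<bullet> pair (pr13 (Robj C) (Robj C) (Robj C)) (pr33 (Robj C) (Robj C) (Robj C)))"
begin

definition rneg :: "'a" where
  "rneg = (THE n. n \<in> Hom C (Robj C) (Robj C) \<and>
     radd C \<bullet> pair (Ident C (Robj C)) n = rzero C \<bullet> bang (Robj C))"

end

locale tangent_module_structure = ring_object C
  for C :: "('o, 'a, 'm) scalar_tangent_category_scheme" (structure) +
  assumes kappa_closed: "X \<in> Obj C \<Longrightarrow> kappa C X \<in> Hom C (Prod C (Robj C) (Tob C X)) (Tob C X)"
    and kappa_natural: "f \<in> Hom C X Y \<Longrightarrow>
      Tar C f \<bullet> kappa C X = kappa C Y \<bullet> prod_map (Robj C) (Tob C X) (Ident C (Robj C)) (Tar C f)"
    and tproj_kappa: "X \<in> Obj C \<Longrightarrow>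
      tproj C X \<bullet> kappa C X = tproj C X \<bullet> pr2 C (Robj C) (Tob C X)"
    and kappa_assoc: "X \<in> Obj C \<Longrightarrow>
      kappa C X \<bullet> pair (pr13 (Robj C) (Robj C) (Tob C X))
        (kappa C X \<bullet> pair (pr23 (Robj C) (Robj C) (Tob C X)) (pr33 (Robj C) (Robj C) (Tob C X))) =
      kappa C X \<bullet> prod_map (Prod C (Robj C) (Robj C)) (Tob C X) (rmult C) (Ident C (Tob C X))"
    and kappa_rone: "X \<in> Obj C \<Longrightarrow>
      kappa C X \<bullet> prod_map (Terminal C) (Tob C X) (rone C) (Ident C (Tob C X)) =
      pr2 C (Terminal C) (Tob C X)"
    and kappa_radd: "X \<in> Obj C \<Longrightarrow>
      kappa C X \<bullet> prod_map (Prod C (Robj C) (Robj C)) (Tob C X) (radd C) (Ident C (Tob C X)) =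
      tplus C X \<bullet> tpair X
        (kappa C X \<bullet> pair (pr13 (Robj C) (Robj C) (Tob C X)) (pr33 (Robj C) (Robj C) (Tob C X)))
        (kappa C X \<bullet> pair (pr23 (Robj C) (Robj C) (Tob C X)) (pr33 (Robj C) (Robj C) (Tob C X)))"
    and kappa_tplus: "X \<in> Obj C \<Longrightarrow>
      kappa C X \<bullet> prod_map (Robj C) (Tpow C 2 X) (Ident C (Robj C)) (tplus C X) =
      tplus C X \<bullet> tpair X
        (kappa C X \<bullet> prod_map (Robj C) (Tpow C 2 X) (Ident C (Robj C)) (tpr C 2 X 1))
        (kappa C X \<bullet> prod_map (Robj C) (Tpow C 2 X) (Ident C (Robj C)) (tpr C 2 X 2))"
    and Tfib_pullback: "is_pullback (rzero C) (tproj C (Robj C)) (Tfib C) (bang (Tfib C)) (fib_inc C)"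
begin

definition fib_plus :: "'a" where
  "fib_plus = (THE h. h \<in> Hom C (Prod C (Tfib C) (Tfib C)) (Tfib C) \<and>
     fib_inc C \<bullet> h = tplus C (Robj C) \<bullet> tpair (Robj C)
       (fib_inc C \<bullet> pr1 C (Tfib C) (Tfib C)) (fib_inc C \<bullet> pr2 C (Tfib C) (Tfib C)))"

definition fib_kappa :: "'a" where
  "fib_kappa = (THE h. h \<in> Hom C (Prod C (Robj C) (Tfib C)) (Tfib C) \<and>
     fib_inc C \<bullet> h = kappa C (Robj C) \<bullet> prod_map (Robj C) (Tfib C) (Ident C (Robj C)) (fib_inc C))"

text \<open>Projection of \<open>TR\<close> onto the fiber at \<open>0\<close>: translate a tangent vector at \<open>r\<close> by \<open>-r\<close>.\<close>

definition eta :: "'a" where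
  "eta = fib_iso C \<bullet> (THE h. h \<in> Hom C (Tob C (Robj C)) (Tfib C) \<and>
     fib_inc C \<bullet> h = partial2 (Robj C) (Robj C) (radd C) \<bullet>
       pair (rneg \<bullet> tproj C (Robj C)) (Ident C (Tob C (Robj C))))"

end

locale scalar_tangent_category = tangent_module_structure C
  for C :: "('o, 'a, 'm) scalar_tangent_category_scheme" (structure) +
  \<comment> \<open>tangent-stability: \<open>fib_iso\<close> is an isomorphism of \<open>R\<close>-modules\<close>
  assumes fib_iso_closed: "fib_iso C \<in> Hom C (Tfib C) (Robj C)"
    and fib_iso: "is_iso (fib_iso C)"
    and fib_iso_plus: "fib_iso C \<bullet> fib_plus =
      radd C \<bullet> prod_map (Tfib C) (Tfib C) (fib_iso C) (fib_iso C)"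
    and fib_iso_kappa: "fib_iso C \<bullet> fib_kappa =
      rmult C \<bullet> prod_map (Robj C) (Tfib C) (Ident C (Robj C)) (fib_iso C)"
    and scalar1: "X \<in> Obj C \<Longrightarrow>
      tlift C X \<bullet> kappa C X =
      kappa C (Tob C X) \<bullet> prod_map (Robj C) (Tob C X) (Ident C (Robj C)) (tlift C X)"
    and scalar2: "X \<in> Obj C \<Longrightarrow>
      partial1 (Robj C) (Tob C X) (kappa C X) =
      tlift2 X \<bullet>
        tpair X
          (kappa C X \<bullet> pair (pr13 (Robj C) (Robj C) (Tob C X)) (pr33 (Robj C) (Robj C) (Tob C X)))
          (kappa C X \<bullet> pair (pr23 (Robj C) (Robj C) (Tob C X)) (pr33 (Robj C) (Robj C) (Tob C X))) \<bullet>
        prod_map (Tob C (Robj C)) (Tob C X) (pair (tproj C (Robj C)) eta) (Ident C (Tob C X))"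
    and scalar3: "X \<in> Obj C \<Longrightarrow>
      partial2 (Robj C) (Tob C X) (kappa C X) =
      tflip C X \<bullet> kappa C (Tob C X) \<bullet> prod_map (Robj C) (Tob C (Tob C X)) (Ident C (Robj C)) (tflip C X)"
begin

definition function_ring :: "'o \<Rightarrow> 'a ring" where
  "function_ring X = \<lparr> carrier = Hom C X (Robj C),
     monoid.mult = (\<lambda>f g. rmult C \<bullet> pair f g), one = rone C \<bullet> bang X,
     zero = rzero C \<bullet> bang X, add = (\<lambda>f g. radd C \<bullet> pair f g) \<rparr>"

text \<open>The fields \<open>mult\<close> and \<open>one\<close> of a module record carry no meaning.\<close>

definition vector_fields :: "'o \<Rightarrow> ('a, 'a) module" where
  "vector_fields X = \<lparr> carrier = vector_field_set X,
     monoid.mult = undefined, one = undefined,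
     zero = tzero C X, add = (\<lambda>v w. tplus C X \<bullet> tpair X v w),
     smult = (\<lambda>f v. kappa C X \<bullet> pair f v) \<rparr>"

definition vf_action :: "'a \<Rightarrow> 'a \<Rightarrow> 'a" where
  "vf_action v f = eta \<bullet> Tar C f \<bullet> v"

end


section \<open>Cartan calculi\<close>

text \<open>A graded algebra is a family of abelian groups indexed by the integers, with products
  \<open>gmult p q\<close> from degrees \<open>p\<close> and \<open>q\<close> to degree \<open>p + q\<close>.\<close>

record 'f graded_algebra =
  gcarrier :: "int \<Rightarrow> 'f set"
  gadd :: "int \<Rightarrow> 'f \<Rightarrow> 'f \<Rightarrow> 'f"
  gzero :: "int \<Rightarrow> 'f"
  gmult :: "int \<Rightarrow> int \<Rightarrow> 'f \<Rightarrow> 'f \<Rightarrow> 'f"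
  gone :: "'f"

text \<open>The multiplicative fields of \<open>component A k\<close> are only meaningful for \<open>k = 0\<close>.\<close>

definition component :: "('f, 'm) graded_algebra_scheme \<Rightarrow> int \<Rightarrow> 'f ring" where
  "component A k = \<lparr> carrier = gcarrier A k, monoid.mult = gmult A k k, one = gone A,
     zero = gzero A k, add = gadd A k \<rparr>"

text \<open>\<open>gsign A k m x\<close> is \<open>(-1)\<^sup>m x\<close> for \<open>x\<close> of degree \<open>k\<close>.\<close>

definition gsign :: "('f, 'm) graded_algebra_scheme \<Rightarrow> int \<Rightarrow> int \<Rightarrow> 'f \<Rightarrow> 'f" where
  "gsign A k m x = (if even m then x else \<ominus>\<^bsub>component A k\<^esub> x)"

locale graded_commutative_algebra =
  fixes A :: "('f, 'm) graded_algebra_scheme" (structure)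
  assumes component_group: "abelian_group (component A k)"
    and gmult_closed: "a \<in> gcarrier A p \<Longrightarrow> b \<in> gcarrier A q \<Longrightarrow> gmult A p q a b \<in> gcarrier A (p + q)"
    and gmult_add_left: "a \<in> gcarrier A p \<Longrightarrow> a' \<in> gcarrier A p \<Longrightarrow> b \<in> gcarrier A q \<Longrightarrow>
      gmult A p q (gadd A p a a') b = gadd A (p + q) (gmult A p q a b) (gmult A p q a' b)"
    and gmult_add_right: "a \<in> gcarrier A p \<Longrightarrow> b \<in> gcarrier A q \<Longrightarrow> b' \<in> gcarrier A q \<Longrightarrow>
      gmult A p q a (gadd A q b b') = gadd A (p + q) (gmult A p q a b) (gmult A p q a b')"
    and gmult_assoc: "a \<in> gcarrier A p \<Longrightarrow> b \<in> gcarrier A q \<Longrightarrow> c \<in> gcarrier A r \<Longrightarrow>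
      gmult A (p + q) r (gmult A p q a b) c = gmult A p (q + r) a (gmult A q r b c)"
    and gone_closed: "gone A \<in> gcarrier A 0"
    and gone_left: "a \<in> gcarrier A p \<Longrightarrow> gmult A 0 p (gone A) a = a"
    and gone_right: "a \<in> gcarrier A p \<Longrightarrow> gmult A p 0 a (gone A) = a"
    and gmult_comm: "a \<in> gcarrier A p \<Longrightarrow> b \<in> gcarrier A q \<Longrightarrow>
      gmult A p q a b = gsign A (p + q) (p * q) (gmult A q p b a)"

text \<open>A graded map is a family indexed by the degree of the argument.\<close>

definition graded_derivation ::
  "('f, 'm) graded_algebra_scheme \<Rightarrow> int \<Rightarrow> (int \<Rightarrow> 'f \<Rightarrow> 'f) \<Rightarrow> bool" where
  "graded_derivation A p \<delta> \<longleftrightarrow>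
     (\<forall>k. \<forall>a \<in> gcarrier A k. \<delta> k a \<in> gcarrier A (k + p)) \<and>
     (\<forall>k. \<forall>a \<in> gcarrier A k. \<forall>b \<in> gcarrier A k.
        \<delta> k (gadd A k a b) = gadd A (k + p) (\<delta> k a) (\<delta> k b)) \<and>
     (\<forall>k l. \<forall>a \<in> gcarrier A k. \<forall>b \<in> gcarrier A l.
        \<delta> (k + l) (gmult A k l a b) =
        gadd A (k + l + p) (gmult A (k + p) l (\<delta> k a) b)
          (gsign A (k + l + p) (p * k) (gmult A k (l + p) a (\<delta> l b))))"

text \<open>The graded commutator of maps \<open>\<delta>\<close>, \<open>\<epsilon>\<close> of degrees \<open>p\<close>, \<open>q\<close>.\<close>

definition graded_commutator ::
  "('f, 'm) graded_algebra_scheme \<Rightarrow> int \<Rightarrow> int \<Rightarrow> (int \<Rightarrow> 'f \<Rightarrow> 'f) \<Rightarrow> (int \<Rightarrow> 'f \<Rightarrow> 'f) \<Rightarrow>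
    int \<Rightarrow> 'f \<Rightarrow> 'f" where
  "graded_commutator A p q \<delta> \<epsilon> k a =
     \<delta> (k + q) (\<epsilon> k a) \<ominus>\<^bsub>component A (k + p + q)\<^esub>
     gsign A (k + p + q) (p * q) (\<epsilon> (k + p) (\<delta> k a))"

locale lie_bracket = abelian_group M
  for M :: "('r, 'v, 'm) module_scheme" (structure)
    and br :: "'v \<Rightarrow> 'v \<Rightarrow> 'v" +
  assumes br_closed: "v \<in> carrier M \<Longrightarrow> w \<in> carrier M \<Longrightarrow> br v w \<in> carrier M"
    and br_add_left: "u \<in> carrier M \<Longrightarrow> v \<in> carrier M \<Longrightarrow> w \<in> carrier M \<Longrightarrow>
      br (u \<oplus> v) w = br u w \<oplus> br v w"
    and br_add_right: "u \<in> carrier M \<Longrightarrow> v \<in> carrier M \<Longrightarrow> w \<in> carrier M \<Longrightarrow>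
      br u (v \<oplus> w) = br u v \<oplus> br u w"
    and br_antisym: "v \<in> carrier M \<Longrightarrow> w \<in> carrier M \<Longrightarrow> br v w = \<ominus> br w v"
    and br_jacobi: "u \<in> carrier M \<Longrightarrow> v \<in> carrier M \<Longrightarrow> w \<in> carrier M \<Longrightarrow>
      br u (br v w) \<oplus> br v (br w u) \<oplus> br w (br u v) = \<zero>"

definition lie_derivative ::
  "('f, 'm) graded_algebra_scheme \<Rightarrow> (int \<Rightarrow> 'f \<Rightarrow> 'f) \<Rightarrow> ('v \<Rightarrow> int \<Rightarrow> 'f \<Rightarrow> 'f) \<Rightarrow> 'v \<Rightarrow>
    int \<Rightarrow> 'f \<Rightarrow> 'f" where
  "lie_derivative A d \<iota> v = graded_commutator A (-1) 1 (\<iota> v) d"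

locale cartan_calculus = graded_commutative_algebra A + module "component A 0" M + lie_bracket M br
  for A :: "('f, 'm) graded_algebra_scheme"
    and d :: "int \<Rightarrow> 'f \<Rightarrow> 'f"
    and M :: "('f, 'v, 'n) module_scheme"
    and br :: "'v \<Rightarrow> 'v \<Rightarrow> 'v"
    and \<iota> :: "'v \<Rightarrow> int \<Rightarrow> 'f \<Rightarrow> 'f" +
  assumes d_derivation: "graded_derivation A 1 d"
    and d_squared: "\<omega> \<in> gcarrier A k \<Longrightarrow> d (k + 1) (d k \<omega>) = gzero A (k + 2)"
    and inner_derivation: "v \<in> carrier M \<Longrightarrow> graded_derivation A (-1) (\<iota> v)"
    and inner_add: "v \<in> carrier M \<Longrightarrow> w \<in> carrier M \<Longrightarrow> \<omega> \<in> gcarrier A k \<Longrightarrow>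
      \<iota> (v \<oplus>\<^bsub>M\<^esub> w) k \<omega> = gadd A (k - 1) (\<iota> v k \<omega>) (\<iota> w k \<omega>)"
    and inner_smult: "f \<in> gcarrier A 0 \<Longrightarrow> v \<in> carrier M \<Longrightarrow> \<omega> \<in> gcarrier A k \<Longrightarrow>
      \<iota> (f \<odot>\<^bsub>M\<^esub> v) k \<omega> = gmult A 0 (k - 1) f (\<iota> v k \<omega>)"
    and inner_inner: "v \<in> carrier M \<Longrightarrow> w \<in> carrier M \<Longrightarrow> \<omega> \<in> gcarrier A k \<Longrightarrow>
      graded_commutator A (-1) (-1) (\<iota> v) (\<iota> w) k \<omega> = gzero A (k - 2)"
    and lie_inner: "v \<in> carrier M \<Longrightarrow> w \<in> carrier M \<Longrightarrow> \<omega> \<in> gcarrier A k \<Longrightarrow>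
      graded_commutator A 0 (-1) (lie_derivative A d \<iota> v) (\<iota> w) k \<omega> = \<iota> (br v w) k \<omega>"
    and lie_lie: "v \<in> carrier M \<Longrightarrow> w \<in> carrier M \<Longrightarrow> \<omega> \<in> gcarrier A k \<Longrightarrow>
      graded_commutator A 0 0 (lie_derivative A d \<iota> v) (lie_derivative A d \<iota> w) k \<omega> =
      lie_derivative A d \<iota> (br v w) k \<omega>"
    and lie_d: "v \<in> carrier M \<Longrightarrow> \<omega> \<in> gcarrier A k \<Longrightarrow>
      graded_commutator A 0 1 (lie_derivative A d \<iota> v) d k \<omega> = gzero A (k + 1)"


section \<open>Lie-Rinehart forms\<close>

text \<open>A form of degree \<open>k\<close> is a function on lists of \<open>k\<close> vectors, \<open>undefined\<close> elsewhere. There is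
  no list of negative length, so in negative degrees \<open>\<lambda>_. undefined\<close> is the only form.\<close>

definition vectors :: "('r, 'v, 'm) module_scheme \<Rightarrow> int \<Rightarrow> 'v list set" where
  "vectors M k = {vs. set vs \<subseteq> carrier M \<and> int (length vs) = k}"

definition form_set ::
  "('r, 'n) ring_scheme \<Rightarrow> ('r, 'v, 'm) module_scheme \<Rightarrow> int \<Rightarrow> ('v list \<Rightarrow> 'r) set" where
  "form_set S M k = {\<omega> \<in> vectors M k \<rightarrow>\<^sub>E carrier S.
     (\<forall>us ws. \<forall>v \<in> carrier M. \<forall>w \<in> carrier M. us @ [v] @ ws \<in> vectors M k \<longrightarrow>
        \<omega> (us @ [v \<oplus>\<^bsub>M\<^esub> w] @ ws) = \<omega> (us @ [v] @ ws) \<oplus>\<^bsub>S\<^esub> \<omega> (us @ [w] @ ws)) \<and>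
     (\<forall>us ws. \<forall>f \<in> carrier S. \<forall>v \<in> carrier M. us @ [v] @ ws \<in> vectors M k \<longrightarrow>
        \<omega> (us @ [f \<odot>\<^bsub>M\<^esub> v] @ ws) = f \<otimes>\<^bsub>S\<^esub> \<omega> (us @ [v] @ ws)) \<and>
     (\<forall>vs \<in> vectors M k. \<forall>i < length vs. \<forall>j < length vs. i \<noteq> j \<longrightarrow>
        \<omega> (vs[i := vs ! j, j := vs ! i]) = \<ominus>\<^bsub>S\<^esub> \<omega> vs)}"

text \<open>The antisymmetrization of the pointwise product is normalized as the sum over
  \<open>(p, q)\<close>-shuffles. By \<open>sum_permutations_eq_shuffles\<close> below, the sum over the
  whole symmetric group is \<open>p! q!\<close> times this, so the normalizing factor in front of the latter sum
  is \<open>1 / (p! q!)\<close>, written without dividing by integers. It is the factor for which the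
  differential and the inner derivative, as defined below, are derivations. With
  \<open>1 / (p + q)!\<close> instead, the product of \<open>f\<close> in degree \<open>0\<close> and \<open>\<beta>\<close> in
  degree \<open>1\<close> would have the differential \<open>f d\<beta> + 2 df \<and> \<beta>\<close>.\<close>

definition shuffle_perms :: "int \<Rightarrow> int \<Rightarrow> (nat \<Rightarrow> nat) set" where
  "shuffle_perms p q = {\<sigma>. 0 \<le> p \<and> 0 \<le> q \<and> \<sigma> permutes {..<nat (p + q)} \<and>
     strict_mono_on {..<nat p} \<sigma> \<and> strict_mono_on {nat p..<nat (p + q)} \<sigma>}"

definition wedge_term ::
  "('r, 'n) ring_scheme \<Rightarrow> int \<Rightarrow> int \<Rightarrow> ('v list \<Rightarrow> 'r) \<Rightarrow> ('v list \<Rightarrow> 'r) \<Rightarrow> 'v list \<Rightarrow>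
    (nat \<Rightarrow> nat) \<Rightarrow> 'r" where
  "wedge_term S p q \<alpha> \<beta> vs \<sigma> = [sign \<sigma>] \<cdot>\<^bsub>S\<^esub>
     (\<alpha> (map (\<lambda>i. vs ! \<sigma> i) [0..<nat p]) \<otimes>\<^bsub>S\<^esub> \<beta> (map (\<lambda>i. vs ! \<sigma> i) [nat p..<nat (p + q)]))"

definition wedge ::
  "('r, 'n) ring_scheme \<Rightarrow> ('r, 'v, 'm) module_scheme \<Rightarrow> int \<Rightarrow> int \<Rightarrow>
    ('v list \<Rightarrow> 'r) \<Rightarrow> ('v list \<Rightarrow> 'r) \<Rightarrow> 'v list \<Rightarrow> 'r" where
  "wedge S M p q \<alpha> \<beta> = (\<lambda>vs \<in> vectors M (p + q).
     \<Oplus>\<^bsub>S\<^esub> \<sigma> \<in> shuffle_perms p q. wedge_term S p q \<alpha> \<beta> vs \<sigma>)"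

definition form_algebra ::
  "('r, 'n) ring_scheme \<Rightarrow> ('r, 'v, 'm) module_scheme \<Rightarrow> ('v list \<Rightarrow> 'r) graded_algebra" where
  "form_algebra S M = \<lparr>
     gcarrier = form_set S M,
     gadd = (\<lambda>k \<alpha> \<beta>. \<lambda>vs \<in> vectors M k. \<alpha> vs \<oplus>\<^bsub>S\<^esub> \<beta> vs),
     gzero = (\<lambda>k. \<lambda>vs \<in> vectors M k. \<zero>\<^bsub>S\<^esub>),
     gmult = wedge S M,
     gone = (\<lambda>vs \<in> vectors M 0. \<one>\<^bsub>S\<^esub>) \<rparr>"

text \<open>\<open>act v f\<close> is the action of a vector on a ring element, \<open>br\<close> the bracket. The list
  \<open>nths vs (- {i})\<close> is \<open>vs\<close> with its \<open>i\<close>-th entry removed.\<close>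

definition CE_differential ::
  "('r, 'n) ring_scheme \<Rightarrow> ('r, 'v, 'm) module_scheme \<Rightarrow> ('v \<Rightarrow> 'v \<Rightarrow> 'v) \<Rightarrow> ('v \<Rightarrow> 'r \<Rightarrow> 'r) \<Rightarrow>
    int \<Rightarrow> ('v list \<Rightarrow> 'r) \<Rightarrow> 'v list \<Rightarrow> 'r" where
  "CE_differential S M br act k \<omega> = (\<lambda>vs \<in> vectors M (k + 1).
     (\<Oplus>\<^bsub>S\<^esub> i \<in> {..<length vs}. [((-1::int) ^ i)] \<cdot>\<^bsub>S\<^esub> act (vs ! i) (\<omega> (nths vs (- {i})))) \<oplus>\<^bsub>S\<^esub>
     (\<Oplus>\<^bsub>S\<^esub> j \<in> {..<length vs}. \<Oplus>\<^bsub>S\<^esub> i \<in> {..<j}.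
        [((-1::int) ^ (i + j))] \<cdot>\<^bsub>S\<^esub> \<omega> (br (vs ! i) (vs ! j) # nths vs (- {i, j}))))"

definition inner_derivative ::
  "('r, 'v, 'm) module_scheme \<Rightarrow> 'v \<Rightarrow> int \<Rightarrow> ('v list \<Rightarrow> 'r) \<Rightarrow> 'v list \<Rightarrow> 'r" where
  "inner_derivative M v k \<omega> = (\<lambda>vs \<in> vectors M (k - 1). \<omega> (v # vs))"

text \<open>\<open>M\<close> as a module over the degree \<open>0\<close> forms, which are the functions
  on \<open>{[]}\<close> with values in the ring.\<close>

definition degree0_module :: "('r, 'v, 'm) module_scheme \<Rightarrow> ('v list \<Rightarrow> 'r, 'v) module" where
  "degree0_module M = \<lparr> carrier = carrier M, monoid.mult = monoid.mult M, one = one M,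
     zero = zero M, add = add M, smult = (\<lambda>f v. f [] \<odot>\<^bsub>M\<^esub> v) \<rparr>"


section \<open>Normalization of the product\<close>

lemma sorting_permutation:
  fixes f :: "nat \<Rightarrow> nat"
  assumes "inj_on f {a..<b}"
  obtains \<rho> where "\<rho> permutes {a..<b}" "strict_mono_on {a..<b} (f \<circ> \<rho>)"
proof -
  define xs where "xs = sorted_list_of_set (f ` {a..<b})"
  have len: "length xs = b - a"
    unfolding xs_def using assms by (simp add: card_image)
  have set: "set xs = f ` {a..<b}" and dist: "distinct xs" and srt: "sorted_wrt (<) xs"
    unfolding xs_def by auto
  define \<rho> where "\<rho> = (\<lambda>i. if i \<in> {a..<b} then inv_into {a..<b} f (xs ! (i - a)) else i)"
  have mem: "xs ! (i - a) \<in> f ` {a..<b}" if "i \<in> {a..<b}" for i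
    unfolding set[symmetric] using that len by (intro nth_mem) auto
  have f\<rho>: "f (\<rho> i) = xs ! (i - a)" if "i \<in> {a..<b}" for i
    using f_inv_into_f[OF mem[OF that]] that unfolding \<rho>_def by simp
  have \<rho>_in: "\<rho> i \<in> {a..<b}" if "i \<in> {a..<b}" for i
    using inv_into_into[OF mem[OF that]] that unfolding \<rho>_def by simp
  have sm: "strict_mono_on {a..<b} (f \<circ> \<rho>)"
  proof (rule strict_mono_onI)
    fix i j assume ij: "i \<in> {a..<b}" "j \<in> {a..<b}" "i < j"
    then have "xs ! (i - a) < xs ! (j - a)"
      using srt len by (auto simp: sorted_wrt_iff_nth_less)
    then show "(f \<circ> \<rho>) i < (f \<circ> \<rho>) j" using ij f\<rho> by simp
  qed
  have "inj_on \<rho> {a..<b}"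
    using strict_mono_on_imp_inj_on[OF sm] by (rule inj_on_imageI2)
  moreover have "\<rho> ` {a..<b} \<subseteq> {a..<b}" using \<rho>_in by blast
  ultimately have "bij_betw \<rho> {a..<b} {a..<b}"
    by (simp add: bij_betw_def endo_inj_surj)
  then have "\<rho> permutes {a..<b}"
    by (rule bij_imp_permutes) (auto simp: \<rho>_def)
  then show thesis using sm that by blast
qed

lemma strict_mono_on_eqI:
  fixes f g :: "nat \<Rightarrow> nat"
  assumes "strict_mono_on {a..<b} f" "strict_mono_on {a..<b} g" "f ` {a..<b} = g ` {a..<b}"
    and "i \<in> {a..<b}"
  shows "f i = g i"
proof -
  have "sorted_wrt (<) (map f [a..<b])" "sorted_wrt (<) (map g [a..<b])"
    using assms(1,2)[THEN strict_mono_onD] by (simp_all add: sorted_wrt_iff_nth_less)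
  moreover have "set (map f [a..<b]) = set (map g [a..<b])" using assms(3) by simp
  ultimately have "map f [a..<b] = map g [a..<b]" by (metis strict_sorted_equal)
  then show ?thesis using assms(4) by auto
qed

definition block_perms :: "nat \<Rightarrow> nat \<Rightarrow> (nat \<Rightarrow> nat) set" where
  "block_perms p q =
     (\<lambda>(\<rho>, \<rho>'). \<rho> \<circ> \<rho>') ` ({\<rho>. \<rho> permutes {0..<p}} \<times> {\<rho>. \<rho> permutes {p..<p + q}})"

lemma block_perms_facts:
  fixes p q :: nat
  assumes "\<rho> permutes {0..<p}" "\<rho>' permutes {p..<p + q}"
  shows "i < p \<Longrightarrow> (\<rho> \<circ> \<rho>') i = \<rho> i" "p \<le> i \<Longrightarrow> (\<rho> \<circ> \<rho>') i = \<rho>' i"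
    and "\<rho> \<circ> \<rho>' permutes {..<p + q}"
proof -
  show "i < p \<Longrightarrow> (\<rho> \<circ> \<rho>') i = \<rho> i" by (simp add: permutes_not_in[OF assms(2)])
  show "p \<le> i \<Longrightarrow> (\<rho> \<circ> \<rho>') i = \<rho>' i"
    using permutes_not_in[OF assms(1), of "\<rho>' i"] permutes_in_image[OF assms(2), of i]
      permutes_not_in[OF assms(2), of i]
    by (cases "i \<in> {p..<p+q}") auto
  have "\<rho> permutes {..<p+q}" "\<rho>' permutes {..<p+q}"
    by (rule permutes_subset[OF assms(1)], simp add: lessThan_atLeast0)
       (rule permutes_subset[OF assms(2)], auto)
  then show "\<rho> \<circ> \<rho>' permutes {..<p + q}" by (rule permutes_compose[rotated])
qed

lemma finite_block_perms: "finite (block_perms p q)"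
  unfolding block_perms_def by (intro finite_imageI finite_cartesian_product finite_permutations) auto

lemma card_block_perms: "card (block_perms p q) = fact p * fact q"
proof -
  have "inj_on (\<lambda>(\<rho>, \<rho>'). \<rho> \<circ> \<rho>') ({\<rho>. \<rho> permutes {0..<p}} \<times> {\<rho>. \<rho> permutes {p..<p + q}})"
  proof (rule inj_onI, clarsimp)
    fix \<rho> \<rho>' \<pi> \<pi>' :: "nat \<Rightarrow> nat"
    assume *: "\<rho> permutes {0..<p}" "\<rho>' permutes {p..<p + q}"
      "\<pi> permutes {0..<p}" "\<pi>' permutes {p..<p + q}" and eq: "\<rho> \<circ> \<rho>' = \<pi> \<circ> \<pi>'"
    have "\<rho> i = \<pi> i" for i
      using block_perms_facts(1)[OF *(1,2), of i] block_perms_facts(1)[OF *(3,4), of i] eq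
        permutes_not_in[OF *(1), of i] permutes_not_in[OF *(3), of i] by (cases "i < p") auto
    moreover have "\<rho>' i = \<pi>' i" for i
      using block_perms_facts(2)[OF *(1,2), of i] block_perms_facts(2)[OF *(3,4), of i] eq
        permutes_not_in[OF *(2), of i] permutes_not_in[OF *(4), of i] by (cases "p \<le> i") auto
    ultimately show "\<rho> = \<pi> \<and> \<rho>' = \<pi>'" by auto
  qed
  then show ?thesis
    unfolding block_perms_def
    by (simp add: card_image card_cartesian_product card_permutations[OF refl])
qed

lemma block_perms_image:
  assumes "\<rho> \<in> block_perms p q"
  shows "\<rho> ` {0..<p} = {0..<p}" "\<rho> ` {p..<p + q} = {p..<p + q}" "\<rho> permutes {..<p + q}"
proof -
  from assms obtain \<rho>1 \<rho>2 where *: "\<rho>1 permutes {0..<p}" "\<rho>2 permutes {p..<p + q}" "\<rho> = \<rho>1 \<circ> \<rho>2"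
    unfolding block_perms_def by auto
  have "\<rho> ` {0..<p} = \<rho>1 ` {0..<p}" unfolding *(3)
    by (rule image_cong[OF refl]) (use block_perms_facts(1)[OF *(1,2)] in simp)
  then show "\<rho> ` {0..<p} = {0..<p}" using permutes_image[OF *(1)] by simp
  have "\<rho> ` {p..<p+q} = \<rho>2 ` {p..<p+q}" unfolding *(3)
    by (rule image_cong[OF refl]) (use block_perms_facts(2)[OF *(1,2)] in simp)
  then show "\<rho> ` {p..<p+q} = {p..<p+q}" using permutes_image[OF *(2)] by simp
  show "\<rho> permutes {..<p + q}" using block_perms_facts(3)[OF *(1,2)] *(3) by simp
qed

lemma shuffle_perms_nat:
  "shuffle_perms (int p) (int q) = {\<sigma>. \<sigma> permutes {..<p + q} \<and>
     strict_mono_on {0..<p} \<sigma> \<and> strict_mono_on {p..<p + q} \<sigma>}"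
proof -
  have "nat (int p + int q) = p + q" by simp
  then show ?thesis unfolding shuffle_perms_def by (simp add: lessThan_atLeast0)
qed

lemma shuffle_perms_unique:
  assumes "s \<in> shuffle_perms (int p) (int q)" "t \<in> shuffle_perms (int p) (int q)"
    and "\<rho> \<in> block_perms p q" "\<rho>' \<in> block_perms p q" "s \<circ> \<rho> = t \<circ> \<rho>'"
  shows "s = t"
proof
  fix i
  have img: "s ` B = t ` B" if "\<rho> ` B = B" "\<rho>' ` B = B" for B
    using assms(5) that by (metis image_comp)
  note st = assms(1,2)[unfolded shuffle_perms_nat]
  consider "i \<in> {0..<p}" | "i \<in> {p..<p + q}" | "i \<notin> {..<p + q}" by fastforce
  then show "s i = t i"
  proof cases
    case 1 then show ?thesis
      using st by (intro strict_mono_on_eqI[of 0 p s t]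
        img block_perms_image[OF assms(3)] block_perms_image[OF assms(4)]) auto
  next
    case 2 then show ?thesis
      using st by (intro strict_mono_on_eqI[of p "p + q" s t]
        img block_perms_image[OF assms(3)] block_perms_image[OF assms(4)]) auto
  next
    case 3 then show ?thesis using st by (auto simp: permutes_def)
  qed
qed

lemma permutes_shuffle_decomposition:
  "{\<sigma>. \<sigma> permutes {..<p + q}} =
     (\<Union>s \<in> shuffle_perms (int p) (int q). (\<lambda>\<rho>. s \<circ> \<rho>) ` block_perms p q)"
proof (intro equalityI subsetI)
  fix \<sigma> assume "\<sigma> \<in> {\<sigma>. \<sigma> permutes {..<p + q}}"
  then have \<sigma>: "\<sigma> permutes {..<p + q}" by simp
  then have inj: "inj_on \<sigma> A" for A using permutes_inj inj_on_subset by blast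
  obtain \<rho> where \<rho>: "\<rho> permutes {0..<p}" "strict_mono_on {0..<p} (\<sigma> \<circ> \<rho>)"
    using sorting_permutation[OF inj] by blast
  obtain \<rho>' where \<rho>': "\<rho>' permutes {p..<p + q}" "strict_mono_on {p..<p + q} (\<sigma> \<circ> \<rho>')"
    using sorting_permutation[OF inj] by blast
  note bf = block_perms_facts[OF \<rho>(1) \<rho>'(1)]
  have "\<sigma> \<circ> (\<rho> \<circ> \<rho>') permutes {..<p + q}" using \<sigma> bf(3) by (rule permutes_compose[rotated])
  moreover have "strict_mono_on {0..<p} (\<sigma> \<circ> (\<rho> \<circ> \<rho>'))"
    using \<rho>(2) bf(1) unfolding strict_mono_on_def by simp
  moreover have "strict_mono_on {p..<p + q} (\<sigma> \<circ> (\<rho> \<circ> \<rho>'))"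
    using \<rho>'(2) bf(2) unfolding strict_mono_on_def by simp
  ultimately have s: "\<sigma> \<circ> (\<rho> \<circ> \<rho>') \<in> shuffle_perms (int p) (int q)"
    unfolding shuffle_perms_nat by blast
  have bij: "bij \<rho>" "bij \<rho>'" using \<rho>(1) \<rho>'(1) permutes_bij by auto
  have "inv_into UNIV \<rho>' \<circ> inv_into UNIV \<rho> \<in> block_perms p q"
  proof -
    have "inv_into UNIV \<rho>' \<circ> inv_into UNIV \<rho> = inv_into UNIV \<rho> \<circ> inv_into UNIV \<rho>'"
    proof
      fix i
      have i1: "inv_into UNIV \<rho> permutes {0..<p}" and i2: "inv_into UNIV \<rho>' permutes {p..<p + q}"
        using \<rho>(1) \<rho>'(1) permutes_inv by auto
      show "(inv_into UNIV \<rho>' \<circ> inv_into UNIV \<rho>) i = (inv_into UNIV \<rho> \<circ> inv_into UNIV \<rho>') i"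
      proof (cases "i < p")
        case True
        then have "inv_into UNIV \<rho> i < p" using permutes_in_image[OF i1, of i] by simp
        then show ?thesis using True block_perms_facts(1)[OF i1 i2]
            permutes_not_in[OF i2, of "inv_into UNIV \<rho> i"] by simp
      next
        case False
        then show ?thesis using block_perms_facts(2)[OF i1 i2, of i]
            permutes_not_in[OF i1, of i] by simp
      qed
    qed
    then show ?thesis unfolding block_perms_def
      using permutes_inv[OF \<rho>(1)] permutes_inv[OF \<rho>'(1)] by auto
  qed
  moreover have "\<sigma> = (\<sigma> \<circ> (\<rho> \<circ> \<rho>')) \<circ> (inv_into UNIV \<rho>' \<circ> inv_into UNIV \<rho>)"
    using bij by (auto simp: fun_eq_iff bij_is_surj surj_f_inv_f)
  ultimately show "\<sigma> \<in> (\<Union>s \<in> shuffle_perms (int p) (int q). (\<lambda>\<rho>. s \<circ> \<rho>) ` block_perms p q)"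
    using s by blast
next
  fix \<sigma> assume "\<sigma> \<in> (\<Union>s \<in> shuffle_perms (int p) (int q). (\<lambda>\<rho>. s \<circ> \<rho>) ` block_perms p q)"
  then obtain s \<rho> where "s \<in> shuffle_perms (int p) (int q)" "\<rho> \<in> block_perms p q" "\<sigma> = s \<circ> \<rho>"
    by blast
  then show "\<sigma> \<in> {\<sigma>. \<sigma> permutes {..<p + q}}"
    using block_perms_image(3) permutes_compose unfolding shuffle_perms_nat by blast
qed

lemma wedge_term_closed:
  assumes "cring S" "\<alpha> \<in> form_set S M (int p)" "\<beta> \<in> form_set S M (int q)"
    and "vs \<in> vectors M (int p + int q)" "\<sigma> permutes {..<p + q}"
  shows "\<alpha> (map (\<lambda>i. vs ! \<sigma> i) [0..<p]) \<in> carrier S"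
    and "\<beta> (map (\<lambda>i. vs ! \<sigma> i) [p..<p + q]) \<in> carrier S"
    and "wedge_term S (int p) (int q) \<alpha> \<beta> vs \<sigma> \<in> carrier S"
    and "map (\<lambda>i. vs ! \<sigma> i) [0..<p] \<in> vectors M (int p)"
    and "map (\<lambda>i. vs ! \<sigma> i) [p..<p + q] \<in> vectors M (int q)"
proof -
  interpret cring S by fact
  have *: "vs ! \<sigma> i \<in> carrier M" if "i < p + q" for i
    using assms(4) permutes_in_image[OF assms(5), of i] that
    by (auto simp: vectors_def)
  show v: "map (\<lambda>i. vs ! \<sigma> i) [0..<p] \<in> vectors M (int p)"
     "map (\<lambda>i. vs ! \<sigma> i) [p..<p + q] \<in> vectors M (int q)"
    using * by (auto simp: vectors_def)
  show c: "\<alpha> (map (\<lambda>i. vs ! \<sigma> i) [0..<p]) \<in> carrier S"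
    "\<beta> (map (\<lambda>i. vs ! \<sigma> i) [p..<p + q]) \<in> carrier S"
    using v assms(2,3) by (auto simp: form_set_def)
  have "nat (int p + int q) = p + q" by simp
  then show "wedge_term S (int p) (int q) \<alpha> \<beta> vs \<sigma> \<in> carrier S"
    unfolding wedge_term_def using c by simp
qed

lemma form_swap:
  assumes "\<omega> \<in> form_set S M k" "map f [a..<b] \<in> vectors M k"
    and "i \<in> {a..<b}" "j \<in> {a..<b}" "i \<noteq> j"
  shows "\<omega> (map (f \<circ> Transposition.transpose i j) [a..<b]) = \<ominus>\<^bsub>S\<^esub> \<omega> (map f [a..<b])"
proof -
  let ?vs = "map f [a..<b]"
  have "map (f \<circ> Transposition.transpose i j) [a..<b] =
    ?vs[i - a := ?vs ! (j - a), j - a := ?vs ! (i - a)]"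
  proof (rule nth_equalityI)
    fix l assume "l < length (map (f \<circ> Transposition.transpose i j) [a..<b])"
    then have "l < b - a" by simp
    then show "map (f \<circ> Transposition.transpose i j) [a..<b] ! l =
      ?vs[i - a := ?vs ! (j - a), j - a := ?vs ! (i - a)] ! l"
      using assms(3-5) by (auto simp: nth_list_update Transposition.transpose_def)
  qed simp
  moreover have "i - a < length ?vs" "j - a < length ?vs" "i - a \<noteq> j - a" using assms(3-5) by auto
  moreover have "\<And>vs i j. vs \<in> vectors M k \<Longrightarrow> i < length vs \<Longrightarrow> j < length vs \<Longrightarrow> i \<noteq> j \<Longrightarrow>
      \<omega> (vs[i := vs ! j, j := vs ! i]) = \<ominus>\<^bsub>S\<^esub> \<omega> vs"
    using assms(1) unfolding form_set_def by blast
  ultimately show ?thesis using assms(2) by metis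
qed

lemma wedge_term_swap:
  assumes S: "cring S" and \<alpha>: "\<alpha> \<in> form_set S M (int p)" and \<beta>: "\<beta> \<in> form_set S M (int q)"
    and vs: "vs \<in> vectors M (int p + int q)" and \<sigma>: "\<sigma> permutes {..<p + q}"
    and ij: "i \<noteq> j" "{i, j} \<subseteq> {0..<p} \<or> {i, j} \<subseteq> {p..<p + q}"
  shows "wedge_term S (int p) (int q) \<alpha> \<beta> vs (\<sigma> \<circ> Transposition.transpose i j) =
    wedge_term S (int p) (int q) \<alpha> \<beta> vs \<sigma>"
proof -
  interpret cring S by fact
  note cl = wedge_term_closed[OF S \<alpha> \<beta> vs \<sigma>]
  have n: "nat (int p + int q) = p + q" by simp
  have t: "Transposition.transpose i j permutes {..<p + q}"
    using ij by (intro permutes_swap_id) auto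
  have sgn: "sign (\<sigma> \<circ> Transposition.transpose i j) = - sign \<sigma>"
    using \<sigma> t ij by (subst sign_compose) (auto simp: permutation_permutes sign_swap_id)
  have neg: "[(- sign \<sigma>)] \<cdot>\<^bsub>S\<^esub> (\<ominus>\<^bsub>S\<^esub> x) = [sign \<sigma>] \<cdot>\<^bsub>S\<^esub> x" if "x \<in> carrier S" for x
    using that by (cases \<sigma> rule: sign_cases) (simp_all add: add.int_pow_neg)
  let ?f = "\<lambda>i. vs ! \<sigma> i"
  have same: "map (?f \<circ> Transposition.transpose i j) [a..<b] = map ?f [a..<b]"
    if "i \<notin> {a..<b}" "j \<notin> {a..<b}" for a b
    using that by (auto simp: Transposition.transpose_def)
  from ij(2) show ?thesis
  proof
    assume "{i, j} \<subseteq> {0..<p}"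
    then have "\<alpha> (map (?f \<circ> Transposition.transpose i j) [0..<p]) = \<ominus>\<^bsub>S\<^esub> \<alpha> (map ?f [0..<p])"
      "map (?f \<circ> Transposition.transpose i j) [p..<p + q] = map ?f [p..<p + q]"
      using ij(1) by (auto intro!: form_swap[OF \<alpha> cl(4)] same simp del: map_eq_conv)
    then show ?thesis unfolding wedge_term_def sgn n using cl
      by (simp add: comp_def l_minus neg del: map_eq_conv)
  next
    assume "{i, j} \<subseteq> {p..<p + q}"
    then have "\<beta> (map (?f \<circ> Transposition.transpose i j) [p..<p + q]) = \<ominus>\<^bsub>S\<^esub> \<beta> (map ?f [p..<p + q])"
      "map (?f \<circ> Transposition.transpose i j) [0..<p] = map ?f [0..<p]"
      using ij(1) by (auto intro!: form_swap[OF \<beta> cl(5)] same simp del: map_eq_conv)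
    then show ?thesis unfolding wedge_term_def sgn n using cl
      by (simp add: comp_def r_minus neg del: map_eq_conv)
  qed
qed

lemma wedge_term_block:
  assumes S: "cring S" and \<alpha>: "\<alpha> \<in> form_set S M (int p)" and \<beta>: "\<beta> \<in> form_set S M (int q)"
    and vs: "vs \<in> vectors M (int p + int q)" and \<sigma>: "\<sigma> permutes {..<p + q}"
    and \<rho>: "\<rho> permutes B" "B = {0..<p} \<or> B = {p..<p + q}"
  shows "wedge_term S (int p) (int q) \<alpha> \<beta> vs (\<sigma> \<circ> \<rho>) = wedge_term S (int p) (int q) \<alpha> \<beta> vs \<sigma>"
proof -
  have fin: "finite B" using \<rho>(2) by auto
  show ?thesis
    using fin \<rho>(1)
  proof (induction \<rho> rule: permutes_rev_induct)
    case id show ?case by simp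
  next
    case (swap a b \<rho>)
    have "B \<subseteq> {..<p + q}" using \<rho>(2) by auto
    with swap(5) have "\<rho> permutes {..<p + q}" by (meson permutes_subset swap)
    then have "\<sigma> \<circ> \<rho> permutes {..<p + q}" using \<sigma> by (rule permutes_compose)
    moreover have "{a, b} \<subseteq> {0..<p} \<or> {a, b} \<subseteq> {p..<p + q}" using swap \<rho>(2) by blast
    ultimately have "wedge_term S (int p) (int q) \<alpha> \<beta> vs (\<sigma> \<circ> \<rho> \<circ> Transposition.transpose a b) =
        wedge_term S (int p) (int q) \<alpha> \<beta> vs (\<sigma> \<circ> \<rho>)"
      using swap by (intro wedge_term_swap[OF S \<alpha> \<beta> vs]) auto
    with swap show ?case by (simp only: comp_assoc)
  qed
qed

lemma sum_permutations_eq_shuffles: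
  assumes S: "cring S" and \<alpha>: "\<alpha> \<in> form_set S M (int p)" and \<beta>: "\<beta> \<in> form_set S M (int q)"
    and vs: "vs \<in> vectors M (int p + int q)"
  shows "(\<Oplus>\<^bsub>S\<^esub> \<sigma> \<in> {\<sigma>. \<sigma> permutes {..<p + q}}. wedge_term S (int p) (int q) \<alpha> \<beta> vs \<sigma>) =
    [(fact p * fact q :: nat)] \<cdot>\<^bsub>S\<^esub> wedge S M (int p) (int q) \<alpha> \<beta> vs"
proof -
  interpret cring S by fact
  let ?t = "wedge_term S (int p) (int q) \<alpha> \<beta> vs"
  let ?Sh = "shuffle_perms (int p) (int q)"
  let ?F = "\<lambda>s. (\<lambda>\<rho>. s \<circ> \<rho>) ` block_perms p q"
  note cl = wedge_term_closed(3)[OF S \<alpha> \<beta> vs]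
  have sh: "s permutes {..<p + q}" if "s \<in> ?Sh" for s using that unfolding shuffle_perms_nat by simp
  have fin: "finite ?Sh"
    by (rule finite_subset[of _ "{\<sigma>. \<sigma> permutes {..<p + q}}"]) (use sh finite_permutations in auto)
  have F: "\<sigma> permutes {..<p + q}" if "\<sigma> \<in> ?F s" "s \<in> ?Sh" for \<sigma> s
    using permutes_shuffle_decomposition[of p q] that by blast
  have "(\<Oplus>\<^bsub>S\<^esub> \<sigma> \<in> {\<sigma>. \<sigma> permutes {..<p + q}}. ?t \<sigma>) =
    (\<Oplus>\<^bsub>S\<^esub> s \<in> ?Sh. \<Oplus>\<^bsub>S\<^esub> \<sigma> \<in> ?F s. ?t \<sigma>)"
    unfolding permutes_shuffle_decomposition
  proof (rule add.finprod_UN_disjoint[OF fin])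
    show "finite (?F s)" for s by (intro finite_imageI finite_block_perms)
    show "pairwise (\<lambda>i j. disjnt (?F i) (?F j)) ?Sh"
      using shuffle_perms_unique unfolding pairwise_def disjnt_def by blast
    show "?t x \<in> carrier S" if "i \<in> ?Sh" "x \<in> ?F i" for i x using cl F that by blast
  qed
  also have "\<dots> = (\<Oplus>\<^bsub>S\<^esub> s \<in> ?Sh. [(fact p * fact q :: nat)] \<cdot>\<^bsub>S\<^esub> ?t s)"
  proof (rule finsum_cong'[OF refl])
    show "(\<lambda>s. [(fact p * fact q :: nat)] \<cdot>\<^bsub>S\<^esub> ?t s) \<in> ?Sh \<rightarrow> carrier S" using cl sh by auto
    fix s assume s: "s \<in> ?Sh"
    have "?t \<sigma> = ?t s" if "\<sigma> \<in> ?F s" for \<sigma>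
    proof -
      from that obtain \<rho> \<rho>' where r: "\<rho> permutes {0..<p}" "\<rho>' permutes {p..<p + q}" "\<sigma> = s \<circ> \<rho> \<circ> \<rho>'"
        unfolding block_perms_def by (auto simp: comp_assoc)
      have "\<rho> permutes {..<p + q}" by (rule permutes_subset[OF r(1)]) auto
      then have "s \<circ> \<rho> permutes {..<p + q}" using sh[OF s] by (rule permutes_compose)
      then show ?thesis
        unfolding r(3) using wedge_term_block[OF S \<alpha> \<beta> vs _ r(2)]
          wedge_term_block[OF S \<alpha> \<beta> vs sh[OF s] r(1)] by simp
    qed
    then have "(\<Oplus>\<^bsub>S\<^esub> \<sigma> \<in> ?F s. ?t \<sigma>) = (\<Oplus>\<^bsub>S\<^esub> \<sigma> \<in> ?F s. ?t s)"
      using cl sh[OF s] by (intro finsum_cong') auto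
    also have "\<dots> = [card (?F s)] \<cdot>\<^bsub>S\<^esub> ?t s" using cl sh[OF s] by (intro add.finprod_const) auto
    also have "card (?F s) = card (block_perms p q)"
    proof (rule card_image, rule inj_onI)
      fix x y assume "s \<circ> x = s \<circ> y"
      then show "x = y" using permutes_inj[OF sh[OF s]] by (auto simp: fun_eq_iff dest: injD)
    qed
    finally show "(\<Oplus>\<^bsub>S\<^esub> \<sigma> \<in> ?F s. ?t \<sigma>) = [(fact p * fact q :: nat)] \<cdot>\<^bsub>S\<^esub> ?t s"
      by (simp only: card_block_perms)
  qed
  also have "\<dots> = [(fact p * fact q :: nat)] \<cdot>\<^bsub>S\<^esub> (\<Oplus>\<^bsub>S\<^esub> s \<in> ?Sh. ?t s)"
  proof -
    have "(\<Oplus>\<^bsub>S\<^esub> s \<in> A. [m] \<cdot>\<^bsub>S\<^esub> ?t s) = [m] \<cdot>\<^bsub>S\<^esub> (\<Oplus>\<^bsub>S\<^esub> s \<in> A. ?t s)"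
      if "finite A" "\<And>s. s \<in> A \<Longrightarrow> ?t s \<in> carrier S" for A and m :: nat
      using that
      by (induction A rule: finite_induct) (simp_all add: Pi_def add.nat_pow_distrib)
    then show ?thesis using fin cl sh by blast
  qed
  finally show ?thesis using vs unfolding wedge_def by simp
qed

end

theory Submission
  imports Defs
begin

text \<open>The equation that defines the bracket says that the arrow \<open>w\<close> relates the field \<open>v\<close> on \<open>X\<close> to the
  sum of the complete lift of \<open>v\<close> and the vertical lift of \<open>[v, w]\<close> on \<open>TX\<close>. Brackets of related fields
  are related, and the brackets of complete and vertical lifts are again such lifts; this gives the
  Jacobi identity. The derivatives of the ring operations and of the scalar multiplication give the
  Leibniz rules, so that vector fields and functions form a Lie-Rinehart algebra. The Cartan
  calculus of the latter follows by induction on the degree of a form, through contraction with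
  its first argument.\<close>

section \<open>Shuffles and products of forms\<close>

text \<open>Arrows are treated as generalized elements, so that the diagrammatic axioms become laws
  for sums of tangent vectors over a common base point. The obstacle is that \<open>T (T X)\<close>
  carries two fiberwise additions and \<open>T (T (T X))\<close> three; flips exchange them and
  interchange laws relate them, and these laws carry the brackets of lifted fields. Differences are
  avoided: second order vectors with the same two faces form a torsor under tangent vectors, written
  \<open>core X A c\<close>, and the bracket is the translation from
  \<open>tflip C X \<bullet> (T v \<bullet> w)\<close> to \<open>T w \<bullet> v\<close>. Invariance
  of this translation under the flip gives antisymmetry and, for functions, the symmetry of mixed
  second derivatives. On the algebraic side integers cannot be inverted, so the product of forms is
  a sum over shuffles; contraction is a graded derivation of it, and this recursion determines it.
  Linearity of the differential over functions is invisible in its own recursion; it is obtained by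
  exchanging the first two arguments.\<close>

definition lift_perm :: "(nat \<Rightarrow> nat) \<Rightarrow> nat \<Rightarrow> nat" where
  "lift_perm \<tau> i = (case i of 0 \<Rightarrow> 0 | Suc j \<Rightarrow> Suc (\<tau> j))"

lemma lift_perm_simps [simp]: "lift_perm \<tau> 0 = 0" "lift_perm \<tau> (Suc j) = Suc (\<tau> j)"
  by (simp_all add: lift_perm_def)

lemma inj_lift_perm: "lift_perm \<sigma> = lift_perm \<tau> \<Longrightarrow> \<sigma> = \<tau>"
  by (metis ext lift_perm_simps(2) nat.inject)

text \<open>Transport of a permutation along the injection \<open>Suc\<close> keeps both the
  permutation property and the sign; \<open>lift_perm\<close> is this transport, with 0 as an
  additional fixed point.\<close>

lemma lift_perm_permutes:
  assumes "\<tau> permutes {..<n}"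
  shows "lift_perm \<tau> permutes {..<Suc n}" "sign (lift_perm \<tau>) = sign \<tau>"
proof -
  have eq: "map_permutation {..<n} Suc \<tau> = lift_perm \<tau>"
  proof
    fix i
    show "map_permutation {..<n} Suc \<tau> i = lift_perm \<tau> i"
    proof (cases i)
      case 0
      then show ?thesis by (auto simp: map_permutation_def restrict_id_def)
    next
      case (Suc j)
      show ?thesis
      proof (cases "j < n")
        case True
        then show ?thesis using map_permutation_apply[of Suc "{..<n}" j \<tau>] Suc by simp
      next
        case False
        then show ?thesis using Suc permutes_not_in[OF assms, of j]
          by (auto simp: map_permutation_def restrict_id_def)
      qed
    qed
  qed
  have "map_permutation {..<n} Suc \<tau> permutes Suc ` {..<n}"
    using assms by (intro map_permutation_permutes bij_betw_imageI) auto
  then show "lift_perm \<tau> permutes {..<Suc n}"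
    unfolding eq by (rule permutes_subset) auto
  show "sign (lift_perm \<tau>) = sign \<tau>"
    using sign_map_permutation[of Suc "{..<n}" \<tau>] assms unfolding eq by simp
qed

lemma lift_perm_surj:
  assumes "\<sigma> permutes {..<Suc n}" "\<sigma> 0 = 0"
  obtains \<tau> where "\<tau> permutes {..<n}" "\<sigma> = lift_perm \<tau>"
proof -
  define \<tau> where "\<tau> j = \<sigma> (Suc j) - 1" for j
  have inj: "inj \<sigma>" by (rule permutes_inj[OF assms(1)])
  have nz: "\<sigma> (Suc j) \<noteq> 0" for j using injD[OF inj, of "Suc j" 0] assms(2) by auto
  then have S: "\<sigma> (Suc j) = Suc (\<tau> j)" for j unfolding \<tau>_def by (metis Suc_pred' not_gr_zero)
  have eq: "\<sigma> = lift_perm \<tau>"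
    by (rule ext) (auto simp: lift_perm_def assms(2) S split: nat.split)
  have "\<tau> permutes {..<n}"
  proof (rule bij_imp_permutes)
    show "\<tau> x = x" if "x \<notin> {..<n}" for x
      using permutes_not_in[OF assms(1), of "Suc x"] S[of x] that by simp
    have "inj \<tau>" using injD[OF inj, of "Suc _" "Suc _"] S by (auto intro!: injI)
    moreover have "\<tau> j < n" if "j < n" for j
      using permutes_in_image[OF assms(1), of "Suc j"] S[of j] that by simp
    ultimately have "inj_on \<tau> {..<n}" "\<tau> ` {..<n} \<subseteq> {..<n}" by (auto intro: inj_on_subset)
    then show "bij_betw \<tau> {..<n} {..<n}"
      unfolding bij_betw_def by (simp add: endo_inj_surj)
  qed
  with eq show thesis by (intro that)
qed

text \<open>A cycle of length p + 1. Precomposed with a lifted permutation, it places the value 0 at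
  position p, where the second block of a shuffle begins.\<close>

definition front_cycle :: "nat \<Rightarrow> nat \<Rightarrow> nat" where
  "front_cycle p i = (if i < p then Suc i else if i = p then 0 else i)"

text \<open>The cycle is a product of p adjacent transpositions. Its sign is the source of the
  factor \<open>usgn p\<close> in \<open>wedge_Cons\<close>: contracting into the second factor
  passes p arguments.\<close>

lemma front_cycle_permutes: "front_cycle p permutes {..p}" "sign (front_cycle p) = (-1) ^ p"
proof (induction p)
  case 0
  have "front_cycle 0 = id" by (auto simp: front_cycle_def fun_eq_iff)
  then show "front_cycle 0 permutes {..0}" "sign (front_cycle 0) = (-1) ^ 0" by (simp_all add: permutes_id)
next
  case (Suc p)
  have eq: "front_cycle (Suc p) = front_cycle p \<circ> Transposition.transpose p (Suc p)"
    by (auto simp: front_cycle_def fun_eq_iff Transposition.transpose_def)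
  have t: "Transposition.transpose p (Suc p) permutes {..Suc p}" by (rule permutes_swap_id) auto
  have f: "front_cycle p permutes {..Suc p}" by (rule permutes_subset[OF Suc(1)]) auto
  show "front_cycle (Suc p) permutes {..Suc p}" unfolding eq by (rule permutes_compose[OF t f])
  have "sign (front_cycle p \<circ> Transposition.transpose p (Suc p)) =
      sign (front_cycle p) * sign (Transposition.transpose p (Suc p))"
    using t f by (intro sign_compose permutes_imp_permutation) auto
  then show "sign (front_cycle (Suc p)) = (-1) ^ Suc p"
    unfolding eq using Suc(2) by (simp add: sign_swap_id)
qed

lemma strict_mono_on_shift:
  "strict_mono_on {Suc a..<Suc b} f \<longleftrightarrow> strict_mono_on {a..<b} (\<lambda>i. f (Suc i))"
proof
  assume l: "strict_mono_on {a..<b} (\<lambda>i. f (Suc i))"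
  show "strict_mono_on {Suc a..<Suc b} f"
  proof (rule strict_mono_onI)
    fix r s assume rs: "r \<in> {Suc a..<Suc b}" "s \<in> {Suc a..<Suc b}" "r < s"
    obtain r' s' where "r = Suc r'" "s = Suc s'" using rs by (metis atLeastLessThan_iff Suc_le_D)
    then show "f r < f s" using strict_mono_onD[OF l, of r' s'] rs by simp
  qed
qed (auto simp: strict_mono_on_def)

lemma strict_mono_on_Suc: "strict_mono_on A (\<lambda>i. Suc (f i)) \<longleftrightarrow> strict_mono_on A f"
  by (auto simp: strict_mono_on_def)

text \<open>The value 0 is below all others, so placing it in front of the first block keeps both
  blocks increasing, and removing it leaves a shuffle of the remaining letters.\<close>

lemma shuffles_first_in_left:
  "{\<sigma> \<in> shuffle_perms (int (Suc p)) (int q). \<sigma> 0 = 0} = lift_perm ` shuffle_perms (int p) (int q)"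
  (is "?L = ?R")
proof -
  have *: "lift_perm \<tau> \<in> shuffle_perms (int (Suc p)) (int q) \<longleftrightarrow> \<tau> \<in> shuffle_perms (int p) (int q)"
    if "\<tau> permutes {..<p + q}" for \<tau>
  proof -
    have "strict_mono_on {0..<Suc p} (lift_perm \<tau>) \<longleftrightarrow> strict_mono_on {0..<p} \<tau>"
    proof
      assume l: "strict_mono_on {0..<p} \<tau>"
      show "strict_mono_on {0..<Suc p} (lift_perm \<tau>)"
      proof (rule strict_mono_onI)
        fix r s assume "r \<in> {0..<Suc p}" "s \<in> {0..<Suc p}" "r < s"
        then show "lift_perm \<tau> r < lift_perm \<tau> s"
          using strict_mono_onD[OF l] by (auto simp: lift_perm_def split: nat.split)
      qed
    next
      assume l: "strict_mono_on {0..<Suc p} (lift_perm \<tau>)"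
      show "strict_mono_on {0..<p} \<tau>"
      proof (rule strict_mono_onI)
        fix r s assume "r \<in> {0..<p}" "s \<in> {0..<p}" "r < s"
        then show "\<tau> r < \<tau> s" using strict_mono_onD[OF l, of "Suc r" "Suc s"] by simp
      qed
    qed
    moreover have "strict_mono_on {Suc p..<Suc p + q} (lift_perm \<tau>) \<longleftrightarrow> strict_mono_on {p..<p + q} \<tau>"
      using strict_mono_on_shift[of p "p + q" "lift_perm \<tau>"] by (simp add: strict_mono_on_Suc)
    ultimately show ?thesis
      using that lift_perm_permutes(1)[OF that] unfolding shuffle_perms_nat by simp
  qed
  show ?thesis
  proof (intro equalityI subsetI)
    fix \<sigma> assume "\<sigma> \<in> ?L"
    then have s: "\<sigma> \<in> shuffle_perms (int (Suc p)) (int q)" "\<sigma> permutes {..<Suc (p + q)}" "\<sigma> 0 = 0"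
      unfolding shuffle_perms_nat by auto
    obtain \<tau> where "\<tau> permutes {..<p + q}" "\<sigma> = lift_perm \<tau>" by (rule lift_perm_surj[OF s(2,3)])
    then show "\<sigma> \<in> ?R" using s(1) * by blast
  next
    fix \<sigma> assume "\<sigma> \<in> ?R"
    then obtain \<tau> where t: "\<tau> \<in> shuffle_perms (int p) (int q)" "\<sigma> = lift_perm \<tau>" by blast
    then have "\<tau> permutes {..<p + q}" unfolding shuffle_perms_nat by simp
    with t show "\<sigma> \<in> ?L" using * by simp
  qed
qed

text \<open>The analogous bijection for shuffles whose second block begins with 0. The cycle appears
  because the new entry is inserted at position p, behind the first block.\<close>

lemma shuffles_first_in_right:
  "{\<sigma> \<in> shuffle_perms (int p) (int (Suc q)). \<sigma> p = 0} =
    (\<lambda>\<tau>. lift_perm \<tau> \<circ> front_cycle p) ` shuffle_perms (int p) (int q)"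
  (is "?L = ?R")
proof -
  have cyc: "front_cycle p permutes {..<Suc (p + q)}"
    by (rule permutes_subset[OF front_cycle_permutes(1)]) auto
  have *: "lift_perm \<tau> \<circ> front_cycle p \<in> shuffle_perms (int p) (int (Suc q)) \<longleftrightarrow> \<tau> \<in> shuffle_perms (int p) (int q)"
    if "\<tau> permutes {..<p + q}" for \<tau>
  proof -
    let ?s = "lift_perm \<tau> \<circ> front_cycle p"
    have s: "?s i = (if i < p then Suc (\<tau> i) else if i = p then 0 else lift_perm \<tau> i)" for i
      by (simp add: front_cycle_def)
    have "strict_mono_on {0..<p} ?s \<longleftrightarrow> strict_mono_on {0..<p} \<tau>"
      unfolding strict_mono_on_def s by simp
    moreover have "strict_mono_on {p..<p + Suc q} ?s \<longleftrightarrow> strict_mono_on {p..<p + q} \<tau>"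
    proof
      assume l: "strict_mono_on {p..<p + Suc q} ?s"
      show "strict_mono_on {p..<p + q} \<tau>"
      proof (rule strict_mono_onI)
        fix r t assume "r \<in> {p..<p + q}" "t \<in> {p..<p + q}" "r < t"
        then show "\<tau> r < \<tau> t" using strict_mono_onD[OF l, of "Suc r" "Suc t"] by (simp add: front_cycle_def)
      qed
    next
      assume l: "strict_mono_on {p..<p + q} \<tau>"
      show "strict_mono_on {p..<p + Suc q} ?s"
      proof (rule strict_mono_onI)
        fix r t assume rt: "r \<in> {p..<p + Suc q}" "t \<in> {p..<p + Suc q}" "r < t"
        then obtain t' where t': "t = Suc t'" "t' \<in> {p..<p + q}" by (cases t) auto
        show "?s r < ?s t"
        proof (cases "r = p")
          case True
          then show ?thesis using t' by (simp add: front_cycle_def)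
        next
          case False
          then obtain r' where "r = Suc r'" "r' \<in> {p..<p + q}" using rt by (cases r) auto
          then show ?thesis using t' rt strict_mono_onD[OF l, of r' t'] by (simp add: front_cycle_def)
        qed
      qed
    qed
    moreover have "?s permutes {..<p + Suc q}"
      using permutes_compose[OF cyc lift_perm_permutes(1)[OF that]] by simp
    ultimately show ?thesis using that unfolding shuffle_perms_nat by simp
  qed
  show ?thesis
  proof (intro equalityI subsetI)
    fix \<sigma> assume "\<sigma> \<in> ?L"
    then have s: "\<sigma> \<in> shuffle_perms (int p) (int (Suc q))" "\<sigma> permutes {..<Suc (p + q)}" "\<sigma> p = 0"
      unfolding shuffle_perms_nat by auto
    let ?i = "inv_into UNIV (front_cycle p)"
    have i: "?i permutes {..<Suc (p + q)}" by (rule permutes_inv[OF cyc])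
    have "front_cycle p p = 0" by (simp add: front_cycle_def)
    then have "?i 0 = p" using permutes_inverses(2)[OF cyc, of p] by simp
    then have "(\<sigma> \<circ> ?i) 0 = 0" using s(3) by simp
    then obtain \<tau> where t: "\<tau> permutes {..<p + q}" "\<sigma> \<circ> ?i = lift_perm \<tau>"
      using lift_perm_surj[OF permutes_compose[OF i s(2)]] by blast
    have "\<sigma> = (\<sigma> \<circ> ?i) \<circ> front_cycle p" using permutes_inverses(2)[OF cyc] by (simp add: fun_eq_iff)
    then have "\<sigma> = lift_perm \<tau> \<circ> front_cycle p" unfolding t(2) .
    then show "\<sigma> \<in> ?R" using s(1) *[OF t(1)] by blast
  next
    fix \<sigma> assume "\<sigma> \<in> ?R"
    then obtain \<tau> where t: "\<tau> \<in> shuffle_perms (int p) (int q)" "\<sigma> = lift_perm \<tau> \<circ> front_cycle p" by blast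
    then have "\<tau> permutes {..<p + q}" unfolding shuffle_perms_nat by simp
    with t show "\<sigma> \<in> ?L" using *[of \<tau>] by (simp add: front_cycle_def)
  qed
qed

text \<open>An increasing block can take the least value only at its first position, hence 0 sits at
  the beginning of one of the two blocks. The conditions \<open>0 < p\<close> and
  \<open>0 < q\<close> rule out the beginning of an empty block.\<close>

lemma shuffles_split:
  assumes "0 < p + q"
  shows "shuffle_perms (int p) (int q) =
    {\<sigma> \<in> shuffle_perms (int p) (int q). 0 < p \<and> \<sigma> 0 = 0} \<union> {\<sigma> \<in> shuffle_perms (int p) (int q). 0 < q \<and> \<sigma> p = 0}"
proof (intro equalityI subsetI)
  fix \<sigma> assume s: "\<sigma> \<in> shuffle_perms (int p) (int q)"
  then have p: "\<sigma> permutes {..<p + q}" and m: "strict_mono_on {0..<p} \<sigma>" "strict_mono_on {p..<p + q} \<sigma>"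
    unfolding shuffle_perms_nat by auto
  obtain i where i: "\<sigma> i = 0" using permutes_surj[OF p] by (metis surj_def)
  then have "i < p + q" using permutes_in_image[OF p, of i] assms by auto
  show "\<sigma> \<in> {\<sigma> \<in> shuffle_perms (int p) (int q). 0 < p \<and> \<sigma> 0 = 0} \<union>
      {\<sigma> \<in> shuffle_perms (int p) (int q). 0 < q \<and> \<sigma> p = 0}"
  proof (cases "i < p")
    case True
    then have "i = 0" using strict_mono_onD[OF m(1), of 0 i] i by (cases "i = 0") auto
    then show ?thesis using s i True by auto
  next
    case False
    then have "i = p" using strict_mono_onD[OF m(2), of p i] i \<open>i < p + q\<close> by (cases "i = p") auto
    then show ?thesis using s i \<open>i < p + q\<close> by auto
  qed
qed auto

lemma finite_shuffle_perms: "finite (shuffle_perms p q)"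
proof -
  have "shuffle_perms p q \<subseteq> {\<sigma>. \<sigma> permutes {..<nat (p + q)}}" unfolding shuffle_perms_def by auto
  then show ?thesis by (rule finite_subset) (simp add: finite_permutations)
qed

section \<open>Signs as elements of the ring\<close>

context cring
begin

text \<open>Signs are ring elements instead of integer multiples \<open>[n] \<cdot> x\<close>, so
  that they multiply by ring laws. The exponent is an integer because degrees, and with them
  exponents such as \<open>p - 1\<close>, may be negative.\<close>

definition usgn :: "int \<Rightarrow> 'a" where
  "usgn m = (if even m then \<one> else \<ominus> \<one>)"

lemma usgn_closed [simp]: "usgn m \<in> carrier R"
  by (simp add: usgn_def)

lemma usgn_mult: "usgn m \<otimes> usgn n = usgn (m + n)"
  by (simp add: usgn_def l_minus)

lemma usgn_usgn [simp]: "x \<in> carrier R \<Longrightarrow> usgn m \<otimes> (usgn n \<otimes> x) = usgn (m + n) \<otimes> x"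
  by (simp add: usgn_mult flip: m_assoc)

lemma usgn_power: "x \<in> carrier R \<Longrightarrow> [((-1::int) ^ i)] \<cdot> x = usgn (int i) \<otimes> x"
  by (cases "even i") (simp_all add: usgn_def l_minus add.int_pow_neg add.int_pow_1)

lemma usgn_sign:
  assumes "x \<in> carrier R"
  shows "[((-1) ^ p * sign \<sigma>)] \<cdot> x = usgn (int p) \<otimes> ([sign \<sigma>] \<cdot> x)"
  using usgn_power[OF assms, of p] usgn_power[OF assms, of "Suc p"] assms
  by (cases \<sigma> rule: sign_cases) (simp_all add: add.int_pow_neg add.int_pow_1 usgn_def l_minus)

end

lemma vectors_Cons [simp]: "v # vs \<in> vectors M k \<longleftrightarrow> v \<in> carrier M \<and> vs \<in> vectors M (k - 1)"
  by (auto simp: vectors_def)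

lemma vectors_Nil [simp]: "[] \<in> vectors M k \<longleftrightarrow> k = 0"
  by (auto simp: vectors_def)

lemma vectors_nth: "vs \<in> vectors M k \<Longrightarrow> i < length vs \<Longrightarrow> vs ! i \<in> carrier M"
  by (auto simp: vectors_def)

lemma vectors_length: "vs \<in> vectors M k \<Longrightarrow> int (length vs) = k"
  by (simp add: vectors_def)

lemma inner_derivative_apply [simp]:
  "vs \<in> vectors M (k - 1) \<Longrightarrow> inner_derivative M v k \<omega> vs = \<omega> (v # vs)"
  by (simp add: inner_derivative_def)

section \<open>The shuffle product through contraction with the first argument\<close>

context module
begin

lemma wedge_apply:
  assumes "vs \<in> vectors M (p + q)"
  shows "wedge R M p q \<alpha> \<beta> vs = (\<Oplus> \<sigma> \<in> shuffle_perms p q. wedge_term R p q \<alpha> \<beta> vs \<sigma>)"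
  using assms by (simp add: wedge_def)

text \<open>There are no shuffles for a negative degree. Products with such a factor are therefore
  zero, and the recursion \<open>wedge_Cons\<close> holds at the boundary degrees without extra
  cases.\<close>

lemma wedge_neg:
  assumes "p < 0 \<or> q < 0"
  shows "wedge R M p q \<alpha> \<beta> = (\<lambda>vs \<in> vectors M (p + q). \<zero>)"
proof -
  have "shuffle_perms p q = {}" using assms unfolding shuffle_perms_def by auto
  then show ?thesis unfolding wedge_def by simp
qed

lemma wedge_Nil:
  assumes "p + q = 0" "\<alpha> \<in> vectors M p \<rightarrow> carrier R" "\<beta> \<in> vectors M q \<rightarrow> carrier R"
  shows "wedge R M p q \<alpha> \<beta> [] = (if p = 0 then \<alpha> [] \<otimes> \<beta> [] else \<zero>)"
proof (cases "p = 0")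
  case True
  then have q: "q = 0" using assms(1) by simp
  have "\<alpha> [] \<in> carrier R" "\<beta> [] \<in> carrier R" using assms True q by auto
  moreover have "shuffle_perms 0 0 = {id}" by (auto simp: shuffle_perms_def)
  ultimately show ?thesis unfolding True q by (simp add: wedge_apply wedge_term_def add.int_pow_1)
next
  case False
  then have "p < 0 \<or> q < 0" using assms(1) by auto
  then show ?thesis using False assms(1) by (simp add: wedge_neg)
qed

lemma wedge_term_closed':
  assumes "vs \<in> vectors M (int p + int q)" "\<sigma> \<in> shuffle_perms (int p) (int q)"
    and "\<alpha> \<in> vectors M (int p) \<rightarrow> carrier R" "\<beta> \<in> vectors M (int q) \<rightarrow> carrier R"
  shows "wedge_term R (int p) (int q) \<alpha> \<beta> vs \<sigma> \<in> carrier R"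
proof -
  have s: "\<sigma> permutes {..<p + q}" using assms(2) unfolding shuffle_perms_nat by simp
  have v: "vs ! \<sigma> i \<in> carrier M" if "i < p + q" for i
    using permutes_in_image[OF s, of i] that vectors_length[OF assms(1)] vectors_nth[OF assms(1)] by simp
  have "map (\<lambda>i. vs ! \<sigma> i) [0..<p] \<in> vectors M (int p)"
    "map (\<lambda>i. vs ! \<sigma> i) [p..<p + q] \<in> vectors M (int q)"
    using v by (auto simp: vectors_def)
  moreover have "nat (int p + int q) = p + q" by simp
  ultimately show ?thesis unfolding wedge_term_def using assms(3,4) by (auto simp: Pi_def)
qed

lemma wedge_term_lift:
  assumes \<tau>: "\<tau> permutes {..<p + q}" and vs: "int (length vs) = int p + int q"
  shows "wedge_term R (int (Suc p)) (int q) \<alpha> \<beta> (v # vs) (lift_perm \<tau>) =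
      wedge_term R (int p) (int q) (\<lambda>us. \<alpha> (v # us)) \<beta> vs \<tau>"
proof -
  have n: "nat (int (Suc p) + int q) = Suc p + q" "nat (int p + int q) = p + q" by simp_all
  have a: "map (\<lambda>i. (v # vs) ! lift_perm \<tau> i) [0..<Suc p] = v # map (\<lambda>i. vs ! \<tau> i) [0..<p]"
    by (subst map_upt_Suc) simp
  have b: "map (\<lambda>i. (v # vs) ! lift_perm \<tau> i) [Suc p..<Suc p + q] = map (\<lambda>i. vs ! \<tau> i) [p..<p + q]"
    by (rule nth_equalityI) (simp_all del: upt_Suc)
  show ?thesis unfolding wedge_term_def n nat_int a b lift_perm_permutes(2)[OF \<tau>] ..
qed

text \<open>Moving \<open>v\<close> from the first argument of \<open>\<beta>\<close> to the front
  of the list passes the p arguments of \<open>\<alpha>\<close>; the sign of the cycle records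
  this.\<close>

lemma wedge_term_lift_cycle:
  assumes \<tau>: "\<tau> \<in> shuffle_perms (int p) (int q)" and vs: "vs \<in> vectors M (int p + int q)"
    and \<alpha>: "\<alpha> \<in> vectors M (int p) \<rightarrow> carrier R" and \<beta>: "(\<lambda>us. \<beta> (v # us)) \<in> vectors M (int q) \<rightarrow> carrier R"
  shows "wedge_term R (int p) (int (Suc q)) \<alpha> \<beta> (v # vs) (lift_perm \<tau> \<circ> front_cycle p) =
      usgn (int p) \<otimes> wedge_term R (int p) (int q) \<alpha> (\<lambda>us. \<beta> (v # us)) vs \<tau>"
proof -
  have \<tau>p: "\<tau> permutes {..<p + q}" using \<tau> unfolding shuffle_perms_nat by simp
  have n: "nat (int p + int (Suc q)) = p + Suc q" "nat (int p + int q) = p + q" by simp_all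
  let ?f = "\<lambda>i. (v # vs) ! (lift_perm \<tau> \<circ> front_cycle p) i"
  have a: "map ?f [0..<p] = map (\<lambda>i. vs ! \<tau> i) [0..<p]"
    by (rule nth_equalityI) (simp_all add: front_cycle_def)
  have b: "map ?f [p..<p + Suc q] = v # map (\<lambda>i. vs ! \<tau> i) [p..<p + q]"
  proof (rule nth_equalityI)
    fix i assume "i < length (map ?f [p..<p + Suc q])"
    then show "map ?f [p..<p + Suc q] ! i = (v # map (\<lambda>i. vs ! \<tau> i) [p..<p + q]) ! i"
      by (cases i) (simp_all add: front_cycle_def del: upt_Suc)
  qed simp
  have "sign (lift_perm \<tau> \<circ> front_cycle p) = sign (lift_perm \<tau>) * sign (front_cycle p)"
    using lift_perm_permutes(1)[OF \<tau>p] front_cycle_permutes(1)[of p]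
    by (intro sign_compose permutes_imp_permutation) auto
  then have sgn: "sign (lift_perm \<tau> \<circ> front_cycle p) = (-1) ^ p * sign \<tau>"
    by (simp add: lift_perm_permutes(2)[OF \<tau>p] front_cycle_permutes(2))
  have v: "vs ! \<tau> i \<in> carrier M" if "i < p + q" for i
    using permutes_in_image[OF \<tau>p, of i] that vectors_length[OF vs] vectors_nth[OF vs] by simp
  have "map (\<lambda>i. vs ! \<tau> i) [0..<p] \<in> vectors M (int p)"
    "map (\<lambda>i. vs ! \<tau> i) [p..<p + q] \<in> vectors M (int q)"
    using v by (auto simp: vectors_def)
  then have "\<alpha> (map (\<lambda>i. vs ! \<tau> i) [0..<p]) \<otimes> \<beta> (v # map (\<lambda>i. vs ! \<tau> i) [p..<p + q]) \<in> carrier R"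
    using \<alpha> \<beta> by (auto simp: Pi_def)
  from usgn_sign[OF this] show ?thesis unfolding wedge_term_def n nat_int a b sgn .
qed

text \<open>Contraction with the first vector is a graded derivation of the shuffle product: every
  shuffle hands that vector, as first argument, to one of the two factors. Together with
  \<open>wedge_Nil\<close> the recursion determines the product, so later identities are proved by
  induction on the list of arguments and not by manipulating shuffles.\<close>

lemma wedge_Cons:
  assumes vs: "v # vs \<in> vectors M (p + q)"
    and \<alpha>: "\<alpha> \<in> vectors M p \<rightarrow> carrier R" and \<beta>: "\<beta> \<in> vectors M q \<rightarrow> carrier R"
  shows "wedge R M p q \<alpha> \<beta> (v # vs) =
    wedge R M (p - 1) q (\<lambda>us. \<alpha> (v # us)) \<beta> vs \<oplus> usgn p \<otimes> wedge R M p (q - 1) \<alpha> (\<lambda>us. \<beta> (v # us)) vs"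
proof (cases "p < 0 \<or> q < 0")
  case True
  have v: "vs \<in> vectors M (p - 1 + q)" "vs \<in> vectors M (p + (q - 1))"
    using vs by (simp_all add: algebra_simps)
  from True have "p - 1 < 0 \<or> q < 0" "p < 0 \<or> q - 1 < 0" by auto
  then show ?thesis using True vs v by (simp add: wedge_neg)
next
  case False
  then obtain m n where mn: "p = int m" "q = int n" by (metis linorder_not_less nat_0_le)
  let ?S = "shuffle_perms (int m) (int n)" and ?t = "wedge_term R (int m) (int n) \<alpha> \<beta> (v # vs)"
  let ?A = "{\<sigma> \<in> ?S. 0 < m \<and> \<sigma> 0 = 0}" and ?B = "{\<sigma> \<in> ?S. 0 < n \<and> \<sigma> m = 0}"
  let ?\<alpha> = "\<lambda>us. \<alpha> (v # us)" and ?\<beta> = "\<lambda>us. \<beta> (v # us)"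
  have v: "v \<in> carrier M" "vs \<in> vectors M (p - 1 + q)" "vs \<in> vectors M (p + (q - 1))"
    using vs by (simp_all add: algebra_simps)
  have len: "int (length vs) = p + q - 1" using vectors_length[OF v(2)] by simp
  then have pos: "0 < m + n" unfolding mn by linarith
  have tc: "?t \<sigma> \<in> carrier R" if "\<sigma> \<in> ?S" for \<sigma>
    by (rule wedge_term_closed') (use vs \<alpha> \<beta> that mn in auto)
  have \<alpha>': "?\<alpha> \<in> vectors M (p - 1) \<rightarrow> carrier R" and \<beta>': "?\<beta> \<in> vectors M (q - 1) \<rightarrow> carrier R"
    using \<alpha> \<beta> v(1) by (auto simp: Pi_def)
  \<comment> \<open>Injectivity: for \<open>0 < m\<close> the positions 0 and \<open>m\<close>
    cannot both carry the value 0.\<close>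
  have disj: "?A \<inter> ?B = {}"
  proof (rule ccontr)
    assume "?A \<inter> ?B \<noteq> {}"
    then obtain \<sigma> where "\<sigma> \<in> ?S" "0 < m" "\<sigma> 0 = 0" "\<sigma> m = 0" by blast
    then show False
      using permutes_inj[of \<sigma> "{..<m + n}"] injD[of \<sigma> 0 m] unfolding shuffle_perms_nat by auto
  qed
  have "wedge R M p q \<alpha> \<beta> (v # vs) = (\<Oplus> \<sigma> \<in> ?A \<union> ?B. ?t \<sigma>)"
    unfolding wedge_apply[OF vs] unfolding mn shuffles_split[OF pos, symmetric] ..
  also have "\<dots> = (\<Oplus> \<sigma> \<in> ?A. ?t \<sigma>) \<oplus> (\<Oplus> \<sigma> \<in> ?B. ?t \<sigma>)"
    by (rule R.finsum_Un_disjoint[OF _ _ disj])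
      (use tc in \<open>auto intro: finite_subset[OF _ finite_shuffle_perms[of "int m" "int n"]]\<close>)
  also have "(\<Oplus> \<sigma> \<in> ?A. ?t \<sigma>) = wedge R M (p - 1) q ?\<alpha> \<beta> vs"
  proof (cases m)
    case 0
    then have "p - 1 < 0" using mn by simp
    then show ?thesis using 0 v(2) by (simp add: wedge_neg)
  next
    case (Suc m')
    have A: "?A = lift_perm ` shuffle_perms (int m') (int n)"
      using shuffles_first_in_left[of m' n] unfolding Suc by simp
    have p1: "p - 1 = int m'" using mn Suc by simp
    have "(\<Oplus> \<sigma> \<in> ?A. ?t \<sigma>) = (\<Oplus> \<tau> \<in> shuffle_perms (int m') (int n). ?t (lift_perm \<tau>))"
    proof -
      have "?t \<in> ?A \<rightarrow> carrier R" using tc by blast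
      moreover have "inj_on lift_perm (shuffle_perms (int m') (int n))"
        by (rule inj_onI) (rule inj_lift_perm)
      ultimately show ?thesis unfolding A by (rule R.finsum_reindex)
    qed
    also have "\<dots> = (\<Oplus> \<tau> \<in> shuffle_perms (int m') (int n). wedge_term R (int m') (int n) ?\<alpha> \<beta> vs \<tau>)"
    proof (rule R.finsum_cong'[OF refl])
      show "wedge_term R (int m') (int n) ?\<alpha> \<beta> vs \<in> shuffle_perms (int m') (int n) \<rightarrow> carrier R"
        by (intro Pi_I wedge_term_closed') (use v \<alpha>' \<beta> mn p1 in auto)
      fix \<tau> assume "\<tau> \<in> shuffle_perms (int m') (int n)"
      then have "\<tau> permutes {..<m' + n}" unfolding shuffle_perms_nat by simp
      then show "?t (lift_perm \<tau>) = wedge_term R (int m') (int n) ?\<alpha> \<beta> vs \<tau>"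
        unfolding Suc by (rule wedge_term_lift) (use len mn Suc in simp)
    qed
    also have "\<dots> = wedge R M (p - 1) q ?\<alpha> \<beta> vs"
      unfolding wedge_apply[OF v(2)] unfolding p1 unfolding mn ..
    finally show ?thesis .
  qed
  also have "(\<Oplus> \<sigma> \<in> ?B. ?t \<sigma>) = usgn p \<otimes> wedge R M p (q - 1) \<alpha> ?\<beta> vs"
  proof (cases n)
    case 0
    then have "q - 1 < 0" using mn by simp
    then show ?thesis using 0 v(3) by (simp add: wedge_neg)
  next
    case (Suc n')
    let ?h = "\<lambda>\<tau>. lift_perm \<tau> \<circ> front_cycle m"
    have B: "?B = ?h ` shuffle_perms (int m) (int n')"
      using shuffles_first_in_right[of m n'] unfolding Suc by simp
    have q1: "q - 1 = int n'" using mn Suc by simp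
    have inj: "inj_on ?h (shuffle_perms (int m) (int n'))"
    proof (rule inj_onI)
      fix \<sigma> \<tau> assume "?h \<sigma> = ?h \<tau>"
      then have "lift_perm \<sigma> = lift_perm \<tau>"
        using permutes_surj[OF front_cycle_permutes(1)[of m]] by (metis fun.map_comp surj_iff comp_id)
      then show "\<sigma> = \<tau>" by (rule inj_lift_perm)
    qed
    let ?u = "\<lambda>\<tau>. wedge_term R (int m) (int n') \<alpha> ?\<beta> vs \<tau>"
    have uc: "?u \<in> shuffle_perms (int m) (int n') \<rightarrow> carrier R"
      by (intro Pi_I wedge_term_closed') (use v \<alpha> \<beta>' mn q1 in auto)
    have "(\<Oplus> \<sigma> \<in> ?B. ?t \<sigma>) = (\<Oplus> \<tau> \<in> shuffle_perms (int m) (int n'). ?t (?h \<tau>))"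
    proof -
      have "?t \<in> ?B \<rightarrow> carrier R" using tc by blast
      then show ?thesis unfolding B by (rule R.finsum_reindex[OF _ inj])
    qed
    also have "\<dots> = (\<Oplus> \<tau> \<in> shuffle_perms (int m) (int n'). usgn p \<otimes> ?u \<tau>)"
    proof (rule R.finsum_cong'[OF refl])
      show "(\<lambda>\<tau>. usgn p \<otimes> ?u \<tau>) \<in> shuffle_perms (int m) (int n') \<rightarrow> carrier R"
        using uc by (auto simp: Pi_def)
      fix \<tau> assume \<tau>: "\<tau> \<in> shuffle_perms (int m) (int n')"
      show "?t (?h \<tau>) = usgn p \<otimes> ?u \<tau>"
        unfolding Suc mn(1) by (rule wedge_term_lift_cycle[OF \<tau>]) (use v \<alpha> \<beta>' mn q1 in auto)
    qed
    also have "\<dots> = usgn p \<otimes> (\<Oplus> \<tau> \<in> shuffle_perms (int m) (int n'). ?u \<tau>)"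
      by (rule R.finsum_rdistr[symmetric, OF finite_shuffle_perms _ uc]) simp
    also have "\<dots> = usgn p \<otimes> wedge R M p (q - 1) \<alpha> ?\<beta> vs"
      unfolding wedge_apply[OF v(3)] unfolding q1 unfolding mn ..
    finally show ?thesis .
  qed
  finally show ?thesis .
qed


text \<open>Ring-valued functions on lists of the right length. The recursion of the product lives
  at this level; linearity and antisymmetry are treated separately by \<open>qform\<close>.\<close>

abbreviation cochains :: "int \<Rightarrow> ('c list \<Rightarrow> 'a) set" where
  "cochains k \<equiv> vectors M k \<rightarrow> carrier R"

abbreviation ins :: "'c \<Rightarrow> ('c list \<Rightarrow> 'a) \<Rightarrow> 'c list \<Rightarrow> 'a" where
  "ins v \<omega> \<equiv> \<lambda>us. \<omega> (v # us)"

lemma ins_cochain: "\<omega> \<in> cochains k \<Longrightarrow> v \<in> carrier M \<Longrightarrow> ins v \<omega> \<in> cochains (k - 1)"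
  by (auto simp: Pi_def)

lemma cochain_closed: "\<omega> \<in> cochains k \<Longrightarrow> vs \<in> vectors M k \<Longrightarrow> \<omega> vs \<in> carrier R"
  by (auto simp: Pi_def)

lemma vectors_split:
  assumes "v # vs \<in> vectors M (p + q)"
  shows "v \<in> carrier M" "vs \<in> vectors M (p - 1 + q)" "vs \<in> vectors M (p + (q - 1))"
  using assms by (simp_all add: algebra_simps)

section \<open>Algebra laws of the product, by induction on the list of arguments\<close>

lemma wedge_closed:
  "vs \<in> vectors M (p + q) \<Longrightarrow> \<alpha> \<in> cochains p \<Longrightarrow> \<beta> \<in> cochains q \<Longrightarrow> wedge R M p q \<alpha> \<beta> vs \<in> carrier R"
proof (induction vs arbitrary: p q \<alpha> \<beta>)
  case Nil
  then have "p + q = 0" by simp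
  then show ?case using Nil wedge_Nil[of p q \<alpha> \<beta>] by (auto simp: Pi_def)
next
  case (Cons v vs)
  note v = vectors_split[OF Cons.prems(1)]
  show ?case
    unfolding wedge_Cons[OF Cons.prems]
    using Cons.IH[OF v(2) ins_cochain[OF Cons.prems(2) v(1)] Cons.prems(3)]
      Cons.IH[OF v(3) Cons.prems(2) ins_cochain[OF Cons.prems(3) v(1)]] by simp
qed

lemma wedge_cochain: "\<alpha> \<in> cochains p \<Longrightarrow> \<beta> \<in> cochains q \<Longrightarrow> wedge R M p q \<alpha> \<beta> \<in> cochains (p + q)"
  using wedge_closed by blast

text \<open>The product evaluates its factors on admissible lists only. This allows a factor to be
  replaced by its recursion formula, or a restricted form by an unrestricted one, underneath a
  product.\<close>

lemma wedge_cong: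
  "vs \<in> vectors M (p + q) \<Longrightarrow> \<alpha> \<in> cochains p \<Longrightarrow> \<beta> \<in> cochains q \<Longrightarrow>
   (\<And>us. us \<in> vectors M p \<Longrightarrow> \<alpha> us = \<alpha>' us) \<Longrightarrow> (\<And>us. us \<in> vectors M q \<Longrightarrow> \<beta> us = \<beta>' us) \<Longrightarrow>
   wedge R M p q \<alpha> \<beta> vs = wedge R M p q \<alpha>' \<beta>' vs"
proof (induction vs arbitrary: p q \<alpha> \<beta> \<alpha>' \<beta>')
  case Nil
  then have pq: "p + q = 0" by simp
  have "\<alpha>' \<in> cochains p" "\<beta>' \<in> cochains q" using Nil by (auto simp: Pi_def)
  then show ?case using pq Nil wedge_Nil[of p q \<alpha> \<beta>] wedge_Nil[of p q \<alpha>' \<beta>'] by auto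
next
  case (Cons v vs)
  note v = vectors_split[OF Cons.prems(1)]
  have *: "\<alpha>' \<in> cochains p" "\<beta>' \<in> cochains q" using Cons.prems by (auto simp: Pi_def)
  have "wedge R M (p - 1) q (ins v \<alpha>) \<beta> vs = wedge R M (p - 1) q (ins v \<alpha>') \<beta>' vs"
    by (rule Cons.IH[OF v(2) ins_cochain[OF Cons.prems(2) v(1)] Cons.prems(3)])
      (use Cons.prems(4,5) v(1) in simp_all)
  moreover have "wedge R M p (q - 1) \<alpha> (ins v \<beta>) vs = wedge R M p (q - 1) \<alpha>' (ins v \<beta>') vs"
    by (rule Cons.IH[OF v(3) Cons.prems(2) ins_cochain[OF Cons.prems(3) v(1)]])
      (use Cons.prems(4,5) v(1) in simp_all)
  ultimately show ?case unfolding wedge_Cons[OF Cons.prems(1-3)] wedge_Cons[OF Cons.prems(1) *] by simp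
qed

lemma add_swap4:
  assumes "a \<in> carrier R" "b \<in> carrier R" "c \<in> carrier R" "d \<in> carrier R"
  shows "(a \<oplus> b) \<oplus> (c \<oplus> d) = (a \<oplus> c) \<oplus> (b \<oplus> d)"
  using assms by (simp add: R.a_ac)

lemma wedge_add_left:
  "vs \<in> vectors M (p + q) \<Longrightarrow> \<alpha> \<in> cochains p \<Longrightarrow> \<alpha>' \<in> cochains p \<Longrightarrow> \<beta> \<in> cochains q \<Longrightarrow>
   wedge R M p q (\<lambda>us. \<alpha> us \<oplus> \<alpha>' us) \<beta> vs = wedge R M p q \<alpha> \<beta> vs \<oplus> wedge R M p q \<alpha>' \<beta> vs"
proof (induction vs arbitrary: p q \<alpha> \<beta> \<alpha>')
  case Nil
  then have pq: "p + q = 0" by simp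
  have s: "(\<lambda>us. \<alpha> us \<oplus> \<alpha>' us) \<in> cochains p" using Nil by (auto simp: Pi_def)
  show ?case
    unfolding wedge_Nil[OF pq s Nil(4)] wedge_Nil[OF pq Nil(2,4)] wedge_Nil[OF pq Nil(3,4)]
    using Nil pq cochain_closed[OF Nil(2)] cochain_closed[OF Nil(3)] cochain_closed[OF Nil(4)]
    by (simp add: R.l_distr)
next
  case (Cons v vs)
  note v = vectors_split[OF Cons.prems(1)]
  note a = Cons.prems(2) and a' = Cons.prems(3) and b = Cons.prems(4)
  note i = ins_cochain[OF _ v(1)]
  have s: "(\<lambda>us. \<alpha> us \<oplus> \<alpha>' us) \<in> cochains p" using Cons.prems by (auto simp: Pi_def)
  show ?case
    unfolding wedge_Cons[OF Cons.prems(1) s b] wedge_Cons[OF Cons.prems(1) a b] wedge_Cons[OF Cons.prems(1) a' b]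
      Cons.IH[OF v(2) i[OF a] i[OF a'] b] Cons.IH[OF v(3) a a' i[OF b]]
    using wedge_closed[OF v(2) i[OF a] b] wedge_closed[OF v(2) i[OF a'] b]
      wedge_closed[OF v(3) a i[OF b]] wedge_closed[OF v(3) a' i[OF b]]
    by (simp add: R.r_distr add_swap4)
qed

lemma wedge_smult_left:
  "vs \<in> vectors M (p + q) \<Longrightarrow> \<alpha> \<in> cochains p \<Longrightarrow> \<beta> \<in> cochains q \<Longrightarrow> f \<in> carrier R \<Longrightarrow>
   wedge R M p q (\<lambda>us. f \<otimes> \<alpha> us) \<beta> vs = f \<otimes> wedge R M p q \<alpha> \<beta> vs"
proof (induction vs arbitrary: p q \<alpha> \<beta>)
  case Nil
  then have pq: "p + q = 0" by simp
  have s: "(\<lambda>us. f \<otimes> \<alpha> us) \<in> cochains p" using Nil by (auto simp: Pi_def)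
  show ?case
    unfolding wedge_Nil[OF pq s Nil(3)] wedge_Nil[OF pq Nil(2,3)]
    using Nil pq cochain_closed[OF Nil(2)] cochain_closed[OF Nil(3)] by (simp add: R.m_assoc)
next
  case (Cons v vs)
  note v = vectors_split[OF Cons.prems(1)]
  note a = Cons.prems(2) and b = Cons.prems(3) and f = Cons.prems(4)
  note i = ins_cochain[OF _ v(1)]
  have s: "(\<lambda>us. f \<otimes> \<alpha> us) \<in> cochains p" using Cons.prems by (auto simp: Pi_def)
  show ?case
    unfolding wedge_Cons[OF Cons.prems(1) s b] wedge_Cons[OF Cons.prems(1) a b]
      Cons.IH[OF v(2) i[OF a] b f] Cons.IH[OF v(3) a i[OF b] f]
    using wedge_closed[OF v(2) i[OF a] b] wedge_closed[OF v(3) a i[OF b]] f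
    by (simp add: R.r_distr R.m_lcomm)
qed

text \<open>After contraction of both sides, the two terms of the recursion trade places, and the
  induction hypothesis applies to each of them.\<close>

lemma wedge_comm:
  "vs \<in> vectors M (p + q) \<Longrightarrow> \<alpha> \<in> cochains p \<Longrightarrow> \<beta> \<in> cochains q \<Longrightarrow>
   wedge R M p q \<alpha> \<beta> vs = usgn (p * q) \<otimes> wedge R M q p \<beta> \<alpha> vs"
proof (induction vs arbitrary: p q \<alpha> \<beta>)
  case Nil
  then have pq: "p + q = 0" "q + p = 0" by simp_all
  show ?case
    unfolding wedge_Nil[OF pq(1) Nil(2,3)] wedge_Nil[OF pq(2) Nil(3,2)]
    using Nil pq cochain_closed[OF Nil(2)] cochain_closed[OF Nil(3)]
    by (auto simp: R.m_comm usgn_def)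
next
  case (Cons v vs)
  note v = vectors_split[OF Cons.prems(1)]
  note a = Cons.prems(2) and b = Cons.prems(3)
  note i = ins_cochain[OF _ v(1)]
  have vqp: "v # vs \<in> vectors M (q + p)" using Cons.prems(1) by (simp add: add.commute)
  note v' = vectors_split[OF vqp]
  \<comment> \<open>Only the parity of exponents matters: \<open>p + p * (q - 1) + q\<close> and
    \<open>(p - 1) * q\<close> differ by \<open>2 * q\<close>.\<close>
  have e: "usgn (p + p * (q - 1) + q) = usgn ((p - 1) * q)" "usgn (p * q) = usgn (p + p * (q - 1))"
    by (simp_all add: usgn_def algebra_simps)
  show ?case
    unfolding wedge_Cons[OF Cons.prems] wedge_Cons[OF vqp b a]
      Cons.IH[OF v(2) i[OF a] b] Cons.IH[OF v(3) a i[OF b]]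
    using wedge_closed[OF v'(2) i[OF b] a] wedge_closed[OF v'(3) b i[OF a]]
    by (simp add: R.r_distr R.a_comm e)
qed

text \<open>Commutativity moves the scalar into the left factor; the sign that this costs occurs on
  both sides.\<close>

lemma wedge_smult_right:
  assumes "vs \<in> vectors M (p + q)" "\<alpha> \<in> cochains p" "\<beta> \<in> cochains q" "f \<in> carrier R"
  shows "wedge R M p q \<alpha> (\<lambda>us. f \<otimes> \<beta> us) vs = f \<otimes> wedge R M p q \<alpha> \<beta> vs"
proof -
  have vs: "vs \<in> vectors M (q + p)" using assms(1) by (simp add: add.commute)
  have s: "(\<lambda>us. f \<otimes> \<beta> us) \<in> cochains q" using assms by (auto simp: Pi_def)
  show ?thesis
    unfolding wedge_comm[OF assms(1,2) s] wedge_comm[OF assms(1-3)] wedge_smult_left[OF vs assms(3,2,4)]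
    using wedge_closed[OF vs assms(3,2)] assms(4) by (simp add: R.m_lcomm)
qed

lemma wedge_add_right:
  assumes "vs \<in> vectors M (p + q)" "\<alpha> \<in> cochains p" "\<beta> \<in> cochains q" "\<beta>' \<in> cochains q"
  shows "wedge R M p q \<alpha> (\<lambda>us. \<beta> us \<oplus> \<beta>' us) vs = wedge R M p q \<alpha> \<beta> vs \<oplus> wedge R M p q \<alpha> \<beta>' vs"
proof -
  have vs: "vs \<in> vectors M (q + p)" using assms(1) by (simp add: add.commute)
  have s: "(\<lambda>us. \<beta> us \<oplus> \<beta>' us) \<in> cochains q" using assms by (auto simp: Pi_def)
  show ?thesis
    unfolding wedge_comm[OF assms(1,2) s] wedge_comm[OF assms(1-3)] wedge_comm[OF assms(1,2,4)]
      wedge_add_left[OF vs assms(3,4,2)]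
    using wedge_closed[OF vs assms(3,2)] wedge_closed[OF vs assms(4,2)] by (simp add: R.r_distr)
qed

lemma minus_cochain: "\<alpha> \<in> cochains p \<Longrightarrow> (\<lambda>us. \<ominus> \<alpha> us) \<in> cochains p"
  by (auto simp: Pi_def)

lemma wedge_minus_left:
  assumes "vs \<in> vectors M (p + q)" "\<alpha> \<in> cochains p" "\<beta> \<in> cochains q"
  shows "wedge R M p q (\<lambda>us. \<ominus> \<alpha> us) \<beta> vs = \<ominus> wedge R M p q \<alpha> \<beta> vs"
proof -
  have "wedge R M p q (\<lambda>us. \<ominus> \<alpha> us) \<beta> vs = wedge R M p q (\<lambda>us. (\<ominus> \<one>) \<otimes> \<alpha> us) \<beta> vs"
    by (rule wedge_cong[OF assms(1) minus_cochain[OF assms(2)] assms(3)])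
      (use cochain_closed[OF assms(2)] in \<open>simp_all add: R.l_minus\<close>)
  also have "\<dots> = (\<ominus> \<one>) \<otimes> wedge R M p q \<alpha> \<beta> vs" by (rule wedge_smult_left[OF assms]) simp
  finally show ?thesis using wedge_closed[OF assms] by (simp add: R.l_minus)
qed

lemma wedge_minus_right:
  assumes "vs \<in> vectors M (p + q)" "\<alpha> \<in> cochains p" "\<beta> \<in> cochains q"
  shows "wedge R M p q \<alpha> (\<lambda>us. \<ominus> \<beta> us) vs = \<ominus> wedge R M p q \<alpha> \<beta> vs"
proof -
  have vs: "vs \<in> vectors M (q + p)" using assms(1) by (simp add: add.commute)
  show ?thesis
    unfolding wedge_comm[OF assms(1,2) minus_cochain[OF assms(3)]] wedge_comm[OF assms]
      wedge_minus_left[OF vs assms(3,2)]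
    using wedge_closed[OF vs assms(3,2)] by (simp add: R.r_minus)
qed

text \<open>Contraction with \<open>v\<close> turns each side into three terms, according to the
  factor that receives \<open>v\<close>, with sign exponents 0, p and p + q. The equations
  \<open>L1\<close>, \<open>L2\<close>, \<open>L3\<close> match them by the induction
  hypothesis.\<close>

lemma wedge_assoc:
  "vs \<in> vectors M (p + q + r) \<Longrightarrow> \<alpha> \<in> cochains p \<Longrightarrow> \<beta> \<in> cochains q \<Longrightarrow> \<gamma> \<in> cochains r \<Longrightarrow>
   wedge R M (p + q) r (wedge R M p q \<alpha> \<beta>) \<gamma> vs = wedge R M p (q + r) \<alpha> (wedge R M q r \<beta> \<gamma>) vs"
proof (induction vs arbitrary: p q r \<alpha> \<beta> \<gamma>)
  case Nil
  then have pqr: "(p + q) + r = 0" "p + (q + r) = 0" by simp_all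
  note ab = wedge_cochain[OF Nil(2,3)] and bc = wedge_cochain[OF Nil(3,4)]
  show ?case
    unfolding wedge_Nil[OF pqr(1) ab Nil(4)] wedge_Nil[OF pqr(2) Nil(2) bc]
    using pqr wedge_Nil[OF _ Nil(2,3)] wedge_Nil[OF _ Nil(3,4)]
      cochain_closed[OF Nil(2), of "[]"] cochain_closed[OF Nil(3), of "[]"] cochain_closed[OF Nil(4), of "[]"]
    by (auto simp: R.m_assoc)
next
  case (Cons v vs)
  note a = Cons.prems(2) and b = Cons.prems(3) and c = Cons.prems(4)
  have vs2: "v # vs \<in> vectors M (p + (q + r))" using Cons.prems(1) by (simp add: algebra_simps)
  note v = vectors_split[OF Cons.prems(1)] and v' = vectors_split[OF vs2]
  note i = ins_cochain[OF _ v(1)]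
  note ab = wedge_cochain[OF a b] and bc = wedge_cochain[OF b c]
  have v1: "vs \<in> vectors M (p - 1 + q + r)" "vs \<in> vectors M (p + (q - 1) + r)" "vs \<in> vectors M (p + q + (r - 1))"
    "vs \<in> vectors M (p - 1 + (q + r))" "vs \<in> vectors M (p + (q - 1 + r))" "vs \<in> vectors M (p + (q + (r - 1)))"
    using v(2) by (simp_all add: algebra_simps)
  have d: "p + q - 1 = p - 1 + q" "p + q - 1 = p + (q - 1)" "q + r - 1 = q - 1 + r" "q + r - 1 = q + (r - 1)" by simp_all
  note A1 = wedge_cochain[OF i[OF a] b] and A2 = wedge_cochain[OF a i[OF b]]
    and B1 = wedge_cochain[OF i[OF b] c] and B2 = wedge_cochain[OF b i[OF c]]
  have uA: "(\<lambda>us. usgn p \<otimes> wedge R M p (q - 1) \<alpha> (ins v \<beta>) us) \<in> cochains (p + q - 1)"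
    and uB: "(\<lambda>us. usgn q \<otimes> wedge R M q (r - 1) \<beta> (ins v \<gamma>) us) \<in> cochains (q + r - 1)"
    using A2 B2 by (auto simp: Pi_def algebra_simps)
  have A1': "wedge R M (p - 1) q (ins v \<alpha>) \<beta> \<in> cochains (p + q - 1)" using A1 unfolding d(1) .
  have A2': "wedge R M p (q - 1) \<alpha> (ins v \<beta>) \<in> cochains (p + q - 1)" using A2 unfolding d(2) .
  have B1': "wedge R M (q - 1) r (ins v \<beta>) \<gamma> \<in> cochains (q + r - 1)" using B1 unfolding d(3) .
  have B2': "wedge R M q (r - 1) \<beta> (ins v \<gamma>) \<in> cochains (q + r - 1)" using B2 unfolding d(4) .
  \<comment> \<open>The contracted factor is itself a product; \<open>wedge_cong\<close> inserts its
    recursion underneath the outer product.\<close>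
  have L: "wedge R M (p + q - 1) r (ins v (wedge R M p q \<alpha> \<beta>)) \<gamma> vs =
      wedge R M (p + q - 1) r (\<lambda>us. wedge R M (p - 1) q (ins v \<alpha>) \<beta> us \<oplus> usgn p \<otimes> wedge R M p (q - 1) \<alpha> (ins v \<beta>) us) \<gamma> vs"
    by (rule wedge_cong[OF v(2) i[OF ab] c]) (use v(1) wedge_Cons[OF _ a b] in \<open>simp_all add: algebra_simps\<close>)
  have R: "wedge R M p (q + r - 1) \<alpha> (ins v (wedge R M q r \<beta> \<gamma>)) vs =
      wedge R M p (q + r - 1) \<alpha> (\<lambda>us. wedge R M (q - 1) r (ins v \<beta>) \<gamma> us \<oplus> usgn q \<otimes> wedge R M q (r - 1) \<beta> (ins v \<gamma>) us) vs"
    by (rule wedge_cong[OF v'(3) a i[OF bc]]) (use v(1) wedge_Cons[OF _ b c] in \<open>simp_all add: algebra_simps\<close>)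
  have L1: "wedge R M (p + q - 1) r (wedge R M (p - 1) q (ins v \<alpha>) \<beta>) \<gamma> vs =
      wedge R M (p - 1) (q + r) (ins v \<alpha>) (wedge R M q r \<beta> \<gamma>) vs"
    unfolding d(1) by (rule Cons.IH[OF v1(1) i[OF a] b c])
  have L2: "wedge R M (p + q - 1) r (wedge R M p (q - 1) \<alpha> (ins v \<beta>)) \<gamma> vs =
      wedge R M p (q + r - 1) \<alpha> (wedge R M (q - 1) r (ins v \<beta>) \<gamma>) vs"
    unfolding d(2,3) by (rule Cons.IH[OF v1(2) a i[OF b] c])
  have L3: "wedge R M (p + q) (r - 1) (wedge R M p q \<alpha> \<beta>) (ins v \<gamma>) vs =
      wedge R M p (q + r - 1) \<alpha> (wedge R M q (r - 1) \<beta> (ins v \<gamma>)) vs"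
    unfolding d(4) by (rule Cons.IH[OF v1(3) a b i[OF c]])
  show ?case
    unfolding wedge_Cons[OF Cons.prems(1) ab c] wedge_Cons[OF vs2 a bc] L R
      wedge_add_left[OF v(2) A1' uA c] wedge_smult_left[OF v(2) A2' c usgn_closed]
      wedge_add_right[OF v'(3) a B1' uB] wedge_smult_right[OF v'(3) a B2' usgn_closed] L1 L2 L3
    using wedge_closed[OF v'(2) i[OF a] bc] wedge_closed[OF v'(3) a B1'] wedge_closed[OF v'(3) a B2']
    by (simp add: R.r_distr R.a_assoc)
qed

lemma wedge_degree0_left:
  "vs \<in> vectors M q \<Longrightarrow> \<alpha> \<in> cochains 0 \<Longrightarrow> \<beta> \<in> cochains q \<Longrightarrow> wedge R M 0 q \<alpha> \<beta> vs = \<alpha> [] \<otimes> \<beta> vs"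
proof (induction vs arbitrary: q \<beta>)
  case Nil
  then show ?case using wedge_Nil[of 0 q \<alpha> \<beta>] by simp
next
  case (Cons v vs)
  have v: "v \<in> carrier M" "vs \<in> vectors M (q - 1)" "v # vs \<in> vectors M (0 + q)" "vs \<in> vectors M (- 1 + q)"
    using Cons.prems(1) by (simp_all add: algebra_simps)
  have "\<alpha> [] \<otimes> \<beta> (v # vs) \<in> carrier R"
    using cochain_closed[OF Cons.prems(2)] cochain_closed[OF Cons.prems(3)] Cons.prems(1) by simp
  moreover have "wedge R M (- 1) q (ins v \<alpha>) \<beta> vs = \<zero>" using v(4) by (simp add: wedge_neg)
  ultimately show ?case
    using wedge_Cons[OF v(3) Cons.prems(2,3)] Cons.IH[OF v(2) Cons.prems(2) ins_cochain[OF Cons.prems(3) v(1)]]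
    by (simp add: usgn_def)
qed

section \<open>Antisymmetric multilinear forms\<close>

text \<open>The conditions of \<open>form_set\<close> without extensionality, so that they are inherited by \<open>ins v \<omega>\<close> and
  by pointwise sums.\<close>

definition qform :: "int \<Rightarrow> ('c list \<Rightarrow> 'a) \<Rightarrow> bool" where
  "qform k \<omega> \<longleftrightarrow> \<omega> \<in> cochains k \<and>
     (\<forall>us ws. \<forall>v \<in> carrier M. \<forall>w \<in> carrier M. us @ [v] @ ws \<in> vectors M k \<longrightarrow>
        \<omega> (us @ [v \<oplus>\<^bsub>M\<^esub> w] @ ws) = \<omega> (us @ [v] @ ws) \<oplus> \<omega> (us @ [w] @ ws)) \<and>
     (\<forall>us ws. \<forall>f \<in> carrier R. \<forall>v \<in> carrier M. us @ [v] @ ws \<in> vectors M k \<longrightarrow>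
        \<omega> (us @ [f \<odot>\<^bsub>M\<^esub> v] @ ws) = f \<otimes> \<omega> (us @ [v] @ ws)) \<and>
     (\<forall>vs \<in> vectors M k. \<forall>i < length vs. \<forall>j < length vs. i \<noteq> j \<longrightarrow>
        \<omega> (vs[i := vs ! j, j := vs ! i]) = \<ominus> \<omega> vs)"

lemma form_set_iff: "\<omega> \<in> form_set R M k \<longleftrightarrow> qform k \<omega> \<and> \<omega> \<in> extensional (vectors M k)"
  unfolding form_set_def qform_def PiE_def by blast

lemma qform_cochain: "qform k \<omega> \<Longrightarrow> \<omega> \<in> cochains k"
  unfolding qform_def by blast

lemma qform_closed: "qform k \<omega> \<Longrightarrow> vs \<in> vectors M k \<Longrightarrow> \<omega> vs \<in> carrier R"
  using cochain_closed[OF qform_cochain] .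

lemma qform_add_first:
  assumes "qform k \<omega>" "v \<in> carrier M" "w \<in> carrier M" "vs \<in> vectors M (k - 1)"
  shows "\<omega> ((v \<oplus>\<^bsub>M\<^esub> w) # vs) = \<omega> (v # vs) \<oplus> \<omega> (w # vs)"
proof -
  have "\<forall>us ws. \<forall>v \<in> carrier M. \<forall>w \<in> carrier M. us @ [v] @ ws \<in> vectors M k \<longrightarrow>
        \<omega> (us @ [v \<oplus>\<^bsub>M\<^esub> w] @ ws) = \<omega> (us @ [v] @ ws) \<oplus> \<omega> (us @ [w] @ ws)"
    using assms(1) unfolding qform_def by blast
  from this[rule_format, of v w "[]" vs] show ?thesis using assms by simp
qed

lemma qform_smult_first:
  assumes "qform k \<omega>" "f \<in> carrier R" "v \<in> carrier M" "vs \<in> vectors M (k - 1)"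
  shows "\<omega> ((f \<odot>\<^bsub>M\<^esub> v) # vs) = f \<otimes> \<omega> (v # vs)"
proof -
  have "\<forall>us ws. \<forall>f \<in> carrier R. \<forall>v \<in> carrier M. us @ [v] @ ws \<in> vectors M k \<longrightarrow>
        \<omega> (us @ [f \<odot>\<^bsub>M\<^esub> v] @ ws) = f \<otimes> \<omega> (us @ [v] @ ws)"
    using assms(1) unfolding qform_def by blast
  from this[rule_format, of f v "[]" vs] show ?thesis using assms by simp
qed

lemma qform_swap:
  assumes "qform k \<omega>" "vs \<in> vectors M k" "i < length vs" "j < length vs" "i \<noteq> j"
  shows "\<omega> (vs[i := vs ! j, j := vs ! i]) = \<ominus> \<omega> vs"
  using assms unfolding qform_def by blast

lemma qform_swap_first:
  assumes "qform k \<omega>" "v \<in> carrier M" "w \<in> carrier M" "vs \<in> vectors M (k - 1 - 1)"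
  shows "\<omega> (v # w # vs) = \<ominus> \<omega> (w # v # vs)"
  using qform_swap[OF assms(1), of "w # v # vs" 0 1] assms(2-4) by simp

lemma qform_minus_first:
  assumes "qform k \<omega>" "v \<in> carrier M" "vs \<in> vectors M (k - 1)"
  shows "\<omega> ((\<ominus>\<^bsub>M\<^esub> v) # vs) = \<ominus> \<omega> (v # vs)"
proof -
  have "\<omega> ((\<ominus>\<^bsub>M\<^esub> v) # vs) = \<omega> (((\<ominus> \<one>) \<odot>\<^bsub>M\<^esub> v) # vs)"
    using smult_l_minus[of \<one> v] assms(2) by simp
  then show ?thesis
    using qform_smult_first[OF assms(1), of "\<ominus> \<one>" v vs] qform_closed[OF assms(1), of "v # vs"] assms(2,3)
    by (simp add: R.l_minus)
qed

lemma qform_ins: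
  assumes "qform k \<omega>" "u \<in> carrier M"
  shows "qform (k - 1) (ins u \<omega>)"
  unfolding qform_def
proof (intro conjI allI ballI impI)
  show "ins u \<omega> \<in> cochains (k - 1)" by (rule ins_cochain[OF qform_cochain[OF assms(1)] assms(2)])
next
  fix us ws v w assume h: "v \<in> carrier M" "w \<in> carrier M" "us @ [v] @ ws \<in> vectors M (k - 1)"
  have "\<forall>us ws. \<forall>v \<in> carrier M. \<forall>w \<in> carrier M. us @ [v] @ ws \<in> vectors M k \<longrightarrow>
        \<omega> (us @ [v \<oplus>\<^bsub>M\<^esub> w] @ ws) = \<omega> (us @ [v] @ ws) \<oplus> \<omega> (us @ [w] @ ws)"
    using assms(1) unfolding qform_def by blast
  from this[rule_format, of v w "u # us" ws]
  show "\<omega> (u # us @ [v \<oplus>\<^bsub>M\<^esub> w] @ ws) = \<omega> (u # us @ [v] @ ws) \<oplus> \<omega> (u # us @ [w] @ ws)"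
    using h assms(2) by simp
next
  fix us ws f v assume h: "f \<in> carrier R" "v \<in> carrier M" "us @ [v] @ ws \<in> vectors M (k - 1)"
  have "\<forall>us ws. \<forall>f \<in> carrier R. \<forall>v \<in> carrier M. us @ [v] @ ws \<in> vectors M k \<longrightarrow>
        \<omega> (us @ [f \<odot>\<^bsub>M\<^esub> v] @ ws) = f \<otimes> \<omega> (us @ [v] @ ws)"
    using assms(1) unfolding qform_def by blast
  from this[rule_format, of f v "u # us" ws]
  show "\<omega> (u # us @ [f \<odot>\<^bsub>M\<^esub> v] @ ws) = f \<otimes> \<omega> (u # us @ [v] @ ws)"
    using h assms(2) by simp
next
  fix vs i j assume h: "vs \<in> vectors M (k - 1)" "i < length vs" "j < length vs" "i \<noteq> j"
  show "\<omega> (u # vs[i := vs ! j, j := vs ! i]) = \<ominus> \<omega> (u # vs)"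
    using qform_swap[OF assms(1), of "u # vs" "Suc i" "Suc j"] h assms(2) by simp
qed

text \<open>Lists in these degrees have no slot: at most the empty list is admissible, so linearity
  and antisymmetry are vacuous. This is the base case of the inductions on \<open>nat k\<close>,
  where all nonpositive degrees coincide.\<close>

lemma qform_nonpos:
  assumes "\<omega> \<in> cochains k" "k \<le> 0"
  shows "qform k \<omega>"
  using assms unfolding qform_def vectors_def by auto

text \<open>Contractions cover linearity and exchanges in the slots after the first. What remains is
  linearity in the first slot and the exchange of the first two arguments, because this
  transposition and those of the later positions generate all others.\<close>

lemma qform_ConsI:
  assumes c: "\<omega> \<in> cochains k"
    and ins: "\<And>v. v \<in> carrier M \<Longrightarrow> qform (k - 1) (ins v \<omega>)"
    and add: "\<And>v w vs. v \<in> carrier M \<Longrightarrow> w \<in> carrier M \<Longrightarrow> vs \<in> vectors M (k - 1) \<Longrightarrow>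
      \<omega> ((v \<oplus>\<^bsub>M\<^esub> w) # vs) = \<omega> (v # vs) \<oplus> \<omega> (w # vs)"
    and smult: "\<And>f v vs. f \<in> carrier R \<Longrightarrow> v \<in> carrier M \<Longrightarrow> vs \<in> vectors M (k - 1) \<Longrightarrow>
      \<omega> ((f \<odot>\<^bsub>M\<^esub> v) # vs) = f \<otimes> \<omega> (v # vs)"
    and swap: "\<And>v w vs. v \<in> carrier M \<Longrightarrow> w \<in> carrier M \<Longrightarrow> vs \<in> vectors M (k - 1 - 1) \<Longrightarrow>
      \<omega> (v # w # vs) = \<ominus> \<omega> (w # v # vs)"
  shows "qform k \<omega>"
  unfolding qform_def
proof (intro conjI allI ballI impI)
  show "\<omega> \<in> cochains k" by (rule c)
next
  fix us ws v w assume h: "v \<in> carrier M" "w \<in> carrier M" "us @ [v] @ ws \<in> vectors M k"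
  show "\<omega> (us @ [v \<oplus>\<^bsub>M\<^esub> w] @ ws) = \<omega> (us @ [v] @ ws) \<oplus> \<omega> (us @ [w] @ ws)"
  proof (cases us)
    case Nil
    then show ?thesis using add[OF h(1,2), of ws] h by simp
  next
    case (Cons u us')
    have u: "u \<in> carrier M" "us' @ [v] @ ws \<in> vectors M (k - 1)" using h Cons by simp_all
    have "\<forall>us ws. \<forall>v \<in> carrier M. \<forall>w \<in> carrier M. us @ [v] @ ws \<in> vectors M (k - 1) \<longrightarrow>
        ins u \<omega> (us @ [v \<oplus>\<^bsub>M\<^esub> w] @ ws) = ins u \<omega> (us @ [v] @ ws) \<oplus> ins u \<omega> (us @ [w] @ ws)"
      using ins[OF u(1)] unfolding qform_def by blast
    then show ?thesis using u h Cons by simp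
  qed
next
  fix us ws f v assume h: "f \<in> carrier R" "v \<in> carrier M" "us @ [v] @ ws \<in> vectors M k"
  show "\<omega> (us @ [f \<odot>\<^bsub>M\<^esub> v] @ ws) = f \<otimes> \<omega> (us @ [v] @ ws)"
  proof (cases us)
    case Nil
    then show ?thesis using smult[OF h(1,2), of ws] h by simp
  next
    case (Cons u us')
    have u: "u \<in> carrier M" "us' @ [v] @ ws \<in> vectors M (k - 1)" using h Cons by simp_all
    have "\<forall>us ws. \<forall>f \<in> carrier R. \<forall>v \<in> carrier M. us @ [v] @ ws \<in> vectors M (k - 1) \<longrightarrow>
        ins u \<omega> (us @ [f \<odot>\<^bsub>M\<^esub> v] @ ws) = f \<otimes> ins u \<omega> (us @ [v] @ ws)"
      using ins[OF u(1)] unfolding qform_def by blast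
    then show ?thesis using u h Cons by simp
  qed
next
  have cl: "\<omega> vs \<in> carrier R" if "vs \<in> vectors M k" for vs using cochain_closed[OF c that] .
  have tail: "\<omega> (u # vs[i := vs ! j, j := vs ! i]) = \<ominus> \<omega> (u # vs)"
    if "u # vs \<in> vectors M k" "i < length vs" "j < length vs" "i \<noteq> j" for u vs i j
    using qform_swap[OF ins, of u vs i j] that by simp
  \<comment> \<open>the transposition \<open>(0 (j+1))\<close> is \<open>(1 (j+1))\<close> conjugated by \<open>(0 1)\<close>\<close>
  have head: "\<omega> ((vs ! j) # vs[j := u]) = \<ominus> \<omega> (u # vs)"
    if h: "u # vs \<in> vectors M k" "j < length vs" for u vs j
  proof -
    obtain w ws where vs: "vs = w # ws" using h(2) by (cases vs) auto
    have m: "u \<in> carrier M" "w \<in> carrier M" "ws \<in> vectors M (k - 1 - 1)" using h vs by simp_all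
    show ?thesis
    proof (cases j)
      case 0
      then show ?thesis using swap[OF m(2,1,3)] vs by simp
    next
      case (Suc j')
      have j': "j' < length ws" using h(2) vs Suc by simp
      have x: "ws ! j' \<in> carrier M" using vectors_nth[OF m(3) j'] .
      have ws': "ws[j' := u] \<in> vectors M (k - 1 - 1)"
        using m j' by (auto simp: vectors_def dest!: set_update_subset_insert[THEN subsetD])
      have "\<omega> ((vs ! j) # vs[j := u]) = \<omega> ((ws ! j') # w # ws[j' := u])" using vs Suc by simp
      also have "\<dots> = \<ominus> \<omega> (w # (ws ! j') # ws[j' := u])" by (rule swap[OF x m(2) ws'])
      also have "\<omega> (w # (ws ! j') # ws[j' := u]) = \<ominus> \<omega> (w # u # ws)"
        using tail[of w "u # ws" 0 "Suc j'"] m j' by simp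
      also have "\<omega> (w # u # ws) = \<ominus> \<omega> (u # w # ws)" by (rule swap[OF m(2,1,3)])
      finally show ?thesis using cl[OF h(1)] vs by simp
    qed
  qed
  fix vs i j assume h: "vs \<in> vectors M k" "i < length vs" "j < length vs" "i \<noteq> j"
  obtain u us where vs: "vs = u # us" using h(2) by (cases vs) auto
  show "\<omega> (vs[i := vs ! j, j := vs ! i]) = \<ominus> \<omega> vs"
  proof (cases i)
    case 0
    then obtain j' where j: "j = Suc j'" using h(4) by (cases j) auto
    then show ?thesis using head[of u us j'] h vs 0 by simp
  next
    case (Suc i')
    show ?thesis
    proof (cases j)
      case 0
      then show ?thesis using head[of u us i'] h vs Suc by simp
    next
      case (Suc j')
      then show ?thesis using tail[of u us i' j'] h vs \<open>i = Suc i'\<close> by simp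
    qed
  qed
qed

text \<open>The conditions are tested on admissible lists only, so a function and its restriction
  satisfy them simultaneously.\<close>

lemma qform_cong:
  assumes "qform k \<omega>" "\<And>vs. vs \<in> vectors M k \<Longrightarrow> \<omega>' vs = \<omega> vs"
  shows "qform k \<omega>'"
proof -
  have e: "restrict \<omega>' (vectors M k) = restrict \<omega> (vectors M k)" using assms(2) by (rule restrict_ext)
  have r: "qform k (restrict \<omega> (vectors M k)) \<longleftrightarrow> qform k \<omega>" for \<omega>
  proof -
    have s: "us @ [w] @ ws \<in> vectors M k" if "us @ [v] @ ws \<in> vectors M k" "w \<in> carrier M" for us ws v w
      using that by (auto simp: vectors_def)
    have t: "vs[i := vs ! j, j := vs ! i] \<in> vectors M k"
      if "vs \<in> vectors M k" "i < length vs" "j < length vs" for vs i j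
      using that vectors_nth[OF that(1)]
      by (auto simp: vectors_def dest!: set_update_subset_insert[THEN subsetD])
    show ?thesis
      unfolding qform_def using s t
      by (intro conj_cong all_cong ball_cong imp_cong refl) (auto simp: Pi_def restrict_apply')
  qed
  show ?thesis using assms(1) r[of \<omega>] r[of \<omega>'] e by simp
qed

lemma qform_add:
  assumes "qform k \<alpha>" "qform k \<beta>"
  shows "qform k (\<lambda>vs. \<alpha> vs \<oplus> \<beta> vs)"
  unfolding qform_def
proof (intro conjI allI ballI impI)
  note c = qform_closed[OF assms(1)] qform_closed[OF assms(2)]
  show "(\<lambda>vs. \<alpha> vs \<oplus> \<beta> vs) \<in> cochains k" using c by auto
  have s: "us @ [w] @ ws \<in> vectors M k" if "us @ [v] @ ws \<in> vectors M k" "w \<in> carrier M" for us ws v w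
    using that by (auto simp: vectors_def)
  fix us ws v assume h: "v \<in> carrier M" "us @ [v] @ ws \<in> vectors M k"
  {
    fix w assume w: "w \<in> carrier M"
    show "\<alpha> (us @ [v \<oplus>\<^bsub>M\<^esub> w] @ ws) \<oplus> \<beta> (us @ [v \<oplus>\<^bsub>M\<^esub> w] @ ws) =
      \<alpha> (us @ [v] @ ws) \<oplus> \<beta> (us @ [v] @ ws) \<oplus> (\<alpha> (us @ [w] @ ws) \<oplus> \<beta> (us @ [w] @ ws))"
      using assms h w c[OF h(2)] c[OF s[OF h(2) w]] unfolding qform_def by (simp add: add_swap4)
  }
  fix f assume f: "f \<in> carrier R"
  show "\<alpha> (us @ [f \<odot>\<^bsub>M\<^esub> v] @ ws) \<oplus> \<beta> (us @ [f \<odot>\<^bsub>M\<^esub> v] @ ws) = f \<otimes> (\<alpha> (us @ [v] @ ws) \<oplus> \<beta> (us @ [v] @ ws))"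
    using assms h f c[OF h(2)] unfolding qform_def by (simp add: R.r_distr)
next
  note c = qform_closed[OF assms(1)] qform_closed[OF assms(2)]
  fix vs i j assume "vs \<in> vectors M k" "i < length vs" "j < length vs" "i \<noteq> j"
  then show "\<alpha> (vs[i := vs ! j, j := vs ! i]) \<oplus> \<beta> (vs[i := vs ! j, j := vs ! i]) = \<ominus> (\<alpha> vs \<oplus> \<beta> vs)"
    using qform_swap[OF assms(1)] qform_swap[OF assms(2)] c by (simp add: R.minus_add)
qed

lemma qform_smult:
  assumes "qform k \<alpha>" "g \<in> carrier R"
  shows "qform k (\<lambda>vs. g \<otimes> \<alpha> vs)"
  unfolding qform_def
proof (intro conjI allI ballI impI)
  note c = qform_closed[OF assms(1)]
  show "(\<lambda>vs. g \<otimes> \<alpha> vs) \<in> cochains k" using c assms(2) by auto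
  have s: "us @ [w] @ ws \<in> vectors M k" if "us @ [v] @ ws \<in> vectors M k" "w \<in> carrier M" for us ws v w
    using that by (auto simp: vectors_def)
  fix us ws v assume h: "v \<in> carrier M" "us @ [v] @ ws \<in> vectors M k"
  {
    fix w assume w: "w \<in> carrier M"
    show "g \<otimes> \<alpha> (us @ [v \<oplus>\<^bsub>M\<^esub> w] @ ws) = g \<otimes> \<alpha> (us @ [v] @ ws) \<oplus> g \<otimes> \<alpha> (us @ [w] @ ws)"
      using assms h w c[OF h(2)] c[OF s[OF h(2) w]] unfolding qform_def by (simp add: R.r_distr)
  }
  fix f assume f: "f \<in> carrier R"
  show "g \<otimes> \<alpha> (us @ [f \<odot>\<^bsub>M\<^esub> v] @ ws) = f \<otimes> (g \<otimes> \<alpha> (us @ [v] @ ws))"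
    using assms h f c[OF h(2)] unfolding qform_def by (simp add: R.m_lcomm)
next
  note c = qform_closed[OF assms(1)]
  fix vs i j assume "vs \<in> vectors M k" "i < length vs" "j < length vs" "i \<noteq> j"
  then show "g \<otimes> \<alpha> (vs[i := vs ! j, j := vs ! i]) = \<ominus> (g \<otimes> \<alpha> vs)"
    using qform_swap[OF assms(1)] c assms(2) by (simp add: R.r_minus)
qed

lemma qform_minus:
  assumes "qform k \<alpha>"
  shows "qform k (\<lambda>vs. \<ominus> \<alpha> vs)"
  by (rule qform_cong[OF qform_smult[OF assms, of "\<ominus> \<one>"]]) (use qform_closed[OF assms] in \<open>simp_all add: R.l_minus\<close>)

text \<open>Induction on the degree by \<open>qform_ConsI\<close>. For the exchange of the first two
  arguments the recursion is applied twice: the term with both in \<open>\<alpha>\<close> and the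
  term with both in \<open>\<beta>\<close> change sign by antisymmetry of these forms, while the two
  mixed terms are exchanged, and their signs \<open>usgn (p - 1)\<close> and \<open>usgn p\<close>
  are opposite.\<close>

lemma qform_wedge:
  assumes "qform p \<alpha>" "qform q \<beta>"
  shows "qform (p + q) (wedge R M p q \<alpha> \<beta>)"
proof -
  have "qform (p + q) (wedge R M p q \<alpha> \<beta>)" if "nat (p + q) = n" "qform p \<alpha>" "qform q \<beta>" for n p q \<alpha> \<beta>
    using that
  proof (induction n arbitrary: p q \<alpha> \<beta>)
    case 0
    show ?case
      by (rule qform_nonpos[OF wedge_cochain[OF qform_cochain[OF 0(2)] qform_cochain[OF 0(3)]]]) (use 0(1) in simp)
  next
    case (Suc n)
    note a = Suc.prems(2) and b = Suc.prems(3)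
    note ca = qform_cochain[OF a] and cb = qform_cochain[OF b]
    have n: "nat (p - 1 + q) = n" "nat (p + (q - 1)) = n" using Suc.prems(1) by linarith+
    have d: "p - 1 + q = p + q - 1" "p + (q - 1) = p + q - 1" by simp_all
    note C = wedge_Cons[OF _ ca cb]
    have iC: "wedge R M p q \<alpha> \<beta> (v # vs) = wedge R M (p - 1) q (ins v \<alpha>) \<beta> vs \<oplus> usgn p \<otimes> wedge R M p (q - 1) \<alpha> (ins v \<beta>) vs"
      if "v \<in> carrier M" "vs \<in> vectors M (p + q - 1)" for v vs
      using wedge_Cons[OF _ ca cb, of v vs] that by simp
    note icc = ins_cochain[OF ca] ins_cochain[OF cb]
    have V: "vs \<in> vectors M (p - 1 + q)" "vs \<in> vectors M (p + (q - 1))" if "vs \<in> vectors M (p + q - 1)" for vs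
      using that unfolding d by simp_all
    show ?case
    proof (rule qform_ConsI)
      show "wedge R M p q \<alpha> \<beta> \<in> cochains (p + q)" by (rule wedge_cochain[OF ca cb])
      fix v assume v: "v \<in> carrier M"
      have "qform (p + q - 1) (wedge R M (p - 1) q (ins v \<alpha>) \<beta>)" "qform (p + q - 1) (wedge R M p (q - 1) \<alpha> (ins v \<beta>))"
        using Suc.IH[OF n(1) qform_ins[OF a v] b] Suc.IH[OF n(2) a qform_ins[OF b v]] unfolding d by simp_all
      from qform_add[OF this(1) qform_smult[OF this(2) usgn_closed]]
      show "qform (p + q - 1) (ins v (wedge R M p q \<alpha> \<beta>))"
        by (rule qform_cong) (rule iC[OF v])
      fix vs assume vs: "vs \<in> vectors M (p + q - 1)"
      note cl1 = wedge_closed[OF V(1)[OF vs] icc(1)[of v] cb] and cl2 = wedge_closed[OF V(2)[OF vs] ca icc(2)[of v]]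
      {
        fix w assume w: "w \<in> carrier M"
        have vw: "v \<oplus>\<^bsub>M\<^esub> w \<in> carrier M" using v w by simp
        have 1: "wedge R M (p - 1) q (ins (v \<oplus>\<^bsub>M\<^esub> w) \<alpha>) \<beta> vs =
            wedge R M (p - 1) q (\<lambda>us. ins v \<alpha> us \<oplus> ins w \<alpha> us) \<beta> vs"
          by (rule wedge_cong[OF V(1)[OF vs] icc(1)[OF vw] cb]) (use qform_add_first[OF a v w] in simp_all)
        have 2: "wedge R M p (q - 1) \<alpha> (ins (v \<oplus>\<^bsub>M\<^esub> w) \<beta>) vs =
            wedge R M p (q - 1) \<alpha> (\<lambda>us. ins v \<beta> us \<oplus> ins w \<beta> us) vs"
          by (rule wedge_cong[OF V(2)[OF vs] ca icc(2)[OF vw]]) (use qform_add_first[OF b v w] in simp_all)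
        show "wedge R M p q \<alpha> \<beta> ((v \<oplus>\<^bsub>M\<^esub> w) # vs) = wedge R M p q \<alpha> \<beta> (v # vs) \<oplus> wedge R M p q \<alpha> \<beta> (w # vs)"
          unfolding iC[OF vw vs] iC[OF v vs] iC[OF w vs] 1 2
            wedge_add_left[OF V(1)[OF vs] icc(1)[OF v] icc(1)[OF w] cb]
            wedge_add_right[OF V(2)[OF vs] ca icc(2)[OF v] icc(2)[OF w]]
          using wedge_closed[OF V(1)[OF vs] icc(1)[OF v] cb] wedge_closed[OF V(1)[OF vs] icc(1)[OF w] cb]
            wedge_closed[OF V(2)[OF vs] ca icc(2)[OF v]] wedge_closed[OF V(2)[OF vs] ca icc(2)[OF w]]
          by (simp add: R.r_distr add_swap4)
      }
      fix f assume f: "f \<in> carrier R"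
      have fv: "f \<odot>\<^bsub>M\<^esub> v \<in> carrier M" using f v by simp
      have 1: "wedge R M (p - 1) q (ins (f \<odot>\<^bsub>M\<^esub> v) \<alpha>) \<beta> vs = wedge R M (p - 1) q (\<lambda>us. f \<otimes> ins v \<alpha> us) \<beta> vs"
        by (rule wedge_cong[OF V(1)[OF vs] icc(1)[OF fv] cb]) (use qform_smult_first[OF a f v] in simp_all)
      have 2: "wedge R M p (q - 1) \<alpha> (ins (f \<odot>\<^bsub>M\<^esub> v) \<beta>) vs = wedge R M p (q - 1) \<alpha> (\<lambda>us. f \<otimes> ins v \<beta> us) vs"
        by (rule wedge_cong[OF V(2)[OF vs] ca icc(2)[OF fv]]) (use qform_smult_first[OF b f v] in simp_all)
      show "wedge R M p q \<alpha> \<beta> ((f \<odot>\<^bsub>M\<^esub> v) # vs) = f \<otimes> wedge R M p q \<alpha> \<beta> (v # vs)"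
        unfolding iC[OF fv vs] iC[OF v vs] 1 2
          wedge_smult_left[OF V(1)[OF vs] icc(1)[OF v] cb f] wedge_smult_right[OF V(2)[OF vs] ca icc(2)[OF v] f]
        using cl1[OF v] cl2[OF v] f by (simp add: R.r_distr R.m_lcomm)
    next
      fix v w vs assume v: "v \<in> carrier M" and w: "w \<in> carrier M" and vs: "vs \<in> vectors M (p + q - 1 - 1)"
      have V2: "vs \<in> vectors M (p - 1 - 1 + q)" "vs \<in> vectors M (p - 1 + (q - 1))" "vs \<in> vectors M (p + (q - 1 - 1))"
        using vs by (simp_all add: algebra_simps)
      note i = ins_cochain
      have exp: "wedge R M p q \<alpha> \<beta> (v # w # vs) =
          (wedge R M (p - 1 - 1) q (ins w (ins v \<alpha>)) \<beta> vs \<oplus> usgn (p - 1) \<otimes> wedge R M (p - 1) (q - 1) (ins v \<alpha>) (ins w \<beta>) vs)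
          \<oplus> usgn p \<otimes> (wedge R M (p - 1) (q - 1) (ins w \<alpha>) (ins v \<beta>) vs \<oplus> usgn p \<otimes> wedge R M p (q - 1 - 1) \<alpha> (ins w (ins v \<beta>)) vs)"
        if v: "v \<in> carrier M" and w: "w \<in> carrier M" for v w
      proof -
        have wv: "w # vs \<in> vectors M (p + q - 1)" using w vs by simp
        show ?thesis
          unfolding iC[OF v wv] wedge_Cons[OF V(1)[OF wv] icc(1)[OF v] cb] wedge_Cons[OF V(2)[OF wv] ca icc(2)[OF v]] ..
      qed
      have 1: "wedge R M (p - 1 - 1) q (ins w (ins v \<alpha>)) \<beta> vs = \<ominus> wedge R M (p - 1 - 1) q (ins v (ins w \<alpha>)) \<beta> vs"
      proof -
        have "wedge R M (p - 1 - 1) q (ins w (ins v \<alpha>)) \<beta> vs = wedge R M (p - 1 - 1) q (\<lambda>us. \<ominus> ins v (ins w \<alpha>) us) \<beta> vs"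
          by (rule wedge_cong[OF V2(1) i[OF icc(1)[OF v] w] cb]) (use qform_swap_first[OF a v w] in simp_all)
        then show ?thesis using wedge_minus_left[OF V2(1) i[OF icc(1)[OF w] v] cb] by simp
      qed
      have 2: "wedge R M p (q - 1 - 1) \<alpha> (ins w (ins v \<beta>)) vs = \<ominus> wedge R M p (q - 1 - 1) \<alpha> (ins v (ins w \<beta>)) vs"
      proof -
        have "wedge R M p (q - 1 - 1) \<alpha> (ins w (ins v \<beta>)) vs = wedge R M p (q - 1 - 1) \<alpha> (\<lambda>us. \<ominus> ins v (ins w \<beta>) us) vs"
          by (rule wedge_cong[OF V2(3) ca i[OF icc(2)[OF v] w]]) (use qform_swap_first[OF b v w] in simp_all)
        then show ?thesis using wedge_minus_right[OF V2(3) ca i[OF icc(2)[OF w] v]] by simp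
      qed
      show "wedge R M p q \<alpha> \<beta> (v # w # vs) = \<ominus> wedge R M p q \<alpha> \<beta> (w # v # vs)"
        unfolding exp[OF v w] exp[OF w v] 1 2
        using wedge_closed[OF V2(1) i[OF icc(1)[OF w] v] cb] wedge_closed[OF V2(3) ca i[OF icc(2)[OF w] v]]
          wedge_closed[OF V2(2) icc(1)[OF v] icc(2)[OF w]] wedge_closed[OF V2(2) icc(1)[OF w] icc(2)[OF v]]
        by (cases "even p") (simp_all add: usgn_def R.l_minus R.minus_add R.a_ac)
    qed
  qed
  then show ?thesis using assms by blast
qed

end

section \<open>Lie-Rinehart structures\<close>

text \<open>The function \<open>act\<close> plays the role of the anchor. \<open>act_br\<close>
  says, in a form free of subtraction, that the bracket acts as a commutator;
  \<open>br_smult\<close> is the Leibniz rule, stated for the second argument because antisymmetry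
  gives the other.\<close>

locale lie_rinehart = module S M + lie_bracket M br
  for S :: "('r, 'n) ring_scheme" (structure)
    and M :: "('r, 'v, 'm) module_scheme"
    and br :: "'v \<Rightarrow> 'v \<Rightarrow> 'v"
    and act :: "'v \<Rightarrow> 'r \<Rightarrow> 'r" +
  assumes act_closed: "v \<in> carrier M \<Longrightarrow> f \<in> carrier S \<Longrightarrow> act v f \<in> carrier S"
    and act_add_left: "v \<in> carrier M \<Longrightarrow> w \<in> carrier M \<Longrightarrow> f \<in> carrier S \<Longrightarrow>
      act (v \<oplus>\<^bsub>M\<^esub> w) f = act v f \<oplus> act w f"
    and act_smult: "g \<in> carrier S \<Longrightarrow> v \<in> carrier M \<Longrightarrow> f \<in> carrier S \<Longrightarrow>
      act (g \<odot>\<^bsub>M\<^esub> v) f = g \<otimes> act v f"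
    and act_add: "v \<in> carrier M \<Longrightarrow> f \<in> carrier S \<Longrightarrow> g \<in> carrier S \<Longrightarrow>
      act v (f \<oplus> g) = act v f \<oplus> act v g"
    and act_mult: "v \<in> carrier M \<Longrightarrow> f \<in> carrier S \<Longrightarrow> g \<in> carrier S \<Longrightarrow>
      act v (f \<otimes> g) = act v f \<otimes> g \<oplus> f \<otimes> act v g"
    and act_br: "v \<in> carrier M \<Longrightarrow> w \<in> carrier M \<Longrightarrow> f \<in> carrier S \<Longrightarrow>
      act v (act w f) = act w (act v f) \<oplus> act (br v w) f"
    and br_smult: "f \<in> carrier S \<Longrightarrow> v \<in> carrier M \<Longrightarrow> w \<in> carrier M \<Longrightarrow>
      br v (f \<odot>\<^bsub>M\<^esub> w) = (act v f \<odot>\<^bsub>M\<^esub> w) \<oplus>\<^bsub>M\<^esub> (f \<odot>\<^bsub>M\<^esub> br v w)"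

section \<open>The Lie derivative along a vector\<close>

context lie_rinehart
begin

lemma act_zero:
  assumes "v \<in> carrier M"
  shows "act v \<zero> = \<zero>"
proof -
  have "act v \<zero> \<oplus> act v \<zero> = act v \<zero>" using act_add[OF assms, of \<zero> \<zero>] by simp
  then show ?thesis using act_closed[OF assms, of \<zero>] by (simp add: R.add.l_cancel_one)
qed

lemma act_minus:
  assumes "v \<in> carrier M" "f \<in> carrier S"
  shows "act v (\<ominus> f) = \<ominus> act v f"
proof -
  have "act v (\<ominus> f) \<oplus> act v f = \<zero>"
    using act_add[OF assms(1), of "\<ominus> f" f] act_zero assms R.l_neg by simp
  then show ?thesis using R.minus_equality assms act_closed by simp
qed

primrec Lie :: "'v \<Rightarrow> ('v list \<Rightarrow> 'r) \<Rightarrow> 'v list \<Rightarrow> 'r" where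
  "Lie v \<omega> [] = act v (\<omega> [])"
| "Lie v \<omega> (u # us) = Lie v (ins u \<omega>) us \<ominus> \<omega> (br v u # us)"

text \<open>The recursion is Cartan's formula \<open>\<iota>\<^sub>v d = L\<^sub>v - d \<iota>\<^sub>v\<close>; likewise \<open>Lie\<close> is defined by
  \<open>\<iota>\<^sub>u L\<^sub>v = L\<^sub>v \<iota>\<^sub>u - \<iota>\<^bsub>[v,u]\<^esub>\<close>. Identities between them then follow by induction on the list
  of arguments. By \<open>CE_differential_apply\<close>, \<open>dif\<close> is the Chevalley-Eilenberg differential.\<close>

primrec dif :: "('v list \<Rightarrow> 'r) \<Rightarrow> 'v list \<Rightarrow> 'r" where
  "dif \<omega> [] = \<zero>"
| "dif \<omega> (v # vs) = Lie v \<omega> vs \<ominus> dif (ins v \<omega>) vs"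

lemma Lie_closed:
  assumes v: "v \<in> carrier M"
  shows "vs \<in> vectors M k \<Longrightarrow> \<omega> \<in> cochains k \<Longrightarrow> Lie v \<omega> vs \<in> carrier S"
proof (induction vs arbitrary: k \<omega>)
  case Nil
  then show ?case using act_closed[OF v] cochain_closed[OF Nil(2)] by simp
next
  case (Cons u us)
  then have u: "u \<in> carrier M" "us \<in> vectors M (k - 1)" by simp_all
  show ?case
    using Cons.IH[OF u(2) ins_cochain[OF Cons.prems(2) u(1)]] cochain_closed[OF Cons.prems(2), of "br v u # us"]
      u br_closed[OF v u(1)] by simp
qed

lemma Lie_cochain: "v \<in> carrier M \<Longrightarrow> \<omega> \<in> cochains k \<Longrightarrow> Lie v \<omega> \<in> cochains k"
  using Lie_closed by blast

lemma Lie_cong: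
  assumes v: "v \<in> carrier M"
  shows "vs \<in> vectors M k \<Longrightarrow> (\<And>us. us \<in> vectors M k \<Longrightarrow> \<omega> us = \<omega>' us) \<Longrightarrow> Lie v \<omega> vs = Lie v \<omega>' vs"
proof (induction vs arbitrary: k \<omega> \<omega>')
  case Nil
  then show ?case by simp
next
  case (Cons u us)
  then have u: "u \<in> carrier M" "us \<in> vectors M (k - 1)" by simp_all
  have "Lie v (ins u \<omega>) us = Lie v (ins u \<omega>') us" by (rule Cons.IH[OF u(2)]) (use Cons.prems u in simp_all)
  then show ?case using Cons.prems(2)[of "br v u # us"] u br_closed[OF v u(1)] by simp
qed

lemma Lie_add:
  assumes v: "v \<in> carrier M"
  shows "vs \<in> vectors M k \<Longrightarrow> \<alpha> \<in> cochains k \<Longrightarrow> \<beta> \<in> cochains k \<Longrightarrow>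
    Lie v (\<lambda>us. \<alpha> us \<oplus> \<beta> us) vs = Lie v \<alpha> vs \<oplus> Lie v \<beta> vs"
proof (induction vs arbitrary: k \<alpha> \<beta>)
  case Nil
  then show ?case using act_add[OF v] cochain_closed[OF Nil(2)] cochain_closed[OF Nil(3)] by simp
next
  case (Cons u us)
  then have u: "u \<in> carrier M" "us \<in> vectors M (k - 1)" by simp_all
  note i = ins_cochain[OF _ u(1)]
  note a = Cons.prems(2) and b = Cons.prems(3)
  show ?case
    using Cons.IH[OF u(2) i[OF a] i[OF b]] Lie_closed[OF v u(2) i[OF a]] Lie_closed[OF v u(2) i[OF b]]
      cochain_closed[OF a, of "br v u # us"] cochain_closed[OF b, of "br v u # us"] u br_closed[OF v u(1)]
    by (simp add: R.minus_eq R.minus_add add_swap4)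
qed

text \<open>The bracket terms of the recursion are merely multiplied by \<open>f\<close>; the factor
  \<open>f\<close> is differentiated once, when the empty list is reached.\<close>

lemma Lie_smult:
  assumes v: "v \<in> carrier M" and f: "f \<in> carrier S"
  shows "vs \<in> vectors M k \<Longrightarrow> \<omega> \<in> cochains k \<Longrightarrow>
    Lie v (\<lambda>us. f \<otimes> \<omega> us) vs = act v f \<otimes> \<omega> vs \<oplus> f \<otimes> Lie v \<omega> vs"
proof (induction vs arbitrary: k \<omega>)
  case Nil
  then show ?case using act_mult[OF v f] cochain_closed[OF Nil(2)] by simp
next
  case (Cons u us)
  then have u: "u \<in> carrier M" "us \<in> vectors M (k - 1)" by simp_all
  note i = ins_cochain[OF _ u(1)]
  show ?case
    using Cons.IH[OF u(2) i[OF Cons.prems(2)]] Lie_closed[OF v u(2) i[OF Cons.prems(2)]] act_closed[OF v f] f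
      cochain_closed[OF Cons.prems(2), of "br v u # us"] cochain_closed[OF Cons.prems(2,1)] u br_closed[OF v u(1)]
    by (simp add: R.minus_eq R.r_distr R.r_minus R.a_assoc)
qed

lemma Lie_minus:
  assumes v: "v \<in> carrier M"
  shows "vs \<in> vectors M k \<Longrightarrow> \<omega> \<in> cochains k \<Longrightarrow> Lie v (\<lambda>us. \<ominus> \<omega> us) vs = \<ominus> Lie v \<omega> vs"
proof (induction vs arbitrary: k \<omega>)
  case Nil
  then show ?case using act_minus[OF v] cochain_closed[OF Nil(2)] by simp
next
  case (Cons u us)
  then have u: "u \<in> carrier M" "us \<in> vectors M (k - 1)" by simp_all
  note i = ins_cochain[OF _ u(1)]
  show ?case
    using Cons.IH[OF u(2) i[OF Cons.prems(2)]] Lie_closed[OF v u(2) i[OF Cons.prems(2)]]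
      cochain_closed[OF Cons.prems(2), of "br v u # us"] u br_closed[OF v u(1)]
    by (simp add: R.minus_eq R.minus_add)
qed

text \<open>A derivation annihilates 1 and hence the signs, so these pass through the Lie
  derivative.\<close>

lemma Lie_usgn:
  assumes v: "v \<in> carrier M" and vs: "vs \<in> vectors M k" and w: "\<omega> \<in> cochains k"
  shows "Lie v (\<lambda>us. usgn p \<otimes> \<omega> us) vs = usgn p \<otimes> Lie v \<omega> vs"
proof -
  have "act v \<one> \<oplus> act v \<one> = act v \<one>"
    using act_mult[OF v, of \<one> \<one>] act_closed[OF v, of \<one>] by simp
  then have "act v \<one> = \<zero>" using act_closed[OF v, of \<one>] by (simp add: R.add.l_cancel_one)
  then have "act v (usgn p) = \<zero>" using act_minus[OF v] by (simp add: usgn_def)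
  then show ?thesis using Lie_smult[OF v usgn_closed vs w] Lie_closed[OF v vs w] cochain_closed[OF w vs] by simp
qed

lemma Lie_diff:
  assumes "v \<in> carrier M" "vs \<in> vectors M k" "\<alpha> \<in> cochains k" "\<beta> \<in> cochains k"
  shows "Lie v (\<lambda>us. \<alpha> us \<ominus> \<beta> us) vs = Lie v \<alpha> vs \<ominus> Lie v \<beta> vs"
  unfolding R.minus_eq
  using Lie_add[OF assms(1-3) minus_cochain[OF assms(4)]] Lie_minus[OF assms(1,2,4)] by simp

lemma qform_diff: "qform k \<alpha> \<Longrightarrow> qform k \<beta> \<Longrightarrow> qform k (\<lambda>vs. \<alpha> vs \<ominus> \<beta> vs)"
  unfolding R.minus_eq by (rule qform_add[OF _ qform_minus])

text \<open>Linearity over functions in the first slot rests on a cancellation: differentiating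
  \<open>f \<otimes> \<omega> (u # vs)\<close> produces
  \<open>act v f \<otimes> \<omega> (u # vs)\<close>, and the Leibniz rule for the bracket of
  \<open>v\<close> with the multiple of \<open>u\<close> produces the same term with the opposite
  sign.\<close>

lemma qform_Lie:
  assumes v: "v \<in> carrier M" and w: "qform k \<omega>"
  shows "qform k (Lie v \<omega>)"
proof -
  have "qform k (Lie v \<omega>)" if "nat k = n" "qform k \<omega>" for n k \<omega>
    using that
  proof (induction n arbitrary: k \<omega>)
    case 0
    show ?case by (rule qform_nonpos[OF Lie_cochain[OF v qform_cochain[OF 0(2)]]]) (use 0 in simp)
  next
    case (Suc n)
    note q = Suc.prems(2)
    note c = qform_cochain[OF q] and cl = qform_closed[OF q]
    note i = ins_cochain[OF c]
    have n: "nat (k - 1) = n" using Suc.prems(1) by simp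
    show ?case
    proof (rule qform_ConsI)
      show "Lie v \<omega> \<in> cochains k" by (rule Lie_cochain[OF v c])
      fix u assume u: "u \<in> carrier M"
      show "qform (k - 1) (ins u (Lie v \<omega>))"
        using qform_diff[OF Suc.IH[OF n qform_ins[OF q u]] qform_ins[OF q br_closed[OF v u]]] by simp
      fix vs assume vs: "vs \<in> vectors M (k - 1)"
      note Lu = Lie_closed[OF v vs i[OF u]]
      {
        fix w assume w: "w \<in> carrier M"
        have "Lie v (ins (u \<oplus>\<^bsub>M\<^esub> w) \<omega>) vs = Lie v (\<lambda>us. ins u \<omega> us \<oplus> ins w \<omega> us) vs"
          by (rule Lie_cong[OF v vs]) (rule qform_add_first[OF q u w])
        moreover have "\<omega> (br v (u \<oplus>\<^bsub>M\<^esub> w) # vs) = \<omega> (br v u # vs) \<oplus> \<omega> (br v w # vs)"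
          unfolding br_add_right[OF v u w] by (rule qform_add_first[OF q br_closed[OF v u] br_closed[OF v w] vs])
        ultimately show "Lie v \<omega> ((u \<oplus>\<^bsub>M\<^esub> w) # vs) = Lie v \<omega> (u # vs) \<oplus> Lie v \<omega> (w # vs)"
          using Lie_add[OF v vs i[OF u] i[OF w]] Lu Lie_closed[OF v vs i[OF w]]
            cl[of "br v u # vs"] cl[of "br v w # vs"] br_closed[OF v u] br_closed[OF v w] vs
          by (simp add: R.minus_eq R.minus_add add_swap4)
      }
      fix f assume f: "f \<in> carrier S"
      have "Lie v (ins (f \<odot>\<^bsub>M\<^esub> u) \<omega>) vs = Lie v (\<lambda>us. f \<otimes> ins u \<omega> us) vs"
        by (rule Lie_cong[OF v vs]) (rule qform_smult_first[OF q f u])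
      then have 1: "Lie v (ins (f \<odot>\<^bsub>M\<^esub> u) \<omega>) vs = act v f \<otimes> \<omega> (u # vs) \<oplus> f \<otimes> Lie v (ins u \<omega>) vs"
        using Lie_smult[OF v f vs i[OF u]] by simp
      have fs: "act v f \<odot>\<^bsub>M\<^esub> u \<in> carrier M" "f \<odot>\<^bsub>M\<^esub> br v u \<in> carrier M"
        using act_closed[OF v f] u f br_closed[OF v u] by simp_all
      have 2: "\<omega> (br v (f \<odot>\<^bsub>M\<^esub> u) # vs) = act v f \<otimes> \<omega> (u # vs) \<oplus> f \<otimes> \<omega> (br v u # vs)"
        unfolding br_smult[OF f v u] qform_add_first[OF q fs vs]
          qform_smult_first[OF q act_closed[OF v f] u vs] qform_smult_first[OF q f br_closed[OF v u] vs] ..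
      have cancel: "(a \<oplus> b) \<ominus> (a \<oplus> c) = b \<ominus> c"
        if "a \<in> carrier S" "b \<in> carrier S" "c \<in> carrier S" for a b c
      proof -
        have "(a \<oplus> b) \<ominus> (a \<oplus> c) = (a \<oplus> \<ominus> a) \<oplus> (b \<oplus> \<ominus> c)"
          using that by (simp only: R.minus_eq R.minus_add add_swap4 R.add.inv_closed)
        then show ?thesis using that by (simp add: R.minus_eq R.r_neg)
      qed
      show "Lie v \<omega> ((f \<odot>\<^bsub>M\<^esub> u) # vs) = f \<otimes> Lie v \<omega> (u # vs)"
        using Lu f act_closed[OF v f] cl[of "u # vs"] cl[of "br v u # vs"] br_closed[OF v u] u vs
        by (simp add: 1 2 cancel) (simp add: R.minus_eq R.r_distr R.r_minus)
    next
      fix u w vs assume u: "u \<in> carrier M" and w: "w \<in> carrier M" and vs: "vs \<in> vectors M (k - 1 - 1)"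
      have 1: "Lie v (ins w (ins u \<omega>)) vs = \<ominus> Lie v (ins u (ins w \<omega>)) vs"
      proof -
        have "Lie v (ins w (ins u \<omega>)) vs = Lie v (\<lambda>us. \<ominus> ins u (ins w \<omega>) us) vs"
          by (rule Lie_cong[OF v vs]) (rule qform_swap_first[OF q u w])
        then show ?thesis using Lie_minus[OF v vs ins_cochain[OF i[OF w] u]] by simp
      qed
      show "Lie v \<omega> (u # w # vs) = \<ominus> Lie v \<omega> (w # u # vs)"
        using qform_swap_first[OF q u br_closed[OF v w] vs] qform_swap_first[OF q br_closed[OF v u] w vs]
          Lie_closed[OF v vs ins_cochain[OF i[OF w] u]] cl[of "br v w # u # vs"] cl[of "w # br v u # vs"]
          br_closed[OF v u] br_closed[OF v w] u w vs
        by (simp add: 1 R.minus_eq R.minus_add) (simp add: R.a_ac)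
    qed
  qed
  then show ?thesis using w by blast
qed


text \<open>Contraction with \<open>u\<close> commutes with the Lie derivative up to contraction
  with \<open>br v u\<close>. The correction terms assemble to the recursion of the product at
  \<open>br v u\<close>, and the rest is the induction hypothesis.\<close>

lemma Lie_wedge:
  assumes v: "v \<in> carrier M"
  shows "vs \<in> vectors M (p + q) \<Longrightarrow> \<alpha> \<in> cochains p \<Longrightarrow> \<beta> \<in> cochains q \<Longrightarrow>
    Lie v (wedge S M p q \<alpha> \<beta>) vs = wedge S M p q (Lie v \<alpha>) \<beta> vs \<oplus> wedge S M p q \<alpha> (Lie v \<beta>) vs"
proof (induction vs arbitrary: p q \<alpha> \<beta>)
  case Nil
  then have pq: "p + q = 0" by simp
  note a = Nil(2) and b = Nil(3)
  show ?case
    using pq wedge_Nil[OF pq a b] wedge_Nil[OF pq Lie_cochain[OF v a] b] wedge_Nil[OF pq a Lie_cochain[OF v b]]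
      act_mult[OF v, of "\<alpha> []" "\<beta> []"] cochain_closed[OF a, of "[]"] cochain_closed[OF b, of "[]"]
    by (auto simp: act_zero[OF v])
next
  case (Cons u us)
  note u = vectors_split[OF Cons.prems(1)] and a = Cons.prems(2) and b = Cons.prems(3)
  have us: "us \<in> vectors M (p + q - 1)" using Cons.prems(1) by simp
  have vu: "br v u \<in> carrier M" by (rule br_closed[OF v u(1)])
  have vus: "br v u # us \<in> vectors M (p + q)" using vu us by simp
  note i = ins_cochain[OF _ u(1)] and j = ins_cochain[OF _ vu] and L = Lie_cochain[OF v]
  have A: "wedge S M (p - 1) q (ins u \<alpha>) \<beta> \<in> cochains (p + q - 1)"
    and B: "wedge S M p (q - 1) \<alpha> (ins u \<beta>) \<in> cochains (p + q - 1)"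
    using wedge_cochain[OF i[OF a] b] wedge_cochain[OF a i[OF b]] by (simp_all add: algebra_simps)
  have uB: "(\<lambda>us. usgn p \<otimes> wedge S M p (q - 1) \<alpha> (ins u \<beta>) us) \<in> cochains (p + q - 1)"
    using B by (auto simp: Pi_def)
  have "Lie v (ins u (wedge S M p q \<alpha> \<beta>)) us =
      Lie v (\<lambda>us. wedge S M (p - 1) q (ins u \<alpha>) \<beta> us \<oplus> usgn p \<otimes> wedge S M p (q - 1) \<alpha> (ins u \<beta>) us) us"
    by (rule Lie_cong[OF v us]) (use u(1) in \<open>simp add: wedge_Cons[OF _ a b]\<close>)
  also have "\<dots> = Lie v (wedge S M (p - 1) q (ins u \<alpha>) \<beta>) us \<oplus> usgn p \<otimes> Lie v (wedge S M p (q - 1) \<alpha> (ins u \<beta>)) us"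
    unfolding Lie_add[OF v us A uB] Lie_usgn[OF v us B] ..
  also have "\<dots> = (wedge S M (p - 1) q (Lie v (ins u \<alpha>)) \<beta> us \<oplus> wedge S M (p - 1) q (ins u \<alpha>) (Lie v \<beta>) us) \<oplus>
      usgn p \<otimes> (wedge S M p (q - 1) (Lie v \<alpha>) (ins u \<beta>) us \<oplus> wedge S M p (q - 1) \<alpha> (Lie v (ins u \<beta>)) us)"
    unfolding Cons.IH[OF u(2) i[OF a] b] Cons.IH[OF u(3) a i[OF b]] ..
  finally have 1: "Lie v (ins u (wedge S M p q \<alpha> \<beta>)) us = \<dots>" .
  have iL: "wedge S M (p - 1) q (ins u (Lie v \<alpha>)) \<beta> us =
      wedge S M (p - 1) q (Lie v (ins u \<alpha>)) \<beta> us \<ominus> wedge S M (p - 1) q (ins (br v u) \<alpha>) \<beta> us"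
    unfolding R.minus_eq Lie.simps
      wedge_add_left[OF u(2) L[OF i[OF a]] minus_cochain[OF j[OF a]] b] wedge_minus_left[OF u(2) j[OF a] b] ..
  have iR: "wedge S M p (q - 1) \<alpha> (ins u (Lie v \<beta>)) us =
      wedge S M p (q - 1) \<alpha> (Lie v (ins u \<beta>)) us \<ominus> wedge S M p (q - 1) \<alpha> (ins (br v u) \<beta>) us"
    unfolding R.minus_eq Lie.simps
      wedge_add_right[OF u(3) a L[OF i[OF b]] minus_cochain[OF j[OF b]]] wedge_minus_right[OF u(3) a j[OF b]] ..
  show ?case
    unfolding wedge_Cons[OF Cons.prems(1) L[OF a] b] wedge_Cons[OF Cons.prems(1) a L[OF b]] Lie.simps(2)[of v "wedge S M p q \<alpha> \<beta>"] 1
      wedge_Cons[OF vus a b] iL iR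
    using wedge_closed[OF u(2) L[OF i[OF a]] b] wedge_closed[OF u(2) i[OF a] L[OF b]]
      wedge_closed[OF u(3) L[OF a] i[OF b]] wedge_closed[OF u(3) a L[OF i[OF b]]]
      wedge_closed[OF u(2) j[OF a] b] wedge_closed[OF u(3) a j[OF b]]
    by (simp add: R.minus_eq R.minus_add R.r_distr R.r_minus R.a_ac)
qed

text \<open>The Jacobi identity in derivation form: bracketing with \<open>v\<close> is a derivation
  of the bracket. This is the shape in which it occurs in \<open>Lie_Lie\<close>.\<close>

lemma br_br:
  assumes u: "u \<in> carrier M" and v: "v \<in> carrier M" and w: "w \<in> carrier M"
  shows "br v (br w u) = br w (br v u) \<oplus>\<^bsub>M\<^esub> br (br v w) u"
proof -
  note c = br_closed
  have "br u (br v w) = \<ominus>\<^bsub>M\<^esub> br (br v w) u" by (rule br_antisym[OF u c[OF v w]])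
  moreover have "br w (br u v) = \<ominus>\<^bsub>M\<^esub> br w (br v u)"
  proof -
    have "br w (br u v) \<oplus>\<^bsub>M\<^esub> br w (br v u) = br w (br u v \<oplus>\<^bsub>M\<^esub> br v u)"
      using br_add_right[OF w c[OF u v] c[OF v u]] by simp
    also have "br u v \<oplus>\<^bsub>M\<^esub> br v u = \<zero>\<^bsub>M\<^esub>" using br_antisym[OF u v] c[OF v u] by (simp add: M.l_neg)
    also have "br w \<zero>\<^bsub>M\<^esub> = \<zero>\<^bsub>M\<^esub>"
      using br_add_right[OF w, of "\<zero>\<^bsub>M\<^esub>" "\<zero>\<^bsub>M\<^esub>"] c[OF w, of "\<zero>\<^bsub>M\<^esub>"] by (simp add: M.add.l_cancel_one)
    finally show ?thesis using M.minus_equality c u v w by simp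
  qed
  ultimately have "\<ominus>\<^bsub>M\<^esub> br (br v w) u \<oplus>\<^bsub>M\<^esub> br v (br w u) \<oplus>\<^bsub>M\<^esub> \<ominus>\<^bsub>M\<^esub> br w (br v u) = \<zero>\<^bsub>M\<^esub>"
    using br_jacobi[OF u v w] by simp
  then have "br v (br w u) \<oplus>\<^bsub>M\<^esub> \<ominus>\<^bsub>M\<^esub> (br w (br v u) \<oplus>\<^bsub>M\<^esub> br (br v w) u) = \<zero>\<^bsub>M\<^esub>"
    using c u v w by (simp add: M.minus_add M.a_ac)
  then show ?thesis using c u v w by (metis M.minus_equality M.minus_minus M.add.m_closed M.add.inv_closed)
qed

text \<open>After contraction with \<open>u\<close>, the induction hypothesis leaves the terms in
  which \<open>\<omega>\<close> receives a double bracket; these agree by \<open>br_br\<close>. The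
  base case is \<open>act_br\<close>.\<close>

lemma Lie_Lie:
  assumes v: "v \<in> carrier M" and w: "w \<in> carrier M"
  shows "vs \<in> vectors M k \<Longrightarrow> qform k \<omega> \<Longrightarrow> Lie v (Lie w \<omega>) vs = Lie w (Lie v \<omega>) vs \<oplus> Lie (br v w) \<omega> vs"
proof (induction vs arbitrary: k \<omega>)
  case Nil
  then show ?case using act_br[OF v w] qform_closed[OF Nil(2)] by simp
next
  case (Cons u us)
  then have u: "u \<in> carrier M" and us: "us \<in> vectors M (k - 1)" by simp_all
  note c = qform_cochain[OF Cons.prems(2)]
  note vw = br_closed[OF v w] and vu = br_closed[OF v u] and wu = br_closed[OF w u]
  note i = ins_cochain[OF c]
  have exp: "Lie x (Lie y \<omega>) (u # us) = Lie x (Lie y (ins u \<omega>)) us \<ominus> Lie x (ins (br y u) \<omega>) us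
      \<ominus> (Lie y (ins (br x u) \<omega>) us \<ominus> \<omega> (br y (br x u) # us))"
    if x: "x \<in> carrier M" and y: "y \<in> carrier M" for x y
    using Lie_diff[OF x us Lie_cochain[OF y i[OF u]] i[OF br_closed[OF y u]]] by simp
  have cl: "\<omega> (x # us) \<in> carrier S" if "x \<in> carrier M" for x
    using qform_closed[OF Cons.prems(2)] that us by simp
  have J: "\<omega> (br v (br w u) # us) = \<omega> (br w (br v u) # us) \<oplus> \<omega> (br (br v w) u # us)"
    unfolding br_br[OF u v w]
    by (rule qform_add_first[OF Cons.prems(2) br_closed[OF w vu] br_closed[OF vw u] us])
  have IH: "Lie v (Lie w (ins u \<omega>)) us = Lie w (Lie v (ins u \<omega>)) us \<oplus> Lie (br v w) (ins u \<omega>) us"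
    by (rule Cons.IH[OF us qform_ins[OF Cons.prems(2) u]])
  have alg: "(a \<oplus> b) \<ominus> x \<ominus> (y \<ominus> m) = (a \<ominus> y \<ominus> (x \<ominus> (m \<oplus> n))) \<oplus> (b \<ominus> n)"
    if "a \<in> carrier S" "b \<in> carrier S" "x \<in> carrier S" "y \<in> carrier S" "m \<in> carrier S" "n \<in> carrier S" for a b x y m n
    using that by (simp add: R.minus_eq R.minus_add R.a_ac R.r_neg2 R.r_neg1)
  show ?case
    unfolding exp[OF v w] exp[OF w v] J IH Lie.simps(2)[of "br v w"]
    by (rule alg) (intro Lie_closed[OF v us] Lie_closed[OF w us] Lie_closed[OF vw us]
        Lie_cochain[OF v] Lie_cochain[OF w] i u vu wu cl br_closed[OF w vu] br_closed[OF vw u])+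
qed


section \<open>The differential\<close>

lemma dif_closed: "vs \<in> vectors M (k + 1) \<Longrightarrow> \<omega> \<in> cochains k \<Longrightarrow> dif \<omega> vs \<in> carrier S"
proof (induction vs arbitrary: k \<omega>)
  case Nil
  then show ?case by simp
next
  case (Cons v vs)
  then have v: "v \<in> carrier M" "vs \<in> vectors M k" "vs \<in> vectors M (k - 1 + 1)" by simp_all
  show ?case
    using Cons.IH[OF v(3) ins_cochain[OF Cons.prems(2) v(1)]] Lie_closed[OF v(1,2) Cons.prems(2)] by simp
qed

lemma dif_cochain: "\<omega> \<in> cochains k \<Longrightarrow> dif \<omega> \<in> cochains (k + 1)"
  using dif_closed by blast

lemma dif_cong:
  "vs \<in> vectors M (k + 1) \<Longrightarrow> (\<And>us. us \<in> vectors M k \<Longrightarrow> \<omega> us = \<omega>' us) \<Longrightarrow> dif \<omega> vs = dif \<omega>' vs"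
proof (induction vs arbitrary: k \<omega> \<omega>')
  case Nil
  then show ?case by simp
next
  case (Cons v vs)
  then have v: "v \<in> carrier M" "vs \<in> vectors M k" "vs \<in> vectors M (k - 1 + 1)" by simp_all
  have "dif (ins v \<omega>) vs = dif (ins v \<omega>') vs" by (rule Cons.IH[OF v(3)]) (use Cons.prems v in simp_all)
  moreover have "Lie v \<omega> vs = Lie v \<omega>' vs" by (rule Lie_cong[OF v(1,2) Cons.prems(2)])
  ultimately show ?case by simp
qed

lemma dif_add:
  "vs \<in> vectors M (k + 1) \<Longrightarrow> \<alpha> \<in> cochains k \<Longrightarrow> \<beta> \<in> cochains k \<Longrightarrow>
   dif (\<lambda>us. \<alpha> us \<oplus> \<beta> us) vs = dif \<alpha> vs \<oplus> dif \<beta> vs"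
proof (induction vs arbitrary: k \<alpha> \<beta>)
  case Nil
  then show ?case by simp
next
  case (Cons v vs)
  then have v: "v \<in> carrier M" "vs \<in> vectors M k" "vs \<in> vectors M (k - 1 + 1)" by simp_all
  note i = ins_cochain[OF _ v(1)] and a = Cons.prems(2) and b = Cons.prems(3)
  show ?case
    using Cons.IH[OF v(3) i[OF a] i[OF b]] Lie_add[OF v(1,2) a b] Lie_closed[OF v(1,2) a] Lie_closed[OF v(1,2) b]
      dif_closed[OF v(3) i[OF a]] dif_closed[OF v(3) i[OF b]]
    by (simp add: R.minus_eq R.minus_add add_swap4)
qed

lemma dif_minus: "vs \<in> vectors M (k + 1) \<Longrightarrow> \<omega> \<in> cochains k \<Longrightarrow> dif (\<lambda>us. \<ominus> \<omega> us) vs = \<ominus> dif \<omega> vs"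
proof (induction vs arbitrary: k \<omega>)
  case Nil
  then show ?case by simp
next
  case (Cons v vs)
  then have v: "v \<in> carrier M" "vs \<in> vectors M k" "vs \<in> vectors M (k - 1 + 1)" by simp_all
  note i = ins_cochain[OF _ v(1)] and a = Cons.prems(2)
  show ?case
    using Cons.IH[OF v(3) i[OF a]] Lie_minus[OF v(1,2) a] Lie_closed[OF v(1,2) a] dif_closed[OF v(3) i[OF a]]
    by (simp add: R.minus_eq R.minus_add)
qed

lemma dif_usgn:
  assumes "vs \<in> vectors M (k + 1)" "\<omega> \<in> cochains k"
  shows "dif (\<lambda>us. usgn p \<otimes> \<omega> us) vs = usgn p \<otimes> dif \<omega> vs"
proof (cases "even p")
  case True
  have "dif (\<lambda>us. usgn p \<otimes> \<omega> us) vs = dif \<omega> vs"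
    by (rule dif_cong[OF assms(1)]) (use True cochain_closed[OF assms(2)] in \<open>simp add: usgn_def\<close>)
  then show ?thesis using True dif_closed[OF assms] by (simp add: usgn_def)
next
  case False
  have "dif (\<lambda>us. usgn p \<otimes> \<omega> us) vs = dif (\<lambda>us. \<ominus> \<omega> us) vs"
    by (rule dif_cong[OF assms(1)]) (use False cochain_closed[OF assms(2)] in \<open>simp add: usgn_def R.l_minus\<close>)
  then show ?thesis using False dif_closed[OF assms] dif_minus[OF assms] by (simp add: usgn_def R.l_minus)
qed

lemma dif_diff:
  assumes "vs \<in> vectors M (k + 1)" "\<alpha> \<in> cochains k" "\<beta> \<in> cochains k"
  shows "dif (\<lambda>us. \<alpha> us \<ominus> \<beta> us) vs = dif \<alpha> vs \<ominus> dif \<beta> vs"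
  unfolding R.minus_eq
  using dif_add[OF assms(1,2) minus_cochain[OF assms(3)]] dif_minus[OF assms(1,3)] by simp

text \<open>The recursion treats the first argument unlike the others, so linearity in it cannot be
  read off. Antisymmetry in the first two arguments is computed directly and moves that argument to
  the second slot, where the contraction is a form by induction. Linearity of the action enters when
  the list has a single entry and there is nothing to exchange.\<close>

lemma qform_dif: "qform k \<omega> \<Longrightarrow> qform (k + 1) (dif \<omega>)"
proof -
  have "qform (k + 1) (dif \<omega>)" if "nat (k + 1) = n" "qform k \<omega>" for n k \<omega>
    using that
  proof (induction n arbitrary: k \<omega>)
    case 0
    show ?case by (rule qform_nonpos[OF dif_cochain[OF qform_cochain[OF 0(2)]]]) (use 0 in simp)
  next
    case (Suc n)
    note q = Suc.prems(2)
    note c = qform_cochain[OF q]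
    note i = ins_cochain[OF c]
    have n: "nat (k - 1 + 1) = n" "0 \<le> k" using Suc.prems(1) by simp_all
    have ins: "qform k (ins v (dif \<omega>))" if v: "v \<in> carrier M" for v
      using qform_diff[OF qform_Lie[OF v q]] Suc.IH[OF n(1) qform_ins[OF q v]] by simp
    have swap: "dif \<omega> (v # w # vs) = \<ominus> dif \<omega> (w # v # vs)"
      if v: "v \<in> carrier M" and w: "w \<in> carrier M" and vs: "vs \<in> vectors M (k - 1)" for v w vs
    proof -
      have vs': "vs \<in> vectors M (k - 1 - 1 + 1)" using vs by simp
      have vw: "br v w \<in> carrier M" and wv: "br w v \<in> carrier M" using br_closed v w by simp_all
      have 1: "dif (ins w (ins v \<omega>)) vs = \<ominus> dif (ins v (ins w \<omega>)) vs"
      proof -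
        have "dif (ins w (ins v \<omega>)) vs = dif (\<lambda>us. \<ominus> ins v (ins w \<omega>) us) vs"
          by (rule dif_cong[OF vs']) (rule qform_swap_first[OF q v w])
        then show ?thesis using dif_minus[OF vs' ins_cochain[OF i[OF w] v]] by simp
      qed
      have 2: "\<omega> (br v w # vs) = \<ominus> \<omega> (br w v # vs)"
        unfolding br_antisym[OF v w] by (rule qform_minus_first[OF q wv vs])
      show ?thesis
        using Lie_closed[OF v vs i[OF w]] Lie_closed[OF w vs i[OF v]] dif_closed[OF vs' ins_cochain[OF i[OF w] v]]
          cochain_closed[OF c, of "br w v # vs"] wv vs
        by (simp add: 1 2 R.minus_eq R.minus_add) (simp add: R.a_ac)
    qed
    note cl = cochain_closed[OF dif_cochain[OF c]]
    show ?case
    proof (rule qform_ConsI)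
      show "dif \<omega> \<in> cochains (k + 1)" by (rule dif_cochain[OF c])
      fix v assume v: "v \<in> carrier M"
      show "qform (k + 1 - 1) (ins v (dif \<omega>))" using ins[OF v] by simp
    next
      fix v w vs assume v: "v \<in> carrier M" and w: "w \<in> carrier M" and "vs \<in> vectors M (k + 1 - 1)"
      then have vs: "vs \<in> vectors M k" by simp
      show "dif \<omega> ((v \<oplus>\<^bsub>M\<^esub> w) # vs) = dif \<omega> (v # vs) \<oplus> dif \<omega> (w # vs)"
      proof (cases vs)
        case Nil
        then show ?thesis using act_add_left[OF v w] vs cochain_closed[OF c, of "[]"] act_closed v w
          by (simp add: R.minus_eq)
      next
        case (Cons u us)
        then have u: "u \<in> carrier M" and us: "us \<in> vectors M (k - 1)" using vs by simp_all
        have vw: "v \<oplus>\<^bsub>M\<^esub> w \<in> carrier M" using v w by simp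
        show ?thesis
          unfolding Cons swap[OF vw u us] swap[OF v u us] swap[OF w u us]
          using qform_add_first[OF ins[OF u] v w us] cl[of "u # v # us"] cl[of "u # w # us"] u v w us
          by (simp only: R.minus_add vectors_Cons simp_thms add_diff_cancel_right')
      qed
    next
      fix f v vs assume f: "f \<in> carrier S" and v: "v \<in> carrier M" and "vs \<in> vectors M (k + 1 - 1)"
      then have vs: "vs \<in> vectors M k" by simp
      show "dif \<omega> ((f \<odot>\<^bsub>M\<^esub> v) # vs) = f \<otimes> dif \<omega> (v # vs)"
      proof (cases vs)
        case Nil
        then show ?thesis using act_smult[OF f v] vs cochain_closed[OF c, of "[]"] act_closed[OF v] f
          by (simp add: R.minus_eq)
      next
        case (Cons u us)
        then have u: "u \<in> carrier M" and us: "us \<in> vectors M (k - 1)" using vs by simp_all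
        have fv: "f \<odot>\<^bsub>M\<^esub> v \<in> carrier M" using v f by simp
        show ?thesis
          unfolding Cons swap[OF fv u us] swap[OF v u us]
          using qform_smult_first[OF ins[OF u] f v us] cl[of "u # v # us"] u v us f
          by (simp only: R.r_minus vectors_Cons simp_thms add_diff_cancel_right')
      qed
    next
      fix v w vs assume v: "v \<in> carrier M" and w: "w \<in> carrier M" and vs: "vs \<in> vectors M (k + 1 - 1 - 1)"
      show "dif \<omega> (v # w # vs) = \<ominus> dif \<omega> (w # v # vs)" by (rule swap[OF v w]) (use vs in simp)
    qed
  qed
  then show "qform k \<omega> \<Longrightarrow> qform (k + 1) (dif \<omega>)" by blast
qed

text \<open>Contraction with \<open>v\<close> and induction reduce the claim to
  \<open>Lie_Lie\<close>. The term \<open>Lie (br w v) \<omega> vs\<close> supplied by it cancels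
  against the first term of \<open>dif \<omega> (br w v # vs)\<close>.\<close>

lemma dif_Lie:
  assumes w: "w \<in> carrier M"
  shows "vs \<in> vectors M (k + 1) \<Longrightarrow> qform k \<omega> \<Longrightarrow> dif (Lie w \<omega>) vs = Lie w (dif \<omega>) vs"
proof (induction vs arbitrary: k \<omega>)
  case Nil
  then show ?case using act_zero[OF w] by simp
next
  case (Cons v vs)
  then have v: "v \<in> carrier M" and vs: "vs \<in> vectors M k" and vs': "vs \<in> vectors M (k - 1 + 1)" by simp_all
  note q = Cons.prems(2)
  note c = qform_cochain[OF q]
  have wv: "br w v \<in> carrier M" by (rule br_closed[OF w v])
  note i = ins_cochain[OF c] and L = Lie_closed[OF _ vs]
  have D1: "dif (ins v \<omega>) \<in> cochains k" using dif_cochain[OF i[OF v]] by simp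
  have 1: "dif (ins v (Lie w \<omega>)) vs = dif (Lie w (ins v \<omega>)) vs \<ominus> dif (ins (br w v) \<omega>) vs"
    using dif_diff[OF vs' Lie_cochain[OF w i[OF v]] i[OF wv]] by simp
  have 2: "Lie w (ins v (dif \<omega>)) vs = Lie w (Lie v \<omega>) vs \<ominus> Lie w (dif (ins v \<omega>)) vs"
    using Lie_diff[OF w vs Lie_cochain[OF v c] D1] by simp
  have 3: "dif (Lie w (ins v \<omega>)) vs = Lie w (dif (ins v \<omega>)) vs"
    by (rule Cons.IH[OF vs' qform_ins[OF q v]])
  have 4: "Lie w (Lie v \<omega>) vs = Lie v (Lie w \<omega>) vs \<oplus> Lie (br w v) \<omega> vs" by (rule Lie_Lie[OF w v vs q])
  have alg: "a \<ominus> (x \<ominus> y) = a \<oplus> z \<ominus> x \<ominus> (z \<ominus> y)"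
    if "a \<in> carrier S" "x \<in> carrier S" "y \<in> carrier S" "z \<in> carrier S" for a x y z
  proof -
    have "a \<oplus> z \<ominus> x \<ominus> (z \<ominus> y) = (a \<ominus> (x \<ominus> y)) \<oplus> (z \<oplus> \<ominus> z)"
      using that by (simp add: R.minus_eq R.minus_add R.a_ac)
    then show ?thesis using that by (simp add: R.r_neg)
  qed
  show ?case
    unfolding dif.simps(2)[of "Lie w \<omega>"] Lie.simps(2)[of w "dif \<omega>"] dif.simps(2)[of \<omega> "br w v"] 1 2 3 4
    by (rule alg[OF L[OF v Lie_cochain[OF w c]] L[OF w D1] dif_closed[OF vs' i[OF wv]] L[OF wv c]])
qed

text \<open>Contraction with \<open>v\<close> gives the Lie derivative of
  \<open>dif \<omega>\<close>, minus the differential of \<open>Lie v \<omega>\<close>, plus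
  \<open>dif (dif (ins v \<omega>))\<close>. The first two cancel by \<open>dif_Lie\<close>, the
  last vanishes by induction.\<close>

lemma dif_dif: "vs \<in> vectors M (k + 1 + 1) \<Longrightarrow> qform k \<omega> \<Longrightarrow> dif (dif \<omega>) vs = \<zero>"
proof (induction vs arbitrary: k \<omega>)
  case Nil
  then show ?case by simp
next
  case (Cons v vs)
  then have v: "v \<in> carrier M" and vs: "vs \<in> vectors M (k + 1)" and vs': "vs \<in> vectors M (k - 1 + 1 + 1)"
    by (simp_all add: algebra_simps)
  note q = Cons.prems(2)
  note c = qform_cochain[OF q]
  have D1: "dif (ins v \<omega>) \<in> cochains k" using dif_cochain[OF ins_cochain[OF c v]] by simp
  have "dif (ins v (dif \<omega>)) vs = dif (Lie v \<omega>) vs \<ominus> dif (dif (ins v \<omega>)) vs"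
    using dif_diff[OF vs Lie_cochain[OF v c] D1] by simp
  also have "\<dots> = Lie v (dif \<omega>) vs"
    unfolding dif_Lie[OF v vs q] Cons.IH[OF vs' qform_ins[OF q v]]
    using Lie_closed[OF v vs dif_cochain[OF c]] by (simp add: R.minus_eq)
  finally show ?case using Lie_closed[OF v vs dif_cochain[OF c]] by (simp add: R.minus_eq R.r_neg)
qed

text \<open>By the recursion, the contraction of a differential is a Lie derivative minus the
  differential of a contraction. The former is a derivation by \<open>Lie_wedge\<close>, the latter
  is covered by induction, and the signs are settled by the parity of \<open>p\<close>.\<close>

lemma dif_wedge:
  "vs \<in> vectors M (p + q + 1) \<Longrightarrow> \<alpha> \<in> cochains p \<Longrightarrow> \<beta> \<in> cochains q \<Longrightarrow>
    dif (wedge S M p q \<alpha> \<beta>) vs = wedge S M (p + 1) q (dif \<alpha>) \<beta> vs \<oplus> usgn p \<otimes> wedge S M p (q + 1) \<alpha> (dif \<beta>) vs"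
proof (induction vs arbitrary: p q \<alpha> \<beta>)
  case Nil
  then have pq: "p + 1 + q = 0" "p + (q + 1) = 0" by simp_all
  note a = Nil(2) and b = Nil(3)
  show ?case
    using pq wedge_Nil[OF pq(1) dif_cochain[OF a] b] wedge_Nil[OF pq(2) a dif_cochain[OF b]]
      cochain_closed[OF a, of "[]"] cochain_closed[OF b, of "[]"]
    by (auto split: if_splits)
next
  case (Cons v vs)
  note a = Cons.prems(2) and b = Cons.prems(3)
  have v: "v \<in> carrier M" and vs: "vs \<in> vectors M (p + q)" using Cons.prems(1) by simp_all
  have vs1: "v # vs \<in> vectors M (p + 1 + q)" "v # vs \<in> vectors M (p + (q + 1))"
    using Cons.prems(1) by (simp_all add: algebra_simps)
  have vs2: "vs \<in> vectors M (p - 1 + q + 1)" "vs \<in> vectors M (p + (q - 1) + 1)" "vs \<in> vectors M (p + q - 1 + 1)"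
    "vs \<in> vectors M (p - 1 + (q + 1))" "vs \<in> vectors M (p + 1 + (q - 1))"
    using vs by (simp_all add: algebra_simps)
  note i = ins_cochain[OF _ v] and L = Lie_cochain[OF v]
  have Di: "dif (ins v \<alpha>) \<in> cochains p" "dif (ins v \<beta>) \<in> cochains q"
    using dif_cochain[OF i[OF a]] dif_cochain[OF i[OF b]] by simp_all
  have A: "wedge S M (p - 1) q (ins v \<alpha>) \<beta> \<in> cochains (p + q - 1)"
    and B: "wedge S M p (q - 1) \<alpha> (ins v \<beta>) \<in> cochains (p + q - 1)"
    using wedge_cochain[OF i[OF a] b] wedge_cochain[OF a i[OF b]] by (simp_all add: algebra_simps)
  have uB: "(\<lambda>us. usgn p \<otimes> wedge S M p (q - 1) \<alpha> (ins v \<beta>) us) \<in> cochains (p + q - 1)"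
    using B by (auto simp: Pi_def)
  have "dif (ins v (wedge S M p q \<alpha> \<beta>)) vs =
      dif (\<lambda>us. wedge S M (p - 1) q (ins v \<alpha>) \<beta> us \<oplus> usgn p \<otimes> wedge S M p (q - 1) \<alpha> (ins v \<beta>) us) vs"
    by (rule dif_cong[OF vs2(3)]) (use v in \<open>simp add: wedge_Cons[OF _ a b]\<close>)
  also have "\<dots> = dif (wedge S M (p - 1) q (ins v \<alpha>) \<beta>) vs \<oplus> usgn p \<otimes> dif (wedge S M p (q - 1) \<alpha> (ins v \<beta>)) vs"
    unfolding dif_add[OF vs2(3) A uB] dif_usgn[OF vs2(3) B] ..
  also have "\<dots> = (wedge S M p q (dif (ins v \<alpha>)) \<beta> vs \<oplus> usgn (p - 1) \<otimes> wedge S M (p - 1) (q + 1) (ins v \<alpha>) (dif \<beta>) vs) \<oplus>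
      usgn p \<otimes> (wedge S M (p + 1) (q - 1) (dif \<alpha>) (ins v \<beta>) vs \<oplus> usgn p \<otimes> wedge S M p q \<alpha> (dif (ins v \<beta>)) vs)"
    using Cons.IH[OF vs2(1) i[OF a] b] Cons.IH[OF vs2(2) a i[OF b]] by simp
  finally have 1: "dif (ins v (wedge S M p q \<alpha> \<beta>)) vs = \<dots>" .
  have 2: "wedge S M p q (ins v (dif \<alpha>)) \<beta> vs =
      wedge S M p q (Lie v \<alpha>) \<beta> vs \<ominus> wedge S M p q (dif (ins v \<alpha>)) \<beta> vs"
    unfolding R.minus_eq dif.simps wedge_add_left[OF vs L[OF a] minus_cochain[OF Di(1)] b]
      wedge_minus_left[OF vs Di(1) b] ..
  have 3: "wedge S M p q \<alpha> (ins v (dif \<beta>)) vs =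
      wedge S M p q \<alpha> (Lie v \<beta>) vs \<ominus> wedge S M p q \<alpha> (dif (ins v \<beta>)) vs"
    unfolding R.minus_eq dif.simps wedge_add_right[OF vs a L[OF b] minus_cochain[OF Di(2)]]
      wedge_minus_right[OF vs a Di(2)] ..
  show ?case
    unfolding wedge_Cons[OF vs1(1) dif_cochain[OF a] b] wedge_Cons[OF vs1(2) a dif_cochain[OF b]]
      dif.simps(2)[of "wedge S M p q \<alpha> \<beta>"] 1 Lie_wedge[OF v vs a b] add_diff_cancel_right' 2 3
    using wedge_closed[OF vs L[OF a] b] wedge_closed[OF vs a L[OF b]]
      wedge_closed[OF vs Di(1) b] wedge_closed[OF vs a Di(2)]
      wedge_closed[OF vs2(4) i[OF a] dif_cochain[OF b]] wedge_closed[OF vs2(5) dif_cochain[OF a] i[OF b]]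
    by (cases "even p") (simp_all add: usgn_def R.minus_eq R.minus_add R.l_minus R.r_distr R.a_ac)
qed

end

section \<open>The explicit alternating sums\<close>

lemma nths_remove_0 [simp]: "nths (v # vs) (- {0}) = vs"
  by (simp add: nths_Cons nths_all)

lemma nths_remove_Suc [simp]: "nths (v # vs) (- {Suc i}) = v # nths vs (- {i})"
proof -
  have "{j. Suc j \<in> - {Suc i}} = - {i}" by auto
  then show ?thesis by (simp add: nths_Cons)
qed

lemma nths_remove_0_Suc [simp]: "nths (v # vs) (- {0, Suc i}) = nths vs (- {i})"
proof -
  have "{j. Suc j \<in> - {0, Suc i}} = - {i}" by auto
  then show ?thesis by (simp add: nths_Cons)
qed

lemma nths_remove_Suc_Suc [simp]: "nths (v # vs) (- {Suc i, Suc j}) = v # nths vs (- {i, j})"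
proof -
  have "{l. Suc l \<in> - {Suc i, Suc j}} = - {i, j}" by auto
  then show ?thesis by (simp add: nths_Cons)
qed

lemma vectors_remove1: "vs \<in> vectors M k \<Longrightarrow> i < length vs \<Longrightarrow> nths vs (- {i}) \<in> vectors M (k - 1)"
proof (induction vs arbitrary: k i)
  case (Cons v vs)
  then show ?case using Cons.IH[of "k - 1"] by (cases i) simp_all
qed simp

lemma vectors_remove2:
  "vs \<in> vectors M k \<Longrightarrow> i < j \<Longrightarrow> j < length vs \<Longrightarrow> nths vs (- {i, j}) \<in> vectors M (k - 1 - 1)"
proof (induction vs arbitrary: k i j)
  case (Cons v vs)
  from Cons.prems(2) obtain j' where j: "j = Suc j'" by (cases j) auto
  show ?case
  proof (cases i)
    case 0
    then show ?thesis using Cons.prems j vectors_remove1[of vs M "k - 1" j'] by simp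
  next
    case (Suc i')
    then show ?thesis using Cons.prems j Cons.IH[of "k - 1" i' j'] by simp
  qed
qed simp

context module
begin

lemma finsum_lessThan_Suc_shift:
  assumes "\<And>i. i < Suc n \<Longrightarrow> f i \<in> carrier R"
  shows "(\<Oplus> i \<in> {..<Suc n}. f i) = f 0 \<oplus> (\<Oplus> i \<in> {..<n}. f (Suc i))"
proof -
  have "(\<Oplus> i \<in> {..<Suc n}. f i) = f 0 \<oplus> (\<Oplus> i \<in> Suc ` {..<n}. f i)"
    unfolding lessThan_Suc_eq_insert_0 by (rule R.finsum_insert) (use assms in auto)
  also have "(\<Oplus> i \<in> Suc ` {..<n}. f i) = (\<Oplus> i \<in> {..<n}. f (Suc i))"
    by (rule R.finsum_reindex) (use assms in auto)
  finally show ?thesis .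
qed

lemma finsum_minus:
  "finite A \<Longrightarrow> (\<And>i. i \<in> A \<Longrightarrow> f i \<in> carrier R) \<Longrightarrow> (\<Oplus> i \<in> A. \<ominus> f i) = \<ominus> (\<Oplus> i \<in> A. f i)"
  by (induction A rule: finite_induct) (simp_all add: Pi_def R.minus_add)

end

context lie_rinehart
begin

text \<open>The exponent j + 1 combines the minus sign in the recursion of \<open>Lie\<close> with
  the j exchanges that bring \<open>br v (vs ! j)\<close> to the front.\<close>

lemma Lie_eq_sum:
  assumes v: "v \<in> carrier M"
  shows "vs \<in> vectors M k \<Longrightarrow> qform k \<omega> \<Longrightarrow> Lie v \<omega> vs = act v (\<omega> vs) \<oplus>
    (\<Oplus> j \<in> {..<length vs}. usgn (int j + 1) \<otimes> \<omega> (br v (vs ! j) # nths vs (- {j})))"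
proof (induction vs arbitrary: k \<omega>)
  case Nil
  then show ?case using act_closed[OF v qform_closed[OF Nil(2,1)]] by simp
next
  case (Cons u us)
  then have u: "u \<in> carrier M" and us: "us \<in> vectors M (k - 1)" by simp_all
  note q = Cons.prems(2)
  have b: "br v (us ! j) \<in> carrier M" if "j < length us" for j
    by (rule br_closed[OF v vectors_nth[OF us that]])
  have vu: "br v u \<in> carrier M" by (rule br_closed[OF v u])
  have cl: "\<omega> (br v (us ! j) # u # nths us (- {j})) \<in> carrier S" "\<omega> (u # br v (us ! j) # nths us (- {j})) \<in> carrier S"
    if "j < length us" for j
    using qform_closed[OF q] b[OF that] u vectors_remove1[OF us that] by simp_all
  let ?f = "\<lambda>j. usgn (int j + 1) \<otimes> \<omega> (br v ((u # us) ! j) # nths (u # us) (- {j}))"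
  let ?g = "\<lambda>j. usgn (int j + 1) \<otimes> \<omega> (u # br v (us ! j) # nths us (- {j}))"
  have fc: "?f j \<in> carrier S" if "j < Suc (length us)" for j
    using that cl(1) qform_closed[OF q, of "br v u # us"] vu us by (cases j) simp_all
  have "?f (Suc j) = ?g j" if j: "j < length us" for j
  proof -
    have "\<omega> (br v (us ! j) # u # nths us (- {j})) = \<ominus> \<omega> (u # br v (us ! j) # nths us (- {j}))"
      by (rule qform_swap_first[OF q b[OF j] u vectors_remove1[OF us j]])
    then show ?thesis using cl(2)[OF j] by (simp add: usgn_def R.l_minus)
  qed
  then have s: "(\<Oplus> j \<in> {..<length us}. ?f (Suc j)) = (\<Oplus> j \<in> {..<length us}. ?g j)"
    by (intro R.finsum_cong') (use cl in auto)
  have gc: "(\<Oplus> j \<in> {..<length us}. ?g j) \<in> carrier S" using cl(2) by (auto intro!: R.finsum_closed)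
  have "(\<Oplus> j \<in> {..<length (u # us)}. ?f j) = ?f 0 \<oplus> (\<Oplus> j \<in> {..<length us}. ?g j)"
    unfolding s[symmetric] list.size(4) add_Suc_right add_0_right by (rule finsum_lessThan_Suc_shift) (rule fc)
  moreover have "?f 0 = \<ominus> \<omega> (br v u # us)"
    using qform_closed[OF q, of "br v u # us"] vu us by (simp add: usgn_def R.l_minus)
  ultimately have "(\<Oplus> j \<in> {..<length (u # us)}. ?f j) = \<ominus> \<omega> (br v u # us) \<oplus> (\<Oplus> j \<in> {..<length us}. ?g j)"
    by simp
  moreover have "act v (\<omega> (u # us)) \<in> carrier S" by (rule act_closed[OF v qform_closed[OF q Cons.prems(1)]])
  ultimately show ?case
    using Cons.IH[OF us qform_ins[OF q u]] gc qform_closed[OF q, of "br v u # us"] vu us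
    by (simp add: R.minus_eq R.a_ac)
qed

text \<open>Splitting off index 0 reproduces the recursion. The terms with index 0 form the sum for
  \<open>Lie v \<omega>\<close>; the others are, up to a sign, the formula for
  \<open>ins v \<omega>\<close>. That sign comes from the index shift in the first sum and, in the
  second, from exchanging the bracket with \<open>v\<close>.\<close>

lemma dif_eq_sum:
  "vs \<in> vectors M (k + 1) \<Longrightarrow> qform k \<omega> \<Longrightarrow> dif \<omega> vs =
    (\<Oplus> i \<in> {..<length vs}. usgn (int i) \<otimes> act (vs ! i) (\<omega> (nths vs (- {i})))) \<oplus>
    (\<Oplus> j \<in> {..<length vs}. \<Oplus> i \<in> {..<j}. usgn (int (i + j)) \<otimes> \<omega> (br (vs ! i) (vs ! j) # nths vs (- {i, j})))"
proof (induction vs arbitrary: k \<omega>)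
  case Nil
  then show ?case by simp
next
  case (Cons v vs)
  then have v: "v \<in> carrier M" and vs: "vs \<in> vectors M k" and vs': "vs \<in> vectors M (k - 1 + 1)" by simp_all
  note q = Cons.prems(2)
  have nth: "vs ! i \<in> carrier M" if "i < length vs" for i by (rule vectors_nth[OF vs that])
  have A: "act (vs ! i) (\<omega> (v # nths vs (- {i}))) \<in> carrier S" if "i < length vs" for i
    using act_closed[OF nth[OF that]] qform_closed[OF q] v vectors_remove1[OF vs that] by simp
  have Av: "act v (\<omega> vs) \<in> carrier S" by (rule act_closed[OF v qform_closed[OF q vs]])
  have B: "\<omega> (br v (vs ! j) # nths vs (- {j})) \<in> carrier S" if "j < length vs" for j
    using qform_closed[OF q] br_closed[OF v nth[OF that]] vectors_remove1[OF vs that] by simp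
  have Cm: "nths vs (- {i, j}) \<in> vectors M (k - 1 - 1)" "br (vs ! i) (vs ! j) \<in> carrier M"
    if "i < j" "j < length vs" for i j
    using vectors_remove2[OF vs that] br_closed[OF nth nth] that by simp_all
  have C: "\<omega> (v # br (vs ! i) (vs ! j) # nths vs (- {i, j})) \<in> carrier S"
    "\<omega> (br (vs ! i) (vs ! j) # v # nths vs (- {i, j})) \<in> carrier S"
    if "i < j" "j < length vs" for i j
    using qform_closed[OF q] v Cm[OF that] by simp_all
  let ?a = "\<lambda>i. usgn (int i) \<otimes> act (vs ! i) (\<omega> (v # nths vs (- {i})))"
  let ?b = "\<lambda>j. usgn (int j + 1) \<otimes> \<omega> (br v (vs ! j) # nths vs (- {j}))"
  let ?c = "\<lambda>j i. usgn (int (i + j)) \<otimes> \<omega> (v # br (vs ! i) (vs ! j) # nths vs (- {i, j}))"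
  let ?a' = "\<lambda>i. usgn (int i) \<otimes> act ((v # vs) ! i) (\<omega> (nths (v # vs) (- {i})))"
  let ?c' = "\<lambda>j i. usgn (int (i + j)) \<otimes> \<omega> (br ((v # vs) ! i) ((v # vs) ! j) # nths (v # vs) (- {i, j}))"
  have ac: "?a i \<in> carrier S" "\<ominus> ?a i \<in> carrier S" "?b i \<in> carrier S" if "i < length vs" for i
    using A[OF that] B[OF that] by simp_all
  have cc: "?c j i \<in> carrier S" "\<ominus> ?c j i \<in> carrier S" if "i < j" "j < length vs" for i j
    using C(1)[OF that] by simp_all
  have a': "?a' (Suc i) = \<ominus> ?a i" if "i < length vs" for i
    using A[OF that] by (simp add: usgn_def R.l_minus)
  have c'0: "?c' (Suc j) 0 = ?b j" for j by (simp add: add.commute)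
  have c'S: "?c' (Suc j) (Suc i) = \<ominus> ?c j i" if "i < j" "j < length vs" for i j
  proof -
    have "\<omega> (br (vs ! i) (vs ! j) # v # nths vs (- {i, j})) = \<ominus> \<omega> (v # br (vs ! i) (vs ! j) # nths vs (- {i, j}))"
      by (rule qform_swap_first[OF q Cm(2)[OF that] v Cm(1)[OF that]])
    then show ?thesis using C(1)[OF that] by (simp add: usgn_def R.l_minus)
  qed
  have csum: "(\<Oplus> i \<in> {..<j}. ?c j i) \<in> carrier S" if "j < length vs" for j
    using cc(1) that by (auto intro!: R.finsum_closed)
  have 1: "(\<Oplus> i \<in> {..<length (v # vs)}. ?a' i) = act v (\<omega> vs) \<ominus> (\<Oplus> i \<in> {..<length vs}. ?a i)"
  proof -
    have "(\<Oplus> i \<in> {..<Suc (length vs)}. ?a' i) = ?a' 0 \<oplus> (\<Oplus> i \<in> {..<length vs}. ?a' (Suc i))"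
    proof (rule finsum_lessThan_Suc_shift)
      fix i assume "i < Suc (length vs)"
      then show "?a' i \<in> carrier S" using Av A by (cases i) simp_all
    qed
    also have "(\<Oplus> i \<in> {..<length vs}. ?a' (Suc i)) = (\<Oplus> i \<in> {..<length vs}. \<ominus> ?a i)"
      by (rule R.finsum_cong'[OF refl]) (use ac(2) a' in auto)
    also have "\<dots> = \<ominus> (\<Oplus> i \<in> {..<length vs}. ?a i)" by (rule finsum_minus) (use ac in auto)
    finally show ?thesis using Av by (simp add: usgn_def R.minus_eq)
  qed
  have inner: "(\<Oplus> i \<in> {..<Suc j}. ?c' (Suc j) i) = ?b j \<oplus> \<ominus> (\<Oplus> i \<in> {..<j}. ?c j i)"
    if j: "j < length vs" for j
  proof -
    have "(\<Oplus> i \<in> {..<Suc j}. ?c' (Suc j) i) = ?c' (Suc j) 0 \<oplus> (\<Oplus> i \<in> {..<j}. ?c' (Suc j) (Suc i))"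
    proof (rule finsum_lessThan_Suc_shift)
      fix i assume "i < Suc j"
      then show "?c' (Suc j) i \<in> carrier S" using B[OF j] C(2)[OF _ j] by (cases i) simp_all
    qed
    also have "(\<Oplus> i \<in> {..<j}. ?c' (Suc j) (Suc i)) = (\<Oplus> i \<in> {..<j}. \<ominus> ?c j i)"
      by (rule R.finsum_cong'[OF refl]) (use cc(2)[OF _ j] c'S[OF _ j] in auto)
    also have "\<dots> = \<ominus> (\<Oplus> i \<in> {..<j}. ?c j i)" by (rule finsum_minus) (use cc(1)[OF _ j] in auto)
    finally show ?thesis unfolding c'0 .
  qed
  have 2: "(\<Oplus> j \<in> {..<length (v # vs)}. \<Oplus> i \<in> {..<j}. ?c' j i) =
      (\<Oplus> j \<in> {..<length vs}. ?b j) \<ominus> (\<Oplus> j \<in> {..<length vs}. \<Oplus> i \<in> {..<j}. ?c j i)"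
  proof -
    have "(\<Oplus> j \<in> {..<Suc (length vs)}. \<Oplus> i \<in> {..<j}. ?c' j i) =
        (\<Oplus> i \<in> {..<0}. ?c' 0 i) \<oplus> (\<Oplus> j \<in> {..<length vs}. \<Oplus> i \<in> {..<Suc j}. ?c' (Suc j) i)"
    proof (rule finsum_lessThan_Suc_shift)
      fix j assume "j < Suc (length vs)"
      then show "(\<Oplus> i \<in> {..<j}. ?c' j i) \<in> carrier S"
        using inner ac(3) csum by (cases j) simp_all
    qed
    also have "(\<Oplus> j \<in> {..<length vs}. \<Oplus> i \<in> {..<Suc j}. ?c' (Suc j) i) =
        (\<Oplus> j \<in> {..<length vs}. ?b j \<oplus> \<ominus> (\<Oplus> i \<in> {..<j}. ?c j i))"
      by (rule R.finsum_cong'[OF refl _ inner]) (use ac(3) csum in auto)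
    also have "\<dots> = (\<Oplus> j \<in> {..<length vs}. ?b j) \<oplus> (\<Oplus> j \<in> {..<length vs}. \<ominus> (\<Oplus> i \<in> {..<j}. ?c j i))"
      by (rule R.finsum_addf) (use ac(3) csum in auto)
    also have "(\<Oplus> j \<in> {..<length vs}. \<ominus> (\<Oplus> i \<in> {..<j}. ?c j i)) = \<ominus> (\<Oplus> j \<in> {..<length vs}. \<Oplus> i \<in> {..<j}. ?c j i)"
      by (rule finsum_minus) (use csum in auto)
    finally show ?thesis using ac(3) csum by (simp add: R.minus_eq R.finsum_closed Pi_def)
  qed
  have "dif \<omega> (v # vs) = (act v (\<omega> vs) \<oplus> (\<Oplus> j \<in> {..<length vs}. ?b j)) \<ominus>
      ((\<Oplus> i \<in> {..<length vs}. ?a i) \<oplus> (\<Oplus> j \<in> {..<length vs}. \<Oplus> i \<in> {..<j}. ?c j i))"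
    using Cons.IH[OF vs' qform_ins[OF q v]] Lie_eq_sum[OF v vs q] by simp
  moreover have "(\<Oplus> j \<in> {..<length vs}. ?b j) \<in> carrier S" "(\<Oplus> i \<in> {..<length vs}. ?a i) \<in> carrier S"
    "(\<Oplus> j \<in> {..<length vs}. \<Oplus> i \<in> {..<j}. ?c j i) \<in> carrier S"
    using ac csum by (auto intro!: R.finsum_closed)
  ultimately show ?case
    unfolding 1 2 using Av by (simp only: R.minus_eq R.minus_add add_swap4 R.add.inv_closed)
qed

lemma CE_differential_apply:
  assumes vs: "vs \<in> vectors M (k + 1)" and q: "qform k \<omega>"
  shows "CE_differential S M br act k \<omega> vs = dif \<omega> vs"
proof -
  have nth: "vs ! i \<in> carrier M" if "i < length vs" for i by (rule vectors_nth[OF vs that])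
  have A: "act (vs ! i) (\<omega> (nths vs (- {i}))) \<in> carrier S" if "i < length vs" for i
    using act_closed[OF nth[OF that]] qform_closed[OF q] vectors_remove1[OF vs that] by simp
  have C: "\<omega> (br (vs ! i) (vs ! j) # nths vs (- {i, j})) \<in> carrier S" if "i < j" "j < length vs" for i j
    using qform_closed[OF q] vectors_remove2[OF vs that] br_closed[OF nth nth] that by simp
  have "(\<Oplus> i \<in> {..<length vs}. [((-1::int) ^ i)] \<cdot> act (vs ! i) (\<omega> (nths vs (- {i})))) =
      (\<Oplus> i \<in> {..<length vs}. usgn (int i) \<otimes> act (vs ! i) (\<omega> (nths vs (- {i}))))"
    by (rule R.finsum_cong'[OF refl _ usgn_power]) (use A in auto)
  moreover have "(\<Oplus> j \<in> {..<length vs}. \<Oplus> i \<in> {..<j}.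
        [((-1::int) ^ (i + j))] \<cdot> \<omega> (br (vs ! i) (vs ! j) # nths vs (- {i, j}))) =
      (\<Oplus> j \<in> {..<length vs}. \<Oplus> i \<in> {..<j}. usgn (int (i + j)) \<otimes> \<omega> (br (vs ! i) (vs ! j) # nths vs (- {i, j})))"
  proof (rule R.finsum_cong'[OF refl])
    show "(\<lambda>j. \<Oplus> i \<in> {..<j}. usgn (int (i + j)) \<otimes> \<omega> (br (vs ! i) (vs ! j) # nths vs (- {i, j})))
        \<in> {..<length vs} \<rightarrow> carrier S"
      using C by (auto intro!: R.finsum_closed)
    fix j assume "j \<in> {..<length vs}"
    then show "(\<Oplus> i \<in> {..<j}. [((-1::int) ^ (i + j))] \<cdot> \<omega> (br (vs ! i) (vs ! j) # nths vs (- {i, j}))) =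
        (\<Oplus> i \<in> {..<j}. usgn (int (i + j)) \<otimes> \<omega> (br (vs ! i) (vs ! j) # nths vs (- {i, j})))"
      by (intro R.finsum_cong'[OF refl _ usgn_power]) (use C in auto)
  qed
  ultimately show ?thesis using vs dif_eq_sum[OF vs q] unfolding CE_differential_def by simp
qed

end

section \<open>The graded commutative algebra of forms\<close>

lemma (in graded_commutative_algebra) cring_component0: "cring (component A 0)"
proof (intro cringI)
  show "abelian_group (component A 0)" by (rule component_group)
  show "comm_monoid (component A 0)"
  proof (rule comm_monoidI)
    fix a b assume "a \<in> carrier (component A 0)" "b \<in> carrier (component A 0)"
    then show "a \<otimes>\<^bsub>component A 0\<^esub> b = b \<otimes>\<^bsub>component A 0\<^esub> a"
      using gmult_comm[of a 0 b 0] by (simp add: component_def gsign_def)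
  qed (use gmult_closed[of _ 0 _ 0] gone_closed gmult_assoc[of _ 0 _ 0 _ 0] gone_left[of _ 0]
      in \<open>simp_all add: component_def\<close>)
qed (use gmult_add_left[of _ 0 _ _ 0] in \<open>simp add: component_def\<close>)

lemma form_algebra_simps [simp]:
  "gcarrier (form_algebra S M) = form_set S M" "gmult (form_algebra S M) = wedge S M"
  "gadd (form_algebra S M) k \<alpha> \<beta> = (\<lambda>vs \<in> vectors M k. \<alpha> vs \<oplus>\<^bsub>S\<^esub> \<beta> vs)"
  "gzero (form_algebra S M) k = (\<lambda>vs \<in> vectors M k. \<zero>\<^bsub>S\<^esub>)"
  "gone (form_algebra S M) = (\<lambda>vs \<in> vectors M 0. \<one>\<^bsub>S\<^esub>)"
  by (simp_all add: form_algebra_def)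

context module
begin

lemma form_setD: "\<omega> \<in> form_set R M k \<Longrightarrow> qform k \<omega>"
  by (simp add: form_set_iff)

lemma form_cochain: "\<omega> \<in> form_set R M k \<Longrightarrow> \<omega> \<in> cochains k"
  by (rule qform_cochain[OF form_setD])

lemma form_closed: "\<omega> \<in> form_set R M k \<Longrightarrow> vs \<in> vectors M k \<Longrightarrow> \<omega> vs \<in> carrier R"
  by (rule qform_closed[OF form_setD])

lemma restrict_form: "qform k \<omega> \<Longrightarrow> restrict \<omega> (vectors M k) \<in> form_set R M k"
  unfolding form_set_iff by (auto intro: qform_cong)

lemma form_eqI:
  assumes "\<alpha> \<in> form_set R M k" "\<beta> \<in> form_set R M k" "\<And>vs. vs \<in> vectors M k \<Longrightarrow> \<alpha> vs = \<beta> vs"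
  shows "\<alpha> = \<beta>"
  using assms unfolding form_set_iff by (blast intro: extensionalityI)

lemma form_restrict: "\<omega> \<in> form_set R M k \<Longrightarrow> restrict \<omega> (vectors M k) = \<omega>"
  unfolding form_set_iff by (simp add: extensional_restrict)

lemma add_form: "\<alpha> \<in> form_set R M k \<Longrightarrow> \<beta> \<in> form_set R M k \<Longrightarrow>
    (\<lambda>vs \<in> vectors M k. \<alpha> vs \<oplus> \<beta> vs) \<in> form_set R M k"
  by (rule restrict_form[OF qform_add]) (rule form_setD, assumption)+

lemma qform_zero: "qform k (\<lambda>vs. \<zero>)"
  unfolding qform_def by auto

lemma zero_form: "(\<lambda>vs \<in> vectors M k. \<zero>) \<in> form_set R M k"
  by (rule restrict_form[OF qform_zero])

lemma minus_form: "\<omega> \<in> form_set R M k \<Longrightarrow> (\<lambda>vs \<in> vectors M k. \<ominus> \<omega> vs) \<in> form_set R M k"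
  by (rule restrict_form[OF qform_minus[OF form_setD]])

lemma wedge_form:
  assumes "\<alpha> \<in> form_set R M p" "\<beta> \<in> form_set R M q" "p + q = k"
  shows "wedge R M p q \<alpha> \<beta> \<in> form_set R M k"
  using qform_wedge[OF form_setD[OF assms(1)] form_setD[OF assms(2)]] assms(3)
  unfolding form_set_iff by (auto simp: wedge_def)

abbreviation forms :: "('c list \<Rightarrow> 'a) graded_algebra" where
  "forms \<equiv> form_algebra R M"

lemma forms_component_group: "abelian_group (component forms k)"
proof (rule abelian_groupI)
  fix \<alpha> assume a: "\<alpha> \<in> carrier (component forms k)"
  then have "(\<lambda>vs \<in> vectors M k. \<ominus> \<alpha> vs) \<oplus>\<^bsub>component forms k\<^esub> \<alpha> = \<zero>\<^bsub>component forms k\<^esub>"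
    unfolding component_def using form_closed[of \<alpha> k] by (auto intro!: restrict_ext simp: R.l_neg)
  moreover have "(\<lambda>vs \<in> vectors M k. \<ominus> \<alpha> vs) \<in> carrier (component forms k)"
    using minus_form a unfolding component_def by simp
  ultimately show "\<exists>\<beta> \<in> carrier (component forms k). \<beta> \<oplus>\<^bsub>component forms k\<^esub> \<alpha> = \<zero>\<^bsub>component forms k\<^esub>"
    by blast
  show "\<zero>\<^bsub>component forms k\<^esub> \<oplus>\<^bsub>component forms k\<^esub> \<alpha> = \<alpha>"
  proof -
    have "\<zero>\<^bsub>component forms k\<^esub> \<oplus>\<^bsub>component forms k\<^esub> \<alpha> = restrict \<alpha> (vectors M k)"
      using a by (auto simp: component_def form_closed intro!: restrict_ext)
    then show ?thesis using a form_restrict by (simp add: component_def)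
  qed
next
  fix \<alpha> \<beta> assume ab: "\<alpha> \<in> carrier (component forms k)" "\<beta> \<in> carrier (component forms k)"
  then show "\<alpha> \<oplus>\<^bsub>component forms k\<^esub> \<beta> \<in> carrier (component forms k)"
    by (simp add: component_def add_form)
  show "\<alpha> \<oplus>\<^bsub>component forms k\<^esub> \<beta> = \<beta> \<oplus>\<^bsub>component forms k\<^esub> \<alpha>"
    using ab by (auto simp: component_def form_closed R.a_comm intro!: restrict_ext)
  fix \<gamma> assume "\<gamma> \<in> carrier (component forms k)"
  then show "\<alpha> \<oplus>\<^bsub>component forms k\<^esub> \<beta> \<oplus>\<^bsub>component forms k\<^esub> \<gamma> =
      \<alpha> \<oplus>\<^bsub>component forms k\<^esub> (\<beta> \<oplus>\<^bsub>component forms k\<^esub> \<gamma>)"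
    using ab by (auto simp: component_def form_closed R.a_assoc intro!: restrict_ext)
qed (simp add: component_def zero_form)

lemma component_minus:
  assumes "\<omega> \<in> form_set R M k"
  shows "\<ominus>\<^bsub>component forms k\<^esub> \<omega> = (\<lambda>vs \<in> vectors M k. \<ominus> \<omega> vs)"
proof (rule abelian_group.minus_equality[OF forms_component_group])
  show "(\<lambda>vs \<in> vectors M k. \<ominus> \<omega> vs) \<oplus>\<^bsub>component forms k\<^esub> \<omega> = \<zero>\<^bsub>component forms k\<^esub>"
    unfolding component_def using form_closed[OF assms] by (auto intro!: restrict_ext simp: R.l_neg)
qed (use assms minus_form in \<open>simp_all add: component_def\<close>)

lemma gsign_forms:
  assumes "\<omega> \<in> form_set R M k"
  shows "gsign forms k m \<omega> = (\<lambda>vs \<in> vectors M k. usgn m \<otimes> \<omega> vs)"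
proof -
  have "(\<lambda>vs \<in> vectors M k. usgn m \<otimes> \<omega> vs) = (\<lambda>vs \<in> vectors M k. if even m then \<omega> vs else \<ominus> \<omega> vs)"
    by (rule restrict_ext) (use form_closed[OF assms] in \<open>simp add: usgn_def R.l_minus\<close>)
  then show ?thesis
    using form_restrict[OF assms] component_minus[OF assms] by (auto simp: gsign_def)
qed

lemma gsign_form: "\<omega> \<in> form_set R M k \<Longrightarrow> gsign forms k m \<omega> \<in> form_set R M k"
  unfolding gsign_forms by (rule restrict_form[OF qform_smult[OF form_setD usgn_closed]])

text \<open>Commutators are computed with unrestricted representatives \<open>f\<close> and
  \<open>g\<close> of the two composites, so that the pointwise identities for \<open>Lie\<close>,
  \<open>dif\<close> and \<open>ins\<close> apply directly.\<close>

lemma graded_commutator_forms: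
  assumes "\<delta> (k + q) (\<epsilon> k \<omega>) = restrict f (vectors M r)" "\<epsilon> (k + p) (\<delta> k \<omega>) = restrict g (vectors M r)"
    and "qform r f" "qform r g" "r = k + p + q"
  shows "graded_commutator forms p q \<delta> \<epsilon> k \<omega> = (\<lambda>vs \<in> vectors M r. f vs \<ominus> usgn (p * q) \<otimes> g vs)"
proof -
  have "qform r (\<lambda>vs. usgn (p * q) \<otimes> g vs)" by (rule qform_smult[OF assms(4)]) simp
  then have s: "gsign forms r (p * q) (restrict g (vectors M r)) = (\<lambda>vs \<in> vectors M r. usgn (p * q) \<otimes> g vs)"
    "(\<lambda>vs \<in> vectors M r. usgn (p * q) \<otimes> g vs) \<in> form_set R M r"
    using gsign_forms[OF restrict_form[OF assms(4)]] by (auto intro!: restrict_ext restrict_form)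
  show ?thesis
    unfolding graded_commutator_def assms(1,2) assms(5)[symmetric] s(1) a_minus_def component_minus[OF s(2)]
    by (auto simp: component_def intro!: restrict_ext)
qed

lemma forms_graded_commutative_algebra: "graded_commutative_algebra forms"
proof (rule graded_commutative_algebra.intro)
  show "abelian_group (component forms k)" for k by (rule forms_component_group)
next
  fix \<alpha> \<beta> p q assume a: "\<alpha> \<in> gcarrier forms p" and b: "\<beta> \<in> gcarrier forms q"
  have ca: "\<alpha> \<in> cochains p" and cb: "\<beta> \<in> cochains q" using a b form_cochain by simp_all
  show "gmult forms p q \<alpha> \<beta> \<in> gcarrier forms (p + q)" using wedge_form a b by simp
  have "vectors M (q + p) = vectors M (p + q)" by (simp add: add.commute)
  moreover have "wedge R M q p \<beta> \<alpha> \<in> form_set R M (p + q)" using wedge_form a b by simp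
  moreover note gsign_form[OF this] gsign_forms[OF this]
  ultimately show "gmult forms p q \<alpha> \<beta> = gsign forms (p + q) (p * q) (gmult forms q p \<beta> \<alpha>)"
    using wedge_comm[OF _ ca cb] wedge_form[of \<alpha> p \<beta> q] a b
    by (intro form_eqI[of _ "p + q"]) simp_all
  {
    fix \<gamma> r assume c: "\<gamma> \<in> gcarrier forms r"
    then have cc: "\<gamma> \<in> cochains r" using form_cochain by simp
    have "p + (q + r) = p + q + r" by simp
    then show "gmult forms (p + q) r (gmult forms p q \<alpha> \<beta>) \<gamma> = gmult forms p (q + r) \<alpha> (gmult forms q r \<beta> \<gamma>)"
      using wedge_assoc[OF _ ca cb cc] a b c
      by (intro form_eqI[of _ "p + q + r"]) (simp_all add: wedge_form)
  }
  {
    fix \<alpha>' assume a': "\<alpha>' \<in> gcarrier forms p"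
    then have ca': "\<alpha>' \<in> cochains p" using form_cochain by simp
    have s: "(\<lambda>us \<in> vectors M p. \<alpha> us \<oplus> \<alpha>' us) \<in> form_set R M p" using add_form a a' by simp
    have "wedge R M p q (\<lambda>us \<in> vectors M p. \<alpha> us \<oplus> \<alpha>' us) \<beta> vs = wedge R M p q \<alpha> \<beta> vs \<oplus> wedge R M p q \<alpha>' \<beta> vs"
      if vs: "vs \<in> vectors M (p + q)" for vs
      unfolding wedge_add_left[OF vs ca ca' cb, symmetric]
      by (rule wedge_cong[OF vs form_cochain[OF s] cb]) simp_all
    then show "gmult forms p q (gadd forms p \<alpha> \<alpha>') \<beta> = gadd forms (p + q) (gmult forms p q \<alpha> \<beta>) (gmult forms p q \<alpha>' \<beta>)"
      using a a' b s by (intro form_eqI[of _ "p + q"]) (simp_all add: wedge_form add_form)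
  }
  {
    fix \<beta>' assume b': "\<beta>' \<in> gcarrier forms q"
    then have cb': "\<beta>' \<in> cochains q" using form_cochain by simp
    have s: "(\<lambda>us \<in> vectors M q. \<beta> us \<oplus> \<beta>' us) \<in> form_set R M q" using add_form b b' by simp
    have "wedge R M p q \<alpha> (\<lambda>us \<in> vectors M q. \<beta> us \<oplus> \<beta>' us) vs = wedge R M p q \<alpha> \<beta> vs \<oplus> wedge R M p q \<alpha> \<beta>' vs"
      if vs: "vs \<in> vectors M (p + q)" for vs
      unfolding wedge_add_right[OF vs ca cb cb', symmetric]
      by (rule wedge_cong[OF vs ca form_cochain[OF s]]) simp_all
    then show "gmult forms p q \<alpha> (gadd forms q \<beta> \<beta>') = gadd forms (p + q) (gmult forms p q \<alpha> \<beta>) (gmult forms p q \<alpha> \<beta>')"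
      using a b b' s by (intro form_eqI[of _ "p + q"]) (simp_all add: wedge_form add_form)
  }
next
  have one: "(\<lambda>vs \<in> vectors M 0. \<one>) \<in> form_set R M 0"
    by (rule restrict_form[OF qform_nonpos]) auto
  then show "gone forms \<in> gcarrier forms 0" by simp
  fix \<alpha> p assume a: "\<alpha> \<in> gcarrier forms p"
  then have ca: "\<alpha> \<in> cochains p" using form_cochain by simp
  note c1 = form_cochain[OF one]
  have l: "wedge R M 0 p (\<lambda>vs \<in> vectors M 0. \<one>) \<alpha> vs = \<alpha> vs" if "vs \<in> vectors M p" for vs
    using wedge_degree0_left[OF that c1 ca] cochain_closed[OF ca that] by simp
  then show "gmult forms 0 p (gone forms) \<alpha> = \<alpha>"
    using a one by (intro form_eqI[of _ p]) (simp_all add: wedge_form)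
  have "wedge R M p 0 \<alpha> (\<lambda>vs \<in> vectors M 0. \<one>) vs = \<alpha> vs" if vs: "vs \<in> vectors M p" for vs
    using wedge_comm[OF _ ca c1, of vs] l[OF vs] vs cochain_closed[OF ca vs] by (simp add: usgn_def)
  then show "gmult forms p 0 \<alpha> (gone forms) = \<alpha>"
    using a one by (intro form_eqI[of _ p]) (simp_all add: wedge_form)
qed

lemma degree0_module_simps [simp]:
  "carrier (degree0_module M) = carrier M" "add (degree0_module M) = add M"
  "zero (degree0_module M) = zero M" "smult (degree0_module M) \<alpha> v = \<alpha> [] \<odot>\<^bsub>M\<^esub> v"
  by (simp_all add: degree0_module_def)

lemma degree0_module_group: "abelian_group (degree0_module M)"
proof (rule abelian_groupI)
  fix v assume "v \<in> carrier (degree0_module M)"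
  then show "\<exists>w \<in> carrier (degree0_module M). w \<oplus>\<^bsub>degree0_module M\<^esub> v = \<zero>\<^bsub>degree0_module M\<^esub>"
    using M.l_neg M.a_inv_closed by auto
qed (simp_all add: M.a_ac)

lemma degree0_module_minus:
  assumes "v \<in> carrier M"
  shows "\<ominus>\<^bsub>degree0_module M\<^esub> v = \<ominus>\<^bsub>M\<^esub> v"
  by (rule abelian_group.minus_equality[OF degree0_module_group]) (use assms in \<open>simp_all add: M.l_neg\<close>)

text \<open>Evaluation at the empty list identifies forms of degree 0 with ring elements; the module
  laws are those of \<open>M\<close> under this identification.\<close>

lemma module_degree0: "module (component forms 0) (degree0_module M)"
proof (rule moduleI)
  interpret F: graded_commutative_algebra forms by (rule forms_graded_commutative_algebra)
  show "cring (component forms 0)" by (rule F.cring_component0)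
  show "abelian_group (degree0_module M)" by (rule degree0_module_group)
  have cl: "\<alpha> [] \<in> carrier R" if "\<alpha> \<in> carrier (component forms 0)" for \<alpha>
    using that form_closed[of \<alpha> 0 "[]"] by (simp add: component_def)
  have mult: "(\<alpha> \<otimes>\<^bsub>component forms 0\<^esub> \<beta>) [] = \<alpha> [] \<otimes> \<beta> []"
    if "\<alpha> \<in> carrier (component forms 0)" "\<beta> \<in> carrier (component forms 0)" for \<alpha> \<beta>
    using wedge_Nil[of 0 0 \<alpha> \<beta>] form_cochain that by (simp add: component_def)
  have add: "(\<alpha> \<oplus>\<^bsub>component forms 0\<^esub> \<beta>) [] = \<alpha> [] \<oplus> \<beta> []" for \<alpha> \<beta>
    by (simp add: component_def)
  show "\<one>\<^bsub>component forms 0\<^esub> \<odot>\<^bsub>degree0_module M\<^esub> v = v" if "v \<in> carrier (degree0_module M)" for v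
    using that by (simp add: component_def)
  fix \<alpha> v assume a: "\<alpha> \<in> carrier (component forms 0)" and v: "v \<in> carrier (degree0_module M)"
  show "\<alpha> \<odot>\<^bsub>degree0_module M\<^esub> v \<in> carrier (degree0_module M)" using cl[OF a] v by simp
  {
    fix \<beta> assume b: "\<beta> \<in> carrier (component forms 0)"
    show "(\<alpha> \<oplus>\<^bsub>component forms 0\<^esub> \<beta>) \<odot>\<^bsub>degree0_module M\<^esub> v =
        \<alpha> \<odot>\<^bsub>degree0_module M\<^esub> v \<oplus>\<^bsub>degree0_module M\<^esub> \<beta> \<odot>\<^bsub>degree0_module M\<^esub> v"
      using add cl[OF a] cl[OF b] v by (simp add: smult_l_distr)
    show "(\<alpha> \<otimes>\<^bsub>component forms 0\<^esub> \<beta>) \<odot>\<^bsub>degree0_module M\<^esub> v =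
        \<alpha> \<odot>\<^bsub>degree0_module M\<^esub> (\<beta> \<odot>\<^bsub>degree0_module M\<^esub> v)"
      using mult[OF a b] cl[OF a] cl[OF b] v by (simp add: smult_assoc1)
  }
  {
    fix w assume w: "w \<in> carrier (degree0_module M)"
    show "\<alpha> \<odot>\<^bsub>degree0_module M\<^esub> (v \<oplus>\<^bsub>degree0_module M\<^esub> w) =
        \<alpha> \<odot>\<^bsub>degree0_module M\<^esub> v \<oplus>\<^bsub>degree0_module M\<^esub> \<alpha> \<odot>\<^bsub>degree0_module M\<^esub> w"
      using cl[OF a] v w by (simp add: smult_r_distr)
  }
qed

end

section \<open>The Cartan calculus of a Lie-Rinehart structure\<close>

context lie_rinehart
begin

abbreviation "CE \<equiv> CE_differential S M br act"
abbreviation "inner \<equiv> inner_derivative M"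

lemma CE_eq:
  assumes "qform k \<omega>"
  shows "CE k \<omega> = restrict (dif \<omega>) (vectors M (k + 1))"
proof (rule extensionalityI)
  show "CE k \<omega> \<in> extensional (vectors M (k + 1))" unfolding CE_differential_def by simp
qed (use CE_differential_apply[OF _ assms] in simp_all)

lemma CE_form: "qform k \<omega> \<Longrightarrow> CE k \<omega> \<in> form_set S M (k + 1)"
  using CE_eq restrict_form[OF qform_dif] by simp

lemma inner_form: "v \<in> carrier M \<Longrightarrow> qform k \<omega> \<Longrightarrow> inner v k \<omega> \<in> form_set S M (k - 1)"
  unfolding inner_derivative_def by (rule restrict_form[OF qform_ins])

text \<open>In degrees -1 and 1 the graded commutator is the sum of the two composites, and the
  recursion of \<open>dif\<close> is this sum solved for the contraction of the
  differential.\<close>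

lemma lie_derivative_eq:
  assumes v: "v \<in> carrier M" and q: "qform k \<omega>"
  shows "lie_derivative forms CE inner v k \<omega> = restrict (Lie v \<omega>) (vectors M k)"
proof -
  note i = qform_ins[OF q v]
  have iq: "qform (k + - 1) (inner v k \<omega>)" using form_setD[OF inner_form[OF v q]] by simp
  have 1: "inner v (k + 1) (CE k \<omega>) = restrict (ins v (dif \<omega>)) (vectors M k)"
    unfolding CE_eq[OF q] inner_derivative_def add_diff_cancel_right' by (rule restrict_ext) (use v in simp)
  have D: "dif (inner v k \<omega>) vs = dif (ins v \<omega>) vs" if "vs \<in> vectors M k" for vs
    by (rule dif_cong[of _ "k - 1"]) (use that in simp_all)
  have "CE (k + - 1) (inner v k \<omega>) = restrict (dif (inner v k \<omega>)) (vectors M k)"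
    using CE_eq[OF iq] by simp
  also have "\<dots> = restrict (dif (ins v \<omega>)) (vectors M k)" by (rule restrict_ext) (rule D)
  finally have 2: "CE (k + - 1) (inner v k \<omega>) = \<dots>" .
  have q1: "qform k (ins v (dif \<omega>))" using qform_ins[OF qform_dif[OF q] v] by simp
  have q2: "qform k (dif (ins v \<omega>))" using qform_dif[OF i] by simp
  have "lie_derivative forms CE inner v k \<omega> =
      (\<lambda>vs \<in> vectors M k. ins v (dif \<omega>) vs \<ominus> usgn (- 1 * 1) \<otimes> dif (ins v \<omega>) vs)"
    unfolding lie_derivative_def by (rule graded_commutator_forms, rule 1, rule 2, rule q1, rule q2) simp
  also have "\<dots> = restrict (Lie v \<omega>) (vectors M k)"
  proof (rule restrict_ext)
    fix vs assume vs: "vs \<in> vectors M k"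
    show "dif \<omega> (v # vs) \<ominus> usgn (- 1 * 1) \<otimes> dif (ins v \<omega>) vs = Lie v \<omega> vs"
      using Lie_closed[OF v vs qform_cochain[OF q]] qform_closed[OF q2 vs]
      by (simp add: usgn_def R.l_minus R.minus_eq R.a_assoc R.l_neg)
  qed
  finally show ?thesis .
qed

lemma CE_derivation: "graded_derivation forms 1 CE"
  unfolding graded_derivation_def
proof (intro conjI allI ballI)
  fix k \<alpha> assume "\<alpha> \<in> gcarrier forms k"
  then have a: "\<alpha> \<in> form_set S M k" by simp
  then show "CE k \<alpha> \<in> gcarrier forms (k + 1)" using CE_form[OF form_setD] by simp
  fix \<beta> assume "\<beta> \<in> gcarrier forms k"
  then have b: "\<beta> \<in> form_set S M k" by simp
  have "CE k (gadd forms k \<alpha> \<beta>) = restrict (dif (\<lambda>vs \<in> vectors M k. \<alpha> vs \<oplus> \<beta> vs)) (vectors M (k + 1))"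
    using CE_eq[OF form_setD[OF add_form[OF a b]]] by simp
  also have "\<dots> = gadd forms (k + 1) (CE k \<alpha>) (CE k \<beta>)"
    unfolding form_algebra_simps CE_eq[OF form_setD[OF a]] CE_eq[OF form_setD[OF b]]
  proof (rule restrict_ext)
    fix vs assume vs: "vs \<in> vectors M (k + 1)"
    have "dif (\<lambda>vs \<in> vectors M k. \<alpha> vs \<oplus> \<beta> vs) vs = dif (\<lambda>vs. \<alpha> vs \<oplus> \<beta> vs) vs"
      by (rule dif_cong[OF vs]) simp
    then show "dif (\<lambda>vs \<in> vectors M k. \<alpha> vs \<oplus> \<beta> vs) vs =
        restrict (dif \<alpha>) (vectors M (k + 1)) vs \<oplus> restrict (dif \<beta>) (vectors M (k + 1)) vs"
      using dif_add[OF vs form_cochain[OF a] form_cochain[OF b]] vs by simp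
  qed
  finally show "CE k (gadd forms k \<alpha> \<beta>) = gadd forms (k + 1) (CE k \<alpha>) (CE k \<beta>)" .
next
  fix k l \<alpha> \<beta> assume "\<alpha> \<in> gcarrier forms k" "\<beta> \<in> gcarrier forms l"
  then have a: "\<alpha> \<in> form_set S M k" and b: "\<beta> \<in> form_set S M l" by simp_all
  note ca = form_cochain[OF a] and cb = form_cochain[OF b]
  have d: "k + 1 + l = k + l + 1" "k + (l + 1) = k + l + 1" by simp_all
  note Da = CE_form[OF form_setD[OF a]] and Db = CE_form[OF form_setD[OF b]]
  have f: "wedge S M k l \<alpha> \<beta> \<in> form_set S M (k + l)" "wedge S M k (l + 1) \<alpha> (CE l \<beta>) \<in> form_set S M (k + l + 1)"
    using a b Db by (simp_all add: wedge_form)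
  show "CE (k + l) (gmult forms k l \<alpha> \<beta>) = gadd forms (k + l + 1) (gmult forms (k + 1) l (CE k \<alpha>) \<beta>)
      (gsign forms (k + l + 1) (1 * k) (gmult forms k (l + 1) \<alpha> (CE l \<beta>)))"
    unfolding form_algebra_simps CE_eq[OF form_setD[OF f(1)]] gsign_forms[OF f(2)]
  proof (rule restrict_ext)
    fix vs assume vs: "vs \<in> vectors M (k + l + 1)"
    have vs1: "vs \<in> vectors M (k + 1 + l)" and vs2: "vs \<in> vectors M (k + (l + 1))" unfolding d by (rule vs)+
    have "wedge S M (k + 1) l (CE k \<alpha>) \<beta> vs = wedge S M (k + 1) l (dif \<alpha>) \<beta> vs"
      by (rule wedge_cong[OF vs1 form_cochain[OF Da] cb]) (simp_all add: CE_eq[OF form_setD[OF a]])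
    moreover have "wedge S M k (l + 1) \<alpha> (CE l \<beta>) vs = wedge S M k (l + 1) \<alpha> (dif \<beta>) vs"
      by (rule wedge_cong[OF vs2 ca form_cochain[OF Db]]) (simp_all add: CE_eq[OF form_setD[OF b]])
    ultimately show "dif (wedge S M k l \<alpha> \<beta>) vs = wedge S M (k + 1) l (CE k \<alpha>) \<beta> vs \<oplus>
        (\<lambda>vs \<in> vectors M (k + l + 1). usgn (1 * k) \<otimes> wedge S M k (l + 1) \<alpha> (CE l \<beta>) vs) vs"
      using dif_wedge[OF vs ca cb] vs by simp
  qed
qed

lemma inner_derivation:
  assumes v: "v \<in> carrier M"
  shows "graded_derivation forms (- 1) (inner v)"
  unfolding graded_derivation_def
proof (intro conjI allI ballI)
  fix k \<alpha> assume "\<alpha> \<in> gcarrier forms k"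
  then have a: "\<alpha> \<in> form_set S M k" by simp
  then show "inner v k \<alpha> \<in> gcarrier forms (k + - 1)" using inner_form[OF v form_setD] by simp
  fix \<beta> assume "\<beta> \<in> gcarrier forms k"
  then show "inner v k (gadd forms k \<alpha> \<beta>) = gadd forms (k + - 1) (inner v k \<alpha>) (inner v k \<beta>)"
    using v by (auto simp: inner_derivative_def intro!: restrict_ext)
next
  fix k l \<alpha> \<beta> assume "\<alpha> \<in> gcarrier forms k" "\<beta> \<in> gcarrier forms l"
  then have a: "\<alpha> \<in> form_set S M k" and b: "\<beta> \<in> form_set S M l" by simp_all
  note ca = form_cochain[OF a] and cb = form_cochain[OF b]
  note Ia = inner_form[OF v form_setD[OF a]] and Ib = inner_form[OF v form_setD[OF b]]
  have f: "wedge S M k (l + - 1) \<alpha> (inner v l \<beta>) \<in> form_set S M (k + l + - 1)"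
    using a Ib by (simp add: wedge_form)
  have p: "usgn (- 1 * k) = usgn k" by (simp add: usgn_def)
  have d: "k + l + - 1 = k + l - 1" "k + - 1 = k - 1" "l + - 1 = l - 1" by simp_all
  show "inner v (k + l) (gmult forms k l \<alpha> \<beta>) = gadd forms (k + l + - 1) (gmult forms (k + - 1) l (inner v k \<alpha>) \<beta>)
      (gsign forms (k + l + - 1) (- 1 * k) (gmult forms k (l + - 1) \<alpha> (inner v l \<beta>)))"
    unfolding form_algebra_simps gsign_forms[OF f] p unfolding d inner_derivative_def[of _ _ "k + l"]
  proof (rule restrict_ext)
    fix vs assume vs: "vs \<in> vectors M (k + l - 1)"
    have vs1: "vs \<in> vectors M (k - 1 + l)" and vs2: "vs \<in> vectors M (k + (l - 1))"
      using vs by (simp_all add: algebra_simps)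
    have "wedge S M (k - 1) l (inner v k \<alpha>) \<beta> vs = wedge S M (k - 1) l (ins v \<alpha>) \<beta> vs"
      by (rule wedge_cong[OF vs1 form_cochain[OF Ia] cb]) simp_all
    moreover have "wedge S M k (l - 1) \<alpha> (inner v l \<beta>) vs = wedge S M k (l - 1) \<alpha> (ins v \<beta>) vs"
      by (rule wedge_cong[OF vs2 ca form_cochain[OF Ib]]) simp_all
    ultimately show "wedge S M k l \<alpha> \<beta> (v # vs) = wedge S M (k - 1) l (inner v k \<alpha>) \<beta> vs \<oplus>
        (\<lambda>vs \<in> vectors M (k + l - 1). usgn k \<otimes> wedge S M k (l - 1) \<alpha> (inner v l \<beta>) vs) vs"
      using wedge_Cons[OF _ ca cb, of v vs] v vs by simp
  qed
qed

text \<open>Each commutator axiom is one pointwise identity: for Lie derivative and contraction it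
  is the recursion of \<open>Lie\<close>, for two Lie derivatives \<open>Lie_Lie\<close>, for Lie
  derivative and differential \<open>dif_Lie\<close>. What remains is to exchange forms with their
  unrestricted representatives.\<close>

lemma cartan_calculus_forms: "cartan_calculus forms CE (degree0_module M) br inner"
proof (intro cartan_calculus.intro cartan_calculus_axioms.intro)
  show "graded_commutative_algebra forms" by (rule forms_graded_commutative_algebra)
  show "module (component forms 0) (degree0_module M)" by (rule module_degree0)
  show "lie_bracket (degree0_module M) br"
  proof (rule lie_bracket.intro[OF degree0_module_group], unfold_locales)
    fix v w assume "v \<in> carrier (degree0_module M)" "w \<in> carrier (degree0_module M)"
    then show "br v w = \<ominus>\<^bsub>degree0_module M\<^esub> br w v"
      using br_antisym[of v w] br_closed[of w v] degree0_module_minus[of "br w v"] by simp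
  qed (simp_all add: br_closed br_add_left br_add_right br_jacobi)
  show "graded_derivation forms 1 CE" by (rule CE_derivation)
next
  fix \<omega> k assume "\<omega> \<in> gcarrier forms k"
  then have q: "qform k \<omega>" using form_setD by simp
  note qD = form_setD[OF CE_form[OF q]]
  \<comment> \<open>\<open>CE k \<omega>\<close> agrees with \<open>dif \<omega>\<close> on
    admissible lists, and \<open>dif\<close> sees no others.\<close>
  have "dif (CE k \<omega>) vs = dif (dif \<omega>) vs" if "vs \<in> vectors M (k + 1 + 1)" for vs
    by (rule dif_cong[OF that]) (simp add: CE_eq[OF q])
  then have 0: "dif (CE k \<omega>) vs = \<zero>" if "vs \<in> vectors M (k + 1 + 1)" for vs
    using dif_dif[OF that q] that by simp
  have e: "k + 1 + 1 = k + 2" by simp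
  show "CE (k + 1) (CE k \<omega>) = gzero forms (k + 2)"
    unfolding CE_eq[OF qD] form_algebra_simps e by (rule restrict_ext) (rule 0, simp only: e)
next
  fix v assume "v \<in> carrier (degree0_module M)"
  then show "graded_derivation forms (- 1) (inner v)" using inner_derivation by simp
next
  fix f v \<omega> k assume f: "f \<in> gcarrier forms 0" and "v \<in> carrier (degree0_module M)" and w: "\<omega> \<in> gcarrier forms k"
  then have v: "v \<in> carrier M" and q: "qform k \<omega>" using form_setD by simp_all
  have ff: "f \<in> form_set S M 0" using f by simp
  then have f0: "f [] \<in> carrier S" using form_closed[of f 0 "[]"] by simp
  note i = inner_form[OF v q]
  show "inner (f \<odot>\<^bsub>degree0_module M\<^esub> v) k \<omega> = gmult forms 0 (k - 1) f (inner v k \<omega>)"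
    unfolding form_algebra_simps degree0_module_simps
  proof (rule form_eqI)
    show "inner (f [] \<odot>\<^bsub>M\<^esub> v) k \<omega> \<in> form_set S M (k - 1)" by (rule inner_form[OF smult_closed[OF f0 v] q])
    show "wedge S M 0 (k - 1) f (inner v k \<omega>) \<in> form_set S M (k - 1)" by (rule wedge_form[OF ff i]) simp
    fix vs assume vs: "vs \<in> vectors M (k - 1)"
    show "inner (f [] \<odot>\<^bsub>M\<^esub> v) k \<omega> vs = wedge S M 0 (k - 1) f (inner v k \<omega>) vs"
      using wedge_degree0_left[OF vs form_cochain[OF ff] form_cochain[OF i]] qform_smult_first[OF q f0 v vs] vs by simp
  qed
next
  fix v \<omega> k assume "v \<in> carrier (degree0_module M)" "\<omega> \<in> gcarrier forms k"
  then have v: "v \<in> carrier M" and q: "qform k \<omega>" using form_setD by simp_all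
  note L = qform_Lie[OF v q]
  note rL = form_setD[OF restrict_form[OF L]]
  have 1: "lie_derivative forms CE inner v (k + 1) (CE k \<omega>) = restrict (Lie v (dif \<omega>)) (vectors M (k + 1))"
    unfolding lie_derivative_eq[OF v form_setD[OF CE_form[OF q]]]
    by (rule restrict_ext) (rule Lie_cong[OF v], assumption, simp add: CE_eq[OF q])
  have 2: "CE (k + 0) (lie_derivative forms CE inner v k \<omega>) = restrict (Lie v (dif \<omega>)) (vectors M (k + 1))"
    unfolding lie_derivative_eq[OF v q] add_0_right CE_eq[OF rL]
  proof (rule restrict_ext)
    fix vs assume vs: "vs \<in> vectors M (k + 1)"
    have "dif (restrict (Lie v \<omega>) (vectors M k)) vs = dif (Lie v \<omega>) vs" by (rule dif_cong[OF vs]) simp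
    then show "dif (restrict (Lie v \<omega>) (vectors M k)) vs = Lie v (dif \<omega>) vs" using dif_Lie[OF v vs q] by simp
  qed
  note L' = qform_Lie[OF v qform_dif[OF q]]
  have "graded_commutator forms 0 1 (lie_derivative forms CE inner v) CE k \<omega> =
      (\<lambda>vs \<in> vectors M (k + 1). Lie v (dif \<omega>) vs \<ominus> usgn (0 * 1) \<otimes> Lie v (dif \<omega>) vs)"
    by (rule graded_commutator_forms, rule 1, rule 2, rule L', rule L') simp
  also have "\<dots> = gzero forms (k + 1)"
    unfolding form_algebra_simps
    by (rule restrict_ext) (use qform_closed[OF L'] in \<open>simp add: usgn_def R.minus_eq R.r_neg\<close>)
  finally show "graded_commutator forms 0 1 (lie_derivative forms CE inner v) CE k \<omega> = gzero forms (k + 1)" .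
next
  fix v w \<omega> k assume "v \<in> carrier (degree0_module M)" "w \<in> carrier (degree0_module M)" "\<omega> \<in> gcarrier forms k"
  then have v: "v \<in> carrier M" and w: "w \<in> carrier M" and q: "qform k \<omega>" using form_setD by simp_all
  have vw: "br v w \<in> carrier M" by (rule br_closed[OF v w])
  show "inner (v \<oplus>\<^bsub>degree0_module M\<^esub> w) k \<omega> = gadd forms (k - 1) (inner v k \<omega>) (inner w k \<omega>)"
    unfolding form_algebra_simps degree0_module_simps inner_derivative_def[of _ "v \<oplus>\<^bsub>M\<^esub> w"]
    by (rule restrict_ext) (simp add: qform_add_first[OF q v w])
  show "graded_commutator forms (- 1) (- 1) (inner v) (inner w) k \<omega> = gzero forms (k - 2)"
  proof -
    have 1: "inner x (k + - 1) (inner y k \<omega>) = restrict (ins x (ins y \<omega>)) (vectors M (k - 2))"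
      if "x \<in> carrier M" for x y
      unfolding inner_derivative_def using that by (auto intro!: restrict_ext simp: restrict_def)
    have q2: "qform (k - 2) (ins x (ins y \<omega>))" if "x \<in> carrier M" "y \<in> carrier M" for x y
      using qform_ins[OF qform_ins[OF q that(2)] that(1)] by simp
    have "graded_commutator forms (- 1) (- 1) (inner v) (inner w) k \<omega> =
        (\<lambda>vs \<in> vectors M (k - 2). ins v (ins w \<omega>) vs \<ominus> usgn (- 1 * - 1) \<otimes> ins w (ins v \<omega>) vs)"
      by (rule graded_commutator_forms, rule 1[OF v], rule 1[OF w], rule q2[OF v w], rule q2[OF w v]) simp
    also have "\<dots> = gzero forms (k - 2)"
      unfolding form_algebra_simps
    proof (rule restrict_ext)
      fix vs assume vs: "vs \<in> vectors M (k - 2)"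
      have "\<omega> (w # v # vs) = \<ominus> \<omega> (v # w # vs)" by (rule qform_swap_first[OF q w v]) (use vs in simp)
      then show "\<omega> (w # v # vs) \<ominus> usgn (- 1 * - 1) \<otimes> \<omega> (v # w # vs) = \<zero>"
        using qform_closed[OF q2[OF w v] vs] qform_closed[OF q, of "v # w # vs"] v w vs
        by (simp add: usgn_def R.l_minus R.minus_eq R.l_neg)
    qed
    finally show ?thesis .
  qed
  note Lv = qform_Lie[OF v q] and Lw = qform_Lie[OF w q]
  show "graded_commutator forms 0 (- 1) (lie_derivative forms CE inner v) (inner w) k \<omega> = inner (br v w) k \<omega>"
  proof -
    have qi: "qform (k + - 1) (inner w k \<omega>)" using form_setD[OF inner_form[OF w q]] by simp
    have 1: "lie_derivative forms CE inner v (k + - 1) (inner w k \<omega>) = restrict (Lie v (ins w \<omega>)) (vectors M (k - 1))"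
      unfolding lie_derivative_eq[OF v qi] by (auto intro!: restrict_ext Lie_cong[OF v])
    have 2: "inner w (k + 0) (lie_derivative forms CE inner v k \<omega>) = restrict (ins w (Lie v \<omega>)) (vectors M (k - 1))"
      unfolding lie_derivative_eq[OF v q] inner_derivative_def add_0_right by (rule restrict_ext) (use w in simp)
    have "graded_commutator forms 0 (- 1) (lie_derivative forms CE inner v) (inner w) k \<omega> =
        (\<lambda>vs \<in> vectors M (k - 1). Lie v (ins w \<omega>) vs \<ominus> usgn (0 * - 1) \<otimes> ins w (Lie v \<omega>) vs)"
      by (rule graded_commutator_forms, rule 1, rule 2, rule qform_Lie[OF v qform_ins[OF q w]], rule qform_ins[OF Lv w]) simp
    also have "\<dots> = inner (br v w) k \<omega>"
      unfolding inner_derivative_def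
    proof (rule restrict_ext)
      fix vs assume vs: "vs \<in> vectors M (k - 1)"
      have "Lie v (ins w \<omega>) vs \<in> carrier S" "\<omega> (br v w # vs) \<in> carrier S"
        using Lie_closed[OF v vs ins_cochain[OF qform_cochain[OF q] w]] qform_closed[OF q] vw vs by simp_all
      then show "Lie v (ins w \<omega>) vs \<ominus> usgn (0 * - 1) \<otimes> Lie v \<omega> (w # vs) = \<omega> (br v w # vs)"
        by (simp add: usgn_def R.minus_eq R.minus_add R.r_neg2 R.r_neg flip: R.a_assoc)
    qed
    finally show ?thesis .
  qed
  show "graded_commutator forms 0 0 (lie_derivative forms CE inner v) (lie_derivative forms CE inner w) k \<omega> =
      lie_derivative forms CE inner (br v w) k \<omega>"
  proof -
    have 1: "lie_derivative forms CE inner x (k + 0) (lie_derivative forms CE inner y k \<omega>) =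
        restrict (Lie x (Lie y \<omega>)) (vectors M k)" if x: "x \<in> carrier M" and y: "y \<in> carrier M" for x y
      unfolding lie_derivative_eq[OF y q] add_0_right
        lie_derivative_eq[OF x form_setD[OF restrict_form[OF qform_Lie[OF y q]]]]
      by (rule restrict_ext) (rule Lie_cong[OF x], assumption, simp)
    have "graded_commutator forms 0 0 (lie_derivative forms CE inner v) (lie_derivative forms CE inner w) k \<omega> =
        (\<lambda>vs \<in> vectors M k. Lie v (Lie w \<omega>) vs \<ominus> usgn (0 * 0) \<otimes> Lie w (Lie v \<omega>) vs)"
      by (rule graded_commutator_forms, rule 1[OF v w], rule 1[OF w v], rule qform_Lie[OF v Lw], rule qform_Lie[OF w Lv]) simp
    also have "\<dots> = restrict (Lie (br v w) \<omega>) (vectors M k)"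
    proof (rule restrict_ext)
      fix vs assume vs: "vs \<in> vectors M k"
      show "Lie v (Lie w \<omega>) vs \<ominus> usgn (0 * 0) \<otimes> Lie w (Lie v \<omega>) vs = Lie (br v w) \<omega> vs"
        unfolding Lie_Lie[OF v w vs q]
        using qform_closed[OF qform_Lie[OF w Lv] vs] qform_closed[OF qform_Lie[OF vw q] vs]
        by (simp add: usgn_def R.minus_eq R.a_comm[of "Lie w (Lie v \<omega>) vs"] R.a_assoc R.r_neg)
    qed
    finally show ?thesis using lie_derivative_eq[OF vw q] by simp
  qed
qed

end

section \<open>Tangent vectors\<close>

context category
begin

text \<open>A partial algebra of arrows replaces the typing judgements
  \<open>f \<in> Hom C X Y\<close>: side conditions of rewriting become equations between sources
  and targets, which the simplifier can settle.\<close>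

definition arr :: "'a \<Rightarrow> bool" where
  "arr f \<longleftrightarrow> (\<exists>X Y. f \<in> Hom C X Y)"

definition src :: "'a \<Rightarrow> 'o" where
  "src f = (THE X. \<exists>Y. f \<in> Hom C X Y)"

definition tgt :: "'a \<Rightarrow> 'o" where
  "tgt f = (THE Y. \<exists>X. f \<in> Hom C X Y)"

lemma HomD:
  assumes "f \<in> Hom C X Y"
  shows "arr f" "src f = X" "tgt f = Y" "X \<in> Obj C" "Y \<in> Obj C"
  unfolding arr_def src_def tgt_def using assms Hom_disjoint[OF assms] Hom_Obj[OF assms] by blast+

lemma Hom_iff: "f \<in> Hom C X Y \<longleftrightarrow> arr f \<and> src f = X \<and> tgt f = Y"
  using HomD by (metis arr_def)

lemma arr_Hom: "arr f \<Longrightarrow> f \<in> Hom C (src f) (tgt f)"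
  by (simp add: Hom_iff)

lemma src_tgt_Obj [simp]:
  assumes "arr f"
  shows "src f \<in> Obj C" "tgt f \<in> Obj C"
  using HomD[OF arr_Hom[OF assms]] by auto

lemma arr_Ident [simp]:
  assumes "X \<in> Obj C"
  shows "arr (Ident C X)" "src (Ident C X) = X" "tgt (Ident C X) = X"
  using Id_closed[OF assms] by (auto simp: Hom_iff)

lemma arr_comp [simp]:
  assumes "arr f" "arr g" "src g = tgt f"
  shows "arr (g \<bullet> f)" "src (g \<bullet> f) = src f" "tgt (g \<bullet> f) = tgt g"
  using Comp_closed[of f "src f" "tgt f" g "tgt g"] assms by (auto simp: Hom_iff)

lemma comp_assoc [simp]:
  assumes "arr f" "arr g" "arr h" "src g = tgt f" "src h = tgt g"
  shows "(h \<bullet> g) \<bullet> f = h \<bullet> (g \<bullet> f)"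
  using Comp_assoc[of f "src f" "tgt f" g "tgt g" h "tgt h"] assms by (auto simp: Hom_iff)

lemma Ident_comp [simp]:
  assumes "arr f"
  shows "tgt f = Y \<Longrightarrow> Ident C Y \<bullet> f = f" "src f = X \<Longrightarrow> f \<bullet> Ident C X = f"
  using assms Id_left[OF arr_Hom] Id_right[OF arr_Hom] by auto

text \<open>Composition is kept nested to the right; this turns an equation between composites into a
  rewrite rule that also applies in front of a further factor.\<close>

lemma comp_cong_right:
  assumes "g \<bullet> f = h \<bullet> k"
    and "arr f" "arr g" "src g = tgt f" "arr h" "arr k" "src h = tgt k" "arr z" "tgt z = src f"
      "src k = src f"
  shows "g \<bullet> (f \<bullet> z) = h \<bullet> (k \<bullet> z)"
  using assms by (metis comp_assoc)

lemma comp_cong_right1: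
  assumes "g \<bullet> f = k"
    and "arr f" "arr g" "src g = tgt f" "arr z" "tgt z = src f"
  shows "g \<bullet> (f \<bullet> z) = k \<bullet> z"
  using assms by (metis comp_assoc)

end

section \<open>Fiber products of tangent objects\<close>

context tangent_fiber_powers
begin

abbreviation "T \<equiv> Tar C"
abbreviation "TO \<equiv> Tob C"

lemma Tob_Obj [simp]: "X \<in> Obj C \<Longrightarrow> TO X \<in> Obj C"
  by (rule Tob_closed)

lemma arr_T [simp]:
  assumes "arr f"
  shows "arr (T f)" "src (T f) = TO (src f)" "tgt (T f) = TO (tgt f)"
  using Tar_closed[OF arr_Hom[OF assms]] by (auto simp: Hom_iff)

lemma T_Ident [simp]: "X \<in> Obj C \<Longrightarrow> T (Ident C X) = Ident C (TO X)"
  by (rule Tar_Id)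

lemma T_comp [simp]: "arr f \<Longrightarrow> arr g \<Longrightarrow> src g = tgt f \<Longrightarrow> T (g \<bullet> f) = T g \<bullet> T f"
  using Tar_Comp[of f "src f" "tgt f" g "tgt g"] by (auto simp: Hom_iff)

lemma arr_tproj [simp]:
  assumes "X \<in> Obj C"
  shows "arr (tproj C X)" "src (tproj C X) = TO X" "tgt (tproj C X) = X"
  using tproj_closed[OF assms] by (auto simp: Hom_iff)

lemma tproj_T [simp]:
  assumes "arr f" "tgt f = Y"
  shows "tproj C Y \<bullet> T f = f \<bullet> tproj C (src f)"
    and "arr z \<Longrightarrow> tgt z = TO (src f) \<Longrightarrow> tproj C Y \<bullet> (T f \<bullet> z) = f \<bullet> (tproj C (src f) \<bullet> z)"
proof -
  show *: "tproj C Y \<bullet> T f = f \<bullet> tproj C (src f)"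
    using tproj_natural[of f "src f" "tgt f"] assms by (auto simp: Hom_iff)
  show "tproj C Y \<bullet> (T f \<bullet> z) = f \<bullet> (tproj C (src f) \<bullet> z)" if "arr z" "tgt z = TO (src f)"
    by (rule comp_cong_right[OF *]) (use assms that in auto)
qed

text \<open>Separate names for the case of two factors keep the numerals and indices of the general
  fiber powers out of the rewriting.\<close>

definition fprod :: "'o \<Rightarrow> 'o" where "fprod X = Tpow C 2 X"
definition fpr1 :: "'o \<Rightarrow> 'a" where "fpr1 X = tpr C 2 X 1"
definition fpr2 :: "'o \<Rightarrow> 'a" where "fpr2 X = tpr C 2 X 2"

lemma range_1_2: "{1..2::nat} = {1, 2}"
  by auto

lemma fpr_fiber_power:
  assumes X: "X \<in> Obj C"
  shows "fpr1 X \<in> Hom C (fprod X) (TO X)" "fpr2 X \<in> Hom C (fprod X) (TO X)"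
    "tproj C X \<bullet> fpr1 X = tproj C X \<bullet> fpr2 X"
    "\<And>a b Z. a \<in> Hom C Z (TO X) \<Longrightarrow> b \<in> Hom C Z (TO X) \<Longrightarrow> tproj C X \<bullet> a = tproj C X \<bullet> b \<Longrightarrow>
       \<exists>!h. h \<in> Hom C Z (fprod X) \<and> fpr1 X \<bullet> h = a \<and> fpr2 X \<bullet> h = b"
proof -
  have fp: "is_fiber_power (tproj C X) 2 (Tpow C 2 X) (tpr C 2 X)"
    by (rule Tpow_fiber_power[OF X]) simp
  have AB: "tproj C X \<in> Hom C (TO X) X" by (rule tproj_closed[OF X])
  from fp[unfolded is_fiber_power_def] obtain A B where *: "tproj C X \<in> Hom C A B" "\<forall>i \<in> {1..2}. tpr C 2 X i \<in> Hom C (Tpow C 2 X) A"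
    "\<forall>i \<in> {1..2}. \<forall>j \<in> {1..2}. tproj C X \<bullet> tpr C 2 X i = tproj C X \<bullet> tpr C 2 X j"
    "\<forall>Z a. (\<forall>i \<in> {1..2}. a i \<in> Hom C Z A) \<longrightarrow>
           (\<forall>i \<in> {1..2}. \<forall>j \<in> {1..2}. tproj C X \<bullet> a i = tproj C X \<bullet> a j) \<longrightarrow>
           (\<exists>!h. h \<in> Hom C Z (Tpow C 2 X) \<and> (\<forall>i \<in> {1..2}. tpr C 2 X i \<bullet> h = a i))"
    by (elim exE conjE) blast
  have A: "A = TO X" using *(1) AB Hom_disjoint by blast
  show "fpr1 X \<in> Hom C (fprod X) (TO X)" "fpr2 X \<in> Hom C (fprod X) (TO X)"
    "tproj C X \<bullet> fpr1 X = tproj C X \<bullet> fpr2 X"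
    using *(2,3) A unfolding fpr1_def fpr2_def fprod_def by auto
  fix a b Z assume a: "a \<in> Hom C Z (TO X)" "b \<in> Hom C Z (TO X)" "tproj C X \<bullet> a = tproj C X \<bullet> b"
  show "\<exists>!h. h \<in> Hom C Z (fprod X) \<and> fpr1 X \<bullet> h = a \<and> fpr2 X \<bullet> h = b"
    using *(4)[rule_format, of "\<lambda>i. if i = 1 then a else b" Z] a A
    unfolding range_1_2 fpr1_def fpr2_def fprod_def by simp
qed

lemma fprod_Obj [simp]: "X \<in> Obj C \<Longrightarrow> fprod X \<in> Obj C"
  using fpr_fiber_power(1) HomD by blast

lemma arr_fpr [simp]:
  assumes "X \<in> Obj C"
  shows "arr (fpr1 X)" "src (fpr1 X) = fprod X" "tgt (fpr1 X) = TO X"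
    "arr (fpr2 X)" "src (fpr2 X) = fprod X" "tgt (fpr2 X) = TO X"
  using fpr_fiber_power[OF assms] by (auto simp: Hom_iff)

lemma tproj_fpr2 [simp]: "X \<in> Obj C \<Longrightarrow> tproj C X \<bullet> fpr2 X = tproj C X \<bullet> fpr1 X"
  by (simp add: fpr_fiber_power(3))

lemma tproj_fpr2' [simp]: "X \<in> Obj C \<Longrightarrow> arr z \<Longrightarrow> tgt z = fprod X \<Longrightarrow>
    tproj C X \<bullet> (fpr2 X \<bullet> z) = tproj C X \<bullet> (fpr1 X \<bullet> z)"
  by (rule comp_cong_right) auto

text \<open>\<open>a\<close> and \<open>b\<close> are families of tangent vectors of \<open>X\<close> with the same base points.\<close>

definition compat :: "'o \<Rightarrow> 'a \<Rightarrow> 'a \<Rightarrow> bool" where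
  "compat X a b \<longleftrightarrow> X \<in> Obj C \<and> arr a \<and> arr b \<and> src a = src b \<and> tgt a = TO X \<and> tgt b = TO X \<and>
     tproj C X \<bullet> a = tproj C X \<bullet> b"

lemma compatD:
  assumes "compat X a b"
  shows "X \<in> Obj C" "arr a" "arr b" "src a = src b" "tgt a = TO X" "tgt b = TO X"
    "tproj C X \<bullet> a = tproj C X \<bullet> b"
  using assms unfolding compat_def by auto

lemma tpair_unique:
  assumes "X \<in> Obj C" "arr h" "arr k" "tgt h = fprod X" "tgt k = fprod X" "src h = src k"
    "fpr1 X \<bullet> h = fpr1 X \<bullet> k" "fpr2 X \<bullet> h = fpr2 X \<bullet> k"
  shows "h = k"
proof -
  have "\<exists>!h'. h' \<in> Hom C (src k) (fprod X) \<and> fpr1 X \<bullet> h' = fpr1 X \<bullet> k \<and> fpr2 X \<bullet> h' = fpr2 X \<bullet> k"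
    by (rule fpr_fiber_power(4)) (use assms in \<open>auto simp: Hom_iff\<close>)
  moreover have "h \<in> Hom C (src k) (fprod X)" "k \<in> Hom C (src k) (fprod X)"
    using assms(2-6) by (simp_all add: Hom_iff)
  ultimately show ?thesis using assms(7,8) by blast
qed

lemma tpair_props:
  assumes "compat X a b"
  shows "arr (tpair X a b)" "src (tpair X a b) = src b" "tgt (tpair X a b) = fprod X"
    "fpr1 X \<bullet> tpair X a b = a" "fpr2 X \<bullet> tpair X a b = b"
proof -
  note d = compatD[OF assms]
  have "\<exists>!h. h \<in> Hom C (src b) (fprod X) \<and> fpr1 X \<bullet> h = a \<and> fpr2 X \<bullet> h = b"
    by (rule fpr_fiber_power(4)) (use d in \<open>auto simp: Hom_iff\<close>)
  then obtain h where h: "h \<in> Hom C (src b) (fprod X)" "fpr1 X \<bullet> h = a" "fpr2 X \<bullet> h = b" by blast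
  have "tpair X a b = h"
    unfolding tpair_def fprod_def[symmetric] fpr1_def[symmetric] fpr2_def[symmetric]
  proof (rule the_equality)
    show "(\<exists>Z. h \<in> Hom C Z (fprod X)) \<and> fpr1 X \<bullet> h = a \<and> fpr2 X \<bullet> h = b" using h by blast
    fix k assume k: "(\<exists>Z. k \<in> Hom C Z (fprod X)) \<and> fpr1 X \<bullet> k = a \<and> fpr2 X \<bullet> k = b"
    then obtain Z where "k \<in> Hom C Z (fprod X)" by blast
    note k' = HomD[OF this]
    have "src k = src (fpr1 X \<bullet> k)" using k' d(1) by simp
    then have "src k = src a" using k by (simp only:)
    moreover have "arr k" "tgt k = fprod X" using k' by simp_all
    moreover have "fpr1 X \<bullet> k = fpr1 X \<bullet> h" "fpr2 X \<bullet> k = fpr2 X \<bullet> h" using k h(2,3) by simp_all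
    ultimately show "k = h" using d(1,4) HomD(1-3)[OF h(1)] by - (rule tpair_unique[of X], simp_all)
  qed
  then show "arr (tpair X a b)" "src (tpair X a b) = src b" "tgt (tpair X a b) = fprod X"
    "fpr1 X \<bullet> tpair X a b = a" "fpr2 X \<bullet> tpair X a b = b"
    using h(2,3) HomD(1-3)[OF h(1)] by simp_all
qed

lemma tpair_eta:
  assumes "X \<in> Obj C" "arr h" "tgt h = fprod X"
  shows "tpair X (fpr1 X \<bullet> h) (fpr2 X \<bullet> h) = h"
proof -
  have c: "compat X (fpr1 X \<bullet> h) (fpr2 X \<bullet> h)" using assms unfolding compat_def by simp
  note t = tpair_props[OF c]
  show ?thesis
    by (rule tpair_unique[OF assms(1) t(1) assms(2) t(3) assms(3) _ t(4,5)]) (use t(2) assms in simp)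
qed

lemma compat_comp:
  assumes "compat X a b" "arr z" "tgt z = src b"
  shows "compat X (a \<bullet> z) (b \<bullet> z)"
proof -
  note d = compatD[OF assms(1)]
  have "tproj C X \<bullet> (a \<bullet> z) = tproj C X \<bullet> (b \<bullet> z)"
    by (rule comp_cong_right[OF d(7)]) (use d(1-6) assms(2,3) in auto)
  then show ?thesis using d(1-6) assms(2,3) unfolding compat_def by simp
qed

lemma tpair_comp:
  assumes "compat X a b" "arr z" "tgt z = src b"
  shows "tpair X a b \<bullet> z = tpair X (a \<bullet> z) (b \<bullet> z)"
proof -
  have "fpr1 X \<bullet> (tpair X a b \<bullet> z) = a \<bullet> z" "fpr2 X \<bullet> (tpair X a b \<bullet> z) = b \<bullet> z"
    using assms(2,3) tpair_props(1-3)[OF assms(1)] compatD(1)[OF assms(1)]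
    by (simp_all add: comp_cong_right1[OF tpair_props(4)[OF assms(1)]]
        comp_cong_right1[OF tpair_props(5)[OF assms(1)]])
  moreover have "tpair X (fpr1 X \<bullet> (tpair X a b \<bullet> z)) (fpr2 X \<bullet> (tpair X a b \<bullet> z)) = tpair X a b \<bullet> z"
    by (rule tpair_eta) (use assms tpair_props[OF assms(1)] compatD(1)[OF assms(1)] in simp_all)
  ultimately show ?thesis by (simp only:)
qed

text \<open>Preservation of the fiber product by \<open>T\<close>, read on elements: a pair of
  second order vectors with equal face under \<open>T (tproj C X)\<close> is one arrow into
  \<open>TO (fprod X)\<close>. Statements about \<open>T\<close> of the addition thereby reduce to
  naturality along the arrow \<open>tplus C X\<close>.\<close>

lemma T_fpr_fiber_power:
  assumes X: "X \<in> Obj C" and ab: "arr a" "arr b" "src a = src b" "tgt a = TO (TO X)"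
    "tgt b = TO (TO X)" "T (tproj C X) \<bullet> a = T (tproj C X) \<bullet> b"
  obtains h where "arr h" "src h = src b" "tgt h = TO (fprod X)"
    "T (fpr1 X) \<bullet> h = a" "T (fpr2 X) \<bullet> h = b"
proof -
  have fp: "is_fiber_power (T (tproj C X)) 2 (TO (Tpow C 2 X)) (\<lambda>i. T (tpr C 2 X i))"
    by (rule Tpow_preserved[OF X]) simp
  from fp[unfolded is_fiber_power_def] obtain A B where *: "T (tproj C X) \<in> Hom C A B"
    "\<forall>Z a. (\<forall>i \<in> {1..2}. a i \<in> Hom C Z A) \<longrightarrow>
           (\<forall>i \<in> {1..2}. \<forall>j \<in> {1..2}. T (tproj C X) \<bullet> a i = T (tproj C X) \<bullet> a j) \<longrightarrow>
           (\<exists>!h. h \<in> Hom C Z (TO (Tpow C 2 X)) \<and> (\<forall>i \<in> {1..2}. T (tpr C 2 X i) \<bullet> h = a i))"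
    by (elim exE conjE) blast
  have A: "A = TO (TO X)"
    using Hom_disjoint[OF *(1) Tar_closed[OF tproj_closed[OF X]]] by simp
  have "\<exists>!h. h \<in> Hom C (src b) (TO (fprod X)) \<and> T (fpr1 X) \<bullet> h = a \<and> T (fpr2 X) \<bullet> h = b"
  proof -
    let ?g = "\<lambda>i::nat. if i = 1 then a else b"
    have g: "\<forall>i \<in> {1..2}. ?g i \<in> Hom C (src b) A" using ab(1-5) A by (auto simp: Hom_iff)
    have "\<forall>i \<in> {1..2}. \<forall>j \<in> {1..2}. T (tproj C X) \<bullet> ?g i = T (tproj C X) \<bullet> ?g j"
      using ab(6) by simp
    from *(2)[THEN spec, THEN spec, THEN mp, THEN mp, OF g this] show ?thesis
      unfolding range_1_2 fpr1_def fpr2_def fprod_def by simp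
  qed
  then obtain h where "h \<in> Hom C (src b) (TO (fprod X))" "T (fpr1 X) \<bullet> h = a" "T (fpr2 X) \<bullet> h = b"
    by blast
  then show thesis using that HomD(1-3) by blast
qed

text \<open>Associativity is an axiom about the generic triple of projections; composing it with
  such an \<open>h\<close> gives the law for three arbitrary tangent vectors.\<close>

lemma triple_exists:
  assumes ab: "compat X a b" and bc: "compat X b c"
  obtains h where "arr h" "src h = src c" "tgt h = Tpow C 3 X"
    "tpr C 3 X 1 \<bullet> h = a" "tpr C 3 X 2 \<bullet> h = b" "tpr C 3 X 3 \<bullet> h = c"
    "\<And>i. i \<in> {1,2,3} \<Longrightarrow> tpr C 3 X i \<in> Hom C (Tpow C 3 X) (TO X)"
    "\<And>i j. i \<in> {1,2,3} \<Longrightarrow> j \<in> {1,2,3} \<Longrightarrow> compat X (tpr C 3 X i) (tpr C 3 X j)"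
proof -
  have X: "X \<in> Obj C" using compatD[OF ab] by simp
  have r: "{1..3::nat} = {1,2,3}" by auto
  have fp: "is_fiber_power (tproj C X) 3 (Tpow C 3 X) (tpr C 3 X)"
    by (rule Tpow_fiber_power[OF X]) simp
  from this[unfolded is_fiber_power_def] obtain A B where *: "tproj C X \<in> Hom C A B" "\<forall>i \<in> {1..3}. tpr C 3 X i \<in> Hom C (Tpow C 3 X) A"
    "\<forall>i \<in> {1..3}. \<forall>j \<in> {1..3}. tproj C X \<bullet> tpr C 3 X i = tproj C X \<bullet> tpr C 3 X j"
    "\<forall>Z a. (\<forall>i \<in> {1..3}. a i \<in> Hom C Z A) \<longrightarrow>
           (\<forall>i \<in> {1..3}. \<forall>j \<in> {1..3}. tproj C X \<bullet> a i = tproj C X \<bullet> a j) \<longrightarrow>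
           (\<exists>!h. h \<in> Hom C Z (Tpow C 3 X) \<and> (\<forall>i \<in> {1..3}. tpr C 3 X i \<bullet> h = a i))"
    by (elim exE conjE) blast
  have A: "A = TO X" using Hom_disjoint[OF *(1) tproj_closed[OF X]] by simp
  have "\<exists>!h. h \<in> Hom C (src c) (Tpow C 3 X) \<and> (\<forall>i \<in> {1..3}. tpr C 3 X i \<bullet> h = (\<lambda>i. if i = 1 then a else if i = 2 then b else c) i)"
  proof (rule *(4)[THEN spec, THEN spec, THEN mp, THEN mp])
    show "\<forall>i \<in> {1..3}. (if i = 1 then a else if i = 2 then b else c) \<in> Hom C (src c) A"
      using compatD(1-6)[OF ab] compatD(1-6)[OF bc] A by (simp add: Hom_iff)
    show "\<forall>i \<in> {1..3}. \<forall>j \<in> {1..3}. tproj C X \<bullet> (if i = 1 then a else if i = 2 then b else c) =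
        tproj C X \<bullet> (if j = 1 then a else if j = 2 then b else c)"
      using compatD(7)[OF ab] compatD(7)[OF bc] by simp
  qed
  then obtain h where h: "h \<in> Hom C (src c) (Tpow C 3 X)"
    "tpr C 3 X 1 \<bullet> h = a" "tpr C 3 X 2 \<bullet> h = b" "tpr C 3 X 3 \<bullet> h = c"
    unfolding r by auto
  have t: "tpr C 3 X i \<in> Hom C (Tpow C 3 X) (TO X)" if "i \<in> {1,2,3}" for i
    using *(2) A that unfolding r by blast
  have "compat X (tpr C 3 X i) (tpr C 3 X j)" if "i \<in> {1,2,3}" "j \<in> {1,2,3}" for i j
  proof -
    have "tproj C X \<bullet> tpr C 3 X i = tproj C X \<bullet> tpr C 3 X j"
      using *(3) that unfolding r by blast
    then show ?thesis using X HomD[OF t[OF that(1)]] HomD[OF t[OF that(2)]] unfolding compat_def by simp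
  qed
  from that[OF HomD(1,2,3)[OF h(1)] h(2,3,4) t this] show thesis by blast
qed

end

section \<open>Fiberwise addition of tangent vectors\<close>

context tangent_category
begin

lemma arr_tzero [simp]:
  assumes "X \<in> Obj C"
  shows "arr (tzero C X)" "src (tzero C X) = X" "tgt (tzero C X) = TO X"
  using HomD[OF tzero_closed[OF assms]] by auto

lemma arr_tplus [simp]:
  assumes "X \<in> Obj C"
  shows "arr (tplus C X)" "src (tplus C X) = fprod X" "tgt (tplus C X) = TO X"
  using HomD[OF tplus_closed[OF assms]] unfolding fprod_def by auto

lemma arr_tlift [simp]:
  assumes "X \<in> Obj C"
  shows "arr (tlift C X)" "src (tlift C X) = TO X" "tgt (tlift C X) = TO (TO X)"
  using HomD[OF tlift_closed[OF assms]] by auto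

lemma arr_tflip [simp]:
  assumes "X \<in> Obj C"
  shows "arr (tflip C X)" "src (tflip C X) = TO (TO X)" "tgt (tflip C X) = TO (TO X)"
  using HomD[OF tflip_closed[OF assms]] by auto

lemma T_tzero [simp]:
  assumes "arr f" "src f = X"
  shows "T f \<bullet> tzero C X = tzero C (tgt f) \<bullet> f"
    and "arr z \<Longrightarrow> tgt z = X \<Longrightarrow> T f \<bullet> (tzero C X \<bullet> z) = tzero C (tgt f) \<bullet> (f \<bullet> z)"
proof -
  show *: "T f \<bullet> tzero C X = tzero C (tgt f) \<bullet> f"
    using tzero_natural[OF arr_Hom[OF assms(1)]] assms(2) by simp
  show "T f \<bullet> (tzero C X \<bullet> z) = tzero C (tgt f) \<bullet> (f \<bullet> z)" if "arr z" "tgt z = X"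
    by (rule comp_cong_right[OF *]) (use assms that src_tgt_Obj[OF assms(1)] in auto)
qed

lemma tproj_tzero' [simp]:
  assumes "X \<in> Obj C"
  shows "tproj C X \<bullet> tzero C X = Ident C X"
    and "arr z \<Longrightarrow> tgt z = X \<Longrightarrow> tproj C X \<bullet> (tzero C X \<bullet> z) = z"
proof -
  show *: "tproj C X \<bullet> tzero C X = Ident C X" by (rule tproj_tzero[OF assms])
  show "tproj C X \<bullet> (tzero C X \<bullet> z) = z" if "arr z" "tgt z = X"
    using comp_cong_right1[OF *, of z] assms that by simp
qed

lemma tflip_tflip' [simp]:
  assumes "X \<in> Obj C"
  shows "tflip C X \<bullet> tflip C X = Ident C (TO (TO X))"
    and "arr z \<Longrightarrow> tgt z = TO (TO X) \<Longrightarrow> tflip C X \<bullet> (tflip C X \<bullet> z) = z"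
proof -
  show *: "tflip C X \<bullet> tflip C X = Ident C (TO (TO X))" by (rule tflip_tflip[OF assms])
  show "tflip C X \<bullet> (tflip C X \<bullet> z) = z" if "arr z" "tgt z = TO (TO X)"
    using comp_cong_right1[OF *, of z] assms that by simp
qed

lemma tproj_tflip' [simp]:
  assumes "X \<in> Obj C"
  shows "tproj C (TO X) \<bullet> tflip C X = T (tproj C X)"
    and "arr z \<Longrightarrow> tgt z = TO (TO X) \<Longrightarrow>
      tproj C (TO X) \<bullet> (tflip C X \<bullet> z) = T (tproj C X) \<bullet> z"
proof -
  show *: "tproj C (TO X) \<bullet> tflip C X = T (tproj C X)" by (rule tproj_tflip[OF assms])
  show "tproj C (TO X) \<bullet> (tflip C X \<bullet> z) = T (tproj C X) \<bullet> z"
    if "arr z" "tgt z = TO (TO X)"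
    using comp_cong_right1[OF *, of z] assms that by simp
qed

lemma Tproj_tflip [simp]:
  assumes "X \<in> Obj C"
  shows "T (tproj C X) \<bullet> tflip C X = tproj C (TO X)"
    and "arr z \<Longrightarrow> tgt z = TO (TO X) \<Longrightarrow>
      T (tproj C X) \<bullet> (tflip C X \<bullet> z) = tproj C (TO X) \<bullet> z"
proof -
  have "T (tproj C X) \<bullet> tflip C X = (tproj C (TO X) \<bullet> tflip C X) \<bullet> tflip C X"
    using assms by (simp only: tproj_tflip')
  then show *: "T (tproj C X) \<bullet> tflip C X = tproj C (TO X)" 
    using assms by (simp del: tproj_tflip' tproj_T)
  show "T (tproj C X) \<bullet> (tflip C X \<bullet> z) = tproj C (TO X) \<bullet> z"
    if "arr z" "tgt z = TO (TO X)"
    using comp_cong_right1[OF *, of z] assms that by simp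
qed

lemma TT_tflip [simp]:
  assumes "arr f" "src f = X"
  shows "T (T f) \<bullet> tflip C X = tflip C (tgt f) \<bullet> T (T f)"
    and "arr z \<Longrightarrow> tgt z = TO (TO X) \<Longrightarrow>
      T (T f) \<bullet> (tflip C X \<bullet> z) = tflip C (tgt f) \<bullet> (T (T f) \<bullet> z)"
proof -
  show *: "T (T f) \<bullet> tflip C X = tflip C (tgt f) \<bullet> T (T f)"
    using tflip_natural[OF arr_Hom[OF assms(1)]] assms(2) by simp
  show "T (T f) \<bullet> (tflip C X \<bullet> z) = tflip C (tgt f) \<bullet> (T (T f) \<bullet> z)"
    if "arr z" "tgt z = TO (TO X)"
    by (rule comp_cong_right[OF *]) (use assms that src_tgt_Obj[OF assms(1)] in auto)
qed

lemma TT_tlift [simp]: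
  assumes "arr f" "src f = X"
  shows "T (T f) \<bullet> tlift C X = tlift C (tgt f) \<bullet> T f"
    and "arr z \<Longrightarrow> tgt z = TO X \<Longrightarrow>
      T (T f) \<bullet> (tlift C X \<bullet> z) = tlift C (tgt f) \<bullet> (T f \<bullet> z)"
proof -
  show *: "T (T f) \<bullet> tlift C X = tlift C (tgt f) \<bullet> T f"
    using tlift_natural[OF arr_Hom[OF assms(1)]] assms(2) by simp
  show "T (T f) \<bullet> (tlift C X \<bullet> z) = tlift C (tgt f) \<bullet> (T f \<bullet> z)"
    if "arr z" "tgt z = TO X"
    by (rule comp_cong_right[OF *]) (use assms that src_tgt_Obj[OF assms(1)] in auto)
qed

lemma tflip_tlift' [simp]:
  assumes "X \<in> Obj C"
  shows "tflip C X \<bullet> tlift C X = tlift C X"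
    and "arr z \<Longrightarrow> tgt z = TO X \<Longrightarrow> tflip C X \<bullet> (tlift C X \<bullet> z) = tlift C X \<bullet> z"
proof -
  show *: "tflip C X \<bullet> tlift C X = tlift C X" by (rule tflip_tlift[OF assms])
  show "tflip C X \<bullet> (tlift C X \<bullet> z) = tlift C X \<bullet> z" if "arr z" "tgt z = TO X"
    using comp_cong_right1[OF *, of z] assms that by simp
qed

lemma tproj_tlift' [simp]:
  assumes "X \<in> Obj C"
  shows "tproj C (TO X) \<bullet> tlift C X = tzero C X \<bullet> tproj C X"
    and "arr z \<Longrightarrow> tgt z = TO X \<Longrightarrow> tproj C (TO X) \<bullet> (tlift C X \<bullet> z) = tzero C X \<bullet> (tproj C X \<bullet> z)"
proof -
  show *: "tproj C (TO X) \<bullet> tlift C X = tzero C X \<bullet> tproj C X" by (rule tproj_tlift[OF assms])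
  show "tproj C (TO X) \<bullet> (tlift C X \<bullet> z) = tzero C X \<bullet> (tproj C X \<bullet> z)"
    if "arr z" "tgt z = TO X"
    using comp_cong_right1[OF *, of z] assms that by simp
qed

lemma Tproj_tlift [simp]:
  assumes "X \<in> Obj C"
  shows "T (tproj C X) \<bullet> tlift C X = tzero C X \<bullet> tproj C X"
    and "arr z \<Longrightarrow> tgt z = TO X \<Longrightarrow> T (tproj C X) \<bullet> (tlift C X \<bullet> z) = tzero C X \<bullet> (tproj C X \<bullet> z)"
proof -
  have "T (tproj C X) \<bullet> tlift C X = T (tproj C X) \<bullet> (tflip C X \<bullet> tlift C X)"
    using assms by (simp only: tflip_tlift')
  also have "\<dots> = tzero C X \<bullet> tproj C X"
    using assms by (simp del: tflip_tlift')
  finally show *: "T (tproj C X) \<bullet> tlift C X = tzero C X \<bullet> tproj C X" .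
  show "T (tproj C X) \<bullet> (tlift C X \<bullet> z) = tzero C X \<bullet> (tproj C X \<bullet> z)"
    if "arr z" "tgt z = TO X"
    using comp_cong_right1[OF *, of z] assms that by simp
qed

text \<open>Sum of generalized tangent vectors; through it the axioms of a group object are used as
  ordinary laws for elements with a common base point.\<close>

definition tadd :: "'o \<Rightarrow> 'a \<Rightarrow> 'a \<Rightarrow> 'a" where
  "tadd X a b = tplus C X \<bullet> tpair X a b"

lemma tadd_arr:
  assumes "compat X a b"
  shows "arr (tadd X a b)" "src (tadd X a b) = src b" "tgt (tadd X a b) = TO X"
  using tpair_props[OF assms] compatD(1)[OF assms] unfolding tadd_def by auto

lemma tproj_tadd:
  assumes "compat X a b"
  shows "tproj C X \<bullet> tadd X a b = tproj C X \<bullet> b"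
proof -
  note d = compatD[OF assms] and t = tpair_props[OF assms]
  have "tproj C X \<bullet> (tplus C X \<bullet> tpair X a b) = tproj C X \<bullet> (fpr1 X \<bullet> tpair X a b)"
    by (rule comp_cong_right[OF tproj_tplus[OF d(1), folded fpr1_def]]) (use t d(1) in simp_all)
  then show ?thesis unfolding tadd_def t(4) d(7) .
qed

lemma compat_refl: "arr a \<Longrightarrow> tgt a = TO X \<Longrightarrow> X \<in> Obj C \<Longrightarrow> compat X a a"
  unfolding compat_def by simp

lemma compat_sym: "compat X a b \<Longrightarrow> compat X b a"
  unfolding compat_def by simp

lemma compat_trans: "compat X a b \<Longrightarrow> compat X b c \<Longrightarrow> compat X a c"
  unfolding compat_def by simp

lemma compat_tadd:
  assumes "compat X a b" "compat X b c"
  shows "compat X (tadd X a b) c" "compat X c (tadd X a b)"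
  using assms tproj_tadd[OF assms(1)] tadd_arr[OF assms(1)] unfolding compat_def by simp_all

lemma tadd_comp:
  assumes "compat X a b" "arr z" "tgt z = src b"
  shows "tadd X a b \<bullet> z = tadd X (a \<bullet> z) (b \<bullet> z)"
  using assms(2,3) tpair_props[OF assms(1)] compatD(1)[OF assms(1)]
  by (simp add: tadd_def tpair_comp[OF assms])

lemma compat_T:
  assumes "compat X a b" "arr f" "src f = X"
  shows "compat (tgt f) (T f \<bullet> a) (T f \<bullet> b)"
  using compatD[OF assms(1)] assms(2,3) unfolding compat_def by simp

lemma compat_fpr: "X \<in> Obj C \<Longrightarrow> compat X (fpr1 X) (fpr2 X)"
  unfolding compat_def by simp

text \<open>Naturality of addition, read on elements. Applied to structure arrows such as
  \<open>tplus C X\<close> and \<open>tflip C X\<close>, it is the source of the interchange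
  laws.\<close>

lemma T_tadd:
  assumes "compat X a b" "arr f" "src f = X"
  shows "T f \<bullet> tadd X a b = tadd (tgt f) (T f \<bullet> a) (T f \<bullet> b)"
proof -
  note d = compatD[OF assms(1)] and t = tpair_props[OF assms(1)]
  let ?c = "tpair (tgt f) (T f \<bullet> fpr1 X) (T f \<bullet> fpr2 X)"
  have c: "compat (tgt f) (T f \<bullet> fpr1 X) (T f \<bullet> fpr2 X)"
    by (rule compat_T[OF compat_fpr[OF d(1)] assms(2,3)])
  have "T2ar X (tgt f) f = ?c" by (simp add: T2ar_def fpr1_def fpr2_def)
  then have "T f \<bullet> tplus C X = tplus C (tgt f) \<bullet> ?c"
    using tplus_natural[of f X "tgt f"] assms(2,3) by (simp add: Hom_iff)
  then have "T f \<bullet> (tplus C X \<bullet> tpair X a b) = tplus C (tgt f) \<bullet> (?c \<bullet> tpair X a b)"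
    by (rule comp_cong_right) (use t d(1) assms(2,3) tpair_props[OF c] in simp_all)
  also have "?c \<bullet> tpair X a b = tpair (tgt f) (T f \<bullet> a) (T f \<bullet> b)"
    using t d(1) assms(2,3) by (simp add: tpair_comp[OF c])
  finally show ?thesis unfolding tadd_def .
qed

lemma tadd_comm:
  assumes "compat X a b"
  shows "tadd X a b = tadd X b a"
proof -
  note d = compatD[OF assms] and t = tpair_props[OF assms]
  have c: "compat X (fpr2 X) (fpr1 X)" by (rule compat_sym[OF compat_fpr[OF d(1)]])
  have e: "tplus C X \<bullet> tpair X (fpr2 X) (fpr1 X) = tplus C X"
    using tplus_comm[OF d(1)] unfolding fpr1_def fpr2_def .
  have "tplus C X \<bullet> (tpair X (fpr2 X) (fpr1 X) \<bullet> tpair X a b) = tplus C X \<bullet> tpair X a b"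
    by (rule comp_cong_right1[OF e]) (use tpair_props[OF c] t d in simp_all)
  also have "tpair X (fpr2 X) (fpr1 X) \<bullet> tpair X a b = tpair X b a"
    by (subst tpair_comp[OF c]) (use t d(1) in simp_all)
  finally show ?thesis unfolding tadd_def by simp
qed

lemma tadd_tzero:
  assumes "X \<in> Obj C" "arr a" "tgt a = TO X"
  shows "tadd X a (tzero C X \<bullet> (tproj C X \<bullet> a)) = a"
proof -
  have c: "compat X (Ident C (TO X)) (tzero C X \<bullet> tproj C X)"
    using assms(1) unfolding compat_def by simp
  have "tadd X (Ident C (TO X)) (tzero C X \<bullet> tproj C X) \<bullet> a = Ident C (TO X) \<bullet> a"
    using tplus_tzero[OF assms(1)] unfolding tadd_def by simp
  then show ?thesis using assms by (simp add: tadd_comp[OF c])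
qed

lemma tadd_assoc:
  assumes ab: "compat X a b" and bc: "compat X b c"
  shows "tadd X (tadd X a b) c = tadd X a (tadd X b c)"
proof -
  obtain h where h: "arr h" "src h = src c" "tgt h = Tpow C 3 X"
    "tpr C 3 X 1 \<bullet> h = a" "tpr C 3 X 2 \<bullet> h = b" "tpr C 3 X 3 \<bullet> h = c"
    "\<And>i. i \<in> {1,2,3} \<Longrightarrow> tpr C 3 X i \<in> Hom C (Tpow C 3 X) (TO X)"
    "\<And>i j. i \<in> {1,2,3} \<Longrightarrow> j \<in> {1,2,3} \<Longrightarrow> compat X (tpr C 3 X i) (tpr C 3 X j)"
    using triple_exists[OF ab bc] by blast
  have c: "compat X (tpr C 3 X 1) (tpr C 3 X 2)" "compat X (tpr C 3 X 2) (tpr C 3 X 3)"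
    by (rule h(8); simp)+
  have s: "src (tpr C 3 X 2) = Tpow C 3 X" "src (tpr C 3 X 3) = Tpow C 3 X"
    using HomD(2)[OF h(7)] by simp_all
  have "tadd X (tadd X (tpr C 3 X 1) (tpr C 3 X 2)) (tpr C 3 X 3) =
    tadd X (tpr C 3 X 1) (tadd X (tpr C 3 X 2) (tpr C 3 X 3))"
    using tplus_assoc[OF compatD(1)[OF ab]] unfolding tadd_def .
  then have "tadd X (tadd X (tpr C 3 X 1) (tpr C 3 X 2)) (tpr C 3 X 3) \<bullet> h =
    tadd X (tpr C 3 X 1) (tadd X (tpr C 3 X 2) (tpr C 3 X 3)) \<bullet> h" by simp
  then show ?thesis
    using s by (simp only: tadd_comp[OF compat_tadd(1)[OF c] h(1)]
        tadd_comp[OF compat_tadd(2)[OF c(2) compat_sym[OF compat_trans[OF c]]] h(1)]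
        tadd_comp[OF c(1) h(1)] tadd_comp[OF c(2) h(1)] tadd_arr[OF c(2)] h(3-6))
qed

lemma tadd_tzero':
  assumes "X \<in> Obj C" "arr a" "tgt a = TO X" "y = tproj C X \<bullet> a"
  shows "tadd X a (tzero C X \<bullet> y) = a" "tadd X (tzero C X \<bullet> y) a = a" "compat X a (tzero C X \<bullet> y)"
    "compat X (tzero C X \<bullet> y) a"
proof -
  show c: "compat X a (tzero C X \<bullet> y)" using assms unfolding compat_def by simp
  then show "compat X (tzero C X \<bullet> y) a" by (rule compat_sym)
  show z: "tadd X a (tzero C X \<bullet> y) = a" using tadd_tzero assms by simp
  show "tadd X (tzero C X \<bullet> y) a = a" using z tadd_comm[OF c] by simp
qed

lemma tneg_unique:
  assumes X: "X \<in> Obj C"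
    and n: "compat X b n" "tadd X b n = tzero C X \<bullet> (tproj C X \<bullet> b)"
    and n': "compat X b n'" "tadd X b n' = tzero C X \<bullet> (tproj C X \<bullet> b)"
  shows "n = n'"
proof -
  note d = compatD[OF n(1)] and d' = compatD[OF n'(1)]
  have "n = tadd X n (tzero C X \<bullet> (tproj C X \<bullet> b))" using tadd_tzero'(1)[OF X d(3,6,7)] by simp
  also have "\<dots> = tadd X n (tadd X b n')" by (simp add: n'(2))
  also have "\<dots> = tadd X (tadd X n b) n'" by (simp add: tadd_assoc[OF compat_sym[OF n(1)] n'(1)])
  also have "tadd X n b = tzero C X \<bullet> (tproj C X \<bullet> b)" using tadd_comm[OF n(1)] n(2) by simp
  also have "tadd X (tzero C X \<bullet> (tproj C X \<bullet> b)) n' = n'" using tadd_tzero'(2)[OF X d'(3,6,7)] by simp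
  finally show ?thesis .
qed

lemma tneg_props:
  assumes X: "X \<in> Obj C"
  shows "arr (tneg X)" "src (tneg X) = TO X" "tgt (tneg X) = TO X" "tproj C X \<bullet> tneg X = tproj C X"
    "tadd X (Ident C (TO X)) (tneg X) = tzero C X \<bullet> tproj C X"
proof -
  let ?P = "\<lambda>n. n \<in> Hom C (TO X) (TO X) \<and> tproj C X \<bullet> n = tproj C X \<and>
     tplus C X \<bullet> tpair X (Ident C (TO X)) n = tzero C X \<bullet> tproj C X"
  have "\<exists>!n. ?P n"
  proof (rule ex_ex1I)
    show "\<exists>n. ?P n" using tplus_inverse[OF X] by blast
    fix n n' assume n: "?P n" and n': "?P n'"
    have c: "compat X (Ident C (TO X)) m" if "?P m" for m
      using that X unfolding compat_def by (simp add: Hom_iff)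
    show "n = n'"
      by (rule tneg_unique[OF X c[OF n] _ c[OF n']]) (use n n' X in \<open>simp_all add: tadd_def\<close>)
  qed
  then have "?P (tneg X)" unfolding tneg_def by (rule theI')
  then show "arr (tneg X)" "src (tneg X) = TO X" "tgt (tneg X) = TO X"
    "tproj C X \<bullet> tneg X = tproj C X" "tadd X (Ident C (TO X)) (tneg X) = tzero C X \<bullet> tproj C X"
    by (simp_all add: tadd_def Hom_iff)
qed

lemma tneg_comp:
  assumes X: "X \<in> Obj C" and a: "arr a" "tgt a = TO X"
  shows "compat X a (tneg X \<bullet> a)" "tadd X a (tneg X \<bullet> a) = tzero C X \<bullet> (tproj C X \<bullet> a)"
    "tproj C X \<bullet> (tneg X \<bullet> a) = tproj C X \<bullet> a"
proof -
  note n = tneg_props[OF X]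
  show p: "tproj C X \<bullet> (tneg X \<bullet> a) = tproj C X \<bullet> a"
    by (rule comp_cong_right1[OF n(4)]) (use n X a in simp_all)
  show "compat X a (tneg X \<bullet> a)" using n(1-3) p X a unfolding compat_def by simp
  have c: "compat X (Ident C (TO X)) (tneg X)" using n X unfolding compat_def by simp
  have "tadd X (Ident C (TO X)) (tneg X) \<bullet> a = (tzero C X \<bullet> tproj C X) \<bullet> a" using n(5) by simp
  then show "tadd X a (tneg X \<bullet> a) = tzero C X \<bullet> (tproj C X \<bullet> a)"
    using n(1-3) X a by (simp add: tadd_comp[OF c])
qed

lemma tadd_cancel:
  assumes "compat X a b" "compat X a c" "tadd X a b = tadd X a c"
  shows "b = c"
proof -
  note d = compatD[OF assms(1)] compatD[OF assms(2)]
  note n = tneg_comp[OF d(1,2,5)]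
  have *: "tadd X (tneg X \<bullet> a) (tadd X a x) = x" if x: "compat X a x" for x
  proof -
    have "tadd X (tneg X \<bullet> a) (tadd X a x) = tadd X (tadd X (tneg X \<bullet> a) a) x"
      by (rule tadd_assoc[OF compat_sym[OF n(1)] x, symmetric])
    also have "\<dots> = tadd X (tadd X a (tneg X \<bullet> a)) x" by (simp only: tadd_comm[OF n(1)])
    also have "\<dots> = x" unfolding n(2) using compatD(3,6,7)[OF x] d(1) by (intro tadd_tzero'(2))
    finally show ?thesis .
  qed
  show ?thesis by (rule trans[OF *[OF assms(1), symmetric, unfolded assms(3)] *[OF assms(2)]])
qed

text \<open>Characterizes the difference by an equation between sums, which is the form in which it
  enters the bracket.\<close>

lemma tminus_solve:
  assumes "compat X a b"
  shows "compat X b (tminus X \<bullet> tpair X a b)" "tadd X b (tminus X \<bullet> tpair X a b) = a"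
proof -
  note d = compatD[OF assms] and t = tpair_props[OF assms]
  note n = tneg_comp[OF d(1,3,6)] and m = tneg_props[OF d(1)]
  have "fpr1 X \<in> Hom C (fprod X) (TO X)" using d(1) by (simp add: Hom_iff)
  have c: "compat X (fpr1 X) (tneg X \<bullet> fpr2 X)"
    using d(1) m(1-3) tneg_comp(3)[OF d(1), of "fpr2 X"] unfolding compat_def by simp
  have "tminus X = tadd X (fpr1 X) (tneg X \<bullet> fpr2 X)"
    unfolding tminus_def tadd_def fpr1_def fpr2_def ..
  then have e: "tminus X \<bullet> tpair X a b = tadd X a (tneg X \<bullet> b)"
    using t d m by (simp add: tadd_comp[OF c])
  have c1: "compat X a (tneg X \<bullet> b)" by (rule compat_trans[OF assms n(1)])
  show "compat X b (tminus X \<bullet> tpair X a b)"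
    unfolding e by (rule compat_tadd(2)[OF c1 compat_sym[OF n(1)]])
  have "tadd X b (tadd X a (tneg X \<bullet> b)) = tadd X b (tadd X (tneg X \<bullet> b) a)"
    by (simp only: tadd_comm[OF c1])
  also have "\<dots> = tadd X (tadd X b (tneg X \<bullet> b)) a"
    by (rule tadd_assoc[OF n(1) compat_sym[OF c1], symmetric])
  also have "\<dots> = a" using n(2) tadd_tzero'(2)[OF d(1,2,5) d(7)[symmetric]] by simp
  finally show "tadd X b (tminus X \<bullet> tpair X a b) = a" unfolding e .
qed

section \<open>Second order tangent vectors and their two additions\<close>

text \<open>Addition in the direction of the outer tangent functor, \<open>T(+)\<close>.\<close>

definition hadd :: "'o \<Rightarrow> 'a \<Rightarrow> 'a \<Rightarrow> 'a" where
  "hadd X a b = tflip C X \<bullet> tadd (TO X) (tflip C X \<bullet> a) (tflip C X \<bullet> b)"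

definition hcompat :: "'o \<Rightarrow> 'a \<Rightarrow> 'a \<Rightarrow> bool" where
  "hcompat X a b \<longleftrightarrow> X \<in> Obj C \<and> arr a \<and> arr b \<and> src a = src b \<and> tgt a = TO (TO X) \<and>
     tgt b = TO (TO X) \<and> T (tproj C X) \<bullet> a = T (tproj C X) \<bullet> b"

lemma hcompatD:
  assumes "hcompat X a b"
  shows "X \<in> Obj C" "arr a" "arr b" "src a = src b" "tgt a = TO (TO X)"
    "tgt b = TO (TO X)" "T (tproj C X) \<bullet> a = T (tproj C X) \<bullet> b"
    "compat (TO X) (tflip C X \<bullet> a) (tflip C X \<bullet> b)"
  using assms unfolding hcompat_def compat_def by auto

lemma hadd_arr:
  assumes "hcompat X a b"
  shows "arr (hadd X a b)" "src (hadd X a b) = src b" "tgt (hadd X a b) = TO (TO X)"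
  using hcompatD(1-6)[OF assms] tadd_arr[OF hcompatD(8)[OF assms]] unfolding hadd_def by auto

lemma tflip_hadd:
  assumes "hcompat X a b"
  shows "tflip C X \<bullet> hadd X a b = tadd (TO X) (tflip C X \<bullet> a) (tflip C X \<bullet> b)"
  using hcompatD(1-6)[OF assms] tadd_arr[OF hcompatD(8)[OF assms]] unfolding hadd_def by simp

lemma tflip_tadd:
  assumes "compat (TO X) a b" "X \<in> Obj C"
  shows "tflip C X \<bullet> tadd (TO X) a b = hadd X (tflip C X \<bullet> a) (tflip C X \<bullet> b)"
    "hcompat X (tflip C X \<bullet> a) (tflip C X \<bullet> b)"
  using compatD[OF assms(1)] assms(2) unfolding hadd_def hcompat_def by simp_all

lemma Tproj_hadd:
  assumes "hcompat X a b"
  shows "T (tproj C X) \<bullet> hadd X a b = T (tproj C X) \<bullet> b"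
    and "tproj C (TO X) \<bullet> hadd X a b = tadd X (tproj C (TO X) \<bullet> a) (tproj C (TO X) \<bullet> b)"
    and "compat X (tproj C (TO X) \<bullet> a) (tproj C (TO X) \<bullet> b)"
proof -
  note d = hcompatD[OF assms] and t = tadd_arr[OF hcompatD(8)[OF assms]]
  show "T (tproj C X) \<bullet> hadd X a b = T (tproj C X) \<bullet> b"
    unfolding hadd_def using d(1-6) t by (simp add: tproj_tadd[OF d(8)])
  show "tproj C (TO X) \<bullet> hadd X a b = tadd X (tproj C (TO X) \<bullet> a) (tproj C (TO X) \<bullet> b)"
    unfolding hadd_def using d(1-6) t by (simp add: T_tadd[OF d(8)])
  show "compat X (tproj C (TO X) \<bullet> a) (tproj C (TO X) \<bullet> b)"
    using compat_T[OF d(8), of "tproj C X"] d(1-6) by simp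
qed

lemma hadd_comp:
  assumes "hcompat X a b" "arr z" "tgt z = src b"
  shows "hadd X a b \<bullet> z = hadd X (a \<bullet> z) (b \<bullet> z)" "hcompat X (a \<bullet> z) (b \<bullet> z)"
proof -
  note d = hcompatD[OF assms(1)] and t = tadd_arr[OF hcompatD(8)[OF assms(1)]]
  show "hadd X a b \<bullet> z = hadd X (a \<bullet> z) (b \<bullet> z)"
    unfolding hadd_def using d(1-6) t assms(2,3) by (simp add: tadd_comp[OF d(8)])
  show "hcompat X (a \<bullet> z) (b \<bullet> z)"
    unfolding hcompat_def using d(1-6) assms(2,3)
    by (simp add: comp_cong_right[OF d(7)])
qed

text \<open>By the flip axiom for addition, \<open>tflip C X\<close> carries \<open>T\<close> of the
  addition to the fiberwise addition of \<open>T (T X)\<close>; \<open>hadd\<close> is the latter,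
  conjugated by the flip.\<close>

lemma T_tadd_hadd:
  assumes "compat X a b"
  shows "T (tadd X a b) = hadd X (T a) (T b)" "hcompat X (T a) (T b)"
proof -
  note d = compatD[OF assms] and t = tpair_props[OF assms]
  have c: "compat (TO X) (tflip C X \<bullet> T (fpr1 X)) (tflip C X \<bullet> T (fpr2 X))"
    using d(1) arg_cong[OF tproj_fpr2[OF d(1)], of "T"] unfolding compat_def by (simp del: tproj_fpr2)
  have e: "tadd (TO X) (tflip C X \<bullet> T (fpr1 X)) (tflip C X \<bullet> T (fpr2 X)) =
      tflip C X \<bullet> T (tplus C X)"
    using tplus_tflip[OF d(1)] unfolding tadd_def fpr1_def fpr2_def .
  have T: "T (fpr1 X) \<bullet> T (tpair X a b) = T a" "T (fpr2 X) \<bullet> T (tpair X a b) = T b"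
    using t d(1) T_comp[of "tpair X a b" "fpr1 X"] T_comp[of "tpair X a b" "fpr2 X"] by simp_all
  have "tadd (TO X) (tflip C X \<bullet> T (fpr1 X)) (tflip C X \<bullet> T (fpr2 X)) \<bullet> T (tpair X a b) =
      (tflip C X \<bullet> T (tplus C X)) \<bullet> T (tpair X a b)"
    by (simp only: e)
  then have "tadd (TO X) (tflip C X \<bullet> T a) (tflip C X \<bullet> T b) = tflip C X \<bullet> T (tadd X a b)"
    using d(1) t T by (simp add: tadd_comp[OF c] tadd_def[of X a b])
  then have "tflip C X \<bullet> tadd (TO X) (tflip C X \<bullet> T a) (tflip C X \<bullet> T b) =
     tflip C X \<bullet> (tflip C X \<bullet> T (tadd X a b))" by simp
  then show "T (tadd X a b) = hadd X (T a) (T b)"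
    using d(1) tadd_arr[OF assms] by (simp add: hadd_def)
  have "T (tproj C X \<bullet> a) = T (tproj C X \<bullet> b)" by (simp only: d(7))
  then show "hcompat X (T a) (T b)" unfolding hcompat_def using d(1-6) by simp
qed

text \<open>The pairs (a, b) and (c, d) are arrows \<open>h\<close> and \<open>k\<close> into
  \<open>TO (fprod X)\<close> over the same base point. Both sides are \<open>T (tplus C X)\<close>
  applied to the fiberwise sum of \<open>h\<close> and \<open>k\<close>: additivity of this tangent
  map gives one side, additivity of the tangent maps of the projections the other.\<close>

lemma interchange:
  assumes ab: "hcompat X a b" and cd: "hcompat X c d"
    and ac: "compat (TO X) a c" and bd: "compat (TO X) b d"
  shows "tadd (TO X) (hadd X a b) (hadd X c d) = hadd X (tadd (TO X) a c) (tadd (TO X) b d)"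
    "compat (TO X) (hadd X a b) (hadd X c d)"
    "hcompat X (tadd (TO X) a c) (tadd (TO X) b d)"
proof -
  note A = hcompatD[OF ab] and B = hcompatD[OF cd]
  obtain h where h: "arr h" "src h = src b" "tgt h = TO (fprod X)"
    "T (fpr1 X) \<bullet> h = a" "T (fpr2 X) \<bullet> h = b"
    by (rule T_fpr_fiber_power[OF A(1-7)])
  obtain k where k: "arr k" "src k = src d" "tgt k = TO (fprod X)"
    "T (fpr1 X) \<bullet> k = c" "T (fpr2 X) \<bullet> k = d"
    by (rule T_fpr_fiber_power[OF B(1-7)])
  have *: "T (tplus C X) \<bullet> m = hadd X (T (fpr1 X) \<bullet> m) (T (fpr2 X) \<bullet> m)"
    "hcompat X (T (fpr1 X) \<bullet> m) (T (fpr2 X) \<bullet> m)"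
    if "arr m" "tgt m = TO (fprod X)" for m
  proof -
    have "tadd X (fpr1 X) (fpr2 X) = tplus C X"
      using tpair_eta[of X "Ident C (fprod X)"] A(1) unfolding tadd_def by simp
    then have "T (tplus C X) = hadd X (T (fpr1 X)) (T (fpr2 X))"
      using T_tadd_hadd(1)[OF compat_fpr[OF A(1)]] by simp
    then show "T (tplus C X) \<bullet> m = hadd X (T (fpr1 X) \<bullet> m) (T (fpr2 X) \<bullet> m)"
      using hadd_comp(1)[OF T_tadd_hadd(2)[OF compat_fpr[OF A(1)]], of m] that A(1) by simp
    show "hcompat X (T (fpr1 X) \<bullet> m) (T (fpr2 X) \<bullet> m)"
      using hadd_comp(2)[OF T_tadd_hadd(2)[OF compat_fpr[OF A(1)]], of m] that A(1) by simp
  qed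
  have s: "src b = src d" using compatD(4)[OF bd] .
  \<comment> \<open>The base points of \<open>h\<close> and \<open>k\<close> in
    \<open>fprod X\<close> are compared through the two projections.\<close>
  have 1: "fpr1 X \<bullet> (tproj C (fprod X) \<bullet> h) = fpr1 X \<bullet> (tproj C (fprod X) \<bullet> k)"
  proof -
    have "fpr1 X \<bullet> (tproj C (fprod X) \<bullet> h) = tproj C (TO X) \<bullet> (T (fpr1 X) \<bullet> h)"
      using h(1-3) A(1) by simp
    also have "\<dots> = tproj C (TO X) \<bullet> (T (fpr1 X) \<bullet> k)"
      unfolding h(4) k(4) by (rule compatD(7)[OF ac])
    also have "\<dots> = fpr1 X \<bullet> (tproj C (fprod X) \<bullet> k)" using k(1-3) A(1) by simp
    finally show ?thesis .
  qed
  have 2: "fpr2 X \<bullet> (tproj C (fprod X) \<bullet> h) = fpr2 X \<bullet> (tproj C (fprod X) \<bullet> k)"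
  proof -
    have "fpr2 X \<bullet> (tproj C (fprod X) \<bullet> h) = tproj C (TO X) \<bullet> (T (fpr2 X) \<bullet> h)"
      using h(1-3) A(1) by simp
    also have "\<dots> = tproj C (TO X) \<bullet> (T (fpr2 X) \<bullet> k)"
      unfolding h(5) k(5) by (rule compatD(7)[OF bd])
    also have "\<dots> = fpr2 X \<bullet> (tproj C (fprod X) \<bullet> k)" using k(1-3) A(1) by simp
    finally show ?thesis .
  qed
  have "tproj C (fprod X) \<bullet> h = tproj C (fprod X) \<bullet> k"
    by (rule tpair_unique[OF A(1) _ _ _ _ _ 1 2]) (use h(1-3) k(1-3) A(1) s in simp_all)
  then have hk: "compat (fprod X) h k" using h(1-3) k(1-3) A(1) s unfolding compat_def by simp
  note m = tadd_arr[OF hk]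
  have p: "T (fpr1 X) \<bullet> tadd (fprod X) h k = tadd (TO X) a c"
      "T (fpr2 X) \<bullet> tadd (fprod X) h k = tadd (TO X) b d"
    using T_tadd[OF hk, of "fpr1 X"] T_tadd[OF hk, of "fpr2 X"] A(1) h k by simp_all
  have q: "T (tplus C X) \<bullet> tadd (fprod X) h k =
      tadd (TO X) (T (tplus C X) \<bullet> h) (T (tplus C X) \<bullet> k)"
      "compat (TO X) (T (tplus C X) \<bullet> h) (T (tplus C X) \<bullet> k)"
    using T_tadd[OF hk, of "tplus C X"] compat_T[OF hk, of "tplus C X"] A(1) by simp_all
  show "tadd (TO X) (hadd X a b) (hadd X c d) = hadd X (tadd (TO X) a c) (tadd (TO X) b d)"
    using q(1) *(1)[OF m(1,3)] *(1)[OF h(1,3)] *(1)[OF k(1,3)] p h(4,5) k(4,5) by simp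
  show "compat (TO X) (hadd X a b) (hadd X c d)"
    using q(2) *(1)[OF h(1,3)] *(1)[OF k(1,3)] h(4,5) k(4,5) by simp
  show "hcompat X (tadd (TO X) a c) (tadd (TO X) b d)" using *(2)[OF m(1,3)] p by simp
qed

text \<open>Additivity for \<open>hadd\<close> follows from the axiom for the fiberwise addition,
  because the flip fixes lifts and exchanges the two additions.\<close>

lemma tlift_tadd:
  assumes "compat X a b"
  shows "tlift C X \<bullet> tadd X a b = tadd (TO X) (tlift C X \<bullet> a) (tlift C X \<bullet> b)"
    "compat (TO X) (tlift C X \<bullet> a) (tlift C X \<bullet> b)"
    "hcompat X (tlift C X \<bullet> a) (tlift C X \<bullet> b)"
    "tlift C X \<bullet> tadd X a b = hadd X (tlift C X \<bullet> a) (tlift C X \<bullet> b)"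
proof -
  note d = compatD[OF assms] and t = tpair_props[OF assms]
  have c: "compat (TO X) (tlift C X \<bullet> fpr1 X) (tlift C X \<bullet> fpr2 X)"
    using d(1) unfolding compat_def by simp
  have e: "tadd (TO X) (tlift C X \<bullet> fpr1 X) (tlift C X \<bullet> fpr2 X) = tlift C X \<bullet> tplus C X"
    using tplus_tlift[OF d(1)] unfolding tadd_def fpr1_def fpr2_def .
  have "tadd (TO X) (tlift C X \<bullet> fpr1 X) (tlift C X \<bullet> fpr2 X) \<bullet> tpair X a b =
      (tlift C X \<bullet> tplus C X) \<bullet> tpair X a b"
    by (simp only: e)
  then show 1: "tlift C X \<bullet> tadd X a b = tadd (TO X) (tlift C X \<bullet> a) (tlift C X \<bullet> b)"
    using d(1) t by (simp add: tadd_comp[OF c] tadd_def[of X a b])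
  show 2: "compat (TO X) (tlift C X \<bullet> a) (tlift C X \<bullet> b)" using d unfolding compat_def by simp
  show "hcompat X (tlift C X \<bullet> a) (tlift C X \<bullet> b)" using d unfolding hcompat_def by simp
  have "tlift C X \<bullet> tadd X a b = tflip C X \<bullet> (tlift C X \<bullet> tadd X a b)"
    using d(1) tadd_arr[OF assms] by simp
  also have "\<dots> = hadd X (tlift C X \<bullet> a) (tlift C X \<bullet> b)"
    unfolding 1 using tflip_tadd(1)[OF 2 d(1)] d(1-6) by simp
  finally show "tlift C X \<bullet> tadd X a b = hadd X (tlift C X \<bullet> a) (tlift C X \<bullet> b)" .
qed


text \<open>In a group an idempotent is zero. In this way additive operations are seen to preserve
  zero vectors.\<close>

lemma idem_tzero:
  assumes "Y \<in> Obj C" "arr z" "tgt z = TO Y" "tadd Y z z = z"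
  shows "z = tzero C Y \<bullet> (tproj C Y \<bullet> z)"
proof -
  note c = compat_refl[OF assms(2,3,1)] and z = tadd_tzero'(1,3)[OF assms(1,2,3) refl]
  show ?thesis by (rule tadd_cancel[OF c z(2)]) (simp only: z(1) assms(4))
qed

lemma Tproj_Ttzero [simp]:
  assumes "X \<in> Obj C"
  shows "T (tproj C X) \<bullet> T (tzero C X) = Ident C (TO X)"
    and "arr z \<Longrightarrow> tgt z = TO X \<Longrightarrow> T (tproj C X) \<bullet> (T (tzero C X) \<bullet> z) = z"
proof -
  show *: "T (tproj C X) \<bullet> T (tzero C X) = Ident C (TO X)"
    using assms T_comp[of "tzero C X" "tproj C X"] by simp
  show "T (tproj C X) \<bullet> (T (tzero C X) \<bullet> z) = z" if "arr z" "tgt z = TO X"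
    using comp_cong_right1[OF *, of z] assms that by simp
qed

text \<open>\<open>T (tzero C X)\<close> is idempotent for \<open>hadd\<close>, so its flip is
  idempotent for the fiberwise addition and hence a zero vector.\<close>

lemma tflip_Ttzero [simp]:
  assumes X: "X \<in> Obj C"
  shows "tflip C X \<bullet> T (tzero C X) = tzero C (TO X)"
    and "arr z \<Longrightarrow> tgt z = TO X \<Longrightarrow> tflip C X \<bullet> (T (tzero C X) \<bullet> z) = tzero C (TO X) \<bullet> z"
proof -
  have c: "compat X (tzero C X) (tzero C X)" using X unfolding compat_def by simp
  have t: "tadd X (tzero C X) (tzero C X) = tzero C X"
    using tadd_tzero'(1)[OF X, of "tzero C X" "Ident C X"] X by simp
  note T = T_tadd_hadd[OF c, unfolded t]
  have "tadd (TO X) (tflip C X \<bullet> T (tzero C X)) (tflip C X \<bullet> T (tzero C X)) =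
      tflip C X \<bullet> T (tzero C X)"
    using tflip_hadd[OF T(2)] unfolding T(1)[symmetric] by simp
  from idem_tzero[OF _ _ _ this] show *: "tflip C X \<bullet> T (tzero C X) = tzero C (TO X)"
    using X by simp
  show "tflip C X \<bullet> (T (tzero C X) \<bullet> z) = tzero C (TO X) \<bullet> z" if "arr z" "tgt z = TO X"
    using comp_cong_right1[OF *, of z] X that by simp
qed

lemma tflip_tzero [simp]:
  assumes X: "X \<in> Obj C"
  shows "tflip C X \<bullet> tzero C (TO X) = T (tzero C X)"
    and "arr z \<Longrightarrow> tgt z = TO X \<Longrightarrow> tflip C X \<bullet> (tzero C (TO X) \<bullet> z) = T (tzero C X) \<bullet> z"
proof -
  have "tflip C X \<bullet> tzero C (TO X) = tflip C X \<bullet> (tflip C X \<bullet> T (tzero C X))"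
    using X by (simp del: tflip_tflip')
  also have "\<dots> = T (tzero C X)" using X by (simp del: tflip_Ttzero)
  finally show *: "tflip C X \<bullet> tzero C (TO X) = T (tzero C X)" .
  show "tflip C X \<bullet> (tzero C (TO X) \<bullet> z) = T (tzero C X) \<bullet> z" if "arr z" "tgt z = TO X"
    using comp_cong_right1[OF *, of z] X that by simp
qed

lemma tlift_tzero [simp]:
  assumes X: "X \<in> Obj C"
  shows "tlift C X \<bullet> tzero C X = tzero C (TO X) \<bullet> tzero C X"
    and "arr z \<Longrightarrow> tgt z = X \<Longrightarrow> tlift C X \<bullet> (tzero C X \<bullet> z) = tzero C (TO X) \<bullet> (tzero C X \<bullet> z)"
proof -
  have c: "compat X (tzero C X) (tzero C X)" using X unfolding compat_def by simp
  have t: "tadd X (tzero C X) (tzero C X) = tzero C X"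
    using tadd_tzero'(1)[OF X, of "tzero C X" "Ident C X"] X by simp
  have "tadd (TO X) (tlift C X \<bullet> tzero C X) (tlift C X \<bullet> tzero C X) = tlift C X \<bullet> tzero C X"
    using tlift_tadd(1)[OF c] t by simp
  from idem_tzero[OF _ _ _ this] show *: "tlift C X \<bullet> tzero C X = tzero C (TO X) \<bullet> tzero C X"
    using X by simp
  show "tlift C X \<bullet> (tzero C X \<bullet> z) = tzero C (TO X) \<bullet> (tzero C X \<bullet> z)" if "arr z" "tgt z = X"
    using comp_cong_right[OF *, of z] X that by simp
qed

lemma hcompat_sym: "hcompat X a b \<Longrightarrow> hcompat X b a"
  unfolding hcompat_def by simp

lemma hadd_comm:
  assumes "hcompat X a b"
  shows "hadd X a b = hadd X b a"
  unfolding hadd_def by (simp only: tadd_comm[OF hcompatD(8)[OF assms]])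

lemma hadd_assoc:
  assumes ab: "hcompat X a b" and bc: "hcompat X b c"
  shows "hadd X (hadd X a b) c = hadd X a (hadd X b c)"
  using tadd_assoc[OF hcompatD(8)[OF ab] hcompatD(8)[OF bc]] tflip_hadd[OF ab] tflip_hadd[OF bc]
  unfolding hadd_def[of X "hadd X a b"] hadd_def[of X a "hadd X b c"] by simp

lemma hadd_Ttzero:
  assumes "X \<in> Obj C" "arr a" "tgt a = TO (TO X)" "y = T (tproj C X) \<bullet> a"
  shows "hadd X a (T (tzero C X) \<bullet> y) = a" "hadd X (T (tzero C X) \<bullet> y) a = a"
    "hcompat X a (T (tzero C X) \<bullet> y)" "hcompat X (T (tzero C X) \<bullet> y) a"
proof -
  show h: "hcompat X a (T (tzero C X) \<bullet> y)" using assms unfolding hcompat_def by simp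
  then show "hcompat X (T (tzero C X) \<bullet> y) a" by (rule hcompat_sym)
  have "tadd (TO X) (tflip C X \<bullet> a) (tzero C (TO X) \<bullet> y) = tflip C X \<bullet> a"
    by (rule tadd_tzero'(1)) (use assms in simp_all)
  then show e: "hadd X a (T (tzero C X) \<bullet> y) = a" unfolding hadd_def using assms by simp
  show "hadd X (T (tzero C X) \<bullet> y) a = a" using e hadd_comm[OF h] by simp
qed

lemma tflip_cancel:
  assumes "tflip C X \<bullet> a = tflip C X \<bullet> b" "X \<in> Obj C" "arr a" "arr b" "tgt a = TO (TO X)"
    "tgt b = TO (TO X)"
  shows "a = b"
proof -
  have "a = tflip C X \<bullet> (tflip C X \<bullet> a)" using assms(2-6) by simp
  also have "\<dots> = tflip C X \<bullet> (tflip C X \<bullet> b)" by (simp only: assms(1))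
  also have "\<dots> = b" using assms(2-6) by simp
  finally show ?thesis .
qed

lemma hadd_cancel:
  assumes "hcompat X a b" "hcompat X a c" "hadd X a b = hadd X a c"
  shows "b = c"
proof -
  have "tadd (TO X) (tflip C X \<bullet> a) (tflip C X \<bullet> b) = tadd (TO X) (tflip C X \<bullet> a) (tflip C X \<bullet> c)"
    using tflip_hadd[OF assms(1)] tflip_hadd[OF assms(2)] assms(3) by simp
  from tadd_cancel[OF hcompatD(8)[OF assms(1)] hcompatD(8)[OF assms(2)] this]
  show ?thesis by (rule tflip_cancel) (use hcompatD(1-6)[OF assms(1)] hcompatD(1-6)[OF assms(2)] in simp_all)
qed

lemma hadd_solve:
  assumes "hcompat X a b"
  obtains e where "hcompat X a e" "hadd X a e = b"
proof -
  note d = hcompatD[OF assms]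
  let ?e = "tminus (TO X) \<bullet> tpair (TO X) (tflip C X \<bullet> b) (tflip C X \<bullet> a)"
  note m = tminus_solve[OF compat_sym[OF d(8)]]
  have "hcompat X (tflip C X \<bullet> (tflip C X \<bullet> a)) (tflip C X \<bullet> ?e)" by (rule tflip_tadd(2)[OF m(1) d(1)])
  then have 1: "hcompat X a (tflip C X \<bullet> ?e)" using d(1-6) by simp
  have "tflip C X \<bullet> (tflip C X \<bullet> b) = hadd X (tflip C X \<bullet> (tflip C X \<bullet> a)) (tflip C X \<bullet> ?e)"
    using tflip_tadd(1)[OF m(1) d(1)] unfolding m(2) .
  then have 2: "hadd X a (tflip C X \<bullet> ?e) = b" using d(1-6) by simp
  from that[OF 1 2] show thesis .
qed

lemma TT_hadd:
  assumes "hcompat X a b" "arr f" "src f = X"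
  shows "T (T f) \<bullet> hadd X a b = hadd (tgt f) (T (T f) \<bullet> a) (T (T f) \<bullet> b)"
    "hcompat (tgt f) (T (T f) \<bullet> a) (T (T f) \<bullet> b)"
proof -
  note d = hcompatD[OF assms(1)]
  have "tgt (T f) = TO (tgt f)" using assms(2) by simp
  then show "T (T f) \<bullet> hadd X a b = hadd (tgt f) (T (T f) \<bullet> a) (T (T f) \<bullet> b)"
    unfolding hadd_def using d(1-6) assms(2,3) tadd_arr[OF d(8)]
    by (simp add: T_tadd[OF d(8)])
  have *: "compat (tgt (T f)) (T (T f) \<bullet> (tflip C X \<bullet> a)) (T (T f) \<bullet> (tflip C X \<bullet> b))"
    by (rule compat_T[OF d(8)]) (use assms(2,3) in simp_all)
  show "hcompat (tgt f) (T (T f) \<bullet> a) (T (T f) \<bullet> b)"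
    using tflip_tadd(2)[of "tgt f" "T (T f) \<bullet> (tflip C X \<bullet> a)" "T (T f) \<bullet> (tflip C X \<bullet> b)"]
      * d(1-6) assms(2,3) by simp
qed

section \<open>The pullback property of the lift, and vertical vectors\<close>

lemma tlift_ex:
  assumes X: "X \<in> Obj C" and e: "arr e" "tgt e = TO (TO X)" and y: "arr y" "src y = src e" "tgt y = X"
    and p: "tproj C (TO X) \<bullet> e = tzero C X \<bullet> y" "T (tproj C X) \<bullet> e = tzero C X \<bullet> y"
  shows "\<exists>!c. c \<in> Hom C (src e) (TO X) \<and> tlift C X \<bullet> c = e \<and> tproj C X \<bullet> c = y"
proof -
  let ?f = "tpair X (tproj C (TO X)) (T (tproj C X))" and ?g = "tpair X (tzero C X) (tzero C X)"
  have cf: "compat X (tproj C (TO X)) (T (tproj C X))" using X unfolding compat_def by simp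
  have cg: "compat X (tzero C X) (tzero C X)" using X unfolding compat_def by simp
  note f = tpair_props[OF cf] and g = tpair_props[OF cg]
  from tlift_pullback[OF X, unfolded is_pullback_def] obtain A B D where *:
    "?f \<in> Hom C A D" "?g \<in> Hom C B D"
    "\<And>Z a b. a \<in> Hom C Z A \<Longrightarrow> b \<in> Hom C Z B \<Longrightarrow> ?f \<bullet> a = ?g \<bullet> b \<Longrightarrow>
           \<exists>!h. h \<in> Hom C Z (TO X) \<and> tlift C X \<bullet> h = a \<and> tproj C X \<bullet> h = b"
    by (elim exE conjE) blast
  have A: "A = TO (TO X)" "B = X"
    using HomD(2)[OF *(1)] f(2) HomD(2)[OF *(2)] g(2) X by simp_all
  show ?thesis
  proof (rule *(3))
    show "e \<in> Hom C (src e) A" "y \<in> Hom C (src e) B" using e y A by (simp_all add: Hom_iff)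
    have "?f \<bullet> e = tpair X (tzero C X \<bullet> y) (tzero C X \<bullet> y)"
      using p e X by (simp add: tpair_comp[OF cf])
    also have "\<dots> = ?g \<bullet> y" using y X by (simp add: tpair_comp[OF cg])
    finally show "?f \<bullet> e = ?g \<bullet> y" .
  qed
qed

lemma tlift_inj:
  assumes c: "compat X c c'" and e: "tlift C X \<bullet> c = tlift C X \<bullet> c'"
  shows "c = c'"
proof -
  note d = compatD[OF c]
  have "\<exists>!h. h \<in> Hom C (src (tlift C X \<bullet> c')) (TO X) \<and> tlift C X \<bullet> h = tlift C X \<bullet> c' \<and>
      tproj C X \<bullet> h = tproj C X \<bullet> c'"
    by (rule tlift_ex) (use d(1-6) in simp_all)
  moreover have "c \<in> Hom C (src (tlift C X \<bullet> c')) (TO X)" "c' \<in> Hom C (src (tlift C X \<bullet> c')) (TO X)"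
    using d(1-6) by (simp_all add: Hom_iff)
  ultimately show ?thesis using e d(7) by blast
qed

text \<open>The extended vertical lift on elements: the vector at \<open>a\<close> tangent to the
  fiber, that is, the derivative at 0 of the curve a + t c.\<close>

definition vert :: "'o \<Rightarrow> 'a \<Rightarrow> 'a \<Rightarrow> 'a" where
  "vert X a c = tlift2 X \<bullet> tpair X a c"

text \<open>The outer flip in \<open>tlift2\<close> turns the fiberwise sum into \<open>hadd\<close>
  and the summand \<open>T (tzero C X) \<bullet> a\<close> into the zero vector at \<open>a\<close>,
  while lifts are fixed. In this form the interchange law applies.\<close>

lemma vert_eq:
  assumes "compat X a c"
  shows "vert X a c = hadd X (tzero C (TO X) \<bullet> a) (tlift C X \<bullet> c)"
    "hcompat X (tzero C (TO X) \<bullet> a) (tlift C X \<bullet> c)"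
proof -
  note d = compatD[OF assms] and t = tpair_props[OF assms]
  have c: "compat (TO X) (T (tzero C X) \<bullet> fpr1 X) (tlift C X \<bullet> fpr2 X)"
    using d(1) unfolding compat_def by simp
  have c': "compat (TO X) (T (tzero C X) \<bullet> a) (tlift C X \<bullet> c)"
    using d unfolding compat_def by simp
  have "tlift2 X = tflip C X \<bullet> tadd (TO X) (T (tzero C X) \<bullet> fpr1 X) (tlift C X \<bullet> fpr2 X)"
    unfolding tlift2_def tadd_def fpr1_def fpr2_def ..
  then have "vert X a c = tflip C X \<bullet> tadd (TO X) (T (tzero C X) \<bullet> a) (tlift C X \<bullet> c)"
    unfolding vert_def using t d(1) tadd_arr[OF c] by (simp add: tadd_comp[OF c])
  also have "\<dots> = hadd X (tzero C (TO X) \<bullet> a) (tlift C X \<bullet> c)"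
    unfolding tflip_tadd(1)[OF c' d(1)] using d(1-6) by simp
  finally show "vert X a c = hadd X (tzero C (TO X) \<bullet> a) (tlift C X \<bullet> c)" .
  show "hcompat X (tzero C (TO X) \<bullet> a) (tlift C X \<bullet> c)" using d unfolding hcompat_def by simp
qed

lemma vert_props:
  assumes "compat X a c"
  shows "arr (vert X a c)" "src (vert X a c) = src c" "tgt (vert X a c) = TO (TO X)"
    "tproj C (TO X) \<bullet> vert X a c = a"
    "T (tproj C X) \<bullet> vert X a c = tzero C X \<bullet> (tproj C X \<bullet> a)"
proof -
  note d = compatD[OF assms] and v = vert_eq[OF assms]
  note h = hadd_arr[OF v(2)] Tproj_hadd[OF v(2)]
  show "arr (vert X a c)" "src (vert X a c) = src c" "tgt (vert X a c) = TO (TO X)"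
    unfolding v(1) using h(1-3) d(1-6) by simp_all
  show "tproj C (TO X) \<bullet> vert X a c = a"
    unfolding v(1) h(5) using d(1-6) tadd_tzero'(1)[OF d(1,2,5) d(7)[symmetric]] by simp
  show "T (tproj C X) \<bullet> vert X a c = tzero C X \<bullet> (tproj C X \<bullet> a)"
    unfolding v(1) h(4) d(7) using d(1-6) by simp
qed

lemma vert_comp:
  assumes "compat X a c" "arr z" "tgt z = src c"
  shows "vert X a c \<bullet> z = vert X (a \<bullet> z) (c \<bullet> z)"
proof -
  note v = vert_eq[OF assms(1)] and v' = vert_eq[OF compat_comp[OF assms]] and d = compatD[OF assms(1)]
  show ?thesis unfolding v(1) v'(1)
    using hadd_comp(1)[OF v(2), of z] d(1-6) assms(2,3) by simp
qed

text \<open>By interchange the zero vectors at \<open>a\<close> and the lifts add up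
  separately.\<close>

lemma vert_tadd:
  assumes ac: "compat X a c" and cc': "compat X c c'"
  shows "tadd (TO X) (vert X a c) (vert X a c') = vert X a (tadd X c c')"
    "compat (TO X) (vert X a c) (vert X a c')"
proof -
  have ac': "compat X a c'" using compat_trans[OF ac cc'] .
  have act: "compat X a (tadd X c c')" by (rule compat_tadd(2)[OF cc' compat_sym[OF ac']])
  note d = compatD[OF ac] compatD[OF ac']
  have z: "compat (TO X) (tzero C (TO X) \<bullet> a) (tzero C (TO X) \<bullet> a)"
    using d unfolding compat_def by simp
  have zz: "tadd (TO X) (tzero C (TO X) \<bullet> a) (tzero C (TO X) \<bullet> a) = tzero C (TO X) \<bullet> a"
    by (rule tadd_tzero'(1)) (use d(1-6) in simp_all)
  note i = interchange[OF vert_eq(2)[OF ac] vert_eq(2)[OF ac'] z tlift_tadd(2)[OF cc']]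
  show "tadd (TO X) (vert X a c) (vert X a c') = vert X a (tadd X c c')"
    unfolding vert_eq(1)[OF ac] vert_eq(1)[OF ac'] vert_eq(1)[OF act] i(1) zz tlift_tadd(1)[OF cc'] ..
  show "compat (TO X) (vert X a c) (vert X a c')"
    using i(2) unfolding vert_eq(1)[OF ac] vert_eq(1)[OF ac'] .
qed

lemma vert_tzero:
  assumes "X \<in> Obj C" "arr a" "tgt a = TO X" "y = tproj C X \<bullet> a"
  shows "vert X a (tzero C X \<bullet> y) = tzero C (TO X) \<bullet> a"
proof -
  have "hadd X (tzero C (TO X) \<bullet> a) (T (tzero C X) \<bullet> (tzero C X \<bullet> y)) = tzero C (TO X) \<bullet> a"
    by (rule hadd_Ttzero(1)) (use assms in simp_all)
  then show ?thesis unfolding vert_eq(1)[OF tadd_tzero'(3)[OF assms]] using assms by simp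
qed

section \<open>Vertical translation as the difference of second order vectors\<close>

text \<open>Translation of second order tangent vectors by vertical ones.\<close>

definition core :: "'o \<Rightarrow> 'a \<Rightarrow> 'a \<Rightarrow> 'a" where
  "core X A c = tadd (TO X) A (vert X (tproj C (TO X) \<bullet> A) c)"

definition ccompat :: "'o \<Rightarrow> 'a \<Rightarrow> 'a \<Rightarrow> bool" where
  "ccompat X A c \<longleftrightarrow> arr A \<and> tgt A = TO (TO X) \<and> compat X (tproj C (TO X) \<bullet> A) c"

lemma ccompatD:
  assumes "ccompat X A c"
  shows "X \<in> Obj C" "arr A" "arr c" "src A = src c" "tgt A = TO (TO X)" "tgt c = TO X"
    "tproj C X \<bullet> (tproj C (TO X) \<bullet> A) = tproj C X \<bullet> c" "compat X (tproj C (TO X) \<bullet> A) c"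
    "compat (TO X) A (vert X (tproj C (TO X) \<bullet> A) c)"
proof -
  show c: "compat X (tproj C (TO X) \<bullet> A) c" and A: "arr A" "tgt A = TO (TO X)"
    using assms unfolding ccompat_def by auto
  note d = compatD[OF c]
  show "X \<in> Obj C" "arr c" "src A = src c" "tgt c = TO X"
    "tproj C X \<bullet> (tproj C (TO X) \<bullet> A) = tproj C X \<bullet> c" using d A by simp_all
  show "compat (TO X) A (vert X (tproj C (TO X) \<bullet> A) c)"
    using A d vert_props[OF c] unfolding compat_def by simp
qed

lemma core_props:
  assumes "ccompat X A c"
  shows "arr (core X A c)" "src (core X A c) = src c" "tgt (core X A c) = TO (TO X)"
    "tproj C (TO X) \<bullet> core X A c = tproj C (TO X) \<bullet> A"
    "T (tproj C X) \<bullet> core X A c = T (tproj C X) \<bullet> A"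
proof -
  note d = ccompatD[OF assms] and v = vert_props[OF ccompatD(8)[OF assms]]
  note t = tadd_arr[OF d(9)]
  show "arr (core X A c)" "src (core X A c) = src c" "tgt (core X A c) = TO (TO X)"
    unfolding core_def using t v(2) by simp_all
  show "tproj C (TO X) \<bullet> core X A c = tproj C (TO X) \<bullet> A"
    unfolding core_def tproj_tadd[OF d(9)] v(4) ..
  have "T (tproj C X) \<bullet> core X A c =
      tadd X (T (tproj C X) \<bullet> A) (tzero C X \<bullet> (tproj C X \<bullet> (tproj C (TO X) \<bullet> A)))"
    unfolding core_def using T_tadd[OF d(9), of "tproj C X"] d(1) v(5) by simp
  also have "\<dots> = T (tproj C X) \<bullet> A"
    by (rule tadd_tzero'(1)) (use d(1-6) in simp_all)
  finally show "T (tproj C X) \<bullet> core X A c = T (tproj C X) \<bullet> A" .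
qed

lemma core_comp:
  assumes "ccompat X A c" "arr z" "tgt z = src c"
  shows "core X A c \<bullet> z = core X (A \<bullet> z) (c \<bullet> z)" "ccompat X (A \<bullet> z) (c \<bullet> z)"
proof -
  note d = ccompatD[OF assms(1)] and v = vert_props[OF ccompatD(8)[OF assms(1)]]
  show "core X A c \<bullet> z = core X (A \<bullet> z) (c \<bullet> z)"
    unfolding core_def using tadd_comp[OF d(9), of z] vert_comp[OF d(8), of z] d(1-6) v(2) assms(2,3) by simp
  show "ccompat X (A \<bullet> z) (c \<bullet> z)"
    using d(1-6) assms(2,3) compat_comp[OF d(8), of z] unfolding ccompat_def by simp
qed

lemma ccompat_tflip: "ccompat X A c \<Longrightarrow> ccompat X (tflip C X \<bullet> A) c"
  using ccompatD(1-7)[of X A c] unfolding ccompat_def[of X "tflip C X \<bullet> A"] compat_def by simp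

lemma core_core:
  assumes "ccompat X A c" "compat X c c'"
  shows "core X (core X A c) c' = core X A (tadd X c c')"
proof -
  note d = ccompatD[OF assms(1)] and p = core_props[OF assms(1)]
  note v = vert_tadd[OF d(8) assms(2)]
  have "core X (core X A c) c' = tadd (TO X) (core X A c) (vert X (tproj C (TO X) \<bullet> A) c')"
    by (simp only: core_def[of X "core X A c"] p(4))
  also have "\<dots> = core X A (tadd X c c')"
    unfolding core_def tadd_assoc[OF d(9) v(2)] v(1) ..
  finally show ?thesis .
qed

lemma core_tzero:
  assumes "X \<in> Obj C" "arr A" "tgt A = TO (TO X)" "y = tproj C X \<bullet> (tproj C (TO X) \<bullet> A)"
  shows "core X A (tzero C X \<bullet> y) = A" "ccompat X A (tzero C X \<bullet> y)"
proof -
  have *: "vert X (tproj C (TO X) \<bullet> A) (tzero C X \<bullet> y) = tzero C (TO X) \<bullet> (tproj C (TO X) \<bullet> A)"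
    by (rule vert_tzero) (use assms in simp_all)
  show "core X A (tzero C X \<bullet> y) = A"
    unfolding core_def * by (rule tadd_tzero) (use assms in simp_all)
  show "ccompat X A (tzero C X \<bullet> y)" using assms unfolding ccompat_def compat_def by simp
qed

text \<open>The second description of the translation adds in the other direction. It arises by
  writing \<open>A\<close> as its \<open>hadd\<close> sum with a zero vector and applying the
  interchange law.\<close>

lemma core_hadd:
  assumes "ccompat X A c"
  shows "core X A c =
    hadd X A (tadd (TO X) (T (tzero C X) \<bullet> (T (tproj C X) \<bullet> A)) (tlift C X \<bullet> c))"
    "tflip C X \<bullet> vert X (T (tproj C X) \<bullet> A) c =
      tadd (TO X) (T (tzero C X) \<bullet> (T (tproj C X) \<bullet> A)) (tlift C X \<bullet> c)"
proof -
  note d = ccompatD[OF assms]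
  note h = hadd_Ttzero[OF d(1,2,5) refl] and z = tadd_tzero'[OF _ d(2,5) refl]
  have c: "compat (TO X) (T (tzero C X) \<bullet> (T (tproj C X) \<bullet> A)) (tlift C X \<bullet> c)"
    using d(1-7) unfolding compat_def by simp
  have X': "TO X \<in> Obj C" using d(1) by simp
  note i = interchange[OF h(3) vert_eq(2)[OF d(8)] z(3)[OF X'] c]
  show "core X A c =
    hadd X A (tadd (TO X) (T (tzero C X) \<bullet> (T (tproj C X) \<bullet> A)) (tlift C X \<bullet> c))"
    using i(1) unfolding h(1) z(1)[OF X'] core_def vert_eq(1)[OF d(8)] .
  have c': "compat X (T (tproj C X) \<bullet> A) c" using d(1-7) unfolding compat_def by simp
  show "tflip C X \<bullet> vert X (T (tproj C X) \<bullet> A) c =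
      tadd (TO X) (T (tzero C X) \<bullet> (T (tproj C X) \<bullet> A)) (tlift C X \<bullet> c)"
    unfolding vert_eq(1)[OF c'] tflip_hadd[OF vert_eq(2)[OF c']] using d(1-6) by simp
qed

text \<open>The flip exchanges the two descriptions of the translation in \<open>core_hadd\<close>.
  This symmetry is behind the antisymmetry of the bracket and the symmetry of mixed second
  derivatives.\<close>

lemma tflip_core:
  assumes "ccompat X A c"
  shows "tflip C X \<bullet> core X A c = core X (tflip C X \<bullet> A) c"
proof -
  note d = ccompatD[OF assms]
  have c: "ccompat X (tflip C X \<bullet> A) c" by (rule ccompat_tflip[OF assms])
  note d' = ccompatD[OF c]
  have p: "tproj C (TO X) \<bullet> (tflip C X \<bullet> A) = T (tproj C X) \<bullet> A" using d(1-6) by simp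
  have "tflip C X \<bullet> core X (tflip C X \<bullet> A) c = hadd X (tflip C X \<bullet> (tflip C X \<bullet> A))
      (tflip C X \<bullet> vert X (T (tproj C X) \<bullet> A) c)"
    unfolding core_def[of X "tflip C X \<bullet> A"] p tflip_tadd(1)[OF d'(9)[unfolded p] d(1)] ..
  also have "\<dots> = core X A c"
    unfolding core_hadd[OF assms] using d(1-6) by simp
  finally have "tflip C X \<bullet> (tflip C X \<bullet> core X (tflip C X \<bullet> A) c) = tflip C X \<bullet> core X A c" by simp
  then show ?thesis using core_props[OF c] d(1) by simp
qed

text \<open>A second tangent map respects both additions, zero vectors and lifts, which are all the
  ingredients of a translation.\<close>

lemma TT_core:
  assumes "ccompat X A c" "arr f" "src f = X"
  shows "T (T f) \<bullet> core X A c = core (tgt f) (T (T f) \<bullet> A) (T f \<bullet> c)"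
    "ccompat (tgt f) (T (T f) \<bullet> A) (T f \<bullet> c)"
proof -
  note d = ccompatD[OF assms(1)]
  have p: "tproj C (TO (tgt f)) \<bullet> (T (T f) \<bullet> A) = T f \<bullet> (tproj C (TO X) \<bullet> A)"
    using d(1-6) assms(2,3) by simp
  show cc: "ccompat (tgt f) (T (T f) \<bullet> A) (T f \<bullet> c)"
    using d(1-6) compat_T[OF d(8) assms(2,3)] p assms(2,3) unfolding ccompat_def by simp
  note d' = ccompatD(8)[OF cc, unfolded p]
  note h = TT_hadd[OF vert_eq(2)[OF d(8)] assms(2,3)]
  have v: "T (T f) \<bullet> vert X (tproj C (TO X) \<bullet> A) c =
      vert (tgt f) (T f \<bullet> (tproj C (TO X) \<bullet> A)) (T f \<bullet> c)"
    unfolding vert_eq(1)[OF d(8)] h(1) vert_eq(1)[OF d'] using d(1-6) assms(2,3) by simp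
  show "T (T f) \<bullet> core X A c = core (tgt f) (T (T f) \<bullet> A) (T f \<bullet> c)"
    unfolding core_def p v[symmetric] using T_tadd[OF d(9), of "T f"] assms(2,3) by simp
qed

lemma tadd_core:
  assumes "ccompat X B c" "compat (TO X) A B"
  shows "tadd (TO X) A (core X B c) = core X (tadd (TO X) A B) c" "ccompat X (tadd (TO X) A B) c"
    "compat (TO X) A (core X B c)"
proof -
  note d = ccompatD[OF assms(1)] and t = tadd_arr[OF assms(2)] tproj_tadd[OF assms(2)]
  show "ccompat X (tadd (TO X) A B) c" using d(8) t unfolding ccompat_def by simp
  show "tadd (TO X) A (core X B c) = core X (tadd (TO X) A B) c"
    unfolding core_def t(4) tadd_assoc[OF assms(2) d(9)] ..
  show "compat (TO X) A (core X B c)"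
    using compatD[OF assms(2)] core_props[OF assms(1)] d(4) unfolding compat_def by simp
qed

lemma core_inj:
  assumes "ccompat X A c" "ccompat X A c'" "core X A c = core X A c'"
  shows "c = c'"
proof -
  note d = ccompatD[OF assms(1)] and d' = ccompatD[OF assms(2)]
  have "vert X (tproj C (TO X) \<bullet> A) c = vert X (tproj C (TO X) \<bullet> A) c'"
    by (rule tadd_cancel[OF d(9) d'(9)]) (use assms(3) in \<open>simp only: core_def\<close>)
  then have "tlift C X \<bullet> c = tlift C X \<bullet> c'"
    unfolding vert_eq(1)[OF d(8)] vert_eq(1)[OF d'(8)]
    by (rule hadd_cancel[OF vert_eq(2)[OF d(8)] vert_eq(2)[OF d'(8)]])
  then show ?thesis
    by (rule tlift_inj[OF compat_trans[OF compat_sym[OF d(8)] d'(8)]])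
qed

text \<open>The fiberwise difference \<open>?D\<close> of \<open>B\<close> and \<open>A\<close> has
  zero face under \<open>T (tproj C X)\<close>. Removing from it the zero vector at
  \<open>?a\<close>, in the direction of \<open>hadd\<close>, leaves a vector \<open>E\<close> both
  of whose faces are zero; such a vector is a lift. With \<open>core_inj\<close> this makes the
  second order vectors with given faces a torsor under tangent vectors.\<close>

lemma core_ex:
  assumes c: "compat (TO X) A B" and X: "X \<in> Obj C" and h: "T (tproj C X) \<bullet> A = T (tproj C X) \<bullet> B"
  obtains c where "ccompat X A c" "core X A c = B"
proof -
  note d = compatD[OF c]
  let ?a = "tproj C (TO X) \<bullet> A" and ?D = "tminus (TO X) \<bullet> tpair (TO X) B A"
  let ?y = "tproj C X \<bullet> (tproj C (TO X) \<bullet> A)"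
  note m = tminus_solve[OF compat_sym[OF c]]
  note D = compatD[OF m(1)]
  have "tadd X (T (tproj C X) \<bullet> A) (T (tproj C X) \<bullet> ?D) = T (tproj C X) \<bullet> tadd (TO X) A ?D"
    using T_tadd[OF m(1), of "tproj C X"] X by simp
  also have "\<dots> = T (tproj C X) \<bullet> A" unfolding m(2) h ..
  also have "\<dots> = tadd X (T (tproj C X) \<bullet> A) (tzero C X \<bullet> ?y)"
    by (rule tadd_tzero'(1)[symmetric]) (use d(1-6) X in simp_all)
  finally have *: "tadd X (T (tproj C X) \<bullet> A) (T (tproj C X) \<bullet> ?D) =
      tadd X (T (tproj C X) \<bullet> A) (tzero C X \<bullet> ?y)" .
  have TD: "T (tproj C X) \<bullet> ?D = tzero C X \<bullet> ?y"
    by (rule tadd_cancel[OF _ _ *])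
      (use compat_T[OF m(1), of "tproj C X"] X d(1-6) in \<open>simp_all add: compat_def\<close>)
  have "hcompat X (tzero C (TO X) \<bullet> ?a) ?D"
    unfolding hcompat_def TD using X d(1-6) D(1-6) by simp
  then obtain E where E: "hcompat X (tzero C (TO X) \<bullet> ?a) E" "hadd X (tzero C (TO X) \<bullet> ?a) E = ?D"
    by (rule hadd_solve)
  note e = hcompatD[OF E(1)]
  have TE: "T (tproj C X) \<bullet> E = tzero C X \<bullet> ?y"
    using Tproj_hadd(1)[OF E(1)] unfolding E(2) TD by simp
  have 1: "tadd X ?a (tproj C (TO X) \<bullet> E) = ?a" "compat X ?a (tproj C (TO X) \<bullet> E)"
    using Tproj_hadd(2,3)[OF E(1)] X d(1-6) unfolding E(2) D(7)[symmetric] by simp_all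
  have "tproj C (TO X) \<bullet> E = tzero C X \<bullet> ?y"
    by (rule tadd_cancel[OF 1(2) tadd_tzero'(3)[OF X _ _ refl]])
      (use 1(1) tadd_tzero'(1)[OF X, of ?a, OF _ _ refl] X d(1-6) in simp_all)
  then have "\<exists>!c. c \<in> Hom C (src E) (TO X) \<and> tlift C X \<bullet> c = E \<and> tproj C X \<bullet> c = ?y"
    by (intro tlift_ex[OF X e(3,6) _ _ _ _ TE]) (use X d(1-6) e(1-6) in simp_all)
  then obtain c where c: "c \<in> Hom C (src E) (TO X)" "tlift C X \<bullet> c = E" "tproj C X \<bullet> c = ?y" by blast
  have cc: "ccompat X A c"
    using HomD(1-3)[OF c(1)] c(3) X d(1-6) e(4) unfolding ccompat_def compat_def by simp
  have "core X A c = B"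
    unfolding core_def vert_eq(1)[OF ccompatD(8)[OF cc]] c(2) E(2) m(2) ..
  from that[OF cc this] show thesis .
qed


section \<open>Third order tangent vectors\<close>

lemma Tflip_Tflip [simp]:
  assumes "X \<in> Obj C"
  shows "T (tflip C X) \<bullet> T (tflip C X) = Ident C (TO (TO (TO X)))"
    and "arr z \<Longrightarrow> tgt z = TO (TO (TO X)) \<Longrightarrow> T (tflip C X) \<bullet> (T (tflip C X) \<bullet> z) = z"
proof -
  show *: "T (tflip C X) \<bullet> T (tflip C X) = Ident C (TO (TO (TO X)))"
    using assms T_comp[of "tflip C X" "tflip C X"] by simp
  show "T (tflip C X) \<bullet> (T (tflip C X) \<bullet> z) = z" if "arr z" "tgt z = TO (TO (TO X))"
    using comp_cong_right1[OF *, of z] assms that by simp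
qed

lemma Ttproj_Ttflip [simp]:
  assumes "X \<in> Obj C" "arr z" "tgt z = TO (TO (TO X))"
  shows "T (tproj C (TO X)) \<bullet> (T (tflip C X) \<bullet> z) = T (T (tproj C X)) \<bullet> z"
proof -
  have "T (tproj C (TO X)) \<bullet> T (tflip C X) = T (T (tproj C X))"
    using assms T_comp[of "tflip C X" "tproj C (TO X)"] by simp
  from comp_cong_right1[OF this] show ?thesis using assms by simp
qed

lemma TTtproj_Ttflip [simp]:
  assumes "X \<in> Obj C" "arr z" "tgt z = TO (TO (TO X))"
  shows "T (T (tproj C X)) \<bullet> (T (tflip C X) \<bullet> z) = T (tproj C (TO X)) \<bullet> z"
  using assms by (simp flip: Ttproj_Ttflip)

lemma flip_braid:
  assumes "X \<in> Obj C" "arr z" "tgt z = TO (TO (TO X))"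
  shows "tflip C (TO X) \<bullet> (T (tflip C X) \<bullet> (tflip C (TO X) \<bullet> z)) =
    T (tflip C X) \<bullet> (tflip C (TO X) \<bullet> (T (tflip C X) \<bullet> z))"
proof -
  have "(tflip C (TO X) \<bullet> T (tflip C X) \<bullet> tflip C (TO X)) \<bullet> z =
    (T (tflip C X) \<bullet> tflip C (TO X) \<bullet> T (tflip C X)) \<bullet> z"
    by (simp only: tflip_braid[OF assms(1)])
  then show ?thesis using assms by simp
qed

lemma flip_Tlift:
  assumes "X \<in> Obj C" "arr z" "tgt z = TO (TO X)"
  shows "T (tflip C X) \<bullet> (tflip C (TO X) \<bullet> (T (tlift C X) \<bullet> z)) =
      tlift C (TO X) \<bullet> (tflip C X \<bullet> z)"
    and "tflip C (TO X) \<bullet> (T (tflip C X) \<bullet> (tlift C (TO X) \<bullet> z)) =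
      T (tlift C X) \<bullet> (tflip C X \<bullet> z)"
proof -
  have *: "T (tflip C X) \<bullet> (tflip C (TO X) \<bullet> (T (tlift C X) \<bullet> z)) =
      tlift C (TO X) \<bullet> (tflip C X \<bullet> z)" if "arr z" "tgt z = TO (TO X)" for z
  proof -
    have "(T (tflip C X) \<bullet> tflip C (TO X) \<bullet> T (tlift C X)) \<bullet> z =
        (tlift C (TO X) \<bullet> tflip C X) \<bullet> z"
      by (simp only: tflip_Tlift[OF assms(1)])
    then show ?thesis using assms that by simp
  qed
  show "T (tflip C X) \<bullet> (tflip C (TO X) \<bullet> (T (tlift C X) \<bullet> z)) =
      tlift C (TO X) \<bullet> (tflip C X \<bullet> z)" by (rule *[OF assms(2,3)])
  have e: "tlift C (TO X) \<bullet> z =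
      T (tflip C X) \<bullet> (tflip C (TO X) \<bullet> (T (tlift C X) \<bullet> (tflip C X \<bullet> z)))"
    using *[of "tflip C X \<bullet> z"] assms by simp
  show "tflip C (TO X) \<bullet> (T (tflip C X) \<bullet> (tlift C (TO X) \<bullet> z)) =
      T (tlift C X) \<bullet> (tflip C X \<bullet> z)" unfolding e using assms by simp
qed

text \<open>Addition in the direction of the outermost two tangent functors, \<open>T\<^sup>2(+)\<close>.\<close>

definition hadd3 :: "'o \<Rightarrow> 'a \<Rightarrow> 'a \<Rightarrow> 'a" where
  "hadd3 X a b = T (tflip C X) \<bullet> hadd (TO X) (T (tflip C X) \<bullet> a) (T (tflip C X) \<bullet> b)"

definition h3compat :: "'o \<Rightarrow> 'a \<Rightarrow> 'a \<Rightarrow> bool" where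
  "h3compat X a b \<longleftrightarrow> X \<in> Obj C \<and> arr a \<and> arr b \<and> src a = src b \<and> tgt a = TO (TO (TO X)) \<and>
     tgt b = TO (TO (TO X)) \<and> T (T (tproj C X)) \<bullet> a = T (T (tproj C X)) \<bullet> b"

lemma h3compatD:
  assumes "h3compat X a b"
  shows "X \<in> Obj C" "arr a" "arr b" "src a = src b" "tgt a = TO (TO (TO X))"
    "tgt b = TO (TO (TO X))" "T (T (tproj C X)) \<bullet> a = T (T (tproj C X)) \<bullet> b"
    "hcompat (TO X) (T (tflip C X) \<bullet> a) (T (tflip C X) \<bullet> b)"
  using assms unfolding h3compat_def hcompat_def by auto

lemma hadd3_arr:
  assumes "h3compat X a b"
  shows "arr (hadd3 X a b)" "src (hadd3 X a b) = src b" "tgt (hadd3 X a b) = TO (TO (TO X))"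
  using h3compatD(1-6)[OF assms] hadd_arr[OF h3compatD(8)[OF assms]] unfolding hadd3_def by auto

lemma h3compat_sym: "h3compat X a b \<Longrightarrow> h3compat X b a"
  unfolding h3compat_def by simp

lemma hadd3_comm:
  assumes "h3compat X a b"
  shows "hadd3 X a b = hadd3 X b a"
  unfolding hadd3_def hadd_comm[OF h3compatD(8)[OF assms]] ..

lemma Tflip_hadd3:
  assumes "h3compat X a b"
  shows "T (tflip C X) \<bullet> hadd3 X a b = hadd (TO X) (T (tflip C X) \<bullet> a) (T (tflip C X) \<bullet> b)"
  using h3compatD(1-6)[OF assms] hadd_arr[OF h3compatD(8)[OF assms]] unfolding hadd3_def by simp

lemma hadd3_assoc:
  assumes ab: "h3compat X a b" and bc: "h3compat X b c"
  shows "hadd3 X (hadd3 X a b) c = hadd3 X a (hadd3 X b c)"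
  using hadd_assoc[OF h3compatD(8)[OF ab] h3compatD(8)[OF bc]] Tflip_hadd3[OF ab] Tflip_hadd3[OF bc]
  unfolding hadd3_def[of X "hadd3 X a b"] hadd3_def[of X a "hadd3 X b c"] by simp

lemma hadd3_comp:
  assumes "h3compat X a b" "arr z" "tgt z = src b"
  shows "hadd3 X a b \<bullet> z = hadd3 X (a \<bullet> z) (b \<bullet> z)" "h3compat X (a \<bullet> z) (b \<bullet> z)"
proof -
  note d = h3compatD[OF assms(1)] and t = hadd_arr[OF h3compatD(8)[OF assms(1)]]
  show "hadd3 X a b \<bullet> z = hadd3 X (a \<bullet> z) (b \<bullet> z)"
    unfolding hadd3_def using d(1-6) t assms(2,3) by (simp add: hadd_comp[OF d(8)])
  show "h3compat X (a \<bullet> z) (b \<bullet> z)"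
    unfolding h3compat_def using d(1-6) assms(2,3) by (simp add: comp_cong_right[OF d(7)])
qed

lemma T_hadd:
  assumes "hcompat X a b"
  shows "T (hadd X a b) = hadd3 X (T a) (T b)" "h3compat X (T a) (T b)"
proof -
  note d = hcompatD[OF assms]
  have "T (hadd X a b) = T (tflip C X) \<bullet> T (tadd (TO X) (tflip C X \<bullet> a) (tflip C X \<bullet> b))"
    unfolding hadd_def using d(1-6) tadd_arr[OF d(8)] by simp
  then show "T (hadd X a b) = hadd3 X (T a) (T b)"
    unfolding T_tadd_hadd(1)[OF d(8)] hadd3_def using d(1-6) by simp
  have "T (T (tproj C X) \<bullet> a) = T (T (tproj C X) \<bullet> b)" by (simp only: d(7))
  then show "h3compat X (T a) (T b)" unfolding h3compat_def using d(1-6) by simp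
qed

text \<open>\<open>T (tflip C X)\<close> identifies \<open>hadd3\<close> with \<open>hadd\<close> at
  \<open>TO X\<close> and is itself additive, so the interchange law is transported from
  there.\<close>

lemma tadd_hadd3_interchange:
  assumes ab: "h3compat X a b" and cd: "h3compat X c d"
    and ac: "compat (TO (TO X)) a c" and bd: "compat (TO (TO X)) b d"
  shows "tadd (TO (TO X)) (hadd3 X a b) (hadd3 X c d) =
      hadd3 X (tadd (TO (TO X)) a c) (tadd (TO (TO X)) b d)"
    "compat (TO (TO X)) (hadd3 X a b) (hadd3 X c d)"
    "h3compat X (tadd (TO (TO X)) a c) (tadd (TO (TO X)) b d)"
proof -
  have X: "X \<in> Obj C" using h3compatD(1)[OF ab] .
  have f: "arr (tflip C X)" "src (tflip C X) = TO (TO X)" "tgt (tflip C X) = TO (TO X)"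
    using X by simp_all
  note ca = compat_T[OF ac f(1,2), unfolded f(3)] and cb = compat_T[OF bd f(1,2), unfolded f(3)]
  note i = interchange[OF h3compatD(8)[OF ab] h3compatD(8)[OF cd] ca cb]
  note ta = T_tadd[OF ac f(1,2), unfolded f(3)] and tb = T_tadd[OF bd f(1,2), unfolded f(3)]
  show "tadd (TO (TO X)) (hadd3 X a b) (hadd3 X c d) =
      hadd3 X (tadd (TO (TO X)) a c) (tadd (TO (TO X)) b d)"
    unfolding hadd3_def T_tadd[OF i(2) f(1,2), unfolded f(3), symmetric] i(1) ta tb ..
  show "compat (TO (TO X)) (hadd3 X a b) (hadd3 X c d)"
    unfolding hadd3_def by (rule compat_T[OF i(2) f(1,2), unfolded f(3)])
  have "T (tproj C (TO X)) \<bullet> (T (tflip C X) \<bullet> tadd (TO (TO X)) a c) =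
      T (tproj C (TO X)) \<bullet> (T (tflip C X) \<bullet> tadd (TO (TO X)) b d)"
    unfolding ta tb by (rule hcompatD(7)[OF i(3)])
  then show "h3compat X (tadd (TO (TO X)) a c) (tadd (TO (TO X)) b d)"
    using X tadd_arr[OF ac] tadd_arr[OF bd] h3compatD(4)[OF cd] unfolding h3compat_def by simp
qed

text \<open>The flip of the two outer copies of \<open>T\<close> leaves the innermost direction
  alone. The braid relation moves it through the two flips that define \<open>hadd3\<close>.\<close>

lemma tflip_hadd3:
  assumes "h3compat X a b"
  shows "tflip C (TO X) \<bullet> hadd3 X a b = hadd3 X (tflip C (TO X) \<bullet> a) (tflip C (TO X) \<bullet> b)"
    "h3compat X (tflip C (TO X) \<bullet> a) (tflip C (TO X) \<bullet> b)"
proof -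
  note d = h3compatD[OF assms]
  show h: "h3compat X (tflip C (TO X) \<bullet> a) (tflip C (TO X) \<bullet> b)"
    unfolding h3compat_def using d(1-6) d(7) by simp
  let ?f = "tflip C (TO X)" and ?Tf = "T (tflip C X)" and ?Y = "TO (TO X)"
  note h' = h3compatD[OF h]
  have f: "arr (tflip C X)" "src (tflip C X) = ?Y" "tgt (tflip C X) = ?Y" using d(1) by simp_all
  note c = hcompatD(8)[OF d(8)] and c' = hcompatD(8)[OF h'(8)]
  have "?f \<bullet> hadd3 X a b = ?f \<bullet> (?Tf \<bullet> (?f \<bullet> tadd ?Y (?f \<bullet> (?Tf \<bullet> a)) (?f \<bullet> (?Tf \<bullet> b))))"
    unfolding hadd3_def hadd_def ..
  also have "\<dots> = ?Tf \<bullet> (?f \<bullet> (?Tf \<bullet> tadd ?Y (?f \<bullet> (?Tf \<bullet> a)) (?f \<bullet> (?Tf \<bullet> b))))"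
    by (rule flip_braid) (use d(1) tadd_arr[OF c] in simp_all)
  also have "?Tf \<bullet> tadd ?Y (?f \<bullet> (?Tf \<bullet> a)) (?f \<bullet> (?Tf \<bullet> b)) =
      tadd ?Y (?Tf \<bullet> (?f \<bullet> (?Tf \<bullet> a))) (?Tf \<bullet> (?f \<bullet> (?Tf \<bullet> b)))"
    by (rule T_tadd[OF c f(1,2), unfolded f(3)])
  also have "\<dots> = tadd ?Y (?f \<bullet> (?Tf \<bullet> (?f \<bullet> a))) (?f \<bullet> (?Tf \<bullet> (?f \<bullet> b)))"
    using d(1-6) by (simp only: flip_braid)
  finally show "?f \<bullet> hadd3 X a b = hadd3 X (?f \<bullet> a) (?f \<bullet> b)"
    unfolding hadd3_def hadd_def .
qed

lemma hadd_hadd3_interchange: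
  assumes ab: "h3compat X a b" and cd: "h3compat X c d"
    and ac: "hcompat (TO X) a c" and bd: "hcompat (TO X) b d"
  shows "hadd (TO X) (hadd3 X a b) (hadd3 X c d) = hadd3 X (hadd (TO X) a c) (hadd (TO X) b d)"
    "h3compat X (hadd (TO X) a c) (hadd (TO X) b d)"
proof -
  note f = tflip_hadd3[OF ab] tflip_hadd3[OF cd]
  note i = tadd_hadd3_interchange[OF f(2,4) hcompatD(8)[OF ac] hcompatD(8)[OF bd]]
  note g = tflip_hadd3[OF i(3)]
  show "hadd (TO X) (hadd3 X a b) (hadd3 X c d) = hadd3 X (hadd (TO X) a c) (hadd (TO X) b d)"
    unfolding hadd_def f(1,3) i(1) g(1) ..
  show "h3compat X (hadd (TO X) a c) (hadd (TO X) b d)"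
    using g(2) unfolding hadd_def .
qed

text \<open>Every \<open>hadd\<close> sum is the image of one arrow \<open>h\<close> under
  \<open>T\<close> of the addition, so natural operations pass through the sum. This is how zero,
  lift and scalar multiplication are shown to be additive in the inner directions.\<close>

lemma hadd_factor:
  assumes "hcompat X a b"
  obtains h where "arr h" "src h = src b" "tgt h = TO (fprod X)"
    "a = T (fpr1 X) \<bullet> h" "b = T (fpr2 X) \<bullet> h" "hadd X a b = T (tadd X (fpr1 X) (fpr2 X)) \<bullet> h"
proof -
  note d = hcompatD[OF assms]
  obtain h where h: "arr h" "src h = src b" "tgt h = TO (fprod X)"
    "T (fpr1 X) \<bullet> h = a" "T (fpr2 X) \<bullet> h = b"
    by (rule T_fpr_fiber_power[OF d(1-7)])
  note c = compat_fpr[OF d(1)]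
  have "T (tadd X (fpr1 X) (fpr2 X)) \<bullet> h = hadd X a b"
    unfolding T_tadd_hadd(1)[OF c] using hadd_comp(1)[OF T_tadd_hadd(2)[OF c], of h] h d(1) by simp
  from that[OF h(1-3) h(4,5)[symmetric] this[symmetric]] show thesis .
qed

lemma TT_tadd_fpr:
  assumes "X \<in> Obj C" "arr m" "tgt m = TO (TO (fprod X))"
  shows "T (T (tadd X (fpr1 X) (fpr2 X))) \<bullet> m =
      hadd3 X (T (T (fpr1 X)) \<bullet> m) (T (T (fpr2 X)) \<bullet> m)"
    "h3compat X (T (T (fpr1 X)) \<bullet> m) (T (T (fpr2 X)) \<bullet> m)"
proof -
  note c = compat_fpr[OF assms(1)]
  note T = T_hadd[OF T_tadd_hadd(2)[OF c], folded T_tadd_hadd(1)[OF c]]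
  note k = hadd3_comp[OF T(2), of m]
  show "T (T (tadd X (fpr1 X) (fpr2 X))) \<bullet> m =
      hadd3 X (T (T (fpr1 X)) \<bullet> m) (T (T (fpr2 X)) \<bullet> m)"
    unfolding T(1) using k(1) assms by simp
  show "h3compat X (T (T (fpr1 X)) \<bullet> m) (T (T (fpr2 X)) \<bullet> m)"
    using k(2) assms by simp
qed

lemma tzero_hadd:
  assumes "hcompat X a b"
  shows "tzero C (TO (TO X)) \<bullet> hadd X a b =
      hadd3 X (tzero C (TO (TO X)) \<bullet> a) (tzero C (TO (TO X)) \<bullet> b)"
    "h3compat X (tzero C (TO (TO X)) \<bullet> a) (tzero C (TO (TO X)) \<bullet> b)"
proof -
  note d = hcompatD[OF assms]
  obtain h where h: "arr h" "src h = src b" "tgt h = TO (fprod X)"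
    "a = T (fpr1 X) \<bullet> h" "b = T (fpr2 X) \<bullet> h" "hadd X a b = T (tadd X (fpr1 X) (fpr2 X)) \<bullet> h"
    by (rule hadd_factor[OF assms])
  note t = tadd_arr[OF compat_fpr[OF d(1)]]
  note TT = TT_tadd_fpr[OF d(1), of "tzero C (TO (fprod X)) \<bullet> h"]
  show "tzero C (TO (TO X)) \<bullet> hadd X a b =
      hadd3 X (tzero C (TO (TO X)) \<bullet> a) (tzero C (TO (TO X)) \<bullet> b)"
    unfolding h(6) unfolding h(4,5) using TT(1) h(1-3) d(1) t by simp
  show "h3compat X (tzero C (TO (TO X)) \<bullet> a) (tzero C (TO (TO X)) \<bullet> b)"
    unfolding h(4,5) using TT(2) h(1-3) d(1) by simp
qed

lemma tlift_hadd:
  assumes "hcompat X a b"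
  shows "tlift C (TO X) \<bullet> hadd X a b = hadd3 X (tlift C (TO X) \<bullet> a) (tlift C (TO X) \<bullet> b)"
    "h3compat X (tlift C (TO X) \<bullet> a) (tlift C (TO X) \<bullet> b)"
proof -
  note d = hcompatD[OF assms]
  obtain h where h: "arr h" "src h = src b" "tgt h = TO (fprod X)"
    "a = T (fpr1 X) \<bullet> h" "b = T (fpr2 X) \<bullet> h" "hadd X a b = T (tadd X (fpr1 X) (fpr2 X)) \<bullet> h"
    by (rule hadd_factor[OF assms])
  note t = tadd_arr[OF compat_fpr[OF d(1)]]
  note TT = TT_tadd_fpr[OF d(1), of "tlift C (fprod X) \<bullet> h"]
  show "tlift C (TO X) \<bullet> hadd X a b = hadd3 X (tlift C (TO X) \<bullet> a) (tlift C (TO X) \<bullet> b)"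
    unfolding h(6) unfolding h(4,5) using TT(1) h(1-3) d(1) t by simp
  show "h3compat X (tlift C (TO X) \<bullet> a) (tlift C (TO X) \<bullet> b)"
    unfolding h(4,5) using TT(2) h(1-3) d(1) by simp
qed

lemma Ttzero_hadd:
  assumes "hcompat X a b"
  shows "T (tzero C (TO X)) \<bullet> hadd X a b =
      hadd3 X (T (tzero C (TO X)) \<bullet> a) (T (tzero C (TO X)) \<bullet> b)"
    "h3compat X (T (tzero C (TO X)) \<bullet> a) (T (tzero C (TO X)) \<bullet> b)"
proof -
  note d = hcompatD[OF assms] and z = tzero_hadd[OF assms] and t = hadd_arr[OF assms]
  note f = tflip_hadd3[OF z(2)]
  have "T (tzero C (TO X)) \<bullet> hadd X a b =
      tflip C (TO X) \<bullet> (tzero C (TO (TO X)) \<bullet> hadd X a b)"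
    using d(1) t by simp
  also have "\<dots> = hadd3 X (T (tzero C (TO X)) \<bullet> a) (T (tzero C (TO X)) \<bullet> b)"
    unfolding z(1) f(1) using d(1-6) by simp
  finally show "T (tzero C (TO X)) \<bullet> hadd X a b =
      hadd3 X (T (tzero C (TO X)) \<bullet> a) (T (tzero C (TO X)) \<bullet> b)" .
  show "h3compat X (T (tzero C (TO X)) \<bullet> a) (T (tzero C (TO X)) \<bullet> b)"
    using f(2) d(1-6) by simp
qed

lemma Ttlift_hadd:
  assumes "hcompat X a b"
  shows "T (tlift C X) \<bullet> hadd X a b = hadd (TO X) (T (tlift C X) \<bullet> a) (T (tlift C X) \<bullet> b)"
    "hcompat (TO X) (T (tlift C X) \<bullet> a) (T (tlift C X) \<bullet> b)"
proof -
  note d = hcompatD[OF assms]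
  obtain h where h: "arr h" "src h = src b" "tgt h = TO (fprod X)"
    "a = T (fpr1 X) \<bullet> h" "b = T (fpr2 X) \<bullet> h" "hadd X a b = T (tadd X (fpr1 X) (fpr2 X)) \<bullet> h"
    by (rule hadd_factor[OF assms])
  note t = tadd_arr[OF compat_fpr[OF d(1)]] and l = tlift_tadd[OF compat_fpr[OF d(1)]]
  note T = T_tadd_hadd[OF l(2), folded l(1)]
  note k = hadd_comp[OF T(2), of h]
  have "T (tlift C X) \<bullet> (T (tadd X (fpr1 X) (fpr2 X)) \<bullet> h) =
      T (tlift C X \<bullet> tadd X (fpr1 X) (fpr2 X)) \<bullet> h"
    using h(1-3) d(1) t by simp
  then show "T (tlift C X) \<bullet> hadd X a b = hadd (TO X) (T (tlift C X) \<bullet> a) (T (tlift C X) \<bullet> b)"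
    unfolding h(6) T(1) unfolding h(4,5) using k(1) h(1-3) d(1) by simp
  show "hcompat (TO X) (T (tlift C X) \<bullet> a) (T (tlift C X) \<bullet> b)"
    unfolding h(4,5) using k(2) h(1-3) d(1) by simp
qed

end

section \<open>The bracket of vector fields\<close>

context tangent_category
begin

lemma vfD:
  assumes "v \<in> vector_field_set X"
  shows "X \<in> Obj C" "arr v" "src v = X" "tgt v = TO X" "tproj C X \<bullet> v = Ident C X"
    "\<And>z. arr z \<Longrightarrow> tgt z = X \<Longrightarrow> tproj C X \<bullet> (v \<bullet> z) = z"
    "T (tproj C X) \<bullet> T v = Ident C (TO X)"
    "\<And>z. arr z \<Longrightarrow> tgt z = TO X \<Longrightarrow> T (tproj C X) \<bullet> (T v \<bullet> z) = z"
proof -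
  from assms have v: "v \<in> Hom C X (TO X)" "tproj C X \<bullet> v = Ident C X"
    unfolding vector_field_set_def by auto
  note h = HomD[OF v(1)]
  show X: "X \<in> Obj C" and *: "arr v" "src v = X" "tgt v = TO X" "tproj C X \<bullet> v = Ident C X"
    using h v(2) by auto
  show "tproj C X \<bullet> (v \<bullet> z) = z" if "arr z" "tgt z = X" for z
    using comp_cong_right1[OF v(2), of z] that X * by simp
  show T: "T (tproj C X) \<bullet> T v = Ident C (TO X)"
    using T_comp[of v "tproj C X"] X * by simp
  show "T (tproj C X) \<bullet> (T v \<bullet> z) = z" if "arr z" "tgt z = TO X" for z
    using comp_cong_right1[OF T, of z] that X * by simp
qed

lemma vfI:
  assumes "arr v" "src v = X" "tgt v = TO X" "tproj C X \<bullet> v = Ident C X"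
  shows "v \<in> vector_field_set X"
  using assms unfolding vector_field_set_def by (simp add: Hom_iff)

lemma vf_compat: "v \<in> vector_field_set X \<Longrightarrow> w \<in> vector_field_set X \<Longrightarrow> compat X v w"
  using vfD(1-5)[of v X] vfD(1-5)[of w X] unfolding compat_def by simp

lemma vf_tadd: "v \<in> vector_field_set X \<Longrightarrow> w \<in> vector_field_set X \<Longrightarrow> tadd X v w \<in> vector_field_set X"
  using tadd_arr[OF vf_compat[of v X w]] tproj_tadd[OF vf_compat[of v X w]] vfD(1-5)[of w X]
  by (intro vfI) simp_all

lemma vf_tzero: "X \<in> Obj C \<Longrightarrow> tzero C X \<in> vector_field_set X"
  by (intro vfI) simp_all

lemma vf_tneg:
  assumes "v \<in> vector_field_set X"
  shows "tneg X \<bullet> v \<in> vector_field_set X" "tadd X v (tneg X \<bullet> v) = tzero C X"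
proof -
  note d = vfD(1-5)[OF assms]
  note n = tneg_props[OF d(1)] tneg_comp[OF d(1,2,4)]
  show "tneg X \<bullet> v \<in> vector_field_set X" using d n(1-3,8) by (intro vfI) simp_all
  show "tadd X v (tneg X \<bullet> v) = tzero C X" unfolding n(7) d(5) using d(1) by simp
qed

lemma vf_tadd_tzero:
  assumes "v \<in> vector_field_set X"
  shows "tadd X v (tzero C X) = v" "tadd X (tzero C X) v = v"
  using tadd_tzero'(1,2)[of X v "Ident C X"] vfD(1-5)[OF assms] by simp_all

text \<open>Both second order vectors built from \<open>v\<close> and \<open>w\<close> have the
  faces \<open>w\<close> and \<open>v\<close>, so they differ by a unique tangent vector; that
  vector will be the bracket.\<close>

lemma bracket_faces:
  assumes v: "v \<in> vector_field_set X" and w: "w \<in> vector_field_set X"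
  shows "arr (tflip C X \<bullet> (T v \<bullet> w))" "src (tflip C X \<bullet> (T v \<bullet> w)) = X"
    "tgt (tflip C X \<bullet> (T v \<bullet> w)) = TO (TO X)"
    "tproj C (TO X) \<bullet> (tflip C X \<bullet> (T v \<bullet> w)) = w"
    "T (tproj C X) \<bullet> (tflip C X \<bullet> (T v \<bullet> w)) = v"
    "compat (TO X) (tflip C X \<bullet> (T v \<bullet> w)) (T w \<bullet> v)"
    "T (tproj C X) \<bullet> (tflip C X \<bullet> (T v \<bullet> w)) = T (tproj C X) \<bullet> (T w \<bullet> v)"
    "u \<in> vector_field_set X \<Longrightarrow> ccompat X (tflip C X \<bullet> (T v \<bullet> w)) u"
proof -
  note v' = vfD[OF v] and w' = vfD[OF w]
  show *: "arr (tflip C X \<bullet> (T v \<bullet> w))" "src (tflip C X \<bullet> (T v \<bullet> w)) = X"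
    "tgt (tflip C X \<bullet> (T v \<bullet> w)) = TO (TO X)"
    "tproj C (TO X) \<bullet> (tflip C X \<bullet> (T v \<bullet> w)) = w"
    "T (tproj C X) \<bullet> (tflip C X \<bullet> (T v \<bullet> w)) = v"
    using v' w' by simp_all
  show "compat (TO X) (tflip C X \<bullet> (T v \<bullet> w)) (T w \<bullet> v)"
    unfolding compat_def *(4) using * v' w' by simp
  show "T (tproj C X) \<bullet> (tflip C X \<bullet> (T v \<bullet> w)) = T (tproj C X) \<bullet> (T w \<bullet> v)"
    unfolding *(5) using v' w' by simp
  show "ccompat X (tflip C X \<bullet> (T v \<bullet> w)) u" if "u \<in> vector_field_set X"
    unfolding ccompat_def *(4) using * vf_compat[OF w that] by simp
qed

text \<open>The defining equation with a difference is equivalent to a translation equation.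
  Existence and uniqueness then come from \<open>core_ex\<close> and \<open>core_inj\<close>, and
  comparing base points shows that the translating vector is a section.\<close>

lemma vf_bracket_ex1:
  assumes v: "v \<in> vector_field_set X" and w: "w \<in> vector_field_set X"
  shows "\<exists>!u. u \<in> vector_field_set X \<and> vf_delta X v w = tlift2 X \<bullet> tpair X w u"
    and "u \<in> vector_field_set X \<Longrightarrow>
      vf_delta X v w = tlift2 X \<bullet> tpair X w u \<longleftrightarrow> T w \<bullet> v = core X (tflip C X \<bullet> (T v \<bullet> w)) u"
proof -
  let ?A = "tflip C X \<bullet> (T v \<bullet> w)" and ?B = "T w \<bullet> v"
  note f = bracket_faces[OF v w] and X = vfD(1)[OF v]
  note m = tminus_solve[OF compat_sym[OF f(6)]]
  have delta: "vf_delta X v w = tminus (TO X) \<bullet> tpair (TO X) ?B ?A"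
    unfolding vf_delta_def ..
  have core: "core X ?A u = tadd (TO X) ?A (tlift2 X \<bullet> tpair X w u)" for u
    unfolding core_def vert_def f(4) ..
  show *: "vf_delta X v w = tlift2 X \<bullet> tpair X w u \<longleftrightarrow> ?B = core X ?A u" if "u \<in> vector_field_set X" for u
  proof
    assume "vf_delta X v w = tlift2 X \<bullet> tpair X w u"
    then show "?B = core X ?A u" unfolding core delta using m(2) by simp
  next
    assume B: "?B = core X ?A u"
    note c = ccompatD(9)[OF f(8)[OF that], unfolded vert_def f(4)]
    show "vf_delta X v w = tlift2 X \<bullet> tpair X w u"
      unfolding delta by (rule tadd_cancel[OF m(1) c]) (use m(2) B core in simp)
  qed
  obtain u where u: "ccompat X ?A u" "core X ?A u = ?B" by (rule core_ex[OF f(6) X f(7)])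
  have uvf: "u \<in> vector_field_set X"
    using ccompatD(3,4,6,7)[OF u(1)] vfD(2-5)[OF w] f(2,4) by (intro vfI) simp_all
  show "\<exists>!u. u \<in> vector_field_set X \<and> vf_delta X v w = tlift2 X \<bullet> tpair X w u"
  proof (rule ex1I)
    show "u \<in> vector_field_set X \<and> vf_delta X v w = tlift2 X \<bullet> tpair X w u"
      using uvf u(2) *[OF uvf] by simp
    fix u' assume u': "u' \<in> vector_field_set X \<and> vf_delta X v w = tlift2 X \<bullet> tpair X w u'"
    then have u'': "u' \<in> vector_field_set X" by simp
    show "u' = u"
      by (rule core_inj[OF f(8)[OF u''] u(1)]) (use u' *[OF u''] u(2) in simp)
  qed
qed

lemma vf_bracket:
  assumes v: "v \<in> vector_field_set X" and w: "w \<in> vector_field_set X"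
  shows "vf_bracket X v w \<in> vector_field_set X"
    "T w \<bullet> v = core X (tflip C X \<bullet> (T v \<bullet> w)) (vf_bracket X v w)"
  using theI'[OF vf_bracket_ex1(1)[OF v w], folded vf_bracket_def] vf_bracket_ex1(2)[OF v w] by auto

lemma vf_bracket_eqI:
  assumes v: "v \<in> vector_field_set X" and w: "w \<in> vector_field_set X" and u: "u \<in> vector_field_set X"
    and "T w \<bullet> v = core X (tflip C X \<bullet> (T v \<bullet> w)) u"
  shows "vf_bracket X v w = u"
  using vf_bracket_ex1[OF v w] assms(4) vf_bracket_ex1(2)[OF v w u] u unfolding vf_bracket_def
  by (intro the1_equality) auto

text \<open>The second tangent map of \<open>f\<close> carries the translation equation of
  \<open>v\<close> and \<open>w\<close> to the one of \<open>v'\<close> and \<open>w'\<close>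
  evaluated at \<open>f\<close>; \<open>core_inj\<close> reads off the brackets.\<close>

lemma vf_bracket_related:
  assumes f: "arr f" "src f = X" "tgt f = Y"
    and v: "v \<in> vector_field_set X" and w: "w \<in> vector_field_set X"
    and v': "v' \<in> vector_field_set Y" and w': "w' \<in> vector_field_set Y"
    and vv': "T f \<bullet> v = v' \<bullet> f" and ww': "T f \<bullet> w = w' \<bullet> f"
  shows "T f \<bullet> vf_bracket X v w = vf_bracket Y v' w' \<bullet> f"
proof -
  note V = vfD(1-4)[OF v] and W = vfD(1-4)[OF w] and V' = vfD(1-4)[OF v'] and W' = vfD(1-4)[OF w']
  note b = vf_bracket[OF v w] and b' = vf_bracket[OF v' w']
  note B = vfD(1-4)[OF b(1)] and B' = vfD(1-4)[OF b'(1)]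
  note c = bracket_faces(8)[OF v w b(1)] and c' = bracket_faces(8)[OF v' w' b'(1)]
  note t = TT_core[OF c f(1,2), unfolded f(3)] and k = core_comp[OF c' f(1), unfolded B'(3) f(3), OF refl]
  have e: "T (T f) \<bullet> (T v \<bullet> w) = T v' \<bullet> (w' \<bullet> f)"
    if "v \<in> vector_field_set X" "w \<in> vector_field_set X" "v' \<in> vector_field_set Y" "w' \<in> vector_field_set Y"
      "T f \<bullet> v = v' \<bullet> f" "T f \<bullet> w = w' \<bullet> f" for v w v' w'
  proof -
    note V = vfD(1-4)[OF that(1)] and W = vfD(1-4)[OF that(2)] and V' = vfD(1-4)[OF that(3)]
      and W' = vfD(1-4)[OF that(4)]
    have "T (T f) \<bullet> T v = T v' \<bullet> T f"
      using T_comp[of v "T f"] T_comp[of f v'] that(5) V V' f by simp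
    from comp_cong_right[OF this] have "T (T f) \<bullet> (T v \<bullet> w) = T v' \<bullet> (T f \<bullet> w)"
      using V V' W f by simp
    then show ?thesis unfolding that(6) .
  qed
  have 1: "T (T f) \<bullet> (tflip C X \<bullet> (T v \<bullet> w)) = (tflip C Y \<bullet> (T v' \<bullet> w')) \<bullet> f"
    using V W V' W' f e[OF v w v' w' vv' ww'] by simp
  have "core Y ((tflip C Y \<bullet> (T v' \<bullet> w')) \<bullet> f) (T f \<bullet> vf_bracket X v w) =
      T (T f) \<bullet> (T w \<bullet> v)"
    unfolding b(2) t(1) 1 ..
  also have "\<dots> = T w' \<bullet> (v' \<bullet> f)" by (rule e[OF w v w' v' ww' vv'])
  also have "\<dots> = (T w' \<bullet> v') \<bullet> f" using V' W' f by simp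
  also have "\<dots> = core Y ((tflip C Y \<bullet> (T v' \<bullet> w')) \<bullet> f) (vf_bracket Y v' w' \<bullet> f)"
    unfolding b'(2) k(1) ..
  finally show ?thesis by (rule core_inj[OF t(2)[unfolded 1] k(2)])
qed

text \<open>Flipping the equation for [v, w] gives a translation from \<open>T v \<bullet> w\<close>
  to \<open>tflip C X \<bullet> (T w \<bullet> v)\<close>, and the equation for [w, v] translates
  back. The two translations add up by \<open>core_core\<close>.\<close>

lemma vf_bracket_antisym:
  assumes v: "v \<in> vector_field_set X" and w: "w \<in> vector_field_set X"
  shows "tadd X (vf_bracket X v w) (vf_bracket X w v) = tzero C X"
proof -
  note V = vfD(1-4)[OF v] and W = vfD(1-4)[OF w]
  note b = vf_bracket[OF v w] and b' = vf_bracket[OF w v]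
  note f = bracket_faces[OF v w] and f' = bracket_faces[OF w v]
  let ?A = "T v \<bullet> w"
  have cA: "ccompat X ?A u" if "u \<in> vector_field_set X" for u
    using ccompat_tflip[OF f(8)[OF that]] V W by simp
  have "tflip C X \<bullet> (T w \<bullet> v) = core X ?A (vf_bracket X v w)"
    unfolding b(2) tflip_core[OF f(8)[OF b(1)]] using V W by simp
  then have "core X ?A (tadd X (vf_bracket X v w) (vf_bracket X w v)) =
      core X (tflip C X \<bullet> (T w \<bullet> v)) (vf_bracket X w v)"
    using core_core[OF cA[OF b(1)] vf_compat[OF b(1) b'(1)]] by simp
  also have "\<dots> = ?A" by (rule b'(2)[symmetric])
  also have "\<dots> = core X ?A (tzero C X)"
    using core_tzero(1)[OF V(1), of ?A "Ident C X"] V W vfD(5,6)[OF v] vfD(5)[OF w] by simp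
  finally show ?thesis
    by (rule core_inj[OF cA[OF vf_tadd[OF b(1) b'(1)]] cA[OF vf_tzero[OF V(1)]]])
qed

text \<open>\<open>T w\<close> is additive on fibers, and the flip turns the \<open>hadd\<close> sum
  obtained from \<open>T (tadd X v v')\<close> into a fiberwise one. Both sides are then sums of
  translates, from which the translation parts are collected.\<close>

lemma vf_bracket_add_left:
  assumes v: "v \<in> vector_field_set X" and v': "v' \<in> vector_field_set X" and w: "w \<in> vector_field_set X"
  shows "vf_bracket X (tadd X v v') w = tadd X (vf_bracket X v w) (vf_bracket X v' w)"
proof -
  note V = vfD(1-4)[OF v] and V' = vfD(1-4)[OF v'] and W = vfD(1-4)[OF w]
  note vv' = vf_tadd[OF v v'] and cv = vf_compat[OF v v']
  note b = vf_bracket[OF v w] and b' = vf_bracket[OF v' w]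
  note f = bracket_faces[OF v w] and f' = bracket_faces[OF v' w] and cb = vf_compat[OF b(1) b'(1)]
  let ?A = "tflip C X \<bullet> (T v \<bullet> w)" and ?A' = "tflip C X \<bullet> (T v' \<bullet> w)"
  let ?u = "vf_bracket X v w" and ?u' = "vf_bracket X v' w"
  let ?Y = "TO X"
  have AA: "compat ?Y ?A' ?A" using f(1-4) f'(1-4) V(1) unfolding compat_def by simp
  note T = T_tadd_hadd[OF cv]
  note h = hadd_comp[OF T(2), of w]
  have A: "tflip C X \<bullet> (T (tadd X v v') \<bullet> w) = tadd ?Y ?A ?A'"
    unfolding T(1) using h V V' W tflip_hadd[OF h(2)] by simp
  note core1 = tadd_core[OF f'(8)[OF b'(1)], of "core X ?A ?u"]
  note core2 = tadd_core[OF f(8)[OF b(1)] AA]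
  have cu: "compat ?Y (core X ?A ?u) ?A'" using core2(3) by (rule compat_sym)
  show ?thesis
  proof (rule vf_bracket_eqI[OF vv' w vf_tadd[OF b(1) b'(1)]])
    have "T w \<bullet> tadd X v v' = tadd ?Y (T w \<bullet> v) (T w \<bullet> v')"
      using T_tadd[OF cv, of w] W by simp
    also have "\<dots> = tadd ?Y (core X ?A ?u) (core X ?A' ?u')" by (simp only: b(2)[symmetric] b'(2)[symmetric])
    also have "\<dots> = core X (tadd ?Y (core X ?A ?u) ?A') ?u'" by (rule core1(1)[OF cu])
    also have "tadd ?Y (core X ?A ?u) ?A' = core X (tadd ?Y ?A' ?A) ?u"
      unfolding tadd_comm[OF cu] core2(1) ..
    also have "core X \<dots> ?u' = core X (tadd ?Y ?A' ?A) (tadd X ?u ?u')"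
      by (rule core_core[OF core2(2) cb])
    finally show "T w \<bullet> tadd X v v' =
        core X (tflip C X \<bullet> (T (tadd X v v') \<bullet> w)) (tadd X ?u ?u')"
      unfolding A tadd_comm[OF AA] .
  qed
qed

lemma vf_bracket_swap_unique:
  assumes v: "v \<in> vector_field_set X" and w: "w \<in> vector_field_set X" and u: "u \<in> vector_field_set X"
    and "tadd X (vf_bracket X w v) u = tzero C X"
  shows "vf_bracket X v w = u"
proof -
  note b = vf_bracket(1)[OF v w] vf_bracket(1)[OF w v]
  show ?thesis
    by (rule tadd_cancel[OF vf_compat[OF b(2,1)] vf_compat[OF b(2) u]])
      (simp add: vf_bracket_antisym[OF w v] assms(4))
qed

lemma vf_tadd_swap:
  assumes "a \<in> vector_field_set X" "b \<in> vector_field_set X" "c \<in> vector_field_set X" "d \<in> vector_field_set X"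
  shows "tadd X (tadd X a b) (tadd X c d) = tadd X (tadd X a c) (tadd X b d)"
proof -
  note c = vf_compat[of _ X]
  have "tadd X b (tadd X c d) = tadd X c (tadd X b d)"
    using assms by (simp only: tadd_assoc[OF c c, symmetric] tadd_comm[OF c[of b c]])
  then show ?thesis using assms by (simp only: tadd_assoc[OF c c] vf_tadd)
qed

text \<open>Antisymmetry reduces additivity in the second argument to additivity in the
  first.\<close>

lemma vf_bracket_add_right:
  assumes v: "v \<in> vector_field_set X" and w: "w \<in> vector_field_set X" and w': "w' \<in> vector_field_set X"
  shows "vf_bracket X v (tadd X w w') = tadd X (vf_bracket X v w) (vf_bracket X v w')"
proof (rule vf_bracket_swap_unique[OF v vf_tadd[OF w w'] vf_tadd[OF vf_bracket(1)[OF v w] vf_bracket(1)[OF v w']]])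
  note b = vf_bracket(1)[OF v w] vf_bracket(1)[OF w v] vf_bracket(1)[OF v w'] vf_bracket(1)[OF w' v]
  show "tadd X (vf_bracket X (tadd X w w') v) (tadd X (vf_bracket X v w) (vf_bracket X v w')) = tzero C X"
    unfolding vf_bracket_add_left[OF w w' v] vf_tadd_swap[OF b(2,4,1,3)]
      vf_bracket_antisym[OF w v] vf_bracket_antisym[OF w' v]
    by (rule vf_tadd_tzero[OF vf_tzero[OF vfD(1)[OF v]]])
qed

section \<open>Lifts of vector fields to the tangent object, and the Jacobi identity\<close>

text \<open>The complete and the vertical lift of vector fields from \<open>X\<close> to \<open>TX\<close>.\<close>

definition clift :: "'o \<Rightarrow> 'a \<Rightarrow> 'a" where
  "clift X v = tflip C X \<bullet> T v"

definition vlift :: "'o \<Rightarrow> 'a \<Rightarrow> 'a" where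
  "vlift X w = vert X (Ident C (TO X)) (w \<bullet> tproj C X)"

lemma vf_clift:
  assumes "v \<in> vector_field_set X"
  shows "clift X v \<in> vector_field_set (TO X)"
  using vfD[OF assms] unfolding clift_def by (intro vfI) simp_all

lemma vlift_compat:
  assumes "v \<in> vector_field_set X"
  shows "compat X (Ident C (TO X)) (v \<bullet> tproj C X)"
  using vfD[OF assms] unfolding compat_def by simp

lemma vf_vlift:
  assumes "v \<in> vector_field_set X"
  shows "vlift X v \<in> vector_field_set (TO X)"
  using vfD[OF assms] vert_props[OF vlift_compat[OF assms]] unfolding vlift_def by (intro vfI) simp_all

lemma vlift_comp:
  assumes v: "v \<in> vector_field_set X" and "arr z" "tgt z = TO X"
  shows "vlift X v \<bullet> z = vert X z (v \<bullet> (tproj C X \<bullet> z))"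
  unfolding vlift_def using vert_comp[OF vlift_compat[OF v], of z] vfD(1-4)[OF v] assms(2,3) by simp

lemma vlift_tadd:
  assumes v: "v \<in> vector_field_set X" and w: "w \<in> vector_field_set X"
  shows "vlift X (tadd X v w) = tadd (TO X) (vlift X v) (vlift X w)"
proof -
  note V = vfD(1-4)[OF v] and W = vfD(1-4)[OF w]
  have c: "compat X (v \<bullet> tproj C X) (w \<bullet> tproj C X)"
    by (rule compat_comp[OF vf_compat[OF v w]]) (use V W in simp_all)
  show ?thesis
    unfolding vlift_def vert_tadd(1)[OF vlift_compat[OF v] c]
    using tadd_comp[OF vf_compat[OF v w], of "tproj C X"] V W by simp
qed

lemma clift_vlift_comp:
  assumes v: "v \<in> vector_field_set X" and u: "u \<in> vector_field_set X" and w: "w \<in> vector_field_set X"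
  shows "tadd (TO X) (clift X v) (vlift X u) \<bullet> w = core X (tflip C X \<bullet> (T v \<bullet> w)) u"
proof -
  note V = vfD(1-4)[OF v] and W = vfD[OF w] and U = vfD(1-4)[OF u]
  have "tadd (TO X) (clift X v) (vlift X u) \<bullet> w =
      tadd (TO X) (clift X v \<bullet> w) (vlift X u \<bullet> w)"
    by (rule tadd_comp[OF vf_compat[OF vf_clift[OF v] vf_vlift[OF u]]])
      (use W vfD(3)[OF vf_vlift[OF u]] in simp_all)
  also have "vlift X u \<bullet> w = vert X w u"
    using vlift_comp[OF u, of w] W U by simp
  also have "clift X v \<bullet> w = tflip C X \<bullet> (T v \<bullet> w)" unfolding clift_def using V W by simp
  also have "tadd (TO X) (tflip C X \<bullet> (T v \<bullet> w)) (vert X w u) = core X (tflip C X \<bullet> (T v \<bullet> w)) u"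
    unfolding core_def bracket_faces(4)[OF v w] ..
  finally show ?thesis .
qed

text \<open>The equation defining the bracket says that \<open>w\<close> relates \<open>v\<close> to the sum of the complete lift
  of \<open>v\<close> and the vertical lift of \<open>[v, w]\<close>.\<close>

lemma T_comp_vf:
  assumes v: "v \<in> vector_field_set X" and w: "w \<in> vector_field_set X"
  shows "T w \<bullet> v = tadd (TO X) (clift X v) (vlift X (vf_bracket X v w)) \<bullet> w"
  using vf_bracket[OF v w] clift_vlift_comp[OF v vf_bracket(1)[OF v w] w] by simp

text \<open>The braid relation rearranges the flips around the addition, and
  \<open>flip_Tlift\<close> handles the lifted summand. Differentiating a vertical vector thus
  gives, up to flips, the vertical vector formed from the flipped derivatives.\<close>

lemma vert_T:
  assumes "compat X a c"
  shows "T (tflip C X) \<bullet> (tflip C (TO X) \<bullet> T (vert X a c)) =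
      vert (TO X) (tflip C X \<bullet> T a) (tflip C X \<bullet> T c)"
    "compat (TO X) (tflip C X \<bullet> T a) (tflip C X \<bullet> T c)"
proof -
  note d = compatD[OF assms]
  let ?f = "tflip C (TO X)" and ?Tf = "T (tflip C X)" and ?Y = "TO (TO X)"
  let ?p = "T (tzero C X) \<bullet> a" and ?q = "tlift C X \<bullet> c"
  have f: "arr (tflip C X)" "src (tflip C X) = ?Y" "tgt (tflip C X) = ?Y" using d(1) by simp_all
  have c0: "compat (TO X) ?p ?q" using d unfolding compat_def by simp
  note t = tadd_arr[OF c0] and T = T_tadd_hadd[OF c0]
  note H = hcompatD(8)[OF T(2)]
  have cT: "compat (TO X) (tflip C X \<bullet> T a) (tflip C X \<bullet> T c)"
    using tflip_hadd[OF T_tadd_hadd(2)[OF assms]] hcompatD(8)[OF T_tadd_hadd(2)[OF assms]] by simp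
  then show "compat (TO X) (tflip C X \<bullet> T a) (tflip C X \<bullet> T c)" .
  have V: "vert X a c = tflip C X \<bullet> tadd (TO X) ?p ?q"
    unfolding vert_eq(1)[OF assms] hadd_def using d(1-6) by simp
  have "?Tf \<bullet> (?f \<bullet> T (vert X a c)) = ?Tf \<bullet> (?f \<bullet> (?Tf \<bullet> (?f \<bullet> tadd ?Y (?f \<bullet> T ?p) (?f \<bullet> T ?q))))"
    unfolding V using t f T(1) by (simp add: hadd_def del: T_comp add: T_comp[of "tadd (TO X) ?p ?q" "tflip C X"])
  also have "\<dots> = ?f \<bullet> (?Tf \<bullet> (?f \<bullet> (?f \<bullet> tadd ?Y (?f \<bullet> T ?p) (?f \<bullet> T ?q))))"
    by (rule flip_braid[symmetric]) (use d(1) tadd_arr[OF H] in simp_all)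
  also have "\<dots> = ?f \<bullet> (?Tf \<bullet> tadd ?Y (?f \<bullet> T ?p) (?f \<bullet> T ?q))"
    using d(1) tadd_arr[OF H] by simp
  also have "?Tf \<bullet> tadd ?Y (?f \<bullet> T ?p) (?f \<bullet> T ?q) =
      tadd ?Y (?Tf \<bullet> (?f \<bullet> T ?p)) (?Tf \<bullet> (?f \<bullet> T ?q))"
    by (rule T_tadd[OF H f(1,2), unfolded f(3)])
  also have "?Tf \<bullet> (?f \<bullet> T ?q) = tlift C (TO X) \<bullet> (tflip C X \<bullet> T c)"
    using flip_Tlift(1)[OF d(1), of "T c"] d(1-6) by simp
  also have "?Tf \<bullet> (?f \<bullet> T ?p) = T (tzero C (TO X)) \<bullet> (tflip C X \<bullet> T a)"
  proof -
    have "?f \<bullet> T ?p = T (T (tzero C X)) \<bullet> (tflip C X \<bullet> T a)" using d(1-6) by simp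
    moreover have "?Tf \<bullet> T (T (tzero C X)) = T (tzero C (TO X))"
      using d(1) T_comp[of "T (tzero C X)" "tflip C X"] by simp
    ultimately show ?thesis
      using d(1-6) comp_cong_right1[of ?Tf "T (T (tzero C X))" "T (tzero C (TO X))" "tflip C X \<bullet> T a"]
      by simp
  qed
  also have "?f \<bullet> tadd ?Y (T (tzero C (TO X)) \<bullet> (tflip C X \<bullet> T a))
      (tlift C (TO X) \<bullet> (tflip C X \<bullet> T c)) = vert (TO X) (tflip C X \<bullet> T a) (tflip C X \<bullet> T c)"
    unfolding vert_eq(1)[OF cT] hadd_def using d(1-6) by simp
  finally show "?Tf \<bullet> (?f \<bullet> T (vert X a c)) =
      vert (TO X) (tflip C X \<bullet> T a) (tflip C X \<bullet> T c)" .
qed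

text \<open>The equation for [v, w] is differentiated and flipped. By the braid relation its base
  term becomes the flipped composite of the complete lifts, by \<open>vert_T\<close> its vertical
  term remains vertical; the outcome is the bracket equation of the complete lifts.\<close>

lemma bracket_clift_clift:
  assumes v: "v \<in> vector_field_set X" and w: "w \<in> vector_field_set X"
  shows "vf_bracket (TO X) (clift X v) (clift X w) = clift X (vf_bracket X v w)"
proof -
  note V = vfD(1-4)[OF v] and W = vfD(1-4)[OF w] and b = vf_bracket[OF v w]
  note V' = vf_clift[OF v] and W' = vf_clift[OF w] and f = bracket_faces[OF v w]
  let ?u = "vf_bracket X v w" and ?A = "tflip C X \<bullet> (T v \<bullet> w)" and ?Y = "TO (TO X)"
  let ?f = "tflip C (TO X)" and ?Tf = "T (tflip C X)"
  have cv: "compat X w ?u" by (rule vf_compat[OF w b(1)])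
  have c: "compat (TO X) ?A (vert X w ?u)"
    using ccompatD(9)[OF f(8)[OF b(1)]] unfolding f(4) .
  note T = T_tadd_hadd[OF c] and vT = vert_T[OF cv]
  have tf: "arr (tflip C X)" "src (tflip C X) = ?Y" "tgt (tflip C X) = ?Y" using V by simp_all
  note vv = vert_props[OF cv]
  show ?thesis
  proof (rule vf_bracket_eqI[OF V' W' vf_clift[OF b(1)]])
    have "T (clift X w) \<bullet> clift X v = ?Tf \<bullet> (?f \<bullet> (T (T w) \<bullet> T v))"
      unfolding clift_def using V W by simp
    also have "T (T w) \<bullet> T v = T (T w \<bullet> v)" using V W by simp
    also have "\<dots> = hadd (TO X) (T ?A) (T (vert X w ?u))"
      unfolding b(2) core_def f(4) by (rule T(1))
    also have "?f \<bullet> \<dots> = tadd ?Y (?f \<bullet> T ?A) (?f \<bullet> T (vert X w ?u))"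
      by (rule tflip_hadd[OF T(2)])
    also have "?Tf \<bullet> \<dots> = tadd ?Y (?Tf \<bullet> (?f \<bullet> T ?A)) (?Tf \<bullet> (?f \<bullet> T (vert X w ?u)))"
      by (rule T_tadd[OF hcompatD(8)[OF T(2)] tf(1,2), unfolded tf(3)])
    also have "?Tf \<bullet> (?f \<bullet> T (vert X w ?u)) = vert (TO X) (clift X w) (clift X ?u)"
      unfolding vT(1) clift_def ..
    also have "?Tf \<bullet> (?f \<bullet> T ?A) = ?f \<bullet> (T (clift X v) \<bullet> clift X w)"
    proof -
      have "?Tf \<bullet> (?f \<bullet> T ?A) = ?Tf \<bullet> (?f \<bullet> (?Tf \<bullet> (T (T v) \<bullet> T w)))"
        using V W by simp
      also have "\<dots> = ?f \<bullet> (?Tf \<bullet> (?f \<bullet> (T (T v) \<bullet> T w)))"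
        by (rule flip_braid[symmetric]) (use V W in simp_all)
      also have "\<dots> = ?f \<bullet> (T (clift X v) \<bullet> clift X w)"
        unfolding clift_def using V W by simp
      finally show ?thesis .
    qed
    also have "tadd ?Y (?f \<bullet> (T (clift X v) \<bullet> clift X w)) (vert (TO X) (clift X w) (clift X ?u)) =
        core (TO X) (?f \<bullet> (T (clift X v) \<bullet> clift X w)) (clift X ?u)"
      unfolding core_def bracket_faces(4)[OF V' W'] ..
    finally show "T (clift X w) \<bullet> clift X v =
      core (TO X) (?f \<bullet> (T (clift X v) \<bullet> clift X w)) (clift X ?u)" .
  qed
qed

lemma vlift_hadd:
  assumes "v \<in> vector_field_set X"
  shows "vlift X v = hadd X (tzero C (TO X)) (tlift C X \<bullet> (v \<bullet> tproj C X))"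
    "hcompat X (tzero C (TO X)) (tlift C X \<bullet> (v \<bullet> tproj C X))"
  using vert_eq[OF vlift_compat[OF assms]] vfD(1-4)[OF assms] unfolding vlift_def by simp_all

lemma T_vlift:
  assumes v: "v \<in> vector_field_set X"
  shows "T (vlift X v) = hadd3 X (T (tzero C (TO X)))
      (T (tlift C X) \<bullet> (T v \<bullet> T (tproj C X)))"
    "h3compat X (T (tzero C (TO X))) (T (tlift C X) \<bullet> (T v \<bullet> T (tproj C X)))"
  using T_hadd[OF vlift_hadd(2)[OF v]] vfD(1-4)[OF v] unfolding vlift_hadd(1)[OF v] by simp_all

lemma T_vlift_comp:
  assumes v: "v \<in> vector_field_set X" and z: "arr z" "tgt z = TO (TO X)"
  shows "T (vlift X v) \<bullet> z = hadd3 X (T (tzero C (TO X)) \<bullet> z)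
      (T (tlift C X) \<bullet> (T v \<bullet> (T (tproj C X) \<bullet> z)))"
    "h3compat X (T (tzero C (TO X)) \<bullet> z) (T (tlift C X) \<bullet> (T v \<bullet> (T (tproj C X) \<bullet> z)))"
  using hadd3_comp[OF T_vlift(2)[OF v], of z] vfD(1-4)[OF v] z unfolding T_vlift(1)[OF v] by simp_all

lemma TT_Ttzero [simp]:
  assumes "arr f" "src f = Y" "arr z" "tgt z = TO Y"
  shows "T (T f) \<bullet> (T (tzero C Y) \<bullet> z) = T (tzero C (tgt f)) \<bullet> (T f \<bullet> z)"
proof -
  have Y: "Y \<in> Obj C" using assms(1,2) by auto
  have "T (T f) \<bullet> T (tzero C Y) = T (T f \<bullet> tzero C Y)"
    using assms(1,2) Y by (simp del: T_tzero)
  also have "T f \<bullet> tzero C Y = tzero C (tgt f) \<bullet> f" by (rule T_tzero(1)[OF assms(1,2)])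
  also have "T (tzero C (tgt f) \<bullet> f) = T (tzero C (tgt f)) \<bullet> T f"
    using assms(1) by simp
  finally show ?thesis by (rule comp_cong_right) (use assms Y in simp_all)
qed

lemma TTproj_Tlift [simp]:
  assumes "X \<in> Obj C" "arr z" "tgt z = TO (TO X)"
  shows "T (T (tproj C X)) \<bullet> (T (tlift C X) \<bullet> z) = T (tzero C X) \<bullet> (T (tproj C X) \<bullet> z)"
proof -
  have "T (T (tproj C X)) \<bullet> T (tlift C X) = T (T (tproj C X) \<bullet> tlift C X)"
    using assms(1) by (simp del: Tproj_tlift)
  also have "\<dots> = T (tzero C X) \<bullet> T (tproj C X)" using assms(1) by simp
  finally show ?thesis by (rule comp_cong_right) (use assms in simp_all)
qed

lemma h3compat_hadd3:
  assumes "h3compat X a b" "h3compat X b c"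
  shows "h3compat X (hadd3 X a b) c"
proof -
  note d = h3compatD[OF assms(1)] and e = h3compatD[OF assms(2)]
  have "T (T (tproj C X)) \<bullet> hadd3 X a b =
      T (tproj C (TO X)) \<bullet> hadd (TO X) (T (tflip C X) \<bullet> a) (T (tflip C X) \<bullet> b)"
    unfolding hadd3_def using d(1-6) hadd_arr[OF d(8)] by simp
  also have "\<dots> = T (T (tproj C X)) \<bullet> b"
    unfolding Tproj_hadd(1)[OF d(8)] using d(1-6) by simp
  finally show ?thesis
    using hadd3_arr[OF assms(1)] e unfolding h3compat_def by simp
qed

text \<open>In terms of \<open>hadd3\<close>, the composite of two vertical lifts is a zero term
  plus one term for each field. These two differ in whether \<open>T (tzero C (TO X))\<close> or
  \<open>tzero C (TO (TO X))\<close> is applied, and the outer flip exchanges the two. Hence both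
  orders of composition agree.\<close>

lemma bracket_vlift_vlift:
  assumes v: "v \<in> vector_field_set X" and w: "w \<in> vector_field_set X"
  shows "vf_bracket (TO X) (vlift X v) (vlift X w) = tzero C (TO X)"
proof -
  let ?T2 = "TO (TO X)"
  let ?O = "tzero C ?T2 \<bullet> tzero C (TO X)"
  let ?L = "\<lambda>v. tlift C X \<bullet> (v \<bullet> tproj C X)"
  have X: "X \<in> Obj C" using vfD(1)[OF v] .
  have *: "T (vlift X w) \<bullet> vlift X v =
      hadd3 X (hadd3 X ?O (T (tzero C (TO X)) \<bullet> ?L v)) (tzero C ?T2 \<bullet> ?L w)"
    "h3compat X ?O (T (tzero C (TO X)) \<bullet> ?L v)"
    "h3compat X (T (tzero C (TO X)) \<bullet> ?L v) (tzero C ?T2 \<bullet> ?L w)"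
    if v: "v \<in> vector_field_set X" and w: "w \<in> vector_field_set X" for v w
  proof -
    note V = vfD(1-4)[OF v] and W = vfD(1-4)[OF w]
    note vv = vfD(1-4)[OF vf_vlift[OF v]]
    have 1: "T (tproj C X) \<bullet> vlift X v = tzero C X \<bullet> tproj C X"
      using vert_props(5)[OF vlift_compat[OF v]] X unfolding vlift_def by simp
    note h = Ttzero_hadd[OF vlift_hadd(2)[OF v], folded vlift_hadd(1)[OF v]]
    note k = T_vlift_comp[OF w vv(2,4)]
    have 2: "T (tzero C (TO X)) \<bullet> tzero C (TO X) = ?O" using X by simp
    have 3: "T (tlift C X) \<bullet> (T w \<bullet> (T (tproj C X) \<bullet> vlift X v)) = tzero C ?T2 \<bullet> ?L w"
      unfolding 1 using X W by simp
    show "T (vlift X w) \<bullet> vlift X v =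
      hadd3 X (hadd3 X ?O (T (tzero C (TO X)) \<bullet> ?L v)) (tzero C ?T2 \<bullet> ?L w)"
      unfolding k(1) 3 h(1) 2 ..
    show "h3compat X ?O (T (tzero C (TO X)) \<bullet> ?L v)" using h(2) unfolding 2 .
    show "h3compat X (T (tzero C (TO X)) \<bullet> ?L v) (tzero C ?T2 \<bullet> ?L w)"
      unfolding h3compat_def using V W vfD(6)[OF v] vfD(6)[OF w] by simp
  qed
  let ?f = "tflip C (TO X)"
  note V = vfD(1-4)[OF v] and W = vfD(1-4)[OF w]
  have O: "?f \<bullet> ?O = ?O" using X by simp
  have Lv: "?f \<bullet> (tzero C ?T2 \<bullet> ?L v) = T (tzero C (TO X)) \<bullet> ?L v" using X V by simp
  have Lw: "?f \<bullet> (T (tzero C (TO X)) \<bullet> ?L w) = tzero C ?T2 \<bullet> ?L w" using X W by simp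
  note vw = *[OF v w] and wv = *[OF w v]
  have c: "h3compat X (hadd3 X ?O (T (tzero C (TO X)) \<bullet> ?L w)) (tzero C ?T2 \<bullet> ?L v)"
    by (rule h3compat_hadd3[OF wv(2,3)])
  note f1 = tflip_hadd3[OF c] and f2 = tflip_hadd3[OF wv(2)]
  note d1 = f2(2)[unfolded O Lw] and d2 = f1(2)[unfolded f2(1) O Lw Lv]
  have "?f \<bullet> (T (vlift X v) \<bullet> vlift X w) =
      hadd3 X (hadd3 X ?O (tzero C ?T2 \<bullet> ?L w)) (T (tzero C (TO X)) \<bullet> ?L v)"
    unfolding wv(1) f1(1) f2(1) O Lw Lv ..
  also have "\<dots> = hadd3 X ?O (hadd3 X (tzero C ?T2 \<bullet> ?L w) (T (tzero C (TO X)) \<bullet> ?L v))"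
    by (rule hadd3_assoc[OF d1 h3compat_sym[OF vw(3)]])
  also have "\<dots> = hadd3 X ?O (hadd3 X (T (tzero C (TO X)) \<bullet> ?L v) (tzero C ?T2 \<bullet> ?L w))"
    unfolding hadd3_comm[OF vw(3)] ..
  also have "\<dots> = T (vlift X w) \<bullet> vlift X v"
    unfolding vw(1) by (rule hadd3_assoc[OF vw(2,3), symmetric])
  finally have e: "?f \<bullet> (T (vlift X v) \<bullet> vlift X w) = T (vlift X w) \<bullet> vlift X v" .
  show ?thesis
  proof (rule vf_bracket_eqI[OF vf_vlift[OF v] vf_vlift[OF w] vf_tzero])
    show TX: "TO X \<in> Obj C" using X by simp
    note fc = bracket_faces[OF vf_vlift[OF v] vf_vlift[OF w]]
    have "core (TO X) (?f \<bullet> (T (vlift X v) \<bullet> vlift X w)) (tzero C (TO X) \<bullet> Ident C (TO X)) =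
        ?f \<bullet> (T (vlift X v) \<bullet> vlift X w)"
      by (rule core_tzero(1)[OF TX fc(1,3)])
        (use fc(4) vfD(5)[OF vf_vlift[OF w]] in simp)
    then show "T (vlift X w) \<bullet> vlift X v =
        core (TO X) (?f \<bullet> (T (vlift X v) \<bullet> vlift X w)) (tzero C (TO X))"
      using e TX by simp
  qed
qed

text \<open>Everything is written as a \<open>hadd3\<close> sum of a common part \<open>?P\<close>
  and a part \<open>?Q x\<close> that depends on a second order vector \<open>x\<close> of
  \<open>X\<close> through \<open>T (tlift C X)\<close>. The bracket equation for \<open>v\<close>
  and \<open>w\<close>, inserted under \<open>?Q\<close>, becomes that of the lifts because the
  fiberwise addition and \<open>hadd3\<close> interchange.\<close>

lemma bracket_clift_vlift:
  assumes v: "v \<in> vector_field_set X" and w: "w \<in> vector_field_set X"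
  shows "vf_bracket (TO X) (clift X v) (vlift X w) = vlift X (vf_bracket X v w)"
proof -
  let ?u = "vf_bracket X v w" and ?B = "tflip C X \<bullet> (T v \<bullet> w)" and ?T2 = "TO (TO X)"
  let ?f = "tflip C (TO X)" and ?Tf = "T (tflip C X)" and ?p = "tproj C X"
  let ?P = "T (tzero C (TO X)) \<bullet> clift X v" and ?O = "tzero C ?T2 \<bullet> tzero C (TO X)"
  let ?Q = "\<lambda>x. T (tlift C X) \<bullet> (x \<bullet> ?p)"
  note b = vf_bracket[OF v w]
  note V = vfD(1-4)[OF v] and W = vfD[OF w] and U = vfD(1-4)[OF b(1)]
  note cl = vf_clift[OF v] and vl = vf_vlift[OF w] and f = bracket_faces[OF v w]
  note CL = vfD(1-4)[OF cl] and VL = vfD(1-4)[OF vl]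
  have X: "X \<in> Obj C" by (rule V(1))
  have cwu: "compat X w ?u" by (rule vf_compat[OF w b(1)])
  note vwu = vert_props[OF cwu]
  have c0: "compat (TO X) ?B (vert X w ?u)"
    using ccompatD(9)[OF f(8)[OF b(1)]] unfolding f(4) .
  have cp: "compat (TO X) (?B \<bullet> ?p) (vert X w ?u \<bullet> ?p)"
    by (rule compat_comp[OF c0]) (use X vwu U in simp_all)

  \<comment> \<open>The vertical lift of \<open>w\<close> differentiated along the complete lift of
    \<open>v\<close>: the \<open>?Q\<close> part carries \<open>T w \<bullet> v\<close>.\<close>
  have "T ?p \<bullet> clift X v = v \<bullet> ?p" unfolding clift_def using V by simp
  then have 1: "T (vlift X w) \<bullet> clift X v = hadd3 X ?P (?Q (T w \<bullet> v))"
    "h3compat X ?P (?Q (T w \<bullet> v))"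
    using T_vlift_comp[OF w CL(2,4)] V W by simp_all

  \<comment> \<open>The composite in the other order, flipped: here the \<open>?Q\<close> part
    carries \<open>tflip C X \<bullet> (T v \<bullet> w)\<close>.\<close>
  have v2: "arr v" "src v = X" "tgt v = TO X" using V by simp_all
  note TT = TT_hadd[OF vlift_hadd(2)[OF w] v2(1,2), unfolded v2(3), folded vlift_hadd(1)[OF w]]
  have "T (T v) \<bullet> vlift X w =
      hadd (TO X) (tzero C ?T2 \<bullet> T v) (tlift C (TO X) \<bullet> (T v \<bullet> (w \<bullet> ?p)))"
    unfolding TT(1) using V W by simp
  then have "?f \<bullet> (T (clift X v) \<bullet> vlift X w) =
      ?f \<bullet> (?Tf \<bullet> hadd (TO X) (tzero C ?T2 \<bullet> T v) (tlift C (TO X) \<bullet> (T v \<bullet> (w \<bullet> ?p))))"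
    using V W VL unfolding clift_def by simp
  also have "?Tf \<bullet> hadd (TO X) (tzero C ?T2 \<bullet> T v) (tlift C (TO X) \<bullet> (T v \<bullet> (w \<bullet> ?p))) =
      hadd3 X (?Tf \<bullet> (tzero C ?T2 \<bullet> T v)) (?Tf \<bullet> (tlift C (TO X) \<bullet> (T v \<bullet> (w \<bullet> ?p))))"
    unfolding hadd3_def using V W by (simp del: T_tzero)
  also have "?f \<bullet> \<dots> = hadd3 X (?f \<bullet> (?Tf \<bullet> (tzero C ?T2 \<bullet> T v)))
      (?f \<bullet> (?Tf \<bullet> (tlift C (TO X) \<bullet> (T v \<bullet> (w \<bullet> ?p)))))"
    by (rule tflip_hadd3(1)) (use V W in \<open>simp add: h3compat_def\<close>)
  also have "?f \<bullet> (?Tf \<bullet> (tlift C (TO X) \<bullet> (T v \<bullet> (w \<bullet> ?p)))) = ?Q ?B"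
    using V W by (simp add: flip_Tlift(2))
  also have "?f \<bullet> (?Tf \<bullet> (tzero C ?T2 \<bullet> T v)) = ?P"
    unfolding clift_def using V by simp
  finally have 2: "?f \<bullet> (T (clift X v) \<bullet> vlift X w) = hadd3 X ?P (?Q ?B)" .

  \<comment> \<open>The vertical vector at \<open>vlift X w\<close> in the direction
    \<open>vlift X ?u\<close> is brought into the same shape, with \<open>?O\<close> in place of
    \<open>?P\<close>.\<close>
  have h: "hcompat X (tzero C (TO X) \<bullet> (w \<bullet> ?p)) (tlift C X \<bullet> (?u \<bullet> ?p))"
    using V W U vfD(5,6)[OF b(1)] unfolding hcompat_def by simp
  note z = tzero_hadd[OF vlift_hadd(2)[OF w], folded vlift_hadd(1)[OF w]]
  note l = tlift_hadd[OF vlift_hadd(2)[OF b(1)], folded vlift_hadd(1)[OF b(1)]]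
  note q = Ttlift_hadd[OF h]
  have O1: "tlift C (TO X) \<bullet> tzero C (TO X) = ?O" using X by simp
  have O2: "hadd (TO X) ?O ?O = ?O" "hcompat (TO X) ?O ?O"
  proof -
    have "?O = T (tzero C (TO X)) \<bullet> tzero C (TO X)" using X by simp
    then show "hadd (TO X) ?O ?O = ?O"
      using hadd_Ttzero(1)[of "TO X" ?O "tzero C (TO X)"] X by simp
    show "hcompat (TO X) ?O ?O" using X unfolding hcompat_def by simp
  qed
  \<comment> \<open>The two ways of lifting a lift agree, which exposes the factor
    \<open>T (tlift C X)\<close>.\<close>
  have L1: "tlift C (TO X) \<bullet> (tlift C X \<bullet> (?u \<bullet> ?p)) = T (tlift C X) \<bullet> (tlift C X \<bullet> (?u \<bullet> ?p))"
    by (rule comp_cong_right[OF tlift_tlift[OF X]]) (use X U in simp_all)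
  have L2: "tzero C ?T2 \<bullet> (tlift C X \<bullet> (w \<bullet> ?p)) =
      T (tlift C X) \<bullet> (tzero C (TO X) \<bullet> (w \<bullet> ?p))" using X W by simp
  have i: "hadd (TO X) (tzero C ?T2 \<bullet> vlift X w) (tlift C (TO X) \<bullet> vlift X ?u) =
      hadd3 X ?O (hadd (TO X) (T (tlift C X) \<bullet> (tzero C (TO X) \<bullet> (w \<bullet> ?p)))
        (T (tlift C X) \<bullet> (tlift C X \<bullet> (?u \<bullet> ?p))))"
    "h3compat X ?O (hadd (TO X) (T (tlift C X) \<bullet> (tzero C (TO X) \<bullet> (w \<bullet> ?p)))
        (T (tlift C X) \<bullet> (tlift C X \<bullet> (?u \<bullet> ?p))))"
    using hadd_hadd3_interchange[OF z(2) l(2)] O2 q(2) unfolding z(1) l(1) O1 L1 L2 by simp_all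
  have "hadd X (tzero C (TO X) \<bullet> (w \<bullet> ?p)) (tlift C X \<bullet> (?u \<bullet> ?p)) = vert X w ?u \<bullet> ?p"
    using vert_comp[OF cwu, of ?p] vert_eq(1)[OF compat_comp[OF cwu], of ?p] X U by simp
  then have 3: "hadd (TO X) (T (tlift C X) \<bullet> (tzero C (TO X) \<bullet> (w \<bullet> ?p)))
      (T (tlift C X) \<bullet> (tlift C X \<bullet> (?u \<bullet> ?p))) = ?Q (vert X w ?u)"
    unfolding q(1)[symmetric] by simp
  have vl2: "compat (TO X) (vlift X w) (vlift X ?u)" by (rule vf_compat[OF vl vf_vlift[OF b(1)]])
  have 4: "vert (TO X) (vlift X w) (vlift X ?u) = hadd3 X ?O (?Q (vert X w ?u))"
    "h3compat X ?O (?Q (vert X w ?u))"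
    using i unfolding vert_eq(1)[OF vl2] 3 by simp_all

  have h1: "h3compat X ?P (?Q ?B)"
    using f(5) V W X CL unfolding h3compat_def clift_def by simp
  \<comment> \<open>\<open>?O\<close> is the zero vector with the same base point as
    \<open>?P\<close>, so it disappears from the fiberwise sum.\<close>
  have PO: "?O = tzero C ?T2 \<bullet> (tproj C ?T2 \<bullet> ?P)" unfolding clift_def using V vfD(7)[OF v] by simp
  have P: "tadd ?T2 ?P ?O = ?P" "compat ?T2 ?P ?O"
    using tadd_tzero'(1,3)[OF _ _ _ refl, of ?T2 ?P] CL X unfolding PO[symmetric] by simp_all
  have tl: "arr (tlift C X)" "src (tlift C X) = TO X" "tgt (tlift C X) = ?T2" using X by simp_all
  note Q = T_tadd[OF cp tl(1,2), unfolded tl(3)] compat_T[OF cp tl(1,2), unfolded tl(3)]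
  show ?thesis
  proof (rule vf_bracket_eqI[OF cl vl vf_vlift[OF b(1)]])
    have "core (TO X) (?f \<bullet> (T (clift X v) \<bullet> vlift X w)) (vlift X ?u) =
        tadd ?T2 (hadd3 X ?P (?Q ?B)) (hadd3 X ?O (?Q (vert X w ?u)))"
      unfolding core_def bracket_faces(4)[OF cl vl] unfolding 2 4(1) ..
    also have "\<dots> = hadd3 X (tadd ?T2 ?P ?O) (tadd ?T2 (?Q ?B) (?Q (vert X w ?u)))"
      by (rule tadd_hadd3_interchange(1)[OF h1 4(2) P(2) Q(2)])
    also have "\<dots> = hadd3 X ?P (T (tlift C X) \<bullet> tadd (TO X) (?B \<bullet> ?p) (vert X w ?u \<bullet> ?p))"
      unfolding P(1) Q(1) ..
    also have "tadd (TO X) (?B \<bullet> ?p) (vert X w ?u \<bullet> ?p) = tadd (TO X) ?B (vert X w ?u) \<bullet> ?p"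
      by (rule tadd_comp[OF c0, symmetric]) (use X vwu U in simp_all)
    also have "tadd (TO X) ?B (vert X w ?u) = T w \<bullet> v"
      unfolding b(2) core_def f(4) ..
    finally show "T (vlift X w) \<bullet> clift X v =
        core (TO X) (?f \<bullet> (T (clift X v) \<bullet> vlift X w)) (vlift X ?u)"
      unfolding 1(1) by simp
  qed
qed

text \<open>The field \<open>w\<close> relates \<open>v\<close> and \<open>u\<close> to sums of
  lifts, hence [v, u] to the bracket of these sums. That bracket is the complete lift of [v, u],
  plus the vertical lift of [v, [u, w]], minus that of [u, [v, w]]; by \<open>T_comp_vf\<close>,
  \<open>w\<close> also relates [v, u] to its complete lift plus the vertical lift of [[v, u], w].
  Comparing the two along \<open>w\<close> gives the identity, written without a minus sign.\<close>

lemma vf_bracket_leibniz: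
  assumes u: "u \<in> vector_field_set X" and v: "v \<in> vector_field_set X" and w: "w \<in> vector_field_set X"
  shows "tadd X (vf_bracket X (vf_bracket X v u) w) (vf_bracket X u (vf_bracket X v w)) =
    vf_bracket X v (vf_bracket X u w)"
proof -
  let ?a = "vf_bracket X v w" and ?b = "vf_bracket X u w" and ?N = "vf_bracket X v u" and ?Y = "TO X"
  let ?e = "vf_bracket X ?N w" and ?ua = "vf_bracket X u ?a" and ?vb = "vf_bracket X v ?b"
  have a: "?a \<in> vector_field_set X" and b: "?b \<in> vector_field_set X" and N: "?N \<in> vector_field_set X"
    using vf_bracket(1) u v w by simp_all
  have e: "?e \<in> vector_field_set X" and ua: "?ua \<in> vector_field_set X" and vb: "?vb \<in> vector_field_set X"
    using vf_bracket(1) u v w a b N by simp_all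
  note W = vfD(1-4)[OF w]
  note cv = vf_clift[OF v] and cu = vf_clift[OF u] and la = vf_vlift[OF a] and lb = vf_vlift[OF b]
    and cN = vf_clift[OF N] and le = vf_vlift[OF e] and lua = vf_vlift[OF ua] and lvb = vf_vlift[OF vb]
  let ?V = "tadd ?Y (clift X v) (vlift X ?a)" and ?U = "tadd ?Y (clift X u) (vlift X ?b)"
  let ?VU = "vf_bracket ?Y ?V ?U" and ?S = "vf_bracket ?Y (vlift X ?a) (clift X u)"
  have V: "?V \<in> vector_field_set ?Y" and U: "?U \<in> vector_field_set ?Y"
    using vf_tadd[OF cv la] vf_tadd[OF cu lb] .
  have VU: "?VU \<in> vector_field_set ?Y" by (rule vf_bracket(1)[OF V U])
  have S: "?S \<in> vector_field_set ?Y" by (rule vf_bracket(1)[OF la cu])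
  have X': "?Y \<in> Obj C" using W(1) by simp
  note c = vf_compat[where X = ?Y]
  have Nb: "tadd ?Y (clift X ?N) (vlift X ?vb) \<in> vector_field_set ?Y" by (rule vf_tadd[OF cN lvb])
  have rel: "T w \<bullet> ?N = ?VU \<bullet> w"
    by (rule vf_bracket_related[OF W(2-4) v u V U T_comp_vf[OF v w] T_comp_vf[OF u w]])
  have "?VU = tadd ?Y (tadd ?Y (clift X ?N) (vlift X ?vb)) (tadd ?Y ?S (tzero C ?Y))"
    unfolding vf_bracket_add_left[OF cv la U] vf_bracket_add_right[OF cv cu lb]
      vf_bracket_add_right[OF la cu lb] bracket_clift_clift[OF v u] bracket_clift_vlift[OF v b]
      bracket_vlift_vlift[OF a b] ..
  then have "tadd ?Y ?VU (vlift X ?ua) =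
      tadd ?Y (tadd ?Y (clift X ?N) (vlift X ?vb)) (tadd ?Y ?S (vlift X ?ua))"
    unfolding vf_tadd_tzero(1)[OF S] using tadd_assoc[OF c[OF Nb S] c[OF S lua]] by simp
  also have "tadd ?Y ?S (vlift X ?ua) = tzero C ?Y"
    using vf_bracket_antisym[OF la cu] unfolding bracket_clift_vlift[OF u a] .
  finally have VUua: "tadd ?Y ?VU (vlift X ?ua) = tadd ?Y (clift X ?N) (vlift X ?vb)"
    unfolding vf_tadd_tzero(1)[OF Nb] .
  have "core X (tflip C X \<bullet> (T ?N \<bullet> w)) (tadd X ?e ?ua) =
      tadd ?Y (clift X ?N) (vlift X (tadd X ?e ?ua)) \<bullet> w"
    by (rule clift_vlift_comp[OF N vf_tadd[OF e ua] w, symmetric])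
  also have "\<dots> = tadd ?Y (tadd ?Y (clift X ?N) (vlift X ?e)) (vlift X ?ua) \<bullet> w"
    unfolding vlift_tadd[OF e ua] tadd_assoc[OF c[OF cN le] c[OF le lua]] ..
  also have "\<dots> = tadd ?Y (T w \<bullet> ?N) (vlift X ?ua \<bullet> w)"
    unfolding T_comp_vf[OF N w]
    by (rule tadd_comp[OF c[OF vf_tadd[OF cN le] lua]]) (use W vfD(3)[OF lua] in simp_all)
  also have "\<dots> = tadd ?Y ?VU (vlift X ?ua) \<bullet> w"
    unfolding rel
    by (rule tadd_comp[OF c[OF VU lua], symmetric]) (use W vfD(3)[OF lua] in simp_all)
  also have "\<dots> = core X (tflip C X \<bullet> (T ?N \<bullet> w)) ?vb"
    unfolding VUua by (rule clift_vlift_comp[OF N vb w])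
  finally show ?thesis
    by (rule core_inj[OF bracket_faces(8)[OF N w vf_tadd[OF e ua]] bracket_faces(8)[OF N w vb]])
qed

lemma vf_bracket_tzero:
  assumes v: "v \<in> vector_field_set X"
  shows "vf_bracket X v (tzero C X) = tzero C X"
proof -
  note z = vf_tzero[OF vfD(1)[OF v]]
  note b = vf_bracket(1)[OF v z]
  have "tadd X (vf_bracket X v (tzero C X)) (vf_bracket X v (tzero C X)) = vf_bracket X v (tzero C X)"
    using vf_bracket_add_right[OF v z z] unfolding vf_tadd_tzero(1)[OF z] by simp
  from idem_tzero[OF vfD(1)[OF v] vfD(2,4)[OF b] this] show ?thesis
    using vfD(1,5)[OF b] by simp
qed

text \<open>Antisymmetry turns the derivation form \<open>vf_bracket_leibniz\<close> into the cyclic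
  sum.\<close>

lemma vf_bracket_jacobi:
  assumes u: "u \<in> vector_field_set X" and v: "v \<in> vector_field_set X" and w: "w \<in> vector_field_set X"
  shows "tadd X (tadd X (vf_bracket X u (vf_bracket X v w)) (vf_bracket X v (vf_bracket X w u)))
    (vf_bracket X w (vf_bracket X u v)) = tzero C X"
proof -
  note b = vf_bracket(1) and c = vf_compat[of _ X]
  let ?P = "vf_bracket X (vf_bracket X u v) w" and ?Q = "vf_bracket X v (vf_bracket X u w)"
  let ?P' = "vf_bracket X w (vf_bracket X u v)" and ?Q' = "vf_bracket X v (vf_bracket X w u)"
  have "tadd X ?Q ?Q' = vf_bracket X v (tadd X (vf_bracket X u w) (vf_bracket X w u))"
    by (rule vf_bracket_add_right[symmetric]) (use b u v w in simp_all)
  also have "\<dots> = tzero C X" unfolding vf_bracket_antisym[OF u w] by (rule vf_bracket_tzero[OF v])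
  finally have Q: "tadd X ?Q ?Q' = tzero C X" .
  have "tadd X (tadd X ?P ?Q) ?Q' = tadd X ?P (tadd X ?Q ?Q')"
    by (rule tadd_assoc[OF c c]) (use b u v w in simp_all)
  also have "\<dots> = ?P" unfolding Q by (rule vf_tadd_tzero) (use b u v w in simp)
  finally have "tadd X (tadd X ?P ?Q) ?Q' = ?P" .
  then show ?thesis
    unfolding vf_bracket_leibniz[OF v u w, symmetric]
    using vf_bracket_antisym[OF b[OF u v] w] by simp
qed

end

section \<open>Products and scalars\<close>

context tangent_category_with_products
begin

lemma Terminal_Obj [simp]: "Terminal C \<in> Obj C"
  using Terminal unfolding is_terminal_def by simp

lemma arr_bang [simp]:
  assumes "X \<in> Obj C"
  shows "arr (bang X)" "src (bang X) = X" "tgt (bang X) = Terminal C"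
proof -
  have "\<exists>!f. f \<in> Hom C X (Terminal C)" using Terminal assms unfolding is_terminal_def by simp
  from theI'[OF this] show "arr (bang X)" "src (bang X) = X" "tgt (bang X) = Terminal C"
    unfolding bang_def by (simp_all add: Hom_iff)
qed

lemma bang_unique:
  assumes "arr f" "tgt f = Terminal C" "src f = X"
  shows "f = bang X"
proof -
  have X: "X \<in> Obj C" using assms by auto
  then have "\<exists>!f. f \<in> Hom C X (Terminal C)" using Terminal unfolding is_terminal_def by simp
  moreover have "f \<in> Hom C X (Terminal C)" "bang X \<in> Hom C X (Terminal C)"
    using assms X by (simp_all add: Hom_iff)
  ultimately show ?thesis by blast
qed

lemma bang_comp [simp]: "arr f \<Longrightarrow> tgt f = Y \<Longrightarrow> bang Y \<bullet> f = bang (src f)"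
  using src_tgt_Obj[of f] by (intro bang_unique) auto

lemma pr_product:
  assumes "X \<in> Obj C" "Y \<in> Obj C"
  shows "pr1 C X Y \<in> Hom C (Prod C X Y) X" "pr2 C X Y \<in> Hom C (Prod C X Y) Y"
    "\<And>Z a b. a \<in> Hom C Z X \<Longrightarrow> b \<in> Hom C Z Y \<Longrightarrow>
      \<exists>!h. h \<in> Hom C Z (Prod C X Y) \<and> pr1 C X Y \<bullet> h = a \<and> pr2 C X Y \<bullet> h = b"
  using Prod[OF assms] unfolding is_product_def by blast+

lemma Prod_Obj [simp]: "X \<in> Obj C \<Longrightarrow> Y \<in> Obj C \<Longrightarrow> Prod C X Y \<in> Obj C"
  using pr_product(1) HomD by blast

lemma arr_pr [simp]:
  assumes "X \<in> Obj C" "Y \<in> Obj C"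
  shows "arr (pr1 C X Y)" "src (pr1 C X Y) = Prod C X Y" "tgt (pr1 C X Y) = X"
    "arr (pr2 C X Y)" "src (pr2 C X Y) = Prod C X Y" "tgt (pr2 C X Y) = Y"
  using pr_product(1,2)[OF assms] by (simp_all add: Hom_iff)

lemma pair_unique:
  assumes "X \<in> Obj C" "Y \<in> Obj C" "arr h" "arr k" "tgt h = Prod C X Y" "tgt k = Prod C X Y" "src h = src k"
    "pr1 C X Y \<bullet> h = pr1 C X Y \<bullet> k" "pr2 C X Y \<bullet> h = pr2 C X Y \<bullet> k"
  shows "h = k"
proof -
  have "\<exists>!h'. h' \<in> Hom C (src k) (Prod C X Y) \<and> pr1 C X Y \<bullet> h' = pr1 C X Y \<bullet> k \<and> pr2 C X Y \<bullet> h' = pr2 C X Y \<bullet> k"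
    by (rule pr_product(3)[OF assms(1,2)]) (use assms(1-6) in \<open>simp_all add: Hom_iff\<close>)
  moreover have "h \<in> Hom C (src k) (Prod C X Y)" "k \<in> Hom C (src k) (Prod C X Y)"
    using assms(3-7) by (simp_all add: Hom_iff)
  ultimately show ?thesis using assms(8,9) by blast
qed

lemma pair_props [simp]:
  assumes "arr a" "arr b" "src a = src b"
  shows "arr (pair a b)" "src (pair a b) = src b" "tgt (pair a b) = Prod C (tgt a) (tgt b)"
    "tgt a = X \<Longrightarrow> tgt b = Y \<Longrightarrow> pr1 C X Y \<bullet> pair a b = a"
    "tgt a = X \<Longrightarrow> tgt b = Y \<Longrightarrow> pr2 C X Y \<bullet> pair a b = b"
proof -
  let ?X = "tgt a" and ?Y = "tgt b" and ?Z = "src b"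
  have ab: "a \<in> Hom C ?Z ?X" "b \<in> Hom C ?Z ?Y" using assms by (simp_all add: Hom_iff)
  have O: "?X \<in> Obj C" "?Y \<in> Obj C" using assms by simp_all
  from pr_product(3)[OF O ab] obtain h where h: "h \<in> Hom C ?Z (Prod C ?X ?Y)"
    "pr1 C ?X ?Y \<bullet> h = a" "pr2 C ?X ?Y \<bullet> h = b" by blast
  note H = HomD[OF h(1)]
  have "pair a b = h"
    unfolding pair_def
  proof (rule the_equality)
    show "\<exists>Z X Y. a \<in> Hom C Z X \<and> b \<in> Hom C Z Y \<and> h \<in> Hom C Z (Prod C X Y) \<and>
      pr1 C X Y \<bullet> h = a \<and> pr2 C X Y \<bullet> h = b" using ab h by blast
    fix k assume "\<exists>Z X Y. a \<in> Hom C Z X \<and> b \<in> Hom C Z Y \<and> k \<in> Hom C Z (Prod C X Y) \<and>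
      pr1 C X Y \<bullet> k = a \<and> pr2 C X Y \<bullet> k = b"
    then obtain Z X Y where k: "a \<in> Hom C Z X" "b \<in> Hom C Z Y" "k \<in> Hom C Z (Prod C X Y)"
      "pr1 C X Y \<bullet> k = a" "pr2 C X Y \<bullet> k = b" by blast
    have e: "Z = ?Z" "X = ?X" "Y = ?Y" using Hom_disjoint[OF k(1) ab(1)] Hom_disjoint[OF k(2) ab(2)] by simp_all
    show "k = h"
      by (rule pair_unique[OF O]) (use HomD[OF k(3)] H e k(4,5) h(2,3) in simp_all)
  qed
  then show "arr (pair a b)" "src (pair a b) = src b" "tgt (pair a b) = Prod C (tgt a) (tgt b)"
    "tgt a = X \<Longrightarrow> tgt b = Y \<Longrightarrow> pr1 C X Y \<bullet> pair a b = a"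
    "tgt a = X \<Longrightarrow> tgt b = Y \<Longrightarrow> pr2 C X Y \<bullet> pair a b = b"
    using h(2,3) H by auto
qed

lemma pair_comp [simp]:
  assumes "arr a" "arr b" "src a = src b" "arr z" "tgt z = src b"
  shows "pair a b \<bullet> z = pair (a \<bullet> z) (b \<bullet> z)"
proof (rule pair_unique[of "tgt a" "tgt b"])
  show "pr1 C (tgt a) (tgt b) \<bullet> (pair a b \<bullet> z) = pr1 C (tgt a) (tgt b) \<bullet> pair (a \<bullet> z) (b \<bullet> z)"
    using assms comp_cong_right1[OF pair_props(4)[OF assms(1-3) refl refl], of z] by simp
  show "pr2 C (tgt a) (tgt b) \<bullet> (pair a b \<bullet> z) = pr2 C (tgt a) (tgt b) \<bullet> pair (a \<bullet> z) (b \<bullet> z)"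
    using assms comp_cong_right1[OF pair_props(5)[OF assms(1-3) refl refl], of z] by simp
qed (use assms in simp_all)

lemma pair_eta:
  assumes "X \<in> Obj C" "Y \<in> Obj C" "arr h" "tgt h = Prod C X Y"
  shows "pair (pr1 C X Y \<bullet> h) (pr2 C X Y \<bullet> h) = h"
  by (rule pair_unique[OF assms(1,2)]) (use assms in simp_all)

lemma pair_pr [simp]: "X \<in> Obj C \<Longrightarrow> Y \<in> Obj C \<Longrightarrow> pair (pr1 C X Y) (pr2 C X Y) = Ident C (Prod C X Y)"
  using pair_eta[of X Y "Ident C (Prod C X Y)"] by simp

lemma tproj_Prod:
  assumes "X \<in> Obj C" "Y \<in> Obj C" "arr m" "tgt m = TO (Prod C X Y)"
  shows "tproj C (Prod C X Y) \<bullet> m =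
    pair (tproj C X \<bullet> (T (pr1 C X Y) \<bullet> m)) (tproj C Y \<bullet> (T (pr2 C X Y) \<bullet> m))"
  by (rule pair_unique[OF assms(1,2)]) (use assms in simp_all)

end

section \<open>Tangent objects of products\<close>

context cartesian_tangent_category
begin

text \<open>The arrow into \<open>T\<close> of a product with prescribed components; it hides the
  inverse of \<open>chi\<close>.\<close>

definition Tpair :: "'o \<Rightarrow> 'o \<Rightarrow> 'a \<Rightarrow> 'a \<Rightarrow> 'a" where
  "Tpair X Y a b = inverse_of (chi X Y) \<bullet> pair a b"

lemma inverse_props:
  assumes "is_iso f" "f \<in> Hom C X Y"
  shows "arr (inverse_of f)" "src (inverse_of f) = Y" "tgt (inverse_of f) = X"
    "inverse_of f \<bullet> f = Ident C X" "f \<bullet> inverse_of f = Ident C Y"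
proof -
  from assms(1) obtain g where g: "is_inverse f g" unfolding is_iso_def by blast
  have u: "h \<in> Hom C Y X \<and> h \<bullet> f = Ident C X \<and> f \<bullet> h = Ident C Y" if "is_inverse f h" for h
    using that assms(2) Hom_disjoint unfolding is_inverse_def by metis
  have "inverse_of f = g"
    unfolding inverse_of_def
  proof (rule the_equality)
    show "is_inverse f g" by (rule g)
    fix h assume h: "is_inverse f h"
    note H = u[OF h] and G = u[OF g] and F = HomD[OF assms(2)]
    have "h = h \<bullet> (f \<bullet> g)" using H G F by (simp add: Hom_iff)
    also have "\<dots> = (h \<bullet> f) \<bullet> g"
      by (rule comp_assoc[symmetric]) (use H G F in \<open>simp_all add: Hom_iff\<close>)
    also have "h \<bullet> f = Ident C X" using H by simp
    also have "Ident C X \<bullet> g = g" using G by (simp add: Hom_iff)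
    finally show "h = g" .
  qed
  then show "arr (inverse_of f)" "src (inverse_of f) = Y" "tgt (inverse_of f) = X"
    "inverse_of f \<bullet> f = Ident C X" "f \<bullet> inverse_of f = Ident C Y"
    using u[OF g] by (simp_all add: Hom_iff)
qed

lemma arr_chi:
  assumes "X \<in> Obj C" "Y \<in> Obj C"
  shows "arr (chi X Y)" "src (chi X Y) = TO (Prod C X Y)" "tgt (chi X Y) = Prod C (TO X) (TO Y)"
  using assms unfolding chi_def by simp_all

lemma chi_inverse:
  assumes "X \<in> Obj C" "Y \<in> Obj C"
  shows "arr (inverse_of (chi X Y))" "src (inverse_of (chi X Y)) = Prod C (TO X) (TO Y)"
    "tgt (inverse_of (chi X Y)) = TO (Prod C X Y)"
    "inverse_of (chi X Y) \<bullet> chi X Y = Ident C (TO (Prod C X Y))"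
    "chi X Y \<bullet> inverse_of (chi X Y) = Ident C (Prod C (TO X) (TO Y))"
proof -
  have "chi X Y \<in> Hom C (TO (Prod C X Y)) (Prod C (TO X) (TO Y))"
    using arr_chi[OF assms] by (simp add: Hom_iff)
  note i = inverse_props[OF chi_iso[OF assms] this]
  show "arr (inverse_of (chi X Y))" "src (inverse_of (chi X Y)) = Prod C (TO X) (TO Y)"
    "tgt (inverse_of (chi X Y)) = TO (Prod C X Y)"
    "inverse_of (chi X Y) \<bullet> chi X Y = Ident C (TO (Prod C X Y))"
    "chi X Y \<bullet> inverse_of (chi X Y) = Ident C (Prod C (TO X) (TO Y))" by (fact i)+
qed

lemma chi_comp:
  assumes "X \<in> Obj C" "Y \<in> Obj C" "arr m" "tgt m = TO (Prod C X Y)"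
  shows "chi X Y \<bullet> m = pair (T (pr1 C X Y) \<bullet> m) (T (pr2 C X Y) \<bullet> m)"
  using assms unfolding chi_def by simp

lemma Tpair_props [simp]:
  assumes "X \<in> Obj C" "Y \<in> Obj C" "arr a" "arr b" "src a = src b" "tgt a = TO X" "tgt b = TO Y"
  shows "arr (Tpair X Y a b)" "src (Tpair X Y a b) = src b" "tgt (Tpair X Y a b) = TO (Prod C X Y)"
    "T (pr1 C X Y) \<bullet> Tpair X Y a b = a" "T (pr2 C X Y) \<bullet> Tpair X Y a b = b"
proof -
  note i = chi_inverse[OF assms(1,2)] and ch = arr_chi[OF assms(1,2)]
  show t: "arr (Tpair X Y a b)" "src (Tpair X Y a b) = src b" "tgt (Tpair X Y a b) = TO (Prod C X Y)"
    using i(1-3) assms unfolding Tpair_def by simp_all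
  have "chi X Y \<bullet> Tpair X Y a b = pair a b"
    unfolding Tpair_def using comp_cong_right1[OF i(5), of "pair a b"] i(1-3) ch assms by simp
  then have e: "pair (T (pr1 C X Y) \<bullet> Tpair X Y a b) (T (pr2 C X Y) \<bullet> Tpair X Y a b) = pair a b"
    using chi_comp[OF assms(1,2) t(1,3)] by simp
  have "T (pr1 C X Y) \<bullet> Tpair X Y a b =
      pr1 C (TO X) (TO Y) \<bullet> pair (T (pr1 C X Y) \<bullet> Tpair X Y a b) (T (pr2 C X Y) \<bullet> Tpair X Y a b)"
    using t assms(1,2) by simp
  then show "T (pr1 C X Y) \<bullet> Tpair X Y a b = a" unfolding e using assms by simp
  have "T (pr2 C X Y) \<bullet> Tpair X Y a b =
      pr2 C (TO X) (TO Y) \<bullet> pair (T (pr1 C X Y) \<bullet> Tpair X Y a b) (T (pr2 C X Y) \<bullet> Tpair X Y a b)"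
    using t assms(1,2) by simp
  then show "T (pr2 C X Y) \<bullet> Tpair X Y a b = b" unfolding e using assms by simp
qed

lemma Tpair_unique:
  assumes "X \<in> Obj C" "Y \<in> Obj C" "arr m" "arr n" "tgt m = TO (Prod C X Y)" "tgt n = TO (Prod C X Y)"
    "T (pr1 C X Y) \<bullet> m = T (pr1 C X Y) \<bullet> n" "T (pr2 C X Y) \<bullet> m = T (pr2 C X Y) \<bullet> n"
  shows "m = n"
proof -
  note i = chi_inverse[OF assms(1,2)] and ch = arr_chi[OF assms(1,2)]
  have *: "inverse_of (chi X Y) \<bullet> (chi X Y \<bullet> m) = m" if "arr m" "tgt m = TO (Prod C X Y)" for m
    using comp_cong_right1[OF i(4), of m] i(1-3) ch that by simp
  have e: "chi X Y \<bullet> m = chi X Y \<bullet> n"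
    unfolding chi_comp[OF assms(1-3,5)] chi_comp[OF assms(1,2,4,6)] assms(7,8) ..
  show ?thesis by (rule trans[OF *[OF assms(3,5), symmetric, unfolded e] *[OF assms(4,6)]])
qed

lemma Tpair_comp [simp]:
  assumes "X \<in> Obj C" "Y \<in> Obj C" "arr a" "arr b" "src a = src b" "tgt a = TO X" "tgt b = TO Y"
    and "arr z" "tgt z = src b"
  shows "Tpair X Y a b \<bullet> z = Tpair X Y (a \<bullet> z) (b \<bullet> z)"
  using assms chi_inverse[OF assms(1,2)] unfolding Tpair_def by simp

lemma Tpair_eta:
  assumes "X \<in> Obj C" "Y \<in> Obj C" "arr m" "tgt m = TO (Prod C X Y)"
  shows "Tpair X Y (T (pr1 C X Y) \<bullet> m) (T (pr2 C X Y) \<bullet> m) = m"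
  by (rule Tpair_unique[OF assms(1,2)]) (use assms in simp_all)

lemma T_pair [simp]:
  assumes "arr a" "arr b" "src a = src b" 
  shows "T (pair a b) = Tpair (tgt a) (tgt b) (T a) (T b)"
proof (rule Tpair_unique[of "tgt a" "tgt b"])
  show "T (pr1 C (tgt a) (tgt b)) \<bullet> T (pair a b) =
      T (pr1 C (tgt a) (tgt b)) \<bullet> Tpair (tgt a) (tgt b) (T a) (T b)"
    using assms T_comp[of "pair a b" "pr1 C (tgt a) (tgt b)"] by simp
  show "T (pr2 C (tgt a) (tgt b)) \<bullet> T (pair a b) =
      T (pr2 C (tgt a) (tgt b)) \<bullet> Tpair (tgt a) (tgt b) (T a) (T b)"
    using assms T_comp[of "pair a b" "pr2 C (tgt a) (tgt b)"] by simp
qed (use assms in simp_all)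

lemma tproj_Tpair [simp]:
  assumes "X \<in> Obj C" "Y \<in> Obj C" "arr a" "arr b" "src a = src b" "tgt a = TO X" "tgt b = TO Y"
  shows "tproj C (Prod C X Y) \<bullet> Tpair X Y a b = pair (tproj C X \<bullet> a) (tproj C Y \<bullet> b)"
  using tproj_Prod[of X Y "Tpair X Y a b"] assms by simp

lemma tzero_pair:
  assumes "X \<in> Obj C" "Y \<in> Obj C" "arr a" "arr b" "src a = src b" "tgt a = X" "tgt b = Y"
  shows "Tpair X Y (tzero C X \<bullet> a) (tzero C Y \<bullet> b) = tzero C (Prod C X Y) \<bullet> pair a b"
  by (rule Tpair_unique[OF assms(1,2)]) (use assms in simp_all)

text \<open>The tangent maps of the two projections are additive and jointly injective, so sums over
  a product are formed componentwise.\<close>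

lemma Tpair_tadd:
  assumes a: "compat X a a'" and b: "compat Y b b'" and s: "src a = src b"
  shows "Tpair X Y (tadd X a a') (tadd Y b b') = tadd (Prod C X Y) (Tpair X Y a b) (Tpair X Y a' b')"
    "compat (Prod C X Y) (Tpair X Y a b) (Tpair X Y a' b')"
proof -
  note A = compatD[OF a] tadd_arr[OF a] and B = compatD[OF b] tadd_arr[OF b]
  have s': "src a' = src b'" using A(4) B(4) s by simp
  have ta: "arr (Tpair X Y a b)" "src (Tpair X Y a b) = src b" "tgt (Tpair X Y a b) = TO (Prod C X Y)"
    "T (pr1 C X Y) \<bullet> Tpair X Y a b = a" "T (pr2 C X Y) \<bullet> Tpair X Y a b = b"
    by (intro Tpair_props; use A(1-6) B(1-6) s in simp)+
  have tb: "arr (Tpair X Y a' b')" "src (Tpair X Y a' b') = src b'" "tgt (Tpair X Y a' b') = TO (Prod C X Y)"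
    "T (pr1 C X Y) \<bullet> Tpair X Y a' b' = a'" "T (pr2 C X Y) \<bullet> Tpair X Y a' b' = b'"
    by (intro Tpair_props; use A(1-6) B(1-6) s' in simp)+
  have "tproj C (Prod C X Y) \<bullet> Tpair X Y a b = tproj C (Prod C X Y) \<bullet> Tpair X Y a' b'"
    unfolding tproj_Prod[OF A(1) B(1) ta(1,3)] tproj_Prod[OF A(1) B(1) tb(1,3)] ta(4,5) tb(4,5) A(7) B(7) ..
  then show c: "compat (Prod C X Y) (Tpair X Y a b) (Tpair X Y a' b')"
    using ta tb A(1) B(1,4) unfolding compat_def by simp
  have p: "arr (pr1 C X Y)" "src (pr1 C X Y) = Prod C X Y" "tgt (pr1 C X Y) = X"
    "arr (pr2 C X Y)" "src (pr2 C X Y) = Prod C X Y" "tgt (pr2 C X Y) = Y"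
    using A(1) B(1) by simp_all
  note t1 = T_tadd[OF c p(1,2), unfolded p(3) ta(4) tb(4)]
  note t2 = T_tadd[OF c p(4,5), unfolded p(6) ta(5) tb(5)]
  have s'': "src (tadd X a a') = src (tadd Y b b')" using A(9) B(9) s' by simp
  show "Tpair X Y (tadd X a a') (tadd Y b b') = tadd (Prod C X Y) (Tpair X Y a b) (Tpair X Y a' b')"
    using Tpair_eta[OF A(1) B(1) tadd_arr(1,3)[OF c]] unfolding t1 t2 .
qed

lemma partial1_pair:
  assumes "X \<in> Obj C" "Y \<in> Obj C" "arr f" "src f = Prod C X Y"
    "arr a" "arr y" "src a = src y" "tgt a = TO X" "tgt y = Y"
  shows "partial1 X Y f \<bullet> pair a y = T f \<bullet> Tpair X Y a (tzero C Y \<bullet> y)"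
  using assms chi_inverse[OF assms(1,2)] unfolding partial1_def prod_map_def Tpair_def by simp

lemma partial2_pair:
  assumes "X \<in> Obj C" "Y \<in> Obj C" "arr f" "src f = Prod C X Y"
    "arr x" "arr b" "src x = src b" "tgt b = TO Y" "tgt x = X"
  shows "partial2 X Y f \<bullet> pair x b = T f \<bullet> Tpair X Y (tzero C X \<bullet> x) b"
  using assms chi_inverse[OF assms(1,2)] unfolding partial2_def prod_map_def Tpair_def by simp

text \<open>The total derivative is the sum of the partial ones, since (a, b) is the sum of (a, 0)
  and (0, b). The product rules below rest on this.\<close>

lemma T_Tpair_split:
  assumes "X \<in> Obj C" "Y \<in> Obj C" "arr f" "src f = Prod C X Y"
    "arr a" "arr b" "src a = src b" "tgt a = TO X" "tgt b = TO Y"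
  shows "T f \<bullet> Tpair X Y a b =
      tadd (tgt f) (T f \<bullet> Tpair X Y a (tzero C Y \<bullet> (tproj C Y \<bullet> b)))
        (T f \<bullet> Tpair X Y (tzero C X \<bullet> (tproj C X \<bullet> a)) b)"
    "compat (tgt f) (T f \<bullet> Tpair X Y a (tzero C Y \<bullet> (tproj C Y \<bullet> b)))
        (T f \<bullet> Tpair X Y (tzero C X \<bullet> (tproj C X \<bullet> a)) b)"
proof -
  note za = tadd_tzero'[OF assms(1,5,8) refl] and zb = tadd_tzero'[OF assms(2,6,9) refl]
  have s: "src a = src (tzero C Y \<bullet> (tproj C Y \<bullet> b))" using assms by simp
  note t = Tpair_tadd[OF za(3) zb(4) s, unfolded za(1) zb(2)]
  show "T f \<bullet> Tpair X Y a b =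
      tadd (tgt f) (T f \<bullet> Tpair X Y a (tzero C Y \<bullet> (tproj C Y \<bullet> b)))
        (T f \<bullet> Tpair X Y (tzero C X \<bullet> (tproj C X \<bullet> a)) b)"
    unfolding t(1) by (rule T_tadd[OF t(2) assms(3,4)])
  show "compat (tgt f) (T f \<bullet> Tpair X Y a (tzero C Y \<bullet> (tproj C Y \<bullet> b)))
        (T f \<bullet> Tpair X Y (tzero C X \<bullet> (tproj C X \<bullet> a)) b)"
    by (rule compat_T[OF t(2) assms(3,4)])
qed

text \<open>\<open>T\<close> preserves the terminal object \<open>1\<close>: the two projections of \<open>1 \<times> 1\<close> agree, hence so do the two
  projections of \<open>T1 \<times> T1\<close>.\<close>

lemma T_Terminal_unique:
  assumes "arr x" "arr y" "src x = src y" "tgt x = TO (Terminal C)" "tgt y = TO (Terminal C)"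
  shows "x = y"
proof -
  let ?I = "Terminal C"
  have "pr1 C ?I ?I = bang (Prod C ?I ?I)" by (rule bang_unique) simp_all
  moreover have "pr2 C ?I ?I = bang (Prod C ?I ?I)" by (rule bang_unique) simp_all
  ultimately have "T (pr1 C ?I ?I) \<bullet> Tpair ?I ?I x y = T (pr2 C ?I ?I) \<bullet> Tpair ?I ?I x y" by simp
  then show ?thesis using assms by simp
qed

lemma T_bang [simp]:
  assumes "arr z" "tgt z = TO X" "X \<in> Obj C"
  shows "T (bang X) \<bullet> z = tzero C (Terminal C) \<bullet> bang (src z)"
  by (rule T_Terminal_unique) (use assms in simp_all)

end

context tangent_category_with_products
begin

lemma arr_pr3 [simp]:
  assumes "X \<in> Obj C" "Y \<in> Obj C" "Z \<in> Obj C"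
  shows "arr (pr13 X Y Z)" "src (pr13 X Y Z) = Prod C (Prod C X Y) Z" "tgt (pr13 X Y Z) = X"
    "arr (pr23 X Y Z)" "src (pr23 X Y Z) = Prod C (Prod C X Y) Z" "tgt (pr23 X Y Z) = Y"
    "arr (pr33 X Y Z)" "src (pr33 X Y Z) = Prod C (Prod C X Y) Z" "tgt (pr33 X Y Z) = Z"
  using assms unfolding pr13_def pr23_def pr33_def by simp_all

lemma pr3_pair [simp]:
  assumes "arr a" "arr b" "arr c" "src a = src c" "src b = src c" "tgt a = X" "tgt b = Y" "tgt c = Z"
  shows "pr13 X Y Z \<bullet> pair (pair a b) c = a" "pr23 X Y Z \<bullet> pair (pair a b) c = b"
    "pr33 X Y Z \<bullet> pair (pair a b) c = c"
proof -
  have O: "X \<in> Obj C" "Y \<in> Obj C" "Z \<in> Obj C" using assms by auto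
  show "pr13 X Y Z \<bullet> pair (pair a b) c = a" "pr23 X Y Z \<bullet> pair (pair a b) c = b"
    "pr33 X Y Z \<bullet> pair (pair a b) c = c"
    using assms O unfolding pr13_def pr23_def pr33_def by simp_all
qed

end

context cartesian_tangent_category
begin

lemma Tpr3_Tpair [simp]:
  assumes "X \<in> Obj C" "Y \<in> Obj C" "Z \<in> Obj C" "arr a" "arr b" "arr c" "src a = src c" "src b = src c"
    "tgt a = TO X" "tgt b = TO Y" "tgt c = TO Z"
  shows "T (pr13 X Y Z) \<bullet> Tpair (Prod C X Y) Z (Tpair X Y a b) c = a"
    "T (pr23 X Y Z) \<bullet> Tpair (Prod C X Y) Z (Tpair X Y a b) c = b"
    "T (pr33 X Y Z) \<bullet> Tpair (Prod C X Y) Z (Tpair X Y a b) c = c"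
  using assms unfolding pr13_def pr23_def pr33_def by simp_all

end

section \<open>The ring object and the induced operations on its tangent object\<close>

context ring_object
begin

lemma R_Obj' [simp]: "Robj C \<in> Obj C"
  by (rule R_Obj)

lemma arr_R [simp]:
  "arr (radd C)" "src (radd C) = Prod C (Robj C) (Robj C)" "tgt (radd C) = Robj C"
  "arr (rmult C)" "src (rmult C) = Prod C (Robj C) (Robj C)" "tgt (rmult C) = Robj C"
  "arr (rzero C)" "src (rzero C) = Terminal C" "tgt (rzero C) = Robj C"
  "arr (rone C)" "src (rone C) = Terminal C" "tgt (rone C) = Robj C"
  using radd_closed rmult_closed rzero_closed rone_closed by (auto simp: Hom_iff)

definition rplus :: "'a \<Rightarrow> 'a \<Rightarrow> 'a" where "rplus a b = radd C \<bullet> pair a b"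
definition rtimes :: "'a \<Rightarrow> 'a \<Rightarrow> 'a" where "rtimes a b = rmult C \<bullet> pair a b"
definition rnull :: "'o \<Rightarrow> 'a" where "rnull Z = rzero C \<bullet> bang Z"
definition runit :: "'o \<Rightarrow> 'a" where "runit Z = rone C \<bullet> bang Z"

lemma r_arr [simp]:
  assumes "arr a" "arr b" "src a = src b" "tgt a = Robj C" "tgt b = Robj C"
  shows "arr (rplus a b)" "src (rplus a b) = src b" "tgt (rplus a b) = Robj C"
    "arr (rtimes a b)" "src (rtimes a b) = src b" "tgt (rtimes a b) = Robj C"
  using assms unfolding rplus_def rtimes_def by simp_all

lemma rconst_arr [simp]:
  assumes "Z \<in> Obj C"
  shows "arr (rnull Z)" "src (rnull Z) = Z" "tgt (rnull Z) = Robj C"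
    "arr (runit Z)" "src (runit Z) = Z" "tgt (runit Z) = Robj C"
  using assms unfolding rnull_def runit_def by simp_all

lemma r_comp [simp]:
  assumes "arr a" "arr b" "src a = src b" "tgt a = Robj C" "tgt b = Robj C" "arr z" "tgt z = src b"
  shows "rplus a b \<bullet> z = rplus (a \<bullet> z) (b \<bullet> z)" "rtimes a b \<bullet> z = rtimes (a \<bullet> z) (b \<bullet> z)"
  using assms unfolding rplus_def rtimes_def by simp_all

lemma rconst_comp [simp]:
  assumes "arr z" "tgt z = Z"
  shows "rnull Z \<bullet> z = rnull (src z)" "runit Z \<bullet> z = runit (src z)"
proof -
  have "Z \<in> Obj C" using assms by auto
  then show "rnull Z \<bullet> z = rnull (src z)" "runit Z \<bullet> z = runit (src z)"
    using assms unfolding rnull_def runit_def by simp_all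
qed

text \<open>The axiom for the generic triple of projections is composed with an arbitrary triple;
  the other laws in three variables are obtained in the same way.\<close>

lemma rplus_assoc:
  assumes "arr a" "arr b" "arr c" "src a = src c" "src b = src c" "tgt a = Robj C" "tgt b = Robj C" "tgt c = Robj C"
  shows "rplus (rplus a b) c = rplus a (rplus b c)"
  using arg_cong[OF radd_assoc, of "\<lambda>f. f \<bullet> pair (pair a b) c"] assms unfolding rplus_def by simp

lemma rtimes_assoc:
  assumes "arr a" "arr b" "arr c" "src a = src c" "src b = src c" "tgt a = Robj C" "tgt b = Robj C" "tgt c = Robj C"
  shows "rtimes (rtimes a b) c = rtimes a (rtimes b c)"
  using arg_cong[OF rmult_assoc, of "\<lambda>f. f \<bullet> pair (pair a b) c"] assms unfolding rtimes_def by simp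

lemma rtimes_rplus:
  assumes "arr a" "arr b" "arr c" "src a = src c" "src b = src c" "tgt a = Robj C" "tgt b = Robj C" "tgt c = Robj C"
  shows "rtimes a (rplus b c) = rplus (rtimes a b) (rtimes a c)"
  using arg_cong[OF rdistrib, of "\<lambda>f. f \<bullet> pair (pair a b) c"] assms unfolding rtimes_def rplus_def by simp

lemma rplus_comm:
  assumes "arr a" "arr b" "src a = src b" "tgt a = Robj C" "tgt b = Robj C"
  shows "rplus a b = rplus b a"
proof -
  have "rplus (pr2 C (Robj C) (Robj C)) (pr1 C (Robj C) (Robj C)) \<bullet> pair a b = radd C \<bullet> pair a b"
    unfolding rplus_def using radd_comm by simp
  then show ?thesis using assms by (simp add: rplus_def)
qed

lemma rtimes_comm:
  assumes "arr a" "arr b" "src a = src b" "tgt a = Robj C" "tgt b = Robj C"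
  shows "rtimes a b = rtimes b a"
proof -
  have "rtimes (pr2 C (Robj C) (Robj C)) (pr1 C (Robj C) (Robj C)) \<bullet> pair a b = rmult C \<bullet> pair a b"
    unfolding rtimes_def using rmult_comm by simp
  then show ?thesis using assms by (simp add: rtimes_def)
qed

lemma rplus_rnull:
  assumes "arr a" "tgt a = Robj C"
  shows "rplus a (rnull (src a)) = a" "rplus (rnull (src a)) a = a"
proof -
  have "rplus (Ident C (Robj C)) (rnull (Robj C)) \<bullet> a = Ident C (Robj C) \<bullet> a"
    unfolding rplus_def rnull_def by (simp only: radd_rzero)
  then show "rplus a (rnull (src a)) = a" using assms by simp
  then show "rplus (rnull (src a)) a = a" using rplus_comm[of a "rnull (src a)"] assms by simp
qed

lemma rtimes_runit:
  assumes "arr a" "tgt a = Robj C"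
  shows "rtimes a (runit (src a)) = a" "rtimes (runit (src a)) a = a"
proof -
  have "rtimes (Ident C (Robj C)) (runit (Robj C)) \<bullet> a = Ident C (Robj C) \<bullet> a"
    unfolding rtimes_def runit_def by (simp only: rmult_rone)
  then show "rtimes a (runit (src a)) = a" using assms by simp
  then show "rtimes (runit (src a)) a = a" using rtimes_comm[of a "runit (src a)"] assms by simp
qed

lemma rneg_unique:
  assumes "arr a" "arr n" "arr n'" "src n = src a" "src n' = src a"
    "tgt a = Robj C" "tgt n = Robj C" "tgt n' = Robj C"
    and "rplus a n = rnull (src a)" "rplus a n' = rnull (src a)"
  shows "n = n'"
proof -
  have "n = rplus n (rplus a n')" using assms(10) rplus_rnull(1)[OF assms(2,7)] assms(4) by simp
  also have "\<dots> = rplus (rplus n a) n'" by (rule rplus_assoc[symmetric]) (use assms(1-8) in simp_all)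
  also have "rplus n a = rplus a n" by (rule rplus_comm) (use assms(1-8) in simp_all)
  also have "rplus a n = rnull (src a)" by (rule assms(9))
  also have "rplus (rnull (src a)) n' = n'" using rplus_rnull(2)[OF assms(3,8)] assms(5) by simp
  finally show ?thesis .
qed

lemma arr_rneg [simp]: "arr rneg" "src rneg = Robj C" "tgt rneg = Robj C"
  and rplus_rneg_Ident: "rplus (Ident C (Robj C)) rneg = rnull (Robj C)"
proof -
  let ?P = "\<lambda>n. n \<in> Hom C (Robj C) (Robj C) \<and> radd C \<bullet> pair (Ident C (Robj C)) n = rzero C \<bullet> bang (Robj C)"
  have "\<exists>!n. ?P n"
  proof (rule ex_ex1I)
    show "\<exists>n. ?P n" using radd_inverse by blast
    fix n n' assume n: "?P n" and n': "?P n'"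
    show "n = n'"
      by (rule rneg_unique[of "Ident C (Robj C)"])
        (use n n' in \<open>simp_all add: Hom_iff rplus_def rnull_def\<close>)
  qed
  then have "?P rneg" unfolding rneg_def by (rule theI')
  then show "arr rneg" "src rneg = Robj C" "tgt rneg = Robj C" "rplus (Ident C (Robj C)) rneg = rnull (Robj C)"
    by (simp_all add: Hom_iff rplus_def rnull_def)
qed

lemma rplus_rneg:
  assumes "arr a" "tgt a = Robj C"
  shows "rplus a (rneg \<bullet> a) = rnull (src a)" "rplus (rneg \<bullet> a) a = rnull (src a)"
proof -
  have "rplus (Ident C (Robj C)) rneg \<bullet> a = rnull (Robj C) \<bullet> a" by (simp only: rplus_rneg_Ident)
  then show e: "rplus a (rneg \<bullet> a) = rnull (src a)" using assms by simp
  have "rplus (rneg \<bullet> a) a = rplus a (rneg \<bullet> a)" by (rule rplus_comm) (use assms in simp_all)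
  then show "rplus (rneg \<bullet> a) a = rnull (src a)" unfolding e .
qed

lemma rplus_idem:
  assumes "arr a" "tgt a = Robj C" "rplus a a = a"
  shows "a = rnull (src a)"
proof -
  have "rplus (rplus a a) (rneg \<bullet> a) = rplus a (rplus a (rneg \<bullet> a))"
    by (rule rplus_assoc) (use assms(1,2) in simp_all)
  then show ?thesis
    unfolding assms(3) rplus_rneg(1)[OF assms(1,2)] rplus_rnull(1)[OF assms(1,2)] by (rule sym)
qed

text \<open>\<open>T\<close> preserves finite products, so \<open>TR\<close> is a ring object again.\<close>

definition Tplus :: "'a \<Rightarrow> 'a \<Rightarrow> 'a" where
  "Tplus a b = T (radd C) \<bullet> Tpair (Robj C) (Robj C) a b"

definition Ttimes :: "'a \<Rightarrow> 'a \<Rightarrow> 'a" where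
  "Ttimes a b = T (rmult C) \<bullet> Tpair (Robj C) (Robj C) a b"

lemma Tr_arr [simp]:
  assumes "arr a" "arr b" "src a = src b" "tgt a = TO (Robj C)" "tgt b = TO (Robj C)"
  shows "arr (Tplus a b)" "src (Tplus a b) = src b" "tgt (Tplus a b) = TO (Robj C)"
    "arr (Ttimes a b)" "src (Ttimes a b) = src b" "tgt (Ttimes a b) = TO (Robj C)"
    "tproj C (Robj C) \<bullet> Tplus a b = rplus (tproj C (Robj C) \<bullet> a) (tproj C (Robj C) \<bullet> b)"
  using assms unfolding Tplus_def Ttimes_def rplus_def by simp_all

lemma T_rplus:
  assumes "arr a" "arr b" "src a = src b" "tgt a = Robj C" "tgt b = Robj C"
  shows "T (rplus a b) = Tplus (T a) (T b)" "T (rtimes a b) = Ttimes (T a) (T b)"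
  using assms unfolding Tplus_def Ttimes_def rplus_def rtimes_def by simp_all

lemma Tr_comp:
  assumes "arr a" "arr b" "src a = src b" "tgt a = TO (Robj C)" "tgt b = TO (Robj C)" "arr z" "tgt z = src b"
  shows "Tplus a b \<bullet> z = Tplus (a \<bullet> z) (b \<bullet> z)" "Ttimes a b \<bullet> z = Ttimes (a \<bullet> z) (b \<bullet> z)"
  using assms unfolding Tplus_def Ttimes_def by simp_all

lemma Tplus_assoc:
  assumes "arr a" "arr b" "arr c" "src a = src c" "src b = src c"
    "tgt a = TO (Robj C)" "tgt b = TO (Robj C)" "tgt c = TO (Robj C)"
  shows "Tplus (Tplus a b) c = Tplus a (Tplus b c)"
  using arg_cong[OF radd_assoc, of "\<lambda>f. T f \<bullet> Tpair (Prod C (Robj C) (Robj C)) (Robj C) (Tpair (Robj C) (Robj C) a b) c"]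
    assms unfolding Tplus_def by simp

lemma Ttimes_Tplus:
  assumes "arr a" "arr b" "arr c" "src a = src c" "src b = src c"
    "tgt a = TO (Robj C)" "tgt b = TO (Robj C)" "tgt c = TO (Robj C)"
  shows "Ttimes a (Tplus b c) = Tplus (Ttimes a b) (Ttimes a c)"
  using arg_cong[OF rdistrib, of "\<lambda>f. T f \<bullet> Tpair (Prod C (Robj C) (Robj C)) (Robj C) (Tpair (Robj C) (Robj C) a b) c"]
    assms unfolding Tplus_def Ttimes_def by simp

lemma Tr_comm:
  assumes "arr a" "arr b" "src a = src b" "tgt a = TO (Robj C)" "tgt b = TO (Robj C)"
  shows "Tplus a b = Tplus b a" "Ttimes a b = Ttimes b a"
proof -
  let ?p = "pr1 C (Robj C) (Robj C)" and ?q = "pr2 C (Robj C) (Robj C)" and ?m = "Tpair (Robj C) (Robj C) a b"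
  have "Tplus b a = T (radd C \<bullet> pair ?q ?p) \<bullet> ?m" unfolding Tplus_def using assms by simp
  then show "Tplus a b = Tplus b a" unfolding radd_comm Tplus_def by simp
  have "Ttimes b a = T (rmult C \<bullet> pair ?q ?p) \<bullet> ?m" unfolding Ttimes_def using assms by simp
  then show "Ttimes a b = Ttimes b a" unfolding rmult_comm Ttimes_def by simp
qed

lemma T_rconst:
  assumes "arr z" "tgt z = TO Z" "Z \<in> Obj C"
  shows "T (rnull Z) \<bullet> z = tzero C (Robj C) \<bullet> rnull (src z)"
    "T (runit Z) \<bullet> z = tzero C (Robj C) \<bullet> runit (src z)"
  using assms unfolding rnull_def runit_def by simp_all

lemma Tplus_tzero:
  assumes "arr a" "arr b" "src a = src b" "tgt a = Robj C" "tgt b = Robj C"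
  shows "Tplus (tzero C (Robj C) \<bullet> a) (tzero C (Robj C) \<bullet> b) = tzero C (Robj C) \<bullet> rplus a b"
    "Ttimes (tzero C (Robj C) \<bullet> a) (tzero C (Robj C) \<bullet> b) = tzero C (Robj C) \<bullet> rtimes a b"
  unfolding Tplus_def Ttimes_def rplus_def rtimes_def
  using assms tzero_pair[of "Robj C" "Robj C" a b] by simp_all

text \<open>Translation of tangent vectors \<open>c\<close> of \<open>R\<close> by elements \<open>r\<close> of \<open>R\<close>.\<close>

definition rtrans :: "'a \<Rightarrow> 'a \<Rightarrow> 'a" where
  "rtrans r c = Tplus (tzero C (Robj C) \<bullet> r) c"

lemma rtrans_props:
  assumes "arr r" "arr c" "src r = src c" "tgt r = Robj C" "tgt c = TO (Robj C)"
  shows "arr (rtrans r c)" "src (rtrans r c) = src c" "tgt (rtrans r c) = TO (Robj C)"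
    "tproj C (Robj C) \<bullet> rtrans r c = rplus r (tproj C (Robj C) \<bullet> c)"
  using assms unfolding rtrans_def by simp_all

lemma rtrans_rtrans:
  assumes "arr r" "arr s" "arr c" "src r = src c" "src s = src c" "tgt r = Robj C" "tgt s = Robj C"
    "tgt c = TO (Robj C)"
  shows "rtrans r (rtrans s c) = rtrans (rplus r s) c"
  using assms Tplus_tzero(1)[of r s] unfolding rtrans_def by (simp flip: Tplus_assoc)

lemma rtrans_rnull:
  assumes "arr c" "tgt c = TO (Robj C)"
  shows "rtrans (rnull (src c)) c = c"
proof -
  have "T (radd C \<bullet> pair (Ident C (Robj C)) (rzero C \<bullet> bang (Robj C))) \<bullet> c = c"
    unfolding radd_rzero using assms by simp
  then have "Tplus c (tzero C (Robj C) \<bullet> rnull (src c)) = c"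
    using assms unfolding Tplus_def rnull_def by simp
  moreover have "Tplus (tzero C (Robj C) \<bullet> rnull (src c)) c = Tplus c (tzero C (Robj C) \<bullet> rnull (src c))"
    by (rule Tr_comm) (use assms in simp_all)
  ultimately show ?thesis unfolding rtrans_def by (simp only:)
qed

text \<open>Translation is the tangent map of the ring addition with a zero vector in the first
  place. Zero vectors are idempotent, so additivity of tangent maps applies.\<close>

lemma rtrans_tadd:
  assumes c: "compat (Robj C) a b" and r: "arr r" "src r = src a" "tgt r = Robj C"
  shows "rtrans r (tadd (Robj C) a b) = tadd (Robj C) (rtrans r a) (rtrans r b)"
proof -
  note d = compatD[OF c]
  have z: "compat (Robj C) (tzero C (Robj C) \<bullet> r) (tzero C (Robj C) \<bullet> r)" using r unfolding compat_def by simp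
  have zz: "tadd (Robj C) (tzero C (Robj C) \<bullet> r) (tzero C (Robj C) \<bullet> r) = tzero C (Robj C) \<bullet> r"
    by (rule tadd_tzero'(1)) (use r in simp_all)
  have s: "src (tzero C (Robj C) \<bullet> r) = src a" using r by simp
  note t = Tpair_tadd[OF z c s, unfolded zz]
  have f: "arr (radd C)" "src (radd C) = Prod C (Robj C) (Robj C)" "tgt (radd C) = Robj C" by simp_all
  show ?thesis unfolding rtrans_def Tplus_def t(1) T_tadd[OF t(2) f(1,2), unfolded f(3)] ..
qed

end

section \<open>Scalar multiplication of tangent vectors\<close>

context tangent_module_structure
begin

lemma arr_kappa [simp]:
  assumes "X \<in> Obj C"
  shows "arr (kappa C X)" "src (kappa C X) = Prod C (Robj C) (TO X)" "tgt (kappa C X) = TO X"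
  using kappa_closed[OF assms] by (simp_all add: Hom_iff)

definition kap :: "'o \<Rightarrow> 'a \<Rightarrow> 'a \<Rightarrow> 'a" where
  "kap X r a = kappa C X \<bullet> pair r a"

text \<open>\<open>r\<close> and \<open>a\<close> are families of scalars and of tangent vectors of \<open>X\<close> with the same parameters.\<close>

definition scompat :: "'o \<Rightarrow> 'a \<Rightarrow> 'a \<Rightarrow> bool" where
  "scompat X r a \<longleftrightarrow> X \<in> Obj C \<and> arr r \<and> arr a \<and> src r = src a \<and> tgt r = Robj C \<and> tgt a = TO X"

lemma kap_props:
  assumes "scompat X r a"
  shows "arr (kap X r a)" "src (kap X r a) = src a" "tgt (kap X r a) = TO X"
    "tproj C X \<bullet> kap X r a = tproj C X \<bullet> a"
proof -
  note d = assms[unfolded scompat_def]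
  show "arr (kap X r a)" "src (kap X r a) = src a" "tgt (kap X r a) = TO X"
    using d unfolding kap_def by simp_all
  have X: "X \<in> Obj C" using d by simp
  have "tproj C X \<bullet> (kappa C X \<bullet> pair r a) = tproj C X \<bullet> (pr2 C (Robj C) (TO X) \<bullet> pair r a)"
    by (rule comp_cong_right[OF tproj_kappa[OF X]]) (use d in simp_all)
  then show "tproj C X \<bullet> kap X r a = tproj C X \<bullet> a" unfolding kap_def using d by simp
qed

lemma kap_comp:
  assumes "scompat X r a" "arr z" "tgt z = src a"
  shows "kap X r a \<bullet> z = kap X (r \<bullet> z) (a \<bullet> z)" "scompat X (r \<bullet> z) (a \<bullet> z)"
  using assms unfolding scompat_def kap_def by simp_all

lemma kap_T:
  assumes "scompat X r a" "arr f" "src f = X"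
  shows "T f \<bullet> kap X r a = kap (tgt f) r (T f \<bullet> a)" "scompat (tgt f) r (T f \<bullet> a)"
proof -
  note d = assms(1)[unfolded scompat_def]
  have "f \<in> Hom C X (tgt f)" using assms by (simp add: Hom_iff)
  note n = kappa_natural[OF this]
  have "T f \<bullet> (kappa C X \<bullet> pair r a) = kappa C (tgt f) \<bullet>
      (prod_map (Robj C) (TO X) (Ident C (Robj C)) (T f) \<bullet> pair r a)"
    by (rule comp_cong_right[OF n]) (use d assms(2,3) in \<open>simp_all add: prod_map_def\<close>)
  also have "prod_map (Robj C) (TO X) (Ident C (Robj C)) (T f) \<bullet> pair r a = pair r (T f \<bullet> a)"
    using d assms(2,3) by (simp add: prod_map_def)
  finally show "T f \<bullet> kap X r a = kap (tgt f) r (T f \<bullet> a)" unfolding kap_def .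
  show "scompat (tgt f) r (T f \<bullet> a)" using d assms(2,3) unfolding scompat_def by simp
qed

lemma kap_kap:
  assumes "scompat X s a" "arr r" "src r = src a" "tgt r = Robj C"
  shows "kap X r (kap X s a) = kap X (rtimes r s) a"
proof -
  note d = assms(1)[unfolded scompat_def]
  have X: "X \<in> Obj C" using d by simp
  show ?thesis
    using arg_cong[OF kappa_assoc[OF X], of "\<lambda>f. f \<bullet> pair (pair r s) a"] d assms(2-4)
    unfolding kap_def rtimes_def by (simp add: prod_map_def)
qed

lemma kap_runit:
  assumes "X \<in> Obj C" "arr a" "tgt a = TO X"
  shows "kap X (runit (src a)) a = a"
  using arg_cong[OF kappa_rone[OF assms(1)], of "\<lambda>f. f \<bullet> pair (bang (src a)) a"] assms
  unfolding kap_def runit_def by (simp add: prod_map_def)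

lemma kap_rplus:
  assumes "scompat X r a" "scompat X s a"
  shows "kap X (rplus r s) a = tadd X (kap X r a) (kap X s a)" "compat X (kap X r a) (kap X s a)"
proof -
  note d = assms(1)[unfolded scompat_def] assms(2)[unfolded scompat_def]
  have X: "X \<in> Obj C" using d by simp
  let ?R = "Robj C" and ?TX = "TO X"
  let ?p = "kap X (pr13 ?R ?R ?TX) (pr33 ?R ?R ?TX)" and ?q = "kap X (pr23 ?R ?R ?TX) (pr33 ?R ?R ?TX)"
  have sp: "scompat X (pr13 ?R ?R ?TX) (pr33 ?R ?R ?TX)" "scompat X (pr23 ?R ?R ?TX) (pr33 ?R ?R ?TX)"
    using X unfolding scompat_def by simp_all
  have c: "compat X ?p ?q" using kap_props[OF sp(1)] kap_props[OF sp(2)] X unfolding compat_def by simp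
  have "kappa C X \<bullet> prod_map (Prod C ?R ?R) ?TX (radd C) (Ident C ?TX) = tadd X ?p ?q"
    using kappa_radd[OF X] unfolding tadd_def kap_def .
  then have "(kappa C X \<bullet> prod_map (Prod C ?R ?R) ?TX (radd C) (Ident C ?TX)) \<bullet> pair (pair r s) a =
    tadd X ?p ?q \<bullet> pair (pair r s) a" by simp
  moreover have "tadd X ?p ?q \<bullet> pair (pair r s) a = tadd X (kap X r a) (kap X s a)"
    using tadd_comp[OF c, of "pair (pair r s) a"] kap_comp(1)[OF sp(1), of "pair (pair r s) a"]
      kap_comp(1)[OF sp(2), of "pair (pair r s) a"] kap_props(2)[OF sp(2)] d by simp
  ultimately show "kap X (rplus r s) a = tadd X (kap X r a) (kap X s a)"
    using d by (simp add: prod_map_def kap_def[of X "radd C \<bullet> pair r s"] rplus_def)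
  show "compat X (kap X r a) (kap X s a)"
    using kap_props[OF assms(1)] kap_props[OF assms(2)] X unfolding compat_def by simp
qed

lemma kap_tadd:
  assumes c: "compat X a b" and r: "arr r" "src r = src a" "tgt r = Robj C"
  shows "kap X r (tadd X a b) = tadd X (kap X r a) (kap X r b)" "compat X (kap X r a) (kap X r b)"
proof -
  note d = compatD[OF c] and t = tpair_props[OF c]
  have X: "X \<in> Obj C" using d by simp
  let ?R = "Robj C" and ?P = "fprod X"
  let ?p1 = "pr1 C ?R ?P" and ?p2 = "pr2 C ?R ?P"
  have s: "scompat X ?p1 (fpr1 X \<bullet> ?p2)" "scompat X ?p1 (fpr2 X \<bullet> ?p2)"
    using X unfolding scompat_def by simp_all
  let ?p = "kap X ?p1 (fpr1 X \<bullet> ?p2)" and ?q = "kap X ?p1 (fpr2 X \<bullet> ?p2)"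
  have c': "compat X ?p ?q" using kap_props[OF s(1)] kap_props[OF s(2)] X unfolding compat_def by simp
  have "prod_map ?R ?P (Ident C ?R) (fpr1 X) = pair ?p1 (fpr1 X \<bullet> ?p2)"
    "prod_map ?R ?P (Ident C ?R) (fpr2 X) = pair ?p1 (fpr2 X \<bullet> ?p2)"
    using X unfolding prod_map_def by simp_all
  then have "kappa C X \<bullet> prod_map ?R ?P (Ident C ?R) (tplus C X) = tadd X ?p ?q"
    using kappa_tplus[OF X] unfolding tadd_def kap_def fpr1_def fpr2_def fprod_def by simp
  then have "(kappa C X \<bullet> prod_map ?R ?P (Ident C ?R) (tplus C X)) \<bullet> pair r (tpair X a b) =
    tadd X ?p ?q \<bullet> pair r (tpair X a b)" by simp
  moreover have "tadd X ?p ?q \<bullet> pair r (tpair X a b) = tadd X (kap X r a) (kap X r b)"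
    using tadd_comp[OF c', of "pair r (tpair X a b)"] kap_comp(1)[OF s(1), of "pair r (tpair X a b)"]
      kap_comp(1)[OF s(2), of "pair r (tpair X a b)"] kap_props(2)[OF s(2)] d(1-6) t r by simp
  ultimately show "kap X r (tadd X a b) = tadd X (kap X r a) (kap X r b)"
    using d(1-6) t r by (simp add: prod_map_def kap_def[of X r "tplus C X \<bullet> tpair X a b"] tadd_def[of X a b])
  have "scompat X r a" "scompat X r b" using d(1-6) r unfolding scompat_def by simp_all
  then show "compat X (kap X r a) (kap X r b)"
    using kap_props[of X r a] kap_props[of X r b] d unfolding compat_def by simp
qed

lemma kap_tzero:
  assumes "X \<in> Obj C" "arr y" "tgt y = X" "arr r" "src r = src y" "tgt r = Robj C"
  shows "kap X r (tzero C X \<bullet> y) = tzero C X \<bullet> y"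
proof -
  have c: "compat X (tzero C X \<bullet> y) (tzero C X \<bullet> y)" using assms unfolding compat_def by simp
  have t: "tadd X (tzero C X \<bullet> y) (tzero C X \<bullet> y) = tzero C X \<bullet> y"
    by (rule tadd_tzero'(1)) (use assms in simp_all)
  have s: "scompat X r (tzero C X \<bullet> y)" using assms unfolding scompat_def by simp
  note k = kap_props[OF s]
  have "tadd X (kap X r (tzero C X \<bullet> y)) (kap X r (tzero C X \<bullet> y)) = kap X r (tzero C X \<bullet> y)"
    using kap_tadd(1)[OF c assms(4) _ assms(6)] assms unfolding t by simp
  from idem_tzero[OF assms(1) k(1,3) this] show ?thesis using k(4) assms by simp
qed

lemma kap_rnull:
  assumes "X \<in> Obj C" "arr a" "tgt a = TO X"
  shows "kap X (rnull (src a)) a = tzero C X \<bullet> (tproj C X \<bullet> a)"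
proof -
  have s: "scompat X (rnull (src a)) a" using assms unfolding scompat_def by simp
  note k = kap_props[OF s]
  have "rplus (rnull (src a)) (rnull (src a)) = rnull (src a)"
    using rplus_rnull(1)[of "rnull (src a)"] assms by simp
  then have "tadd X (kap X (rnull (src a)) a) (kap X (rnull (src a)) a) = kap X (rnull (src a)) a"
    using kap_rplus(1)[OF s s] by simp
  from idem_tzero[OF assms(1) k(1,3) this] show ?thesis using k(4) by simp
qed

text \<open>\<open>kappa\<close> is natural, in particular along the addition from
  \<open>fprod X\<close> to \<open>TO X\<close>, and \<open>hadd\<close> is \<open>T\<close> of that
  addition.\<close>

lemma kap_hadd:
  assumes h: "hcompat X a b" and r: "arr r" "src r = src b" "tgt r = Robj C"
  shows "kap (TO X) r (hadd X a b) = hadd X (kap (TO X) r a) (kap (TO X) r b)"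
    "hcompat X (kap (TO X) r a) (kap (TO X) r b)"
proof -
  note d = hcompatD[OF h]
  obtain h where h: "arr h" "src h = src b" "tgt h = TO (fprod X)"
    "a = T (fpr1 X) \<bullet> h" "b = T (fpr2 X) \<bullet> h" "hadd X a b = T (tadd X (fpr1 X) (fpr2 X)) \<bullet> h"
    by (rule hadd_factor[OF assms(1)])
  note cf = compat_fpr[OF d(1)]
  note t = tadd_arr[OF cf] and T = T_tadd_hadd[OF cf]
  have s: "scompat (fprod X) r h" using h(1-3) r d(1) unfolding scompat_def by simp
  note k = kap_props[OF s]
  have f: "arr (fpr1 X)" "src (fpr1 X) = fprod X" "tgt (fpr1 X) = TO X"
    "arr (fpr2 X)" "src (fpr2 X) = fprod X" "tgt (fpr2 X) = TO X" using d(1) by simp_all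
  note n1 = kap_T[OF s f(1,2), unfolded f(3)] and n2 = kap_T[OF s f(4,5), unfolded f(6)]
  have t2: "src (tadd X (fpr1 X) (fpr2 X)) = fprod X" using t(2) f by simp
  note n = kap_T[OF s t(1) t2, unfolded t(3)]
  note m = hadd_comp[OF T(2), of "kap (fprod X) r h"]
  have src: "tgt (kap (fprod X) r h) = src (T (fpr2 X))" using k f by simp
  show "kap (TO X) r (hadd X a b) = hadd X (kap (TO X) r a) (kap (TO X) r b)"
    unfolding h(6) n(1)[symmetric] unfolding T(1) m(1)[OF k(1) src] n1(1) n2(1) h(4,5)[symmetric] ..
  show "hcompat X (kap (TO X) r a) (kap (TO X) r b)"
    using m(2)[OF k(1) src] unfolding n1(1) n2(1) h(4,5)[symmetric] .
qed


section \<open>The tangent fiber of the ring at zero\<close>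

lemma Tfib_cone: "Tfib C \<in> Obj C" "arr (fib_inc C)" "src (fib_inc C) = Tfib C" "tgt (fib_inc C) = TO (Robj C)"
    "tproj C (Robj C) \<bullet> fib_inc C = rnull (Tfib C)"
  and fib_lift: "arr c \<Longrightarrow> tgt c = TO (Robj C) \<Longrightarrow> tproj C (Robj C) \<bullet> c = rnull (src c) \<Longrightarrow>
    \<exists>!h. h \<in> Hom C (src c) (Tfib C) \<and> fib_inc C \<bullet> h = c"
proof -
  from Tfib_pullback[unfolded is_pullback_def] obtain A B D where *:
    "rzero C \<in> Hom C A D" "tproj C (Robj C) \<in> Hom C B D" "bang (Tfib C) \<in> Hom C (Tfib C) A"
    "fib_inc C \<in> Hom C (Tfib C) B" "rzero C \<bullet> bang (Tfib C) = tproj C (Robj C) \<bullet> fib_inc C"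
    "\<And>Z a b. a \<in> Hom C Z A \<Longrightarrow> b \<in> Hom C Z B \<Longrightarrow> rzero C \<bullet> a = tproj C (Robj C) \<bullet> b \<Longrightarrow>
           \<exists>!h. h \<in> Hom C Z (Tfib C) \<and> bang (Tfib C) \<bullet> h = a \<and> fib_inc C \<bullet> h = b"
    by (elim exE conjE) blast
  have AB: "A = Terminal C" "B = TO (Robj C)"
    using HomD(2)[OF *(1)] HomD(2)[OF *(2)] by simp_all
  show T: "Tfib C \<in> Obj C" "arr (fib_inc C)" "src (fib_inc C) = Tfib C" "tgt (fib_inc C) = TO (Robj C)"
    using HomD[OF *(4)] AB by simp_all
  show "tproj C (Robj C) \<bullet> fib_inc C = rnull (Tfib C)" using *(5) unfolding rnull_def by simp
  assume c: "arr c" "tgt c = TO (Robj C)" "tproj C (Robj C) \<bullet> c = rnull (src c)"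
  have "\<exists>!h. h \<in> Hom C (src c) (Tfib C) \<and> bang (Tfib C) \<bullet> h = bang (src c) \<and> fib_inc C \<bullet> h = c"
    by (rule *(6)) (use c AB in \<open>simp_all add: Hom_iff rnull_def\<close>)
  moreover have "bang (Tfib C) \<bullet> h = bang (src c)" if "h \<in> Hom C (src c) (Tfib C)" for h
    using that T by (simp add: Hom_iff)
  ultimately show "\<exists>!h. h \<in> Hom C (src c) (Tfib C) \<and> fib_inc C \<bullet> h = c" by blast
qed

lemma fib_inc_comp: "arr h \<Longrightarrow> tgt h = Tfib C \<Longrightarrow> tproj C (Robj C) \<bullet> (fib_inc C \<bullet> h) = rnull (src h)"
  using comp_cong_right1[OF Tfib_cone(5), of h] Tfib_cone(1-4) by simp

lemma fib_inj:
  assumes "arr h" "arr k" "src h = src k" "tgt h = Tfib C" "tgt k = Tfib C" "fib_inc C \<bullet> h = fib_inc C \<bullet> k"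
  shows "h = k"
proof -
  have "\<exists>!h. h \<in> Hom C (src (fib_inc C \<bullet> k)) (Tfib C) \<and> fib_inc C \<bullet> h = fib_inc C \<bullet> k"
    by (rule fib_lift) (use assms(2,5) Tfib_cone fib_inc_comp in simp_all)
  moreover have "h \<in> Hom C (src (fib_inc C \<bullet> k)) (Tfib C)" "k \<in> Hom C (src (fib_inc C \<bullet> k)) (Tfib C)"
    using assms(1-5) Tfib_cone by (simp_all add: Hom_iff)
  ultimately show ?thesis using assms(6) by blast
qed

lemma fib_plus_props:
  "arr fib_plus" "src fib_plus = Prod C (Tfib C) (Tfib C)" "tgt fib_plus = Tfib C"
  "arr x \<Longrightarrow> arr y \<Longrightarrow> src x = src y \<Longrightarrow> tgt x = Tfib C \<Longrightarrow> tgt y = Tfib C \<Longrightarrow>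
    fib_inc C \<bullet> (fib_plus \<bullet> pair x y) = tadd (Robj C) (fib_inc C \<bullet> x) (fib_inc C \<bullet> y)"
proof -
  note F = Tfib_cone(1-4)
  let ?P = "Prod C (Tfib C) (Tfib C)" and ?p = "pr1 C (Tfib C) (Tfib C)" and ?q = "pr2 C (Tfib C) (Tfib C)"
  let ?t = "tadd (Robj C) (fib_inc C \<bullet> ?p) (fib_inc C \<bullet> ?q)"
  have c: "compat (Robj C) (fib_inc C \<bullet> ?p) (fib_inc C \<bullet> ?q)"
    using F fib_inc_comp[of ?p] fib_inc_comp[of ?q] unfolding compat_def by simp
  note t = tadd_arr[OF c]
  have s: "src ?t = ?P" using t F by simp
  have "tproj C (Robj C) \<bullet> ?t = rnull (src ?t)"
    unfolding tproj_tadd[OF c] s using F fib_inc_comp[of ?q] by simp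
  from fib_lift[OF t(1,3) this] have "\<exists>!h. h \<in> Hom C ?P (Tfib C) \<and> fib_inc C \<bullet> h = ?t" unfolding s .
  from theI'[OF this] have h: "fib_plus \<in> Hom C ?P (Tfib C)" "fib_inc C \<bullet> fib_plus = ?t"
    unfolding fib_plus_def tadd_def by simp_all
  show f: "arr fib_plus" "src fib_plus = ?P" "tgt fib_plus = Tfib C" using HomD[OF h(1)] by simp_all
  assume x: "arr x" "arr y" "src x = src y" "tgt x = Tfib C" "tgt y = Tfib C"
  have "fib_inc C \<bullet> (fib_plus \<bullet> pair x y) = ?t \<bullet> pair x y"
    by (rule comp_cong_right1[OF h(2)]) (use F f x in simp_all)
  also have "\<dots> = tadd (Robj C) (fib_inc C \<bullet> x) (fib_inc C \<bullet> y)"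
    using tadd_comp[OF c, of "pair x y"] F x by simp
  finally show "fib_inc C \<bullet> (fib_plus \<bullet> pair x y) = tadd (Robj C) (fib_inc C \<bullet> x) (fib_inc C \<bullet> y)" .
qed

lemma fib_kappa_props:
  "arr fib_kappa" "src fib_kappa = Prod C (Robj C) (Tfib C)" "tgt fib_kappa = Tfib C"
  "arr r \<Longrightarrow> arr y \<Longrightarrow> src r = src y \<Longrightarrow> tgt r = Robj C \<Longrightarrow> tgt y = Tfib C \<Longrightarrow>
    fib_inc C \<bullet> (fib_kappa \<bullet> pair r y) = kap (Robj C) r (fib_inc C \<bullet> y)"
proof -
  note F = Tfib_cone(1-4)
  let ?P = "Prod C (Robj C) (Tfib C)" and ?p = "pr1 C (Robj C) (Tfib C)" and ?q = "pr2 C (Robj C) (Tfib C)"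
  let ?t = "kap (Robj C) ?p (fib_inc C \<bullet> ?q)"
  have c: "scompat (Robj C) ?p (fib_inc C \<bullet> ?q)" using F unfolding scompat_def by simp
  note t = kap_props[OF c]
  have s: "src ?t = ?P" using t F by simp
  have "tproj C (Robj C) \<bullet> ?t = rnull (src ?t)"
    unfolding t(4) s using F fib_inc_comp[of ?q] by simp
  from fib_lift[OF t(1,3) this] have "\<exists>!h. h \<in> Hom C ?P (Tfib C) \<and> fib_inc C \<bullet> h = ?t" unfolding s .
  from theI'[OF this] have h: "fib_kappa \<in> Hom C ?P (Tfib C)" "fib_inc C \<bullet> fib_kappa = ?t"
    using F unfolding fib_kappa_def kap_def prod_map_def by simp_all
  show f: "arr fib_kappa" "src fib_kappa = ?P" "tgt fib_kappa = Tfib C" using HomD[OF h(1)] by simp_all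
  assume x: "arr r" "arr y" "src r = src y" "tgt r = Robj C" "tgt y = Tfib C"
  have "fib_inc C \<bullet> (fib_kappa \<bullet> pair r y) = ?t \<bullet> pair r y"
    by (rule comp_cong_right1[OF h(2)]) (use F f x in simp_all)
  also have "\<dots> = kap (Robj C) r (fib_inc C \<bullet> y)"
    using kap_comp(1)[OF c, of "pair r y"] F x by simp
  finally show "fib_inc C \<bullet> (fib_kappa \<bullet> pair r y) = kap (Robj C) r (fib_inc C \<bullet> y)" .
qed

text \<open>Naturality of \<open>kappa\<close> along the ring addition and along the two projections
  of the product.\<close>

lemma kap_Tplus:
  assumes "arr a" "arr b" "src a = src b" "tgt a = TO (Robj C)" "tgt b = TO (Robj C)"
    and r: "arr r" "src r = src b" "tgt r = Robj C"
  shows "kap (Robj C) r (Tplus a b) = Tplus (kap (Robj C) r a) (kap (Robj C) r b)"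
proof -
  let ?R = "Robj C" and ?m = "Tpair (Robj C) (Robj C) a b"
  have s: "scompat (Prod C ?R ?R) r ?m" using assms unfolding scompat_def by simp
  note k = kap_props[OF s]
  have f: "arr (radd C)" "src (radd C) = Prod C ?R ?R" "tgt (radd C) = ?R"
    "arr (pr1 C ?R ?R)" "src (pr1 C ?R ?R) = Prod C ?R ?R" "tgt (pr1 C ?R ?R) = ?R"
    "arr (pr2 C ?R ?R)" "src (pr2 C ?R ?R) = Prod C ?R ?R" "tgt (pr2 C ?R ?R) = ?R" by simp_all
  have "T (pr1 C ?R ?R) \<bullet> kap (Prod C ?R ?R) r ?m = kap ?R r a"
    "T (pr2 C ?R ?R) \<bullet> kap (Prod C ?R ?R) r ?m = kap ?R r b"
    unfolding kap_T(1)[OF s f(4,5), unfolded f(6)] kap_T(1)[OF s f(7,8), unfolded f(9)] using assms by simp_all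
  then have "kap (Prod C ?R ?R) r ?m = Tpair ?R ?R (kap ?R r a) (kap ?R r b)"
    using Tpair_eta[of ?R ?R "kap (Prod C ?R ?R) r ?m"] k by simp
  then show ?thesis using kap_T(1)[OF s f(1,2), unfolded f(3)] unfolding Tplus_def by simp
qed

end

section \<open>Tangent vectors of the ring as base point and derivative part\<close>

context scalar_tangent_category
begin

definition fib_inv :: "'a" where "fib_inv = inverse_of (fib_iso C)"

lemma fib_inv:
  "arr (fib_iso C)" "src (fib_iso C) = Tfib C" "tgt (fib_iso C) = Robj C"
  "arr fib_inv" "src fib_inv = Robj C" "tgt fib_inv = Tfib C"
  "arr z \<Longrightarrow> tgt z = Tfib C \<Longrightarrow> fib_inv \<bullet> (fib_iso C \<bullet> z) = z"
  "arr z \<Longrightarrow> tgt z = Robj C \<Longrightarrow> fib_iso C \<bullet> (fib_inv \<bullet> z) = z"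
proof -
  note i = inverse_props[OF fib_iso fib_iso_closed, folded fib_inv_def] and f = HomD[OF fib_iso_closed]
  show F: "arr (fib_iso C)" "src (fib_iso C) = Tfib C" "tgt (fib_iso C) = Robj C"
    "arr fib_inv" "src fib_inv = Robj C" "tgt fib_inv = Tfib C" using i f by simp_all
  show "fib_inv \<bullet> (fib_iso C \<bullet> z) = z" if "arr z" "tgt z = Tfib C"
    using comp_cong_right1[OF i(4), of z] F that Tfib_cone(1) by simp
  show "fib_iso C \<bullet> (fib_inv \<bullet> z) = z" if "arr z" "tgt z = Robj C"
    using comp_cong_right1[OF i(5), of z] F that by simp
qed

text \<open>The inclusion of \<open>R\<close> into \<open>TR\<close> as the tangent fiber at \<open>0\<close>.\<close>

definition rinc :: "'a" where "rinc = fib_inc C \<bullet> fib_inv"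

lemma arr_rinc [simp]: "arr rinc" "src rinc = Robj C" "tgt rinc = TO (Robj C)"
  using fib_inv Tfib_cone unfolding rinc_def by simp_all

lemma rinc_comp: "arr s \<Longrightarrow> tgt s = Robj C \<Longrightarrow> rinc \<bullet> s = fib_inc C \<bullet> (fib_inv \<bullet> s)"
  using fib_inv Tfib_cone unfolding rinc_def by simp

lemma tproj_rinc [simp]:
  assumes "arr s" "tgt s = Robj C"
  shows "tproj C (Robj C) \<bullet> (rinc \<bullet> s) = rnull (src s)"
  unfolding rinc_comp[OF assms] using fib_inc_comp[of "fib_inv \<bullet> s"] fib_inv(1-6) assms by simp

text \<open>As \<open>rinc\<close> is injective, the equation \<open>rinc_eta'\<close> determines
  \<open>eta\<close>: included back into the tangent object, the derivative part of a vector is the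
  vector translated to 0.\<close>

lemma eta_props: "arr eta" "src eta = TO (Robj C)" "tgt eta = Robj C"
  and rinc_eta': "rinc \<bullet> eta = rtrans (rneg \<bullet> tproj C (Robj C)) (Ident C (TO (Robj C)))"
proof -
  let ?R = "Robj C"
  let ?t = "partial2 ?R ?R (radd C) \<bullet> pair (rneg \<bullet> tproj C ?R) (Ident C (TO ?R))"
  have t: "?t = rtrans (rneg \<bullet> tproj C ?R) (Ident C (TO ?R))"
    unfolding rtrans_def Tplus_def by (rule partial2_pair) simp_all
  have p: "arr (rneg \<bullet> tproj C ?R)" "src (rneg \<bullet> tproj C ?R) = src (Ident C (TO ?R))"
    "tgt (rneg \<bullet> tproj C ?R) = ?R" by simp_all
  have a: "arr ?t" "src ?t = TO ?R" "tgt ?t = TO ?R" "tproj C ?R \<bullet> ?t = rnull (src ?t)"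
    unfolding t using rtrans_props[of "rneg \<bullet> tproj C ?R" "Ident C (TO ?R)"] rplus_rneg(2)[of "tproj C ?R"]
    by simp_all
  let ?H = "THE h. h \<in> Hom C (TO ?R) (Tfib C) \<and> fib_inc C \<bullet> h = ?t"
  have H: "?H \<in> Hom C (TO ?R) (Tfib C)" "fib_inc C \<bullet> ?H = ?t"
    using theI'[OF fib_lift[OF a(1,3,4), unfolded a(2)]] by simp_all
  have e: "eta = fib_iso C \<bullet> ?H" unfolding eta_def ..
  note h = HomD[OF H(1)]
  show E: "arr eta" "src eta = TO ?R" "tgt eta = ?R" unfolding e using h fib_inv(1-3) by simp_all
  have "fib_inv \<bullet> eta = ?H" unfolding e using fib_inv(7)[of ?H] h by simp
  then show "rinc \<bullet> eta = rtrans (rneg \<bullet> tproj C ?R) (Ident C (TO ?R))"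
    using rinc_comp[of eta] E H(2) t by simp
qed

lemma arr_eta [simp]: "arr eta" "src eta = TO (Robj C)" "tgt eta = Robj C"
  by (fact eta_props)+

lemma rinc_eta:
  assumes "arr c" "tgt c = TO (Robj C)"
  shows "rinc \<bullet> (eta \<bullet> c) = rtrans (rneg \<bullet> (tproj C (Robj C) \<bullet> c)) c"
proof -
  let ?t = "rtrans (rneg \<bullet> tproj C (Robj C)) (Ident C (TO (Robj C)))"
  have "rinc \<bullet> (eta \<bullet> c) = ?t \<bullet> c" by (rule comp_cong_right1[OF rinc_eta']) (use assms in simp_all)
  also have "\<dots> = rtrans (rneg \<bullet> (tproj C (Robj C) \<bullet> c)) c"
    using assms unfolding rtrans_def by (simp add: Tr_comp)
  finally show ?thesis .
qed

lemma rinc_inj: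
  assumes "arr s" "arr s'" "src s = src s'" "tgt s = Robj C" "tgt s' = Robj C" "rinc \<bullet> s = rinc \<bullet> s'"
  shows "s = s'"
proof -
  have "fib_inv \<bullet> s = fib_inv \<bullet> s'"
    by (rule fib_inj) (use assms fib_inv(4-6) in \<open>simp_all add: rinc_comp\<close>)
  then have "fib_iso C \<bullet> (fib_inv \<bullet> s) = fib_iso C \<bullet> (fib_inv \<bullet> s')" by simp
  then show ?thesis using fib_inv(8) assms by simp
qed

lemma rneg_rnull: "Z \<in> Obj C \<Longrightarrow> rneg \<bullet> rnull Z = rnull Z"
  using rplus_rneg(1)[of "rnull Z"] rplus_rnull(2)[of "rneg \<bullet> rnull Z"] by simp

lemma eta_rinc:
  assumes "arr s" "tgt s = Robj C"
  shows "eta \<bullet> (rinc \<bullet> s) = s"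
proof (rule rinc_inj)
  have "rinc \<bullet> (eta \<bullet> (rinc \<bullet> s)) = rtrans (rneg \<bullet> rnull (src s)) (rinc \<bullet> s)"
    using rinc_eta[of "rinc \<bullet> s"] assms by simp
  also have "\<dots> = rinc \<bullet> s" using rneg_rnull[of "src s"] rtrans_rnull[of "rinc \<bullet> s"] assms by simp
  finally show "rinc \<bullet> (eta \<bullet> (rinc \<bullet> s)) = rinc \<bullet> s" .
qed (use assms in simp_all)

lemma rinc_rplus:
  assumes "arr s" "arr s'" "src s = src s'" "tgt s = Robj C" "tgt s' = Robj C"
  shows "rinc \<bullet> rplus s s' = tadd (Robj C) (rinc \<bullet> s) (rinc \<bullet> s')"
    "compat (Robj C) (rinc \<bullet> s) (rinc \<bullet> s')"
proof -
  note f = fib_inv(1-6) and p = fib_plus_props(1-3)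
  have "fib_iso C \<bullet> (fib_plus \<bullet> pair (fib_inv \<bullet> s) (fib_inv \<bullet> s')) =
     (radd C \<bullet> prod_map (Tfib C) (Tfib C) (fib_iso C) (fib_iso C)) \<bullet> pair (fib_inv \<bullet> s) (fib_inv \<bullet> s')"
    by (rule comp_cong_right1[OF fib_iso_plus]) (use f p assms in simp_all)
  also have "\<dots> = rplus s s'"
    using f assms Tfib_cone(1) fib_inv(8) unfolding prod_map_def rplus_def by simp
  finally have "fib_inv \<bullet> rplus s s' = fib_plus \<bullet> pair (fib_inv \<bullet> s) (fib_inv \<bullet> s')"
    using fib_inv(7)[of "fib_plus \<bullet> pair (fib_inv \<bullet> s) (fib_inv \<bullet> s')"] f p assms by simp
  then show "rinc \<bullet> rplus s s' = tadd (Robj C) (rinc \<bullet> s) (rinc \<bullet> s')"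
    using rinc_comp fib_plus_props(4)[of "fib_inv \<bullet> s" "fib_inv \<bullet> s'"] f assms by simp
  show "compat (Robj C) (rinc \<bullet> s) (rinc \<bullet> s')" using assms unfolding compat_def by simp
qed

lemma rinc_rtimes:
  assumes "arr r" "arr s" "src r = src s" "tgt r = Robj C" "tgt s = Robj C"
  shows "rinc \<bullet> rtimes r s = kap (Robj C) r (rinc \<bullet> s)"
proof -
  note f = fib_inv(1-6) and p = fib_kappa_props(1-3)
  have "fib_iso C \<bullet> (fib_kappa \<bullet> pair r (fib_inv \<bullet> s)) =
     (rmult C \<bullet> prod_map (Robj C) (Tfib C) (Ident C (Robj C)) (fib_iso C)) \<bullet> pair r (fib_inv \<bullet> s)"
    by (rule comp_cong_right1[OF fib_iso_kappa]) (use f p assms in simp_all)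
  also have "\<dots> = rtimes r s"
    using f assms Tfib_cone(1) fib_inv(8) unfolding prod_map_def rtimes_def by simp
  finally have "fib_inv \<bullet> rtimes r s = fib_kappa \<bullet> pair r (fib_inv \<bullet> s)"
    using fib_inv(7)[of "fib_kappa \<bullet> pair r (fib_inv \<bullet> s)"] f p assms by simp
  then show ?thesis
    using rinc_comp fib_kappa_props(4)[of r "fib_inv \<bullet> s"] f assms by simp
qed

text \<open>The two sides are compared after the injective \<open>rinc\<close>, which is additive
  because \<open>fib_iso\<close> is linear; translation to 0 is additive as well.\<close>

lemma eta_tadd:
  assumes c: "compat (Robj C) a b"
  shows "eta \<bullet> tadd (Robj C) a b = rplus (eta \<bullet> a) (eta \<bullet> b)"
proof (rule rinc_inj)
  note d = compatD[OF c] and t = tadd_arr[OF c] tproj_tadd[OF c]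
  let ?n = "rneg \<bullet> (tproj C (Robj C) \<bullet> b)"
  have "rinc \<bullet> (eta \<bullet> tadd (Robj C) a b) = rtrans ?n (tadd (Robj C) a b)"
    using rinc_eta[OF t(1,3)] unfolding t(4) .
  also have "\<dots> = tadd (Robj C) (rtrans ?n a) (rtrans ?n b)"
    by (rule rtrans_tadd[OF c]) (use d in simp_all)
  also have "\<dots> = tadd (Robj C) (rinc \<bullet> (eta \<bullet> a)) (rinc \<bullet> (eta \<bullet> b))"
    using rinc_eta[OF d(2,5)] rinc_eta[OF d(3,6)] d(7) by simp
  also have "\<dots> = rinc \<bullet> rplus (eta \<bullet> a) (eta \<bullet> b)"
    by (rule rinc_rplus(1)[symmetric]) (use d(1-6) in simp_all)
  finally show "rinc \<bullet> (eta \<bullet> tadd (Robj C) a b) = rinc \<bullet> rplus (eta \<bullet> a) (eta \<bullet> b)" .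
qed (use compatD(1-6)[OF c] tadd_arr[OF c] in simp_all)

lemma eta_kap:
  assumes s: "scompat (Robj C) r a"
  shows "eta \<bullet> kap (Robj C) r a = rtimes r (eta \<bullet> a)"
proof (rule rinc_inj)
  note d = s[unfolded scompat_def] and k = kap_props[OF s]
  let ?z = "tzero C (Robj C) \<bullet> (rneg \<bullet> (tproj C (Robj C) \<bullet> a))"
  have z: "kap (Robj C) r ?z = ?z" by (rule kap_tzero) (use d in simp_all)
  have "rinc \<bullet> (eta \<bullet> kap (Robj C) r a) = Tplus ?z (kap (Robj C) r a)"
    using rinc_eta[OF k(1,3)] unfolding k(4) rtrans_def .
  also have "\<dots> = kap (Robj C) r (Tplus ?z a)"
    by (subst kap_Tplus) (use d z in simp_all)
  also have "Tplus ?z a = rinc \<bullet> (eta \<bullet> a)" using rinc_eta[of a] d unfolding rtrans_def by simp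
  also have "kap (Robj C) r (rinc \<bullet> (eta \<bullet> a)) = rinc \<bullet> rtimes r (eta \<bullet> a)"
    by (rule rinc_rtimes[symmetric]) (use d in simp_all)
  finally show "rinc \<bullet> (eta \<bullet> kap (Robj C) r a) = rinc \<bullet> rtimes r (eta \<bullet> a)" .
qed (use s[unfolded scompat_def] kap_props[OF s] in simp_all)

lemma eta_tzero:
  assumes "arr r" "tgt r = Robj C"
  shows "eta \<bullet> (tzero C (Robj C) \<bullet> r) = rnull (src r)"
proof -
  have c: "compat (Robj C) (tzero C (Robj C) \<bullet> r) (tzero C (Robj C) \<bullet> r)" using assms unfolding compat_def by simp
  have "tadd (Robj C) (tzero C (Robj C) \<bullet> r) (tzero C (Robj C) \<bullet> r) = tzero C (Robj C) \<bullet> r"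
    by (rule tadd_tzero'(1)) (use assms in simp_all)
  then have "rplus (eta \<bullet> (tzero C (Robj C) \<bullet> r)) (eta \<bullet> (tzero C (Robj C) \<bullet> r)) = eta \<bullet> (tzero C (Robj C) \<bullet> r)"
    using eta_tadd[OF c] by simp
  from rplus_idem[OF _ _ this] show ?thesis using assms by simp
qed

text \<open>A translated vector has another base point, but translating it and the original back to
  0 gives the same vector.\<close>

lemma eta_rtrans:
  assumes "arr r" "arr c" "src r = src c" "tgt r = Robj C" "tgt c = TO (Robj C)"
  shows "eta \<bullet> rtrans r c = eta \<bullet> c"
proof (rule rinc_inj)
  let ?s = "tproj C (Robj C) \<bullet> c"
  note t = rtrans_props[OF assms]
  have e: "rplus (rneg \<bullet> rplus r ?s) r = rneg \<bullet> ?s"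
  proof (rule rneg_unique[of ?s])
    have "rplus ?s (rplus (rneg \<bullet> rplus r ?s) r) = rplus (rplus (rneg \<bullet> rplus r ?s) r) ?s"
      by (rule rplus_comm) (use assms in simp_all)
    also have "\<dots> = rplus (rneg \<bullet> rplus r ?s) (rplus r ?s)" by (rule rplus_assoc) (use assms in simp_all)
    also have "\<dots> = rnull (src ?s)" using rplus_rneg(2)[of "rplus r ?s"] assms by simp
    finally show "rplus ?s (rplus (rneg \<bullet> rplus r ?s) r) = rnull (src ?s)" .
    show "rplus ?s (rneg \<bullet> ?s) = rnull (src ?s)" by (rule rplus_rneg(1)) (use assms in simp_all)
  qed (use assms in simp_all)
  have "rinc \<bullet> (eta \<bullet> rtrans r c) = rtrans (rneg \<bullet> rplus r ?s) (rtrans r c)"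
    using rinc_eta[OF t(1,3)] unfolding t(4) .
  also have "\<dots> = rtrans (rneg \<bullet> ?s) c"
    by (subst rtrans_rtrans) (use assms e in simp_all)
  also have "\<dots> = rinc \<bullet> (eta \<bullet> c)" using rinc_eta[OF assms(2,5)] by simp
  finally show "rinc \<bullet> (eta \<bullet> rtrans r c) = rinc \<bullet> (eta \<bullet> c)" .
qed (use assms rtrans_props[OF assms] in simp_all)

text \<open>Of the two partial derivatives one is a translate of \<open>a\<close> and the other a
  translate of \<open>b\<close>, and \<open>eta\<close> is invariant under translation.\<close>

lemma eta_Tplus:
  assumes "arr a" "arr b" "src a = src b" "tgt a = TO (Robj C)" "tgt b = TO (Robj C)"
  shows "eta \<bullet> Tplus a b = rplus (eta \<bullet> a) (eta \<bullet> b)"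
proof -
  let ?R = "Robj C"
  let ?x = "Tplus a (tzero C ?R \<bullet> (tproj C ?R \<bullet> b))" and ?y = "rtrans (tproj C ?R \<bullet> a) b"
  have t: "Tplus a b = tadd ?R ?x ?y" "compat ?R ?x ?y"
    using T_Tpair_split[of ?R ?R "radd C" a b] assms unfolding Tplus_def rtrans_def by simp_all
  have "?x = rtrans (tproj C ?R \<bullet> b) a" unfolding rtrans_def by (rule Tr_comm(1)) (use assms in simp_all)
  then show ?thesis
    unfolding t(1) eta_tadd[OF t(2)]
    using eta_rtrans[of "tproj C ?R \<bullet> b" a] eta_rtrans[of "tproj C ?R \<bullet> a" b] assms by simp
qed

text \<open>Base point and \<open>eta\<close> act as coordinates on the tangent object: a vector is
  recovered by translating its derivative part from 0 to its base point.\<close>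

lemma rtrans_rinc_eta:
  assumes "arr c" "tgt c = TO (Robj C)"
  shows "rtrans (tproj C (Robj C) \<bullet> c) (rinc \<bullet> (eta \<bullet> c)) = c"
proof -
  let ?s = "tproj C (Robj C) \<bullet> c"
  have "rtrans ?s (rtrans (rneg \<bullet> ?s) c) = rtrans (rplus ?s (rneg \<bullet> ?s)) c"
    by (rule rtrans_rtrans) (use assms in simp_all)
  also have "rplus ?s (rneg \<bullet> ?s) = rnull (src c)" using rplus_rneg(1)[of ?s] assms by simp
  finally show ?thesis unfolding rinc_eta[OF assms] using rtrans_rnull[OF assms] by simp
qed

lemma kap_tlift:
  assumes s: "scompat X r a"
  shows "tlift C X \<bullet> kap X r a = kap (TO X) r (tlift C X \<bullet> a)"
proof -
  note d = s[unfolded scompat_def]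
  have X: "X \<in> Obj C" using d by simp
  show ?thesis
    using arg_cong[OF scalar1[OF X], of "\<lambda>f. f \<bullet> pair r a"] d unfolding kap_def by (simp add: prod_map_def)
qed

lemma kap_vert:
  assumes c: "compat X a c" and r: "arr r" "src r = src c" "tgt r = Robj C"
  shows "kap (TO X) r (vert X a c) = vert X a (kap X r c)" "compat X a (kap X r c)"
proof -
  note d = compatD[OF c]
  have s: "scompat X r c" using d r unfolding scompat_def by simp
  note k = kap_props[OF s]
  show c': "compat X a (kap X r c)" using d k unfolding compat_def by simp
  have r': "src r = src (tlift C X \<bullet> c)" using r d(1-6) by simp
  have z: "kap (TO X) r (tzero C (TO X) \<bullet> a) = tzero C (TO X) \<bullet> a"
    by (rule kap_tzero) (use d(1-6) r in simp_all)
  show "kap (TO X) r (vert X a c) = vert X a (kap X r c)"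
    unfolding vert_eq(1)[OF c] vert_eq(1)[OF c'] kap_hadd(1)[OF vert_eq(2)[OF c] r(1) r' r(3)] z kap_tlift[OF s] ..
qed

lemma kap_core:
  assumes c: "ccompat X A c" and r: "arr r" "src r = src c" "tgt r = Robj C"
  shows "kap (TO X) r (core X A c) = core X (kap (TO X) r A) (kap X r c)"
    "ccompat X (kap (TO X) r A) (kap X r c)"
proof -
  note d = ccompatD[OF c]
  have s: "scompat (TO X) r A" using d r unfolding scompat_def by simp
  note k = kap_props[OF s] and v = kap_vert[OF d(8) r]
  have r': "src r = src A" using r d by simp
  show "kap (TO X) r (core X A c) = core X (kap (TO X) r A) (kap X r c)"
    unfolding core_def kap_tadd(1)[OF d(9) r(1) r' r(3)] v(1) k(4) ..
  show "ccompat X (kap (TO X) r A) (kap X r c)" using k v(2) unfolding ccompat_def by simp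
qed

lemma arr_tlift2:
  assumes "X \<in> Obj C"
  shows "arr (tlift2 X)" "src (tlift2 X) = fprod X" "tgt (tlift2 X) = TO (TO X)"
proof -
  have c: "compat (TO X) (T (tzero C X) \<bullet> fpr1 X) (tlift C X \<bullet> fpr2 X)"
    using assms unfolding compat_def by simp
  have e: "tlift2 X = tflip C X \<bullet> tadd (TO X) (T (tzero C X) \<bullet> fpr1 X) (tlift C X \<bullet> fpr2 X)"
    unfolding tlift2_def tadd_def fpr1_def fpr2_def ..
  show "arr (tlift2 X)" "src (tlift2 X) = fprod X" "tgt (tlift2 X) = TO (TO X)"
    unfolding e using tadd_arr[OF c] assms by simp_all
qed

text \<open>The axiom \<open>scalar2\<close> on elements: moving the scalar along \<open>a\<close>
  moves the scaled vector inside its fiber, with velocity \<open>eta \<bullet> a\<close> times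
  \<open>w\<close>.\<close>

lemma Tkappa_tzero_right:
  assumes "X \<in> Obj C" "arr a" "arr w" "src a = src w" "tgt a = TO (Robj C)" "tgt w = TO X"
  shows "T (kappa C X) \<bullet> Tpair (Robj C) (TO X) a (tzero C (TO X) \<bullet> w) =
    vert X (kap X (tproj C (Robj C) \<bullet> a) w) (kap X (eta \<bullet> a) w)"
    "compat X (kap X (tproj C (Robj C) \<bullet> a) w) (kap X (eta \<bullet> a) w)"
proof -
  let ?R = "Robj C" and ?TX = "TO X"
  let ?p = "kap X (pr13 ?R ?R ?TX) (pr33 ?R ?R ?TX)" and ?q = "kap X (pr23 ?R ?R ?TX) (pr33 ?R ?R ?TX)"
  have sp: "scompat X (pr13 ?R ?R ?TX) (pr33 ?R ?R ?TX)" "scompat X (pr23 ?R ?R ?TX) (pr33 ?R ?R ?TX)"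
    using assms(1) unfolding scompat_def by simp_all
  have c: "compat X ?p ?q" using kap_props[OF sp(1)] kap_props[OF sp(2)] assms(1) unfolding compat_def by simp
  note v = vert_props[OF c] and tp = tpair_props[OF c] and l = arr_tlift2[OF assms(1)]
  let ?m = "pair (pair (tproj C ?R \<bullet> a) (eta \<bullet> a)) w"
  let ?pm = "prod_map (TO ?R) ?TX (pair (tproj C ?R) eta) (Ident C ?TX)"
  have pm: "arr ?pm" "src ?pm = Prod C (TO ?R) ?TX" "tgt ?pm = Prod C (Prod C ?R ?R) ?TX"
    "?pm \<bullet> pair a w = ?m"
    using assms unfolding prod_map_def by simp_all
  have tp2: "src (tpair X ?p ?q) = Prod C (Prod C ?R ?R) ?TX" using tp(2) kap_props(2)[OF sp(2)] assms(1) by simp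
  have "T (kappa C X) \<bullet> Tpair ?R ?TX a (tzero C ?TX \<bullet> w) = partial1 ?R ?TX (kappa C X) \<bullet> pair a w"
    by (rule partial1_pair[symmetric]) (use assms in simp_all)
  also have "partial1 ?R ?TX (kappa C X) = tlift2 X \<bullet> (tpair X ?p ?q \<bullet> ?pm)"
    unfolding scalar2[OF assms(1)] kap_def ..
  also have "(tlift2 X \<bullet> (tpair X ?p ?q \<bullet> ?pm)) \<bullet> pair a w = tlift2 X \<bullet> (tpair X ?p ?q \<bullet> ?m)"
    using assms l pm tp(1,3) tp2 by simp
  also have "tpair X ?p ?q \<bullet> ?m = tpair X (?p \<bullet> ?m) (?q \<bullet> ?m)"
    by (rule tpair_comp[OF c]) (use assms kap_props(2)[OF sp(2)] in simp_all)
  also have pm': "?p \<bullet> ?m = kap X (tproj C ?R \<bullet> a) w" using kap_comp(1)[OF sp(1), of ?m] assms by simp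
  also have qm': "?q \<bullet> ?m = kap X (eta \<bullet> a) w" using kap_comp(1)[OF sp(2), of ?m] assms by simp
  finally show "T (kappa C X) \<bullet> Tpair ?R ?TX a (tzero C ?TX \<bullet> w) =
    vert X (kap X (tproj C ?R \<bullet> a) w) (kap X (eta \<bullet> a) w)"
    unfolding vert_def .
  have "compat X (?p \<bullet> ?m) (?q \<bullet> ?m)"
    by (rule compat_comp[OF c]) (use assms kap_props(2)[OF sp(2)] in simp_all)
  then show "compat X (kap X (tproj C ?R \<bullet> a) w) (kap X (eta \<bullet> a) w)" unfolding pm' qm' .
qed

text \<open>The axiom \<open>scalar3\<close> on elements: with the scalar held fixed,
  differentiation scales in the inner direction, hence the two flips.\<close>

lemma Tkappa_tzero_left:
  assumes "X \<in> Obj C" "arr r" "arr B" "src r = src B" "tgt r = Robj C" "tgt B = TO (TO X)"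
  shows "T (kappa C X) \<bullet> Tpair (Robj C) (TO X) (tzero C (Robj C) \<bullet> r) B =
    tflip C X \<bullet> kap (TO X) r (tflip C X \<bullet> B)"
proof -
  have "T (kappa C X) \<bullet> Tpair (Robj C) (TO X) (tzero C (Robj C) \<bullet> r) B =
      partial2 (Robj C) (TO X) (kappa C X) \<bullet> pair r B"
    by (rule partial2_pair[symmetric]) (use assms in simp_all)
  then show ?thesis unfolding scalar3[OF assms(1)] kap_def using assms by (simp add: prod_map_def)
qed

text \<open>\<open>rinc\<close> is linear, so its derivative at \<open>0\<close> is the vertical lift.\<close>

lemma T_rinc:
  assumes s: "arr s" "tgt s = Robj C"
  shows "T rinc \<bullet> (rinc \<bullet> s) = tlift C (Robj C) \<bullet> (rinc \<bullet> s)"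
proof -
  let ?R = "Robj C" and ?b = "rinc \<bullet> s" and ?Z = "src s"
  let ?e = "rinc \<bullet> runit ?Z"
  have Z: "?Z \<in> Obj C" using s by simp
  \<comment> \<open>By linearity \<open>rinc\<close> scales its own value at 1, so
    \<open>scalar2\<close> gives its derivative.\<close>
  have "rinc = rinc \<bullet> rtimes (Ident C ?R) (runit ?R)" using rtimes_runit(1)[of "Ident C ?R"] by simp
  also have "\<dots> = kap ?R (Ident C ?R) (rinc \<bullet> runit ?R)" by (rule rinc_rtimes) simp_all
  finally have "T rinc = T (kappa C ?R \<bullet> pair (Ident C ?R) (rinc \<bullet> runit ?R))"
    unfolding kap_def by (rule arg_cong)
  also have "\<dots> = T (kappa C ?R) \<bullet> Tpair ?R (TO ?R) (Ident C (TO ?R)) (T rinc \<bullet> T (runit ?R))"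
    by simp
  finally have "T rinc = T (kappa C ?R) \<bullet> Tpair ?R (TO ?R) (Ident C (TO ?R)) (T rinc \<bullet> T (runit ?R))" .
  then have "T rinc \<bullet> ?b =
      (T (kappa C ?R) \<bullet> Tpair ?R (TO ?R) (Ident C (TO ?R)) (T rinc \<bullet> T (runit ?R))) \<bullet> ?b"
    by simp
  also have "\<dots> = T (kappa C ?R) \<bullet> Tpair ?R (TO ?R) ?b (tzero C (TO ?R) \<bullet> ?e)"
    using s T_rconst(2)[of ?b ?R] by simp
  also have "\<dots> = vert ?R (kap ?R (rnull ?Z) ?e) (kap ?R (eta \<bullet> ?b) ?e)"
    using Tkappa_tzero_right(1)[of ?R ?b ?e] s by simp
  also have "kap ?R (eta \<bullet> ?b) ?e = ?b"
    unfolding eta_rinc[OF s] using rinc_rtimes[of s "runit ?Z"] rtimes_runit(1)[OF s] s by simp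
  also have "kap ?R (rnull ?Z) ?e = tzero C ?R \<bullet> rnull ?Z"
    using kap_rnull[of ?R ?e] s by simp
  also have "vert ?R (tzero C ?R \<bullet> rnull ?Z) ?b = tlift C ?R \<bullet> ?b"
  proof -
    have c: "compat ?R (tzero C ?R \<bullet> rnull ?Z) ?b" using s unfolding compat_def by simp
    have "hadd ?R (T (tzero C ?R) \<bullet> (tzero C ?R \<bullet> rnull ?Z)) (tlift C ?R \<bullet> ?b) = tlift C ?R \<bullet> ?b"
      by (rule hadd_Ttzero(2)) (use s in simp_all)
    then show ?thesis unfolding vert_eq(1)[OF c] using Z by simp
  qed
  finally show ?thesis .
qed

text \<open>For vectors over 0 the linear map \<open>rinc\<close> turns the product into scalar
  multiplication, whose derivative is known from \<open>scalar3\<close>; afterwards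
  \<open>T rinc\<close> is cancelled by \<open>T eta\<close>. A general \<open>b\<close> is a
  translate of such a vector to its base point.\<close>

lemma eta_Ttimes_tzero_left:
  assumes "arr r" "arr b" "src r = src b" "tgt r = Robj C" "tgt b = TO (Robj C)"
  shows "eta \<bullet> Ttimes (tzero C (Robj C) \<bullet> r) b = rtimes r (eta \<bullet> b)"
proof -
  let ?R = "Robj C"
  let ?s = "eta \<bullet> b" and ?b = "rinc \<bullet> (eta \<bullet> b)" and ?z = "tzero C (Robj C) \<bullet> r"
  have t: "arr ?b" "src ?b = src b" "tgt ?b = TO ?R" using assms by simp_all
  \<comment> \<open>Linearity of \<open>rinc\<close> on the generic pair of ring elements, in a form
    that can be differentiated.\<close>
  have "kap ?R (pr1 C ?R ?R) (rinc \<bullet> pr2 C ?R ?R) = rinc \<bullet> rtimes (pr1 C ?R ?R) (pr2 C ?R ?R)"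
    by (rule rinc_rtimes[symmetric]) simp_all
  also have "\<dots> = rinc \<bullet> rmult C" unfolding rtimes_def by simp
  finally have "T (rinc \<bullet> rmult C) \<bullet> Tpair ?R ?R ?z ?b =
      T (kap ?R (pr1 C ?R ?R) (rinc \<bullet> pr2 C ?R ?R)) \<bullet> Tpair ?R ?R ?z ?b" by simp
  then have "T rinc \<bullet> Ttimes ?z ?b = T (kappa C ?R) \<bullet> Tpair ?R (TO ?R) ?z (T rinc \<bullet> ?b)"
    using assms t unfolding Ttimes_def kap_def by simp
  also have "\<dots> = tflip C ?R \<bullet> kap (TO ?R) r (tflip C ?R \<bullet> (T rinc \<bullet> ?b))"
    by (rule Tkappa_tzero_left) (use assms t in simp_all)
  also have "T rinc \<bullet> ?b = tlift C ?R \<bullet> ?b" by (rule T_rinc) (use assms in simp_all)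
  also have "tflip C ?R \<bullet> (tlift C ?R \<bullet> ?b) = tlift C ?R \<bullet> ?b" using t by simp
  also have "kap (TO ?R) r (tlift C ?R \<bullet> ?b) = tlift C ?R \<bullet> kap ?R r ?b"
    by (rule kap_tlift[symmetric]) (use assms t in \<open>simp add: scompat_def\<close>)
  also have k: "kap ?R r ?b = rinc \<bullet> rtimes r ?s" by (rule rinc_rtimes[symmetric]) (use assms in simp_all)
  also have "tflip C ?R \<bullet> (tlift C ?R \<bullet> (rinc \<bullet> rtimes r ?s)) = tlift C ?R \<bullet> (rinc \<bullet> rtimes r ?s)"
    using assms by simp
  also have "\<dots> = T rinc \<bullet> (rinc \<bullet> rtimes r ?s)" by (rule T_rinc[symmetric]) (use assms in simp_all)
  finally have I: "T rinc \<bullet> Ttimes ?z ?b = T rinc \<bullet> (rinc \<bullet> rtimes r ?s)" .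
  have ei: "T eta \<bullet> T rinc = Ident C (TO ?R)"
    using eta_rinc[of "Ident C ?R"] T_comp[of rinc eta] by simp
  have T: "T eta \<bullet> (T rinc \<bullet> x) = x" if "arr x" "tgt x = TO ?R" for x
    using comp_cong_right1[OF ei, of x] that by simp
  have "T eta \<bullet> (T rinc \<bullet> Ttimes ?z ?b) = T eta \<bullet> (T rinc \<bullet> (rinc \<bullet> rtimes r ?s))"
    by (simp only: I)
  then have tb: "Ttimes ?z ?b = rinc \<bullet> rtimes r ?s" using T assms t by simp
  \<comment> \<open>For general \<open>b\<close> the base point contributes a zero vector; it only
    translates the result and is invisible to \<open>eta\<close>.\<close>
  have "Ttimes ?z b = Ttimes ?z (rtrans (tproj C ?R \<bullet> b) ?b)" using rtrans_rinc_eta[of b] assms by simp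
  also have "\<dots> = Tplus (Ttimes ?z (tzero C ?R \<bullet> (tproj C ?R \<bullet> b))) (Ttimes ?z ?b)"
    unfolding rtrans_def by (rule Ttimes_Tplus) (use assms in simp_all)
  also have "Ttimes ?z (tzero C ?R \<bullet> (tproj C ?R \<bullet> b)) = tzero C ?R \<bullet> rtimes r (tproj C ?R \<bullet> b)"
    by (rule Tplus_tzero(2)) (use assms in simp_all)
  also have "Tplus (tzero C ?R \<bullet> rtimes r (tproj C ?R \<bullet> b)) (Ttimes ?z ?b) =
      rtrans (rtimes r (tproj C ?R \<bullet> b)) (rinc \<bullet> rtimes r ?s)"
    unfolding tb rtrans_def ..
  finally have "eta \<bullet> Ttimes ?z b = eta \<bullet> rtrans (rtimes r (tproj C ?R \<bullet> b)) (rinc \<bullet> rtimes r ?s)" by simp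
  also have "\<dots> = eta \<bullet> (rinc \<bullet> rtimes r ?s)" by (rule eta_rtrans) (use assms in simp_all)
  also have "\<dots> = rtimes r ?s" by (rule eta_rinc) (use assms in simp_all)
  finally show ?thesis .
qed

lemma eta_Ttimes:
  assumes "arr a" "arr b" "src a = src b" "tgt a = TO (Robj C)" "tgt b = TO (Robj C)"
  shows "eta \<bullet> Ttimes a b = rplus (rtimes (eta \<bullet> a) (tproj C (Robj C) \<bullet> b)) (rtimes (tproj C (Robj C) \<bullet> a) (eta \<bullet> b))"
proof -
  let ?R = "Robj C"
  let ?x = "Ttimes a (tzero C ?R \<bullet> (tproj C ?R \<bullet> b))" and ?y = "Ttimes (tzero C ?R \<bullet> (tproj C ?R \<bullet> a)) b"
  have t: "Ttimes a b = tadd ?R ?x ?y" "compat ?R ?x ?y"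
    using T_Tpair_split[of ?R ?R "rmult C" a b] assms unfolding Ttimes_def by simp_all
  have x: "?x = Ttimes (tzero C ?R \<bullet> (tproj C ?R \<bullet> b)) a" by (rule Tr_comm(2)) (use assms in simp_all)
  have "eta \<bullet> ?x = rtimes (tproj C ?R \<bullet> b) (eta \<bullet> a)"
    unfolding x by (rule eta_Ttimes_tzero_left) (use assms in simp_all)
  also have "\<dots> = rtimes (eta \<bullet> a) (tproj C ?R \<bullet> b)" by (rule rtimes_comm) (use assms in simp_all)
  finally have ex: "eta \<bullet> ?x = rtimes (eta \<bullet> a) (tproj C ?R \<bullet> b)" .
  have ey: "eta \<bullet> ?y = rtimes (tproj C ?R \<bullet> a) (eta \<bullet> b)"
    by (rule eta_Ttimes_tzero_left) (use assms in simp_all)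
  show ?thesis unfolding t(1) eta_tadd[OF t(2)] ex ey ..
qed

text \<open>The mixed second order coordinate on \<open>T (T R)\<close>. On
  \<open>T (T f) \<bullet> (T w \<bullet> v)\<close> it gives the iterated action
  \<open>vf_action v (vf_action w f)\<close>.\<close>

definition eta2 :: "'a \<Rightarrow> 'a" where "eta2 A = eta \<bullet> (T eta \<bullet> A)"

lemma eta2_tadd:
  assumes c: "compat (TO (Robj C)) A B"
  shows "eta2 (tadd (TO (Robj C)) A B) = rplus (eta2 A) (eta2 B)"
proof -
  have f: "arr eta" "src eta = TO (Robj C)" "tgt eta = Robj C" by simp_all
  show ?thesis
    unfolding eta2_def T_tadd[OF c f(1,2), unfolded f(3)] using eta_tadd[OF compat_T[OF c f(1,2), unfolded f(3)]] .
qed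

text \<open>The rule \<open>eta_Tplus\<close> for the generic pair is an identity of arrows, so it
  can be differentiated once more.\<close>

lemma eta2_TTplus:
  assumes "arr n" "tgt n = TO (TO (Prod C (Robj C) (Robj C)))"
  shows "eta2 (T (T (radd C)) \<bullet> n) =
    rplus (eta2 (T (T (pr1 C (Robj C) (Robj C))) \<bullet> n)) (eta2 (T (T (pr2 C (Robj C) (Robj C))) \<bullet> n))"
proof -
  let ?R = "Robj C" and ?p = "T (pr1 C (Robj C) (Robj C))" and ?q = "T (pr2 C (Robj C) (Robj C))"
  have "Tpair ?R ?R ?p ?q = Ident C (TO (Prod C ?R ?R))"
    using Tpair_eta[of ?R ?R "Ident C (TO (Prod C ?R ?R))"] by simp
  then have "eta \<bullet> T (radd C) = rplus (eta \<bullet> ?p) (eta \<bullet> ?q)"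
    using eta_Tplus[of ?p ?q] unfolding Tplus_def by simp
  then have "T (eta \<bullet> T (radd C)) = Tplus (T (eta \<bullet> ?p)) (T (eta \<bullet> ?q))"
    using T_rplus(1)[of "eta \<bullet> ?p" "eta \<bullet> ?q"] by simp
  then have "T (eta \<bullet> T (radd C)) \<bullet> n = Tplus (T (eta \<bullet> ?p) \<bullet> n) (T (eta \<bullet> ?q) \<bullet> n)"
    using Tr_comp(1)[of "T (eta \<bullet> ?p)" "T (eta \<bullet> ?q)" n] assms by simp
  then have "T eta \<bullet> (T (T (radd C)) \<bullet> n) = Tplus (T eta \<bullet> (T ?p \<bullet> n)) (T eta \<bullet> (T ?q \<bullet> n))"
    using assms by simp
  then show ?thesis unfolding eta2_def using eta_Tplus[of "T eta \<bullet> (T ?p \<bullet> n)" "T eta \<bullet> (T ?q \<bullet> n)"] assms by simp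
qed

lemma eta2_tzero:
  assumes "arr b" "tgt b = TO (Robj C)"
  shows "eta2 (tzero C (TO (Robj C)) \<bullet> b) = rnull (src b)" "eta2 (T (tzero C (Robj C)) \<bullet> b) = rnull (src b)"
proof -
  show "eta2 (tzero C (TO (Robj C)) \<bullet> b) = rnull (src b)"
    unfolding eta2_def using eta_tzero[of "eta \<bullet> b"] assms by simp
  have "eta \<bullet> tzero C (Robj C) = rnull (Robj C)" using eta_tzero[of "Ident C (Robj C)"] by simp
  then have "T eta \<bullet> T (tzero C (Robj C)) = T (rnull (Robj C))"
    using T_comp[of "tzero C (Robj C)" eta] by simp
  then have "T eta \<bullet> (T (tzero C (Robj C)) \<bullet> b) = T (rnull (Robj C)) \<bullet> b"
    by (rule comp_cong_right1) (use assms in simp_all)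
  also have "\<dots> = tzero C (Robj C) \<bullet> rnull (src b)" by (rule T_rconst(1)) (use assms in simp_all)
  finally show "eta2 (T (tzero C (Robj C)) \<bullet> b) = rnull (src b)"
    unfolding eta2_def using eta_tzero[of "rnull (src b)"] assms by simp
qed

text \<open>In the ring structure of the tangent object, \<open>c\<close> is a zero vector plus a
  vector over 0, and the lift is natural along the ring addition. The zero vector contributes
  nothing; on the vector over 0 the lift is \<open>T rinc\<close> by \<open>T_rinc\<close>, which
  \<open>T eta\<close> inverts.\<close>

lemma eta2_tlift:
  assumes c: "arr c" "tgt c = TO (Robj C)"
  shows "eta2 (tlift C (Robj C) \<bullet> c) = eta \<bullet> c"
proof -
  let ?R = "Robj C"
  let ?s = "tproj C ?R \<bullet> c" and ?b = "rinc \<bullet> (eta \<bullet> c)"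
  let ?m = "Tpair ?R ?R (tzero C ?R \<bullet> ?s) ?b"
  have m: "arr ?m" "tgt ?m = TO (Prod C ?R ?R)" using c by simp_all
  have "c = T (radd C) \<bullet> ?m" using rtrans_rinc_eta[OF c] unfolding rtrans_def Tplus_def by simp
  then have "tlift C ?R \<bullet> c = tlift C ?R \<bullet> (T (radd C) \<bullet> ?m)" by simp
  also have "\<dots> = T (T (radd C)) \<bullet> (tlift C (Prod C ?R ?R) \<bullet> ?m)" using m by simp
  finally have e: "tlift C ?R \<bullet> c = T (T (radd C)) \<bullet> (tlift C (Prod C ?R ?R) \<bullet> ?m)" .
  have 1: "eta2 (T (T (pr1 C ?R ?R)) \<bullet> (tlift C (Prod C ?R ?R) \<bullet> ?m)) = rnull (src c)"
    using eta2_tzero(1)[of "tzero C ?R \<bullet> ?s"] c m by simp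
  have ei: "T eta \<bullet> T rinc = Ident C (TO ?R)"
    using eta_rinc[of "Ident C ?R"] T_comp[of rinc eta] by simp
  have T: "T eta \<bullet> (T rinc \<bullet> x) = x" if "arr x" "tgt x = TO ?R" for x
    using comp_cong_right1[OF ei, of x] that by simp
  have "eta2 (tlift C ?R \<bullet> ?b) = eta2 (T rinc \<bullet> ?b)" using T_rinc[of "eta \<bullet> c"] c by simp
  also have "\<dots> = eta \<bullet> c" unfolding eta2_def using T[of ?b] eta_rinc[of "eta \<bullet> c"] c by simp
  finally have 2: "eta2 (T (T (pr2 C ?R ?R)) \<bullet> (tlift C (Prod C ?R ?R) \<bullet> ?m)) = eta \<bullet> c"
    using c m by simp
  show ?thesis
    unfolding e using eta2_TTplus[of "tlift C (Prod C ?R ?R) \<bullet> ?m"] m rplus_rnull(2)[of "eta \<bullet> c"] c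
    unfolding 1 2 by simp
qed

text \<open>\<open>hadd\<close> is \<open>T\<close> of the fiberwise addition, on which
  \<open>eta\<close> is additive; that identity is differentiated at the generic pair
  \<open>fpr1\<close>, \<open>fpr2\<close>.\<close>

lemma eta2_hadd:
  assumes h: "hcompat (Robj C) A B"
  shows "eta2 (hadd (Robj C) A B) = rplus (eta2 A) (eta2 B)"
proof -
  let ?R = "Robj C"
  obtain h where h: "arr h" "src h = src B" "tgt h = TO (fprod ?R)"
    "A = T (fpr1 ?R) \<bullet> h" "B = T (fpr2 ?R) \<bullet> h" "hadd ?R A B = T (tadd ?R (fpr1 ?R) (fpr2 ?R)) \<bullet> h"
    by (rule hadd_factor[OF h])
  note c = compat_fpr[of ?R, OF R_Obj] and t = tadd_arr[OF compat_fpr[of ?R, OF R_Obj]]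
  have "T (eta \<bullet> tadd ?R (fpr1 ?R) (fpr2 ?R)) = Tplus (T (eta \<bullet> fpr1 ?R)) (T (eta \<bullet> fpr2 ?R))"
    unfolding eta_tadd[OF c] by (rule T_rplus(1)) simp_all
  then have "T (eta \<bullet> tadd ?R (fpr1 ?R) (fpr2 ?R)) \<bullet> h = Tplus (T (eta \<bullet> fpr1 ?R) \<bullet> h) (T (eta \<bullet> fpr2 ?R) \<bullet> h)"
    using Tr_comp(1)[of "T (eta \<bullet> fpr1 ?R)" "T (eta \<bullet> fpr2 ?R)" h] h(1-3) by simp
  then have "T eta \<bullet> (T (tadd ?R (fpr1 ?R) (fpr2 ?R)) \<bullet> h) =
      Tplus (T eta \<bullet> (T (fpr1 ?R) \<bullet> h)) (T eta \<bullet> (T (fpr2 ?R) \<bullet> h))"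
    using h(1-3) t by simp
  then show ?thesis
    unfolding eta2_def h(6) unfolding h(4,5)
    using eta_Tplus[of "T eta \<bullet> (T (fpr1 ?R) \<bullet> h)" "T eta \<bullet> (T (fpr2 ?R) \<bullet> h)"] h(1-3) by simp
qed

text \<open>The zero part of the vertical vector has no mixed coordinate, and its lift contributes
  \<open>eta \<bullet> c\<close>.\<close>

lemma eta2_core:
  assumes c: "ccompat (Robj C) B c"
  shows "eta2 (core (Robj C) B c) = rplus (eta2 B) (eta \<bullet> c)"
proof -
  note d = ccompatD[OF c]
  have "eta2 (vert (Robj C) (tproj C (TO (Robj C)) \<bullet> B) c) = rplus (rnull (src c)) (eta \<bullet> c)"
    unfolding vert_eq(1)[OF d(8)] eta2_hadd[OF vert_eq(2)[OF d(8)]]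
    using eta2_tzero(1)[of "tproj C (TO (Robj C)) \<bullet> B"] eta2_tlift[of c] d(1-6) by simp
  also have "\<dots> = eta \<bullet> c" using rplus_rnull(2)[of "eta \<bullet> c"] d by simp
  finally show ?thesis unfolding core_def eta2_tadd[OF d(9)] by simp
qed

text \<open>Every second order tangent vector of \<open>R\<close> is a core translate of the sum of its two faces, whose
  mixed second order part \<open>eta2\<close> vanishes.\<close>

lemma eta2_tflip:
  assumes A: "arr A" "tgt A = TO (TO (Robj C))"
  shows "eta2 (tflip C (Robj C) \<bullet> A) = eta2 A"
proof -
  let ?R = "Robj C" and ?TR = "TO (Robj C)"
  let ?a = "tproj C ?TR \<bullet> A" and ?b = "T (tproj C ?R) \<bullet> A" and ?Z = "src A"
  let ?bz = "rinc \<bullet> (eta \<bullet> ?b)"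
  let ?p = "pr1 C ?R ?R" and ?q = "pr2 C ?R ?R"
  \<comment> \<open>The face \<open>?b\<close> enters through its part over 0 alone, since the base
    point is already contained in \<open>?a\<close>.\<close>
  let ?x = "tzero C ?TR \<bullet> ?a" and ?y = "T (tzero C ?R) \<bullet> ?bz"
  let ?M = "T (inverse_of (chi ?R ?R)) \<bullet> Tpair ?TR ?TR ?x ?y"
  note ci = chi_inverse[of ?R ?R, OF R_Obj R_Obj]
  have xy: "arr ?x" "arr ?y" "src ?x = ?Z" "src ?y = ?Z" "tgt ?x = TO ?TR" "tgt ?y = TO ?TR"
    using A by simp_all
  have M: "arr ?M" "src ?M = ?Z" "tgt ?M = TO (TO (Prod C ?R ?R))" using A ci by simp_all
  have pr: "T ?p \<bullet> inverse_of (chi ?R ?R) = pr1 C ?TR ?TR" "T ?q \<bullet> inverse_of (chi ?R ?R) = pr2 C ?TR ?TR"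
    using Tpair_props(4,5)[of ?R ?R "pr1 C ?TR ?TR" "pr2 C ?TR ?TR"] ci unfolding Tpair_def by simp_all
  have p: "T (T ?p) \<bullet> ?M = ?x"
  proof -
    have "T (T ?p) \<bullet> T (inverse_of (chi ?R ?R)) = T (pr1 C ?TR ?TR)"
      using ci(1-3) T_comp[of "inverse_of (chi ?R ?R)" "T ?p"] unfolding pr by simp
    then have "T (T ?p) \<bullet> ?M = T (pr1 C ?TR ?TR) \<bullet> Tpair ?TR ?TR ?x ?y"
      by (rule comp_cong_right1) (use ci(1-3) xy in simp_all)
    then show ?thesis using xy by (simp del: T_tzero T_comp)
  qed
  have q: "T (T ?q) \<bullet> ?M = ?y"
  proof -
    have "T (T ?q) \<bullet> T (inverse_of (chi ?R ?R)) = T (pr2 C ?TR ?TR)"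
      using ci(1-3) T_comp[of "inverse_of (chi ?R ?R)" "T ?q"] unfolding pr by simp
    then have "T (T ?q) \<bullet> ?M = T (pr2 C ?TR ?TR) \<bullet> Tpair ?TR ?TR ?x ?y"
      by (rule comp_cong_right1) (use ci(1-3) xy in simp_all)
    then show ?thesis using xy by (simp del: T_tzero T_comp)
  qed
  let ?B = "T (T (radd C)) \<bullet> ?M"
  have B: "arr ?B" "src ?B = ?Z" "tgt ?B = TO ?TR" using M by simp_all
  note M' = M
  \<comment> \<open>The variable \<open>m\<close> hides the inverse of \<open>chi\<close> inside
    \<open>?M\<close>; from here on it is known through its two components.\<close>
  obtain m where m: "m = ?M" by simp
  note M = M[folded m] and p = p[folded m] and q = q[folded m] and B = B[folded m]
  have eta: "Tpair ?R ?R (T ?p \<bullet> z) (T ?q \<bullet> z) = z" if "arr z" "tgt z = TO (Prod C ?R ?R)" for z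
    by (rule Tpair_eta) (use that in simp_all)
  have "tproj C ?TR \<bullet> (T (T (radd C)) \<bullet> m) = Tplus (T ?p \<bullet> (tproj C (TO (Prod C ?R ?R)) \<bullet> m)) (T ?q \<bullet> (tproj C (TO (Prod C ?R ?R)) \<bullet> m))"
    unfolding Tplus_def using M eta[of "tproj C (TO (Prod C ?R ?R)) \<bullet> m"] by simp
  also have "T ?p \<bullet> (tproj C (TO (Prod C ?R ?R)) \<bullet> m) = tproj C ?TR \<bullet> ?x"
    using M unfolding p[symmetric] by simp
  also have "T ?q \<bullet> (tproj C (TO (Prod C ?R ?R)) \<bullet> m) = tproj C ?TR \<bullet> ?y"
    using M unfolding q[symmetric] by simp
  also have "Tplus (tproj C ?TR \<bullet> ?x) (tproj C ?TR \<bullet> ?y) = Tplus ?a (tzero C ?R \<bullet> rnull ?Z)"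
    using A by simp
  also have "\<dots> = rtrans (rnull ?Z) ?a" unfolding rtrans_def by (rule Tr_comm(1)) (use A in simp_all)
  also have "\<dots> = ?a" using rtrans_rnull[of ?a] A by simp
  finally have pB: "tproj C ?TR \<bullet> (T (T (radd C)) \<bullet> m) = ?a" .
  have nat: "T (tproj C ?R) \<bullet> (T (T f) \<bullet> m) = T f \<bullet> (T (tproj C (Prod C ?R ?R)) \<bullet> m)"
    if f: "arr f" "src f = Prod C ?R ?R" "tgt f = ?R" for f
  proof -
    have "T (tproj C ?R) \<bullet> T (T f) = T (tproj C ?R \<bullet> T f)"
      using f by (simp del: tproj_T)
    also have "\<dots> = T f \<bullet> T (tproj C (Prod C ?R ?R))" using f by simp
    finally show ?thesis by (rule comp_cong_right) (use f M in simp_all)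
  qed
  have "T (tproj C ?R) \<bullet> (T (T (radd C)) \<bullet> m) =
      Tplus (T ?p \<bullet> (T (tproj C (Prod C ?R ?R)) \<bullet> m)) (T ?q \<bullet> (T (tproj C (Prod C ?R ?R)) \<bullet> m))"
    unfolding nat[OF arr_R(1-3)] Tplus_def using M eta[of "T (tproj C (Prod C ?R ?R)) \<bullet> m"] by simp
  also have "T ?p \<bullet> (T (tproj C (Prod C ?R ?R)) \<bullet> m) = T (tproj C ?R) \<bullet> ?x"
    unfolding p[symmetric] by (rule nat[symmetric]) simp_all
  also have "T ?q \<bullet> (T (tproj C (Prod C ?R ?R)) \<bullet> m) = T (tproj C ?R) \<bullet> ?y"
    unfolding q[symmetric] by (rule nat[symmetric]) simp_all
  also have "Tplus (T (tproj C ?R) \<bullet> ?x) (T (tproj C ?R) \<bullet> ?y) = rtrans (tproj C ?R \<bullet> ?b) ?bz"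
    unfolding rtrans_def using A by simp
  also have "\<dots> = ?b" by (rule rtrans_rinc_eta) (use A in simp_all)
  finally have TB: "T (tproj C ?R) \<bullet> (T (T (radd C)) \<bullet> m) = ?b" .
  let ?B = "T (T (radd C)) \<bullet> m"
  \<comment> \<open>\<open>?B\<close> has the same faces as \<open>A\<close>, so the two differ by a
    core translation, which commutes with the flip.\<close>
  have c: "compat ?TR ?B A" unfolding compat_def pB using A B by simp
  obtain c where c: "ccompat ?R ?B c" "core ?R ?B c = A"
    by (rule core_ex[OF c R_Obj TB])
  note cd = ccompatD[OF c(1)]
  have e0: "eta2 (tzero C ?TR \<bullet> z) = rnull ?Z" "eta2 (T (tzero C ?R) \<bullet> z) = rnull ?Z"
    if "arr z" "src z = ?Z" "tgt z = ?TR" for z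
    using eta2_tzero[of z] that by simp_all
  have rr: "rplus (rnull ?Z) (rnull ?Z) = rnull ?Z" using rplus_rnull(1)[of "rnull ?Z"] A by simp
  have B0: "eta2 ?B = rnull ?Z"
    using eta2_TTplus[OF M(1,3)] e0(1)[of ?a] e0(2)[of ?bz] rr A unfolding p q by simp
  have fB: "tflip C ?R \<bullet> ?B = T (T (radd C)) \<bullet> (tflip C (Prod C ?R ?R) \<bullet> m)" using M by simp
  have fp: "T (T ?p) \<bullet> (tflip C (Prod C ?R ?R) \<bullet> m) = T (tzero C ?R) \<bullet> ?a"
    using M p A by simp
  have fq: "T (T ?q) \<bullet> (tflip C (Prod C ?R ?R) \<bullet> m) = tzero C ?TR \<bullet> ?bz"
    using M q A by simp
  \<comment> \<open>The flip exchanges \<open>tzero C ?TR\<close> and \<open>T (tzero C ?R)\<close>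
    in the components; vectors of either kind have mixed coordinate 0.\<close>
  have B1: "eta2 (tflip C ?R \<bullet> ?B) = rnull ?Z"
    unfolding fB using eta2_TTplus[of "tflip C (Prod C ?R ?R) \<bullet> m"] M e0(1)[of ?bz] e0(2)[of ?a] rr A
    unfolding fp fq by simp
  have "eta2 (tflip C ?R \<bullet> core ?R ?B c) = rplus (rnull ?Z) (eta \<bullet> c)"
    unfolding tflip_core[OF c(1)] eta2_core[OF ccompat_tflip[OF c(1)]] B1 ..
  also have "\<dots> = eta2 (core ?R ?B c)" unfolding eta2_core[OF c(1)] B0 ..
  finally show ?thesis unfolding c(2) .
qed


section \<open>Vector fields and functions as a Lie-Rinehart structure\<close>

lemma function_ring_simps:
  "carrier (function_ring X) = Hom C X (Robj C)" "monoid.mult (function_ring X) = rtimes"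
  "one (function_ring X) = runit X" "zero (function_ring X) = rnull X" "add (function_ring X) = rplus"
  unfolding function_ring_def rtimes_def rplus_def runit_def rnull_def by (auto simp: fun_eq_iff)

lemma vector_fields_simps:
  "carrier (vector_fields X) = vector_field_set X" "zero (vector_fields X) = tzero C X"
  "add (vector_fields X) = tadd X" "smult (vector_fields X) = kap X"
  unfolding vector_fields_def tadd_def kap_def by (auto simp: fun_eq_iff)

lemma cring_function_ring:
  assumes X: "X \<in> Obj C"
  shows "cring (function_ring X)"
proof (intro cringI abelian_groupI comm_monoidI)
  show "\<exists>y\<in>carrier (function_ring X). y \<oplus>\<^bsub>function_ring X\<^esub> x = \<zero>\<^bsub>function_ring X\<^esub>"
    if "x \<in> carrier (function_ring X)" for x
    by (rule bexI[of _ "rneg \<bullet> x"]) (use that rplus_rneg(2)[of x] in \<open>simp_all add: function_ring_simps Hom_iff\<close>)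
  show "(x \<oplus>\<^bsub>function_ring X\<^esub> y) \<otimes>\<^bsub>function_ring X\<^esub> z =
      x \<otimes>\<^bsub>function_ring X\<^esub> z \<oplus>\<^bsub>function_ring X\<^esub> y \<otimes>\<^bsub>function_ring X\<^esub> z"
    if "x \<in> carrier (function_ring X)" "y \<in> carrier (function_ring X)" "z \<in> carrier (function_ring X)" for x y z
  proof -
    note H = that[unfolded function_ring_simps Hom_iff]
    have "rtimes (rplus x y) z = rtimes z (rplus x y)" by (rule rtimes_comm) (use H in simp_all)
    also have "\<dots> = rplus (rtimes z x) (rtimes z y)" by (rule rtimes_rplus) (use H in simp_all)
    also have "rtimes z x = rtimes x z" by (rule rtimes_comm) (use H in simp_all)
    also have "rtimes z y = rtimes y z" by (rule rtimes_comm) (use H in simp_all)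
    finally show ?thesis unfolding function_ring_simps .
  qed
qed (use X rplus_assoc rplus_comm rtimes_assoc rtimes_comm rplus_rnull(2) rtimes_runit(2) in
    \<open>auto simp: function_ring_simps Hom_iff\<close>)

lemma scompat_vf:
  assumes "f \<in> Hom C X (Robj C)" "v \<in> vector_field_set X"
  shows "scompat X f v"
  using assms(1) vfD(1-4)[OF assms(2)] unfolding scompat_def by (simp add: Hom_iff)

lemma vf_kap:
  assumes "f \<in> Hom C X (Robj C)" "v \<in> vector_field_set X"
  shows "kap X f v \<in> vector_field_set X"
  using kap_props[OF scompat_vf[OF assms]] vfD(3,5)[OF assms(2)] by (intro vfI) simp_all

lemma vf_tneg_ex: "v \<in> vector_field_set X \<Longrightarrow> \<exists>w \<in> vector_field_set X. tadd X w v = tzero C X"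
  using vf_tneg[of v X] tadd_comm[OF vf_compat] by metis

lemma module_vector_fields:
  assumes X: "X \<in> Obj C"
  shows "module (function_ring X) (vector_fields X)"
proof (intro moduleI cring_function_ring[OF X] abelian_groupI)
  note c = vf_compat[of _ X]
  fix u v w assume uvw: "u \<in> carrier (vector_fields X)" "v \<in> carrier (vector_fields X)" "w \<in> carrier (vector_fields X)"
  note U = uvw[unfolded vector_fields_simps]
  show "u \<oplus>\<^bsub>vector_fields X\<^esub> v \<in> carrier (vector_fields X)"
    using vf_tadd[OF U(1,2)] by (simp add: vector_fields_simps)
  show "u \<oplus>\<^bsub>vector_fields X\<^esub> v \<oplus>\<^bsub>vector_fields X\<^esub> w = u \<oplus>\<^bsub>vector_fields X\<^esub> (v \<oplus>\<^bsub>vector_fields X\<^esub> w)"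
    using tadd_assoc[OF c[OF U(1,2)] c[OF U(2,3)]] by (simp add: vector_fields_simps)
  show "u \<oplus>\<^bsub>vector_fields X\<^esub> v = v \<oplus>\<^bsub>vector_fields X\<^esub> u"
    unfolding vector_fields_simps by (rule tadd_comm[OF c[OF U(1,2)]])
  show "\<zero>\<^bsub>vector_fields X\<^esub> \<oplus>\<^bsub>vector_fields X\<^esub> u = u"
    using vf_tadd_tzero[OF U(1)] by (simp add: vector_fields_simps)
  show "\<exists>y\<in>carrier (vector_fields X). y \<oplus>\<^bsub>vector_fields X\<^esub> u = \<zero>\<^bsub>vector_fields X\<^esub>"
    using vf_tneg_ex[OF U(1)] by (simp add: vector_fields_simps)
  show "\<one>\<^bsub>function_ring X\<^esub> \<odot>\<^bsub>vector_fields X\<^esub> u = u"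
    using kap_runit[OF vfD(1,2,4)[OF U(1)]] vfD(3)[OF U(1)] by (simp add: vector_fields_simps function_ring_simps)
  fix f g assume fg: "f \<in> carrier (function_ring X)" "g \<in> carrier (function_ring X)"
  note F = fg[unfolded function_ring_simps] and s = scompat_vf
  note F' = HomD[OF F(1)] HomD[OF F(2)]
  show "f \<odot>\<^bsub>vector_fields X\<^esub> u \<in> carrier (vector_fields X)"
    using vf_kap[OF F(1) U(1)] by (simp add: vector_fields_simps)
  show "(f \<oplus>\<^bsub>function_ring X\<^esub> g) \<odot>\<^bsub>vector_fields X\<^esub> u =
      f \<odot>\<^bsub>vector_fields X\<^esub> u \<oplus>\<^bsub>vector_fields X\<^esub> g \<odot>\<^bsub>vector_fields X\<^esub> u"
    using kap_rplus(1)[OF s[OF F(1) U(1)] s[OF F(2) U(1)]] by (simp add: vector_fields_simps function_ring_simps)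
  show "f \<odot>\<^bsub>vector_fields X\<^esub> (u \<oplus>\<^bsub>vector_fields X\<^esub> v) =
      f \<odot>\<^bsub>vector_fields X\<^esub> u \<oplus>\<^bsub>vector_fields X\<^esub> f \<odot>\<^bsub>vector_fields X\<^esub> v"
    using kap_tadd(1)[OF c[OF U(1,2)]] F' vfD(3)[OF U(1)] by (simp add: vector_fields_simps)
  show "(f \<otimes>\<^bsub>function_ring X\<^esub> g) \<odot>\<^bsub>vector_fields X\<^esub> u =
      f \<odot>\<^bsub>vector_fields X\<^esub> (g \<odot>\<^bsub>vector_fields X\<^esub> u)"
    using kap_kap[OF s[OF F(2) U(1)]] F' vfD(3)[OF U(1)] by (simp add: vector_fields_simps function_ring_simps)
qed (use X vf_tzero in \<open>simp_all add: vector_fields_simps\<close>)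

lemma lie_bracket_vector_fields:
  assumes X: "X \<in> Obj C"
  shows "lie_bracket (vector_fields X) (vf_bracket X)"
proof -
  interpret M: module "function_ring X" "vector_fields X" by (rule module_vector_fields[OF X])
  show ?thesis
  proof
    fix u v w
    assume uvw: "u \<in> carrier (vector_fields X)" "v \<in> carrier (vector_fields X)" "w \<in> carrier (vector_fields X)"
    note U = uvw[unfolded vector_fields_simps]
    show b: "vf_bracket X u v \<in> carrier (vector_fields X)"
      unfolding vector_fields_simps by (rule vf_bracket(1)[OF U(1,2)])
    have b': "vf_bracket X v u \<in> carrier (vector_fields X)"
      unfolding vector_fields_simps by (rule vf_bracket(1)[OF U(2,1)])
    show "vf_bracket X (u \<oplus>\<^bsub>vector_fields X\<^esub> v) w = vf_bracket X u w \<oplus>\<^bsub>vector_fields X\<^esub> vf_bracket X v w"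
      unfolding vector_fields_simps by (rule vf_bracket_add_left[OF U])
    show "vf_bracket X u (v \<oplus>\<^bsub>vector_fields X\<^esub> w) = vf_bracket X u v \<oplus>\<^bsub>vector_fields X\<^esub> vf_bracket X u w"
      unfolding vector_fields_simps by (rule vf_bracket_add_right[OF U])
    have "vf_bracket X u v \<oplus>\<^bsub>vector_fields X\<^esub> vf_bracket X v u = \<zero>\<^bsub>vector_fields X\<^esub>"
      unfolding vector_fields_simps by (rule vf_bracket_antisym[OF U(1,2)])
    then show "vf_bracket X u v = \<ominus>\<^bsub>vector_fields X\<^esub> vf_bracket X v u"
      using M.minus_equality[OF _ b' b] by simp
    show "vf_bracket X u (vf_bracket X v w) \<oplus>\<^bsub>vector_fields X\<^esub> vf_bracket X v (vf_bracket X w u)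
        \<oplus>\<^bsub>vector_fields X\<^esub> vf_bracket X w (vf_bracket X u v) = \<zero>\<^bsub>vector_fields X\<^esub>"
      unfolding vector_fields_simps by (rule vf_bracket_jacobi[OF U])
  qed
qed

text \<open>The derivative of the scaled field along \<open>v\<close> splits into partial
  derivatives. Varying the scalar gives a vertical vector whose direction is
  \<open>vf_action v f\<close> times \<open>w\<close>; varying the vector gives, through
  \<open>scalar3\<close>, the bracket equation of \<open>v\<close> and \<open>w\<close> scaled by
  \<open>f\<close>. Their sum is the bracket equation for \<open>v\<close> and the scaled
  field.\<close>

lemma vf_bracket_kap:
  assumes v: "v \<in> vector_field_set X" and w: "w \<in> vector_field_set X" and f: "f \<in> Hom C X (Robj C)"
  shows "vf_bracket X v (kap X f w) = tadd X (kap X (vf_action v f) w) (kap X f (vf_bracket X v w))"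
proof -
  note V = vfD(1-4)[OF v] and W = vfD(1-4)[OF w] and F = HomD[OF f]
  let ?R = "Robj C" and ?TX = "TO X" and ?fw = "kap X f w" and ?u = "vf_bracket X v w"
  let ?vf = "vf_action v f"
  have fw: "?fw \<in> vector_field_set X" by (rule vf_kap[OF f w])
  have vf: "?vf \<in> Hom C X ?R" unfolding vf_action_def using V F by (simp add: Hom_iff)
  note b = vf_bracket[OF v w]
  note U = vfD(1-4)[OF b(1)]
  note fc = bracket_faces[OF v w] and fc' = bracket_faces[OF v fw]
  let ?A = "tflip C X \<bullet> (T v \<bullet> ?fw)"
  have vfw: "kap X ?vf w \<in> vector_field_set X" and fu: "kap X f ?u \<in> vector_field_set X"
    by (rule vf_kap[OF vf w], rule vf_kap[OF f b(1)])
  have pf: "tproj C ?R \<bullet> (T f \<bullet> v) = f" using V F vfD(5)[OF v] by simp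
  have pw: "tproj C ?TX \<bullet> (T w \<bullet> v) = w" using V W vfD(5)[OF v] by simp
  have sp: "scompat ?TX f (T v \<bullet> w)" using V W F unfolding scompat_def by simp
  have vS: "arr v" "src v = X" "tgt v = ?TX" using V by simp_all
  have B: "tflip C X \<bullet> kap ?TX f (tflip C X \<bullet> (T w \<bullet> v)) = core X ?A (kap X f ?u)"
    "ccompat X ?A (kap X f ?u)"
  proof -
    have A: "?A = tflip C X \<bullet> kap ?TX f (T v \<bullet> w)"
      unfolding kap_T(1)[OF scompat_vf[OF f w] vS(1,2), unfolded vS(3)] ..
    have "tflip C X \<bullet> (T w \<bullet> v) = core X (T v \<bullet> w) ?u"
      unfolding b(2) tflip_core[OF fc(8)[OF b(1)]] using V W by simp
    moreover have cc: "ccompat X (T v \<bullet> w) ?u"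
      using ccompat_tflip[OF fc(8)[OF b(1)]] V W by simp
    moreover have fs: "src f = src ?u" using F U by simp
    ultimately have "kap ?TX f (tflip C X \<bullet> (T w \<bullet> v)) = core X (kap ?TX f (T v \<bullet> w)) (kap X f ?u)"
      "ccompat X (kap ?TX f (T v \<bullet> w)) (kap X f ?u)"
      using kap_core[OF cc F(1) fs F(3)] by simp_all
    then show "tflip C X \<bullet> kap ?TX f (tflip C X \<bullet> (T w \<bullet> v)) = core X ?A (kap X f ?u)"
      "ccompat X ?A (kap X f ?u)"
      using tflip_core ccompat_tflip unfolding A by simp_all
  qed
  have Tkw: "T ?fw \<bullet> v = T (kappa C X) \<bullet> Tpair ?R ?TX (T f \<bullet> v) (T w \<bullet> v)"
    unfolding kap_def using V W F by simp
  have split: "T ?fw \<bullet> v = tadd ?TX (vert X ?fw (kap X ?vf w)) (core X ?A (kap X f ?u))"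
    "compat ?TX (vert X ?fw (kap X ?vf w)) (core X ?A (kap X f ?u))"
  proof -
    note s = T_Tpair_split[of ?R ?TX "kappa C X" "T f \<bullet> v" "T w \<bullet> v", unfolded pf pw]
    have k1: "T (kappa C X) \<bullet> Tpair ?R ?TX (T f \<bullet> v) (tzero C ?TX \<bullet> w) = vert X ?fw (kap X ?vf w)"
      using Tkappa_tzero_right(1)[of X "T f \<bullet> v" w] V W F unfolding pf vf_action_def by simp
    have k2: "T (kappa C X) \<bullet> Tpair ?R ?TX (tzero C ?R \<bullet> f) (T w \<bullet> v) = core X ?A (kap X f ?u)"
      unfolding B(1)[symmetric] by (rule Tkappa_tzero_left) (use V W F in simp_all)
    show "T ?fw \<bullet> v = tadd ?TX (vert X ?fw (kap X ?vf w)) (core X ?A (kap X f ?u))"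
      "compat ?TX (vert X ?fw (kap X ?vf w)) (core X ?A (kap X f ?u))"
      unfolding Tkw using s V W F unfolding k1 k2 by simp_all
  qed
  have cs: "compat X (kap X f ?u) (kap X ?vf w)" by (rule vf_compat[OF fu vfw])
  have p: "tproj C ?TX \<bullet> core X ?A (kap X f ?u) = ?fw"
    unfolding core_props(4)[OF B(2)] by (rule fc'(4))
  show ?thesis
  proof (rule vf_bracket_eqI[OF v fw vf_tadd[OF vfw fu]])
    have "T ?fw \<bullet> v = tadd ?TX (core X ?A (kap X f ?u)) (vert X ?fw (kap X ?vf w))"
      unfolding split(1) by (rule tadd_comm[OF split(2)])
    also have "\<dots> = core X (core X ?A (kap X f ?u)) (kap X ?vf w)"
      by (simp only: core_def[of X "core X ?A (kap X f ?u)"] p)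
    also have "\<dots> = core X ?A (tadd X (kap X f ?u) (kap X ?vf w))" by (rule core_core[OF B(2) cs])
    finally show "T ?fw \<bullet> v = core X ?A (tadd X (kap X ?vf w) (kap X f ?u))"
      unfolding tadd_comm[OF cs] .
  qed
qed

text \<open>The second tangent map of \<open>f\<close>, followed by \<open>eta2\<close>, is applied
  to the bracket equation. The translation contributes the action of the bracket, and the flip in
  the base term disappears by \<open>eta2_tflip\<close>.\<close>

lemma vf_action_bracket:
  assumes v: "v \<in> vector_field_set X" and w: "w \<in> vector_field_set X" and f: "f \<in> Hom C X (Robj C)"
  shows "vf_action v (vf_action w f) = rplus (vf_action w (vf_action v f)) (vf_action (vf_bracket X v w) f)"
proof -
  note V = vfD(1-4)[OF v] and W = vfD(1-4)[OF w] and F = HomD[OF f]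
  let ?u = "vf_bracket X v w" and ?A = "tflip C X \<bullet> (T v \<bullet> w)"
  note b = vf_bracket[OF v w]
  note c = bracket_faces(8)[OF v w b(1)]
  note t = TT_core[OF c F(1,2), unfolded F(3)]
  have "vf_action v (vf_action w f) = eta2 (T (T f) \<bullet> (T w \<bullet> v))"
    unfolding vf_action_def eta2_def using V W F by simp
  also have "\<dots> = rplus (eta2 (T (T f) \<bullet> ?A)) (eta \<bullet> (T f \<bullet> ?u))"
    unfolding b(2) t(1) eta2_core[OF t(2)] ..
  also have "T (T f) \<bullet> ?A = tflip C (Robj C) \<bullet> (T (T f) \<bullet> (T v \<bullet> w))"
    using V W F by simp
  also have "eta2 \<dots> = eta2 (T (T f) \<bullet> (T v \<bullet> w))" by (rule eta2_tflip) (use V W F in simp_all)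
  also have "\<dots> = vf_action w (vf_action v f)"
    unfolding vf_action_def eta2_def using V W F by simp
  finally show ?thesis unfolding vf_action_def .
qed

lemma lie_rinehart_vector_fields:
  assumes X: "X \<in> Obj C"
  shows "lie_rinehart (function_ring X) (vector_fields X) (vf_bracket X) vf_action"
proof (intro lie_rinehart.intro module_vector_fields[OF X] lie_bracket_vector_fields[OF X] lie_rinehart_axioms.intro)
  fix v w f g
  assume vw: "v \<in> carrier (vector_fields X)" "w \<in> carrier (vector_fields X)"
    and fg: "f \<in> carrier (function_ring X)" "g \<in> carrier (function_ring X)"
  note v = vw[unfolded vector_fields_simps] and f = fg[unfolded function_ring_simps]
  note V = vfD(1-4)[OF v(1)] and W = vfD(1-4)[OF v(2)] and F = HomD[OF f(1)] and G = HomD[OF f(2)]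
  note c = vf_compat[OF v] and s = scompat_vf[OF f(2) v(1)]
  have pf: "tproj C (Robj C) \<bullet> (T f \<bullet> v) = f" "tproj C (Robj C) \<bullet> (T g \<bullet> v) = g"
    using V F G vfD(5)[OF v(1)] by simp_all
  have tv: "arr (T f \<bullet> v)" "arr (T g \<bullet> v)" "src (T f \<bullet> v) = src (T g \<bullet> v)"
    "tgt (T f \<bullet> v) = TO (Robj C)" "tgt (T g \<bullet> v) = TO (Robj C)"
    using V F G by simp_all
  show "vf_action v f \<in> carrier (function_ring X)"
    unfolding function_ring_simps vf_action_def using V F by (simp add: Hom_iff)
  show "vf_action (v \<oplus>\<^bsub>vector_fields X\<^esub> w) f = vf_action v f \<oplus>\<^bsub>function_ring X\<^esub> vf_action w f"
    unfolding function_ring_simps vector_fields_simps vf_action_def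
      T_tadd[OF c F(1,2), unfolded F(3)] by (rule eta_tadd[OF compat_T[OF c F(1,2), unfolded F(3)]])
  show "vf_action (g \<odot>\<^bsub>vector_fields X\<^esub> v) f = g \<otimes>\<^bsub>function_ring X\<^esub> vf_action v f"
    unfolding function_ring_simps vector_fields_simps vf_action_def
      kap_T(1)[OF s F(1,2), unfolded F(3)] by (rule eta_kap[OF kap_T(2)[OF s F(1,2), unfolded F(3)]])
  have "T (rplus f g) \<bullet> v = Tplus (T f \<bullet> v) (T g \<bullet> v)"
    "T (rtimes f g) \<bullet> v = Ttimes (T f \<bullet> v) (T g \<bullet> v)"
    using T_rplus[of f g] Tr_comp[of "T f" "T g" v] V F G by simp_all
  then show "vf_action v (f \<oplus>\<^bsub>function_ring X\<^esub> g) = vf_action v f \<oplus>\<^bsub>function_ring X\<^esub> vf_action v g"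
    "vf_action v (f \<otimes>\<^bsub>function_ring X\<^esub> g) =
      vf_action v f \<otimes>\<^bsub>function_ring X\<^esub> g \<oplus>\<^bsub>function_ring X\<^esub> f \<otimes>\<^bsub>function_ring X\<^esub> vf_action v g"
    unfolding function_ring_simps vf_action_def using eta_Tplus[OF tv] eta_Ttimes[OF tv] unfolding pf by simp_all
  show "vf_action v (vf_action w f) = vf_action w (vf_action v f) \<oplus>\<^bsub>function_ring X\<^esub> vf_action (vf_bracket X v w) f"
    unfolding function_ring_simps by (rule vf_action_bracket[OF v f(1)])
  show "vf_bracket X v (f \<odot>\<^bsub>vector_fields X\<^esub> w) =
      vf_action v f \<odot>\<^bsub>vector_fields X\<^esub> w \<oplus>\<^bsub>vector_fields X\<^esub> f \<odot>\<^bsub>vector_fields X\<^esub> vf_bracket X v w"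
    unfolding vector_fields_simps by (rule vf_bracket_kap[OF v f(1)])
qed

end

theorem theorem6p13:
  fixes C :: "('o, 'a, 'm) scalar_tangent_category_scheme"
    and X :: 'o
  assumes "scalar_tangent_category C"
    and "X \<in> Obj C"
  shows "cartan_calculus
    (form_algebra (scalar_tangent_category.function_ring C X) (scalar_tangent_category.vector_fields C X))
    (CE_differential (scalar_tangent_category.function_ring C X) (scalar_tangent_category.vector_fields C X)
      (tangent_category.vf_bracket C X) (scalar_tangent_category.vf_action C))
    (degree0_module (scalar_tangent_category.vector_fields C X))
    (tangent_category.vf_bracket C X)
    (inner_derivative (scalar_tangent_category.vector_fields C X))"
  by (rule lie_rinehart.cartan_calculus_forms
      [OF scalar_tangent_category.lie_rinehart_vector_fields[OF assms]])

end
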